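(* For every $\alpha \in (0,1)$, $\beta,\gamma \in [\alpha,1]$, and $\eta > 0$ there exist $\delta_{0},\epsilon > 0$ such that the following holds for all $\delta \in 2^{-\mathbb{N}} \cap (0,\delta_{0}]$. Let $A,B,C \subset \delta \mathbb{Z} \cap [0,1]$ be sets satisfying: (A) $A$ is a Katz-Tao $(\delta,\alpha)$-set; (B) $B$ is a Katz-Tao $(\delta,\beta)$-set; (C) $C$ is a Katz-Tao $(\delta,\gamma)$-set; ($\Pi$) $|B|^{\gamma}|C|^{\beta}\delta^{\beta\gamma} \geq \delta^{-\eta}$. Then there exists $c \in C$ such that \[ |\{a + cb : (a,b) \in G\}|_{\delta} \geq \delta^{-\epsilon}|A| \quad \text{for every } G \subset A \times B \text{ with } |G| \geq \delta^{\epsilon}|A||B|. \]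
   Context: For $\delta \in 2^{-\mathbb{N}}$ and $H \subset \mathbb{R}^{d}$, $|H|_{\delta}$ denotes the number of dyadic $\delta$-cubes intersecting $H$; $|H|$ denotes cardinality. For $s \geq 0$, $C>0$, $\delta \in 2^{-\mathbb{N}}$, a set $P \subset \mathbb{R}^{d}$ is a Katz-Tao $(\delta,s,C)$-set if $|P \cap B(x,r)|_{\delta} \leq C (r/\delta)^{s}$ for all $x \in \mathbb{R}^{d}$ and $r \geq \delta$; a Katz-Tao $(\delta,s)$-set means a Katz-Tao $(\delta,s,1)$-set. *)

theory Defs
  imports "HOL-Analysis.Analysis"
begin

definition dyadic_scales :: "real set" where
  "dyadic_scales = {1 / 2 ^ n | n :: nat. True}"

definition dyadic_cubes :: "real \<Rightarrow> ('a::euclidean_space) set set" where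
  "dyadic_cubes \<delta> =
     {{x. \<forall>b\<in>Basis. \<delta> * of_int (k b) \<le> x \<bullet> b \<and> x \<bullet> b < \<delta> * (of_int (k b) + 1)}
      | k :: 'a \<Rightarrow> int. True}"

text \<open>
  Below, this is applied to bounded sets only, which meet finitely many cubes; the convention
  that the cardinality of an infinite set is 0 therefore plays no role.
\<close>

definition dyadic_number :: "real \<Rightarrow> ('a::euclidean_space) set \<Rightarrow> nat" where
  "dyadic_number \<delta> H = card {Q \<in> dyadic_cubes \<delta>. Q \<inter> H \<noteq> {}}"

definition katz_tao_const :: "real \<Rightarrow> real \<Rightarrow> real \<Rightarrow> ('a::euclidean_space) set \<Rightarrow> bool" where
  "katz_tao_const \<delta> s K P \<longleftrightarrow>
     (\<forall>x r. r \<ge> \<delta> \<longrightarrow> real (dyadic_number \<delta> (P \<inter> cball x r)) \<le> K * (r / \<delta>) powr s)"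

definition katz_tao :: "real \<Rightarrow> real \<Rightarrow> ('a::euclidean_space) set \<Rightarrow> bool" where
  "katz_tao \<delta> s P \<longleftrightarrow> katz_tao_const \<delta> s 1 P"

definition scaled_ints :: "real \<Rightarrow> real set" where
  "scaled_ints \<delta> = {\<delta> * of_int k | k :: int. True}"

end

theory Submission
  imports Defs
begin

text \<open>
  Suppose every \<open>c \<in> C\<close> fails. Cauchy--Schwarz turns each failure into many triples \<open>(a, b, b')\<close> for which
  \<open>a + c (b' - b)\<close> is, up to rounding, again a point of \<open>A\<close>; write \<open>twist\<close> for this point. Hence a dense set \<open>H\<close>
  of triples works simultaneously for any tuple \<open>c\<^sub>0, \<dots>, c\<^sub>k\<close> chosen suitably from a dense subset of \<open>C\<close>, and
  alternating between consecutive \<open>c\<^sub>i\<close> produces many walks \<open>a\<^sub>0, \<dots>, a\<^sub>k\<close> in \<open>A\<close> whose total displacement is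
  \<open>\<Sum>\<^sub>i (c\<^sub>i\<^sub>+\<^sub>1 - c\<^sub>i) (b\<^sub>i' - b\<^sub>i)\<close>. Given the start, the number of walks is at most the number of end points,
  which the Katz--Tao condition on \<open>A\<close> bounds by \<open>r powr \<alpha>\<close>, times the concentration of this random sum.

  After passing to uniform subtrees of \<open>B\<close> and \<open>C\<close>, suitably localised, the levels at which the two trees branch have
  lower densities \<open>\<sigma>\<close> and \<open>\<tau>\<close> with \<open>\<sigma> + \<tau> > \<alpha>\<close>; this is where the product hypothesis on the sizes of \<open>B\<close> and
  \<open>C\<close> enters. If the \<open>c\<^sub>i\<close> zigzag between two branches at level \<open>l\<close> of \<open>C\<close>, then the branching of \<open>B\<close> at level \<open>s\<close>
  spreads the sum out at scale \<open>s + l\<close> by a Littlewood--Offord estimate, with almost the optimal gain. Finitely many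
  levels \<open>l\<close>, chosen greedily, suffice, by an approximate version of Mann's theorem, to make the set of scales \<open>s + l\<close>
  of density greater than \<open>\<alpha>\<close>. The gain then beats the number of end points, a contradiction.
\<close>

text \<open>A chosen level \<open>l\<close> of \<open>C\<close> serves \<open>2 * v\<close> steps,
  so one checkpoint gains nearly \<open>sqrt (2 * v + 1)\<close>, while consecutive checkpoints must
  be \<open>g\<close> scales apart, \<open>D ^ g\<close> being about a constant times
  \<open>sqrt v\<close>. For large \<open>v\<close> the gain per scale is thus close to
  \<open>D\<close>, even where a tree has only two children. So a level is just active or not, and
  only the density of active levels matters; the end points cost about
  \<open>D powr \<alpha>\<close> per scale.

  The obstacle is that the number \<open>k\<close> of steps must stay bounded as \<delta> tends to
  0: the density \<open>\<rho>\<close> of the configuration, only known to be at least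
  \<open>2 powr (- l * n)\<close>, enters to a power proportional to \<open>k\<close>. So only
  boundedly many levels can be chosen, and a dense part of \<open>C\<close> may fail to branch at a
  few levels anyway. The scales \<open>s + l\<close> are therefore controlled for most pairs only,
  which is why Mann's theorem is needed in an approximate form; triangle removal supplies it.

  The base \<open>D = 2 ^ W\<close> is fixed first, large enough for the loss of uniformisation at
  each level to be a small fraction of \<open>W\<close> bits; the \<epsilon> of the theorem is fixed
  last.\<close>

section \<open>Regularity and triangle removal\<close>

text \<open>\<open>fibre_avg\<close> is the conditional expectation of \<open>f\<close> given the labelling \<open>r\<close>.\<close>

definition fibre :: "'s set \<Rightarrow> ('s \<Rightarrow> 'l) \<Rightarrow> 's \<Rightarrow> 's set" where
  "fibre S r s = {s'\<in>S. r s' = r s}"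

definition fibre_avg :: "'s set \<Rightarrow> ('s \<Rightarrow> 'l) \<Rightarrow> ('s \<Rightarrow> real) \<Rightarrow> 's \<Rightarrow> real" where
  "fibre_avg S r f s = (\<Sum>s'\<in>fibre S r s. f s') / card (fibre S r s)"

lemma sum_by_fibres:
  fixes g :: "'s \<Rightarrow> real"
  assumes "finite S"
  shows "(\<Sum>s\<in>S. g s) = (\<Sum>l\<in>r ` S. \<Sum>s\<in>{s\<in>S. r s = l}. g s)"
  using sum.image_gen[OF assms, of g r] by simp

text \<open>On a fibre the weight \<open>g\<close> is constant, so only the total of
  \<open>f\<close> there matters, and averaging preserves that total: conditional expectation is
  self-adjoint.\<close>

lemma sum_fibre_avg_mult:
  assumes fin: "finite S" and meas: "\<And>s s'. s \<in> S \<Longrightarrow> s' \<in> S \<Longrightarrow> r s = r s' \<Longrightarrow> g s = g s'"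
  shows "(\<Sum>s\<in>S. fibre_avg S r f s * g s) = (\<Sum>s\<in>S. f s * g s)"
proof -
  have "(\<Sum>s\<in>{s\<in>S. r s = l}. fibre_avg S r f s * g s) = (\<Sum>s\<in>{s\<in>S. r s = l}. f s * g s)"
    if "l \<in> r ` S" for l
  proof -
    obtain s0 where s0: "s0 \<in> S" "r s0 = l" using \<open>l \<in> r ` S\<close> by blast
    let ?F = "{s\<in>S. r s = l}"
    have F: "fibre S r s = ?F" if "s \<in> ?F" for s using that by (auto simp: fibre_def)
    have g: "g s = g s0" if "s \<in> ?F" for s using meas[of s s0] that s0 by auto
    have pos: "card ?F > 0" using fin s0 by (auto simp: card_gt_0_iff)
    have "(\<Sum>s\<in>?F. fibre_avg S r f s * g s) = (\<Sum>s\<in>?F. (\<Sum>s'\<in>?F. f s') / card ?F * g s0)"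
      by (intro sum.cong refl) (simp add: fibre_avg_def F g)
    also have "\<dots> = (\<Sum>s'\<in>?F. f s') * g s0" using pos by simp
    also have "\<dots> = (\<Sum>s\<in>?F. f s * g s)" by (simp add: sum_distrib_right g)
    finally show ?thesis .
  qed
  then show ?thesis
    by (subst (1 2) sum_by_fibres[OF fin, of _ r]) (rule sum.cong, auto)
qed

lemma sum_fibre_avg:
  assumes "finite S"
  shows "(\<Sum>s\<in>S. fibre_avg S r f s) = (\<Sum>s\<in>S. f s)"
  using sum_fibre_avg_mult[OF assms, where g = "\<lambda>_. 1"] by simp

lemma sum_fibre_avg_saturated:
  assumes "finite S" "T \<subseteq> S" and sat: "\<And>s s'. s \<in> S \<Longrightarrow> s' \<in> S \<Longrightarrow> r s = r s' \<Longrightarrow> s \<in> T \<Longrightarrow> s' \<in> T"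
  shows "(\<Sum>s\<in>T. fibre_avg S r f s) = (\<Sum>s\<in>T. f s)"
proof -
  let ?g = "\<lambda>s. if s \<in> T then 1 else (0::real)"
  have "(\<Sum>s\<in>S. fibre_avg S r f s * ?g s) = (\<Sum>s\<in>S. f s * ?g s)"
    using sat by (intro sum_fibre_avg_mult[OF assms(1)]) metis
  moreover have "(\<Sum>s\<in>S. h s * ?g s) = (\<Sum>s\<in>T. h s)" for h
    using assms(1,2) by (simp add: if_distrib sum.If_cases Int_absorb1 cong: if_cong)
  ultimately show ?thesis by simp
qed

lemma fibre_avg_const: "r s = r s' \<Longrightarrow> fibre_avg S r f s = fibre_avg S r f s'"
  by (simp add: fibre_avg_def fibre_def)

text \<open>The finer average minus the coarser one is orthogonal to every function constant on the
  coarser fibres, in particular to the coarser average itself, so the mixed term vanishes.\<close>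

lemma fibre_avg_pythagoras:
  assumes fin: "finite S" and ref: "\<And>s s'. s \<in> S \<Longrightarrow> s' \<in> S \<Longrightarrow> r' s = r' s' \<Longrightarrow> r s = r s'"
  shows "(\<Sum>s\<in>S. (fibre_avg S r' f s)^2) = (\<Sum>s\<in>S. (fibre_avg S r f s)^2)
    + (\<Sum>s\<in>S. (fibre_avg S r' f s - fibre_avg S r f s)^2)"
proof -
  let ?a = "fibre_avg S r f" and ?b = "fibre_avg S r' f"
  have "(\<Sum>s\<in>S. ?b s * ?a s) = (\<Sum>s\<in>S. f s * ?a s)"
    by (intro sum_fibre_avg_mult[OF fin] fibre_avg_const ref)
  also have "\<dots> = (\<Sum>s\<in>S. ?a s * ?a s)"
    by (intro sum_fibre_avg_mult[OF fin, symmetric] fibre_avg_const)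
  finally have "(\<Sum>s\<in>S. ?b s * ?a s) = (\<Sum>s\<in>S. ?a s * ?a s)" .
  moreover have "(\<Sum>s\<in>S. (?b s - ?a s)^2) = (\<Sum>s\<in>S. (?b s)^2) + (\<Sum>s\<in>S. ?a s * ?a s) - 2 * (\<Sum>s\<in>S. ?b s * ?a s)"
    unfolding power2_diff by (simp add: sum.distrib sum_subtractf sum_distrib_left power2_eq_square mult.assoc)
  ultimately show ?thesis by (simp add: power2_eq_square)
qed

lemma fibre_avg_le_1:
  assumes "finite S" "s \<in> S" "\<And>s. s \<in> S \<Longrightarrow> 0 \<le> f s \<and> f s \<le> 1"
  shows "0 \<le> fibre_avg S r f s" "fibre_avg S r f s \<le> 1"
proof -
  have pos: "card (fibre S r s) > 0" using assms by (auto simp: card_gt_0_iff fibre_def)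
  have "(\<Sum>s'\<in>fibre S r s. f s') \<le> (\<Sum>s'\<in>fibre S r s. 1)"
    using assms by (intro sum_mono) (auto simp: fibre_def)
  then show "fibre_avg S r f s \<le> 1" using pos by (simp add: fibre_avg_def)
  show "0 \<le> fibre_avg S r f s" unfolding fibre_avg_def using assms
    by (intro divide_nonneg_nonneg sum_nonneg) (auto simp: fibre_def)
qed

definition edens :: "('v \<times> 'v) set \<Rightarrow> 'v set \<Rightarrow> 'v set \<Rightarrow> real" where
  "edens G U W = card (G \<inter> U \<times> W) / (card U * card W)"

definition reg_pair :: "real \<Rightarrow> ('v \<times> 'v) set \<Rightarrow> 'v set \<Rightarrow> 'v set \<Rightarrow> bool" where
  "reg_pair \<theta> G U W \<longleftrightarrow> (\<forall>U' W'. U' \<subseteq> U \<and> W' \<subseteq> W \<and> \<theta> * card U \<le> card U' \<and> \<theta> * card W \<le> card W'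
     \<longrightarrow> \<bar>edens G U' W' - edens G U W\<bar> \<le> \<theta>)"

definition lab :: "'v set \<Rightarrow> ('v \<Rightarrow> nat) \<Rightarrow> nat \<Rightarrow> 'v set" where
  "lab V p i = {x\<in>V. p x = i}"

text \<open>Partitions are labellings \<open>p\<close> with cells \<open>lab V p i\<close>; the
  density of a pair of cells is then the conditional expectation of the edge indicator given
  \<open>map_prod p p\<close>, and the energy is its squared norm. It is not normalised, whence the
  bound \<open>(card V)^2\<close>.\<close>

definition energy :: "'v set \<Rightarrow> ('v \<times> 'v) set \<Rightarrow> ('v \<Rightarrow> nat) \<Rightarrow> real" where
  "energy V G p = (\<Sum>s\<in>V \<times> V. (fibre_avg (V \<times> V) (map_prod p p) (\<lambda>s. if s \<in> G then 1 else 0) s)^2)"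

lemma energy_le: "finite V \<Longrightarrow> energy V G p \<le> (card V)^2"
proof -
  assume "finite V"
  let ?f = "fibre_avg (V \<times> V) (map_prod p p) (\<lambda>s. if s \<in> G then 1 else 0)"
  have "energy V G p \<le> (\<Sum>s\<in>V \<times> V. 1)"
    unfolding energy_def
  proof (rule sum_mono)
    fix s assume "s \<in> V \<times> V"
    then have "0 \<le> ?f s" "?f s \<le> 1" using fibre_avg_le_1[of "V \<times> V" s "\<lambda>s. if s \<in> G then 1 else 0" "map_prod p p"] \<open>finite V\<close> by auto
    then show "(?f s)^2 \<le> 1" by (simp add: power_le_one)
  qed
  then show ?thesis by (simp add: card_cartesian_product power2_eq_square)
qed

text \<open>Pairs of vertices, not of cells: each irregular pair of cells is weighted by the product
  of its sizes, so the partition need not be equitable.\<close>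

definition irreg :: "real \<Rightarrow> 'v set \<Rightarrow> ('v \<times> 'v) set \<Rightarrow> ('v \<Rightarrow> nat) \<Rightarrow> ('v \<times> 'v) set" where
  "irreg \<theta> V G p = {(x, y). x \<in> V \<and> y \<in> V \<and> \<not> reg_pair \<theta> G (lab V p (p x)) (lab V p (p y))}"

lemma edens_eq_fibre_avg:
  assumes "finite V" "x \<in> V" "y \<in> V"
  shows "fibre_avg (V \<times> V) (map_prod p p) (\<lambda>s. if s \<in> G then 1 else 0) (x, y)
     = edens G (lab V p (p x)) (lab V p (p y))"
proof -
  have F: "fibre (V \<times> V) (map_prod p p) (x, y) = lab V p (p x) \<times> lab V p (p y)"
    by (auto simp: fibre_def lab_def)
  have fin: "finite (lab V p (p x) \<times> lab V p (p y))" using assms by (simp add: lab_def)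
  then show ?thesis unfolding fibre_avg_def F edens_def
    by (simp add: sum.If_cases card_cartesian_product Int_commute)
qed

text \<open>The witnesses \<open>U\<close>, \<open>W\<close> of an irregular pair are unions of
  cells of \<open>q\<close>. On \<open>U \<times> W\<close>, at least a \<theta>^2 share of the
  pair, the finer and the coarser average differ by more than \<theta> in the mean; Cauchy--Schwarz
  turns this into a squared difference of \<theta>^4 times the size of the pair, and
  \<open>fibre_avg_pythagoras\<close> adds these up.\<close>

lemma energy_increment:
  fixes p :: "'v \<Rightarrow> nat" and q :: "'v \<Rightarrow> nat" and \<theta> :: real
  assumes fin: "finite V" and \<theta>: "0 < \<theta>"
    and ref: "\<And>x y. x \<in> V \<Longrightarrow> y \<in> V \<Longrightarrow> q x = q y \<Longrightarrow> p x = p y"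
    and wit: "\<And>i j. i \<in> p ` V \<Longrightarrow> j \<in> p ` V \<Longrightarrow> \<not> reg_pair \<theta> G (lab V p i) (lab V p j) \<Longrightarrow>
      \<exists>U W. U \<subseteq> lab V p i \<and> W \<subseteq> lab V p j \<and> \<theta> * card (lab V p i) \<le> card U \<and> \<theta> * card (lab V p j) \<le> card W \<and>
        \<theta> < \<bar>edens G U W - edens G (lab V p i) (lab V p j)\<bar> \<and>
        (\<forall>x\<in>V. \<forall>y\<in>V. q x = q y \<longrightarrow> (x \<in> U \<longleftrightarrow> y \<in> U) \<and> (x \<in> W \<longleftrightarrow> y \<in> W))"
  shows "energy V G p + \<theta>^4 * card (irreg \<theta> V G p) \<le> energy V G q"
proof -
  let ?S = "V \<times> V"
  let ?f = "\<lambda>s. if s \<in> G then 1 else (0::real)"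
  let ?a = "fibre_avg ?S (map_prod p p) ?f" and ?b = "fibre_avg ?S (map_prod q q) ?f"
  have finS: "finite ?S" using fin by simp
  let ?I = "irreg \<theta> V G p"
  have finI: "finite ?I" and IS: "?I \<subseteq> ?S" using finite_subset[OF _ finS, of ?I] by (auto simp: irreg_def)
  have local: "\<theta>^4 * card {s\<in>?I. map_prod p p s = l} \<le> (\<Sum>s\<in>{s\<in>?S. map_prod p p s = l}. (?b s - ?a s)^2)"
    if l: "l \<in> map_prod p p ` ?I" for l
  proof -
    obtain x y where xy: "x \<in> V" "y \<in> V" "l = (p x, p y)" "\<not> reg_pair \<theta> G (lab V p (p x)) (lab V p (p y))"
      using l by (auto simp: irreg_def)
    let ?X = "lab V p (p x)" and ?Y = "lab V p (p y)"
    have finXY: "finite ?X" "finite ?Y" using fin by (auto simp: lab_def)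
    obtain U W where UW: "U \<subseteq> ?X" "W \<subseteq> ?Y" "\<theta> * card ?X \<le> card U" "\<theta> * card ?Y \<le> card W"
      "\<theta> < \<bar>edens G U W - edens G ?X ?Y\<bar>"
      and sat: "\<And>x y. x \<in> V \<Longrightarrow> y \<in> V \<Longrightarrow> q x = q y \<Longrightarrow> (x \<in> U \<longleftrightarrow> y \<in> U) \<and> (x \<in> W \<longleftrightarrow> y \<in> W)"
      using wit[of "p x" "p y"] xy by blast
    have finUW: "finite U" "finite W" using UW finXY finite_subset by blast+
    have UV: "U \<times> W \<subseteq> ?S" using UW by (auto simp: lab_def)
    have posX: "card ?X > 0" "card ?Y > 0" using xy fin by (auto simp: card_gt_0_iff lab_def)
    have posU: "card U > 0" "card W > 0"
    proof -
      have "0 < \<theta> * card ?X" "0 < \<theta> * card ?Y" using posX \<theta> by auto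
      then show "card U > 0" "card W > 0" using UW by linarith+
    qed
    have aval: "?a s = edens G ?X ?Y" if h: "s \<in> U \<times> W" for s
    proof -
      obtain u w where s: "s = (u, w)" "u \<in> V" "w \<in> V" "p u = p x" "p w = p y"
        using h UW by (auto simp: lab_def)
      then show ?thesis using edens_eq_fibre_avg[OF fin s(2,3), of p G] by simp
    qed
    have "(\<Sum>s\<in>U \<times> W. ?b s) = (\<Sum>s\<in>U \<times> W. ?f s)"
    proof (rule sum_fibre_avg_saturated[OF finS UV])
      fix s s' assume "s \<in> ?S" "s' \<in> ?S" "map_prod q q s = map_prod q q s'" "s \<in> U \<times> W"
      then show "s' \<in> U \<times> W" using sat[of "fst s" "fst s'"] sat[of "snd s" "snd s'"]
        by (cases s; cases s') auto
    qed
    also have "\<dots> = card (G \<inter> U \<times> W)" using finUW by (simp add: sum.If_cases Int_commute)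
    finally have b: "(\<Sum>s\<in>U \<times> W. ?b s) = edens G U W * (card U * card W)"
      using posU by (simp add: edens_def)
    define N where "N = real (card U * card W)"
    have N: "N > 0" using posU by (simp add: N_def)
    have cN: "card (U \<times> W) = card U * card W" by (simp add: card_cartesian_product)
    have diff: "(\<Sum>s\<in>U \<times> W. ?b s - ?a s) = (edens G U W - edens G ?X ?Y) * N"
      using b aval cN by (simp add: sum_subtractf N_def algebra_simps)
    have "(\<theta> * N)^2 \<le> ((\<Sum>s\<in>U \<times> W. ?b s - ?a s))^2"
      unfolding diff using UW(5) \<theta> N
      by (intro abs_le_square_iff[THEN iffD1]) (auto simp: abs_mult)
    also have "\<dots> \<le> (\<Sum>s\<in>U \<times> W. 1^2) * (\<Sum>s\<in>U \<times> W. (?b s - ?a s)^2)"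
      using Cauchy_Schwarz_ineq_sum[of "\<lambda>_. 1" "\<lambda>s. ?b s - ?a s" "U \<times> W"] by simp
    finally have "\<theta>^2 * N * N \<le> N * (\<Sum>s\<in>U \<times> W. (?b s - ?a s)^2)"
      using cN by (simp add: N_def power2_eq_square algebra_simps)
    then have 1: "\<theta>^2 * N \<le> (\<Sum>s\<in>U \<times> W. (?b s - ?a s)^2)" using N by (simp add: mult.commute)
    have "(\<theta> * card ?X) * (\<theta> * card ?Y) \<le> N"
      unfolding N_def of_nat_mult using UW \<theta> by (intro mult_mono) auto
    then have 2: "\<theta>^4 * (card ?X * card ?Y) \<le> \<theta>^2 * N"
      using mult_left_mono[of "(\<theta> * card ?X) * (\<theta> * card ?Y)" N "\<theta>^2"]
      by (simp add: power2_eq_square power4_eq_xxxx algebra_simps)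
    have 3: "(\<Sum>s\<in>U \<times> W. (?b s - ?a s)^2) \<le> (\<Sum>s\<in>{s\<in>?S. map_prod p p s = l}. (?b s - ?a s)^2)"
      using finS UW xy by (intro sum_mono2) (auto simp: lab_def)
    have "{s\<in>?I. map_prod p p s = l} \<subseteq> ?X \<times> ?Y" using xy by (auto simp: irreg_def lab_def)
    then have "card {s\<in>?I. map_prod p p s = l} \<le> card (?X \<times> ?Y)"
      using finXY by (intro card_mono) auto
    then have "\<theta>^4 * card {s\<in>?I. map_prod p p s = l} \<le> \<theta>^4 * (card ?X * card ?Y)"
      using \<theta> by (intro mult_left_mono) (auto simp: card_cartesian_product simp flip: of_nat_mult)
    then show ?thesis using 1 2 3 by linarith
  qed
  have "\<theta>^4 * card ?I = \<theta>^4 * (\<Sum>s\<in>?I. 1)" by simp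
  also have "(\<Sum>s\<in>?I. 1) = (\<Sum>l\<in>map_prod p p ` ?I. \<Sum>s\<in>{s\<in>?I. map_prod p p s = l}. (1::real))"
    by (rule sum_by_fibres[OF finI])
  also have "\<theta>^4 * \<dots> \<le> (\<Sum>l\<in>map_prod p p ` ?I. \<Sum>s\<in>{s\<in>?S. map_prod p p s = l}. (?b s - ?a s)^2)"
    unfolding sum_distrib_left[of "\<theta>^4"] using local by (intro sum_mono) (simp add: mult.commute)
  also have "\<dots> \<le> (\<Sum>l\<in>map_prod p p ` ?S. \<Sum>s\<in>{s\<in>?S. map_prod p p s = l}. (?b s - ?a s)^2)"
    using finS IS by (intro sum_mono2) (auto intro!: sum_nonneg)
  also have "\<dots> = (\<Sum>s\<in>?S. (?b s - ?a s)^2)"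
    by (rule sum_by_fibres[OF finS, symmetric])
  also have "\<dots> = energy V G q - energy V G p"
    unfolding energy_def using fibre_avg_pythagoras[OF finS, of "map_prod q q" "map_prod p p" ?f] ref by auto
  finally show ?thesis by simp
qed


text \<open>One labelling has to serve three graphs. The new label records the old one and the
  memberships in the two witness sets of each of the \<open>3 * K^2\<close> triples of a graph and
  two cells, hence the factor \<open>2 ^ (6 * K^2)\<close>.\<close>

lemma regularity_refine:
  fixes p :: "'v \<Rightarrow> nat" and G :: "nat \<Rightarrow> ('v \<times> 'v) set" and \<theta> :: real
  assumes fin: "finite V" and \<theta>: "0 < \<theta>" and p: "p ` V \<subseteq> {..<K}"
  obtains q where "q ` V \<subseteq> {..<K * 2 ^ (6 * K^2)}"
    and "\<And>g. g < 3 \<Longrightarrow> energy V (G g) p + \<theta>^4 * card (irreg \<theta> V (G g) p) \<le> energy V (G g) q"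
proof -
  define wit where "wit g i j U W \<longleftrightarrow> U \<subseteq> lab V p i \<and> W \<subseteq> lab V p j \<and> \<theta> * card (lab V p i) \<le> card U \<and>
      \<theta> * card (lab V p j) \<le> card W \<and> \<theta> < \<bar>edens (G g) U W - edens (G g) (lab V p i) (lab V p j)\<bar>" for g i j U W
  have "\<forall>t. \<exists>UW. \<not> reg_pair \<theta> (G (fst t)) (lab V p (fst (snd t))) (lab V p (snd (snd t))) \<longrightarrow>
      wit (fst t) (fst (snd t)) (snd (snd t)) (fst UW) (snd UW)"
    unfolding reg_pair_def wit_def by (auto simp: not_le)
  then obtain UW where UW: "\<And>g i j. \<not> reg_pair \<theta> (G g) (lab V p i) (lab V p j) \<Longrightarrow>
      wit g i j (fst (UW (g, i, j))) (snd (UW (g, i, j)))"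
    by (metis fst_conv snd_conv)
  define T where "T = {..<3::nat} \<times> {..<K} \<times> {..<K}"
  define \<phi> where "\<phi> x = (p x, {t\<in>T. x \<in> fst (UW t)}, {t\<in>T. x \<in> snd (UW t)})" for x
  let ?R = "{..<K} \<times> Pow T \<times> Pow T"
  have finT: "finite T" and cT: "card T = 3 * K^2"
    by (auto simp: T_def card_cartesian_product power2_eq_square)
  have finR: "finite ?R" using finT by simp
  have "card ?R = K * (2 ^ (3 * K^2) * 2 ^ (3 * K^2))"
    using finT cT by (simp add: card_cartesian_product card_Pow)
  also have "\<dots> = K * 2 ^ (6 * K^2)" by (simp flip: power_add)
  finally have cR: "card ?R = K * 2 ^ (6 * K^2)" .
  obtain h where h: "bij_betw h ?R {0..<card ?R}" using ex_bij_betw_finite_nat[OF finR] by blast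
  have \<phi>R: "\<phi> x \<in> ?R" if "x \<in> V" for x using that p by (auto simp: \<phi>_def)
  define q where "q x = h (\<phi> x)" for x
  have qinj: "\<phi> x = \<phi> y" if "x \<in> V" "y \<in> V" "q x = q y" for x y
    using inj_onD[OF bij_betw_imp_inj_on[OF h] _ \<phi>R[OF that(1)] \<phi>R[OF that(2)]] that(3) unfolding q_def by simp
  show ?thesis
  proof (rule that[of q])
    have "q x < card ?R" if "x \<in> V" for x
      using bij_betwE[OF h] \<phi>R[OF that] by (auto simp: q_def)
    then show "q ` V \<subseteq> {..<K * 2 ^ (6 * K^2)}" using cR by auto
    fix g :: nat assume g: "g < 3"
    show "energy V (G g) p + \<theta>^4 * card (irreg \<theta> V (G g) p) \<le> energy V (G g) q"
    proof (rule energy_increment[OF fin \<theta>])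
      show "p x = p y" if "x \<in> V" "y \<in> V" "q x = q y" for x y using qinj[OF that] by (simp add: \<phi>_def)
      fix i j assume ij: "i \<in> p ` V" "j \<in> p ` V" "\<not> reg_pair \<theta> (G g) (lab V p i) (lab V p j)"
      have tT: "(g, i, j) \<in> T" using ij p g by (auto simp: T_def)
      have sat: "(x \<in> fst (UW (g,i,j)) \<longleftrightarrow> y \<in> fst (UW (g,i,j))) \<and> (x \<in> snd (UW (g,i,j)) \<longleftrightarrow> y \<in> snd (UW (g,i,j)))"
        if "x \<in> V" "y \<in> V" "q x = q y" for x y
        using qinj[OF that] tT unfolding \<phi>_def prod.inject set_eq_iff by blast
      show "\<exists>U W. U \<subseteq> lab V p i \<and> W \<subseteq> lab V p j \<and> \<theta> * card (lab V p i) \<le> card U \<and> \<theta> * card (lab V p j) \<le> card W \<and>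
        \<theta> < \<bar>edens (G g) U W - edens (G g) (lab V p i) (lab V p j)\<bar> \<and>
        (\<forall>x\<in>V. \<forall>y\<in>V. q x = q y \<longrightarrow> (x \<in> U \<longleftrightarrow> y \<in> U) \<and> (x \<in> W \<longleftrightarrow> y \<in> W))"
        using UW[OF ij(3)] sat unfolding wit_def by blast
    qed
  qed
qed

fun reg_bound :: "nat \<Rightarrow> nat" where
  "reg_bound 0 = 1"
| "reg_bound (Suc t) = reg_bound t * 2 ^ (6 * (reg_bound t)^2)"

theorem regularity_lemma:
  fixes \<theta> :: real
  assumes \<theta>: "0 < \<theta>"
  obtains K :: nat where "K > 0"
    "\<And>(V::'v set) G. finite V \<Longrightarrow> \<exists>p. p ` V \<subseteq> {..<K} \<and> (\<forall>g<3::nat. card (irreg \<theta> V (G g) p) \<le> \<theta> * (card V)^2)"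
proof -
  \<comment> \<open>A round that fails for some graph raises the sum of the three energies by
    \<open>\<theta>^5 * (card V)^2\<close>. That sum is at most \<open>3 * (card V)^2\<close>, so
    \<open>T\<close> failures are impossible unless \<open>V\<close> is empty.\<close>
  define T where "T = nat \<lceil>3 / \<theta>^5\<rceil> + 1"
  have T: "T * \<theta>^5 > 3"
  proof -
    have "3 / \<theta>^5 < T" unfolding T_def by linarith
    then show ?thesis using \<theta> by (simp add: field_simps)
  qed
  have pos: "reg_bound t > 0" for t by (induction t) auto
  have "\<exists>p. p ` V \<subseteq> {..<reg_bound T} \<and> (\<forall>g<3::nat. card (irreg \<theta> V (G g) p) \<le> \<theta> * (card V)^2)"
    if fin: "finite V" for V :: "'v set" and G
  proof -
    let ?good = "\<lambda>t p. p ` V \<subseteq> {..<reg_bound t} \<and> (\<forall>g<3::nat. card (irreg \<theta> V (G g) p) \<le> \<theta> * (card V)^2)"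
    have "(\<exists>p. ?good t p) \<or> (\<exists>p. p ` V \<subseteq> {..<reg_bound t} \<and> t * \<theta>^5 * (card V)^2 \<le> (\<Sum>g<3::nat. energy V (G g) p))" for t
    proof (induction t)
      case 0
      have "(\<lambda>_. 0) ` V \<subseteq> {..<reg_bound 0}" by auto
      moreover have "0 \<le> (\<Sum>g<3::nat. energy V (G g) (\<lambda>_. 0))" by (auto simp: energy_def intro!: sum_nonneg)
      ultimately show ?case by (intro disjI2 exI[of _ "\<lambda>_. 0"]) simp
    next
      case (Suc t)
      have mono: "reg_bound t \<le> reg_bound (Suc t)" by simp
      show ?case
      proof (cases "\<exists>p. ?good t p")
        case True
        then obtain p where p: "?good t p" by blast
        then have "?good (Suc t) p" using mono by (auto simp del: reg_bound.simps intro: less_le_trans)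
        then show ?thesis by blast
      next
        case False
        then obtain p where p: "p ` V \<subseteq> {..<reg_bound t}" "t * \<theta>^5 * (card V)^2 \<le> (\<Sum>g<3::nat. energy V (G g) p)"
          using Suc by blast
        then obtain g0 :: nat where g0: "g0 < 3" "card (irreg \<theta> V (G g0) p) > \<theta> * (card V)^2"
          using False by (meson not_le)
        obtain q where q: "q ` V \<subseteq> {..<reg_bound (Suc t)}"
          "\<And>g. g < 3 \<Longrightarrow> energy V (G g) p + \<theta>^4 * card (irreg \<theta> V (G g) p) \<le> energy V (G g) q"
          using regularity_refine[OF fin \<theta> p(1), of G] by auto
        have "(\<Sum>g<3::nat. energy V (G g) p) + \<theta>^5 * (card V)^2 \<le> (\<Sum>g<3::nat. energy V (G g) p) + \<theta>^4 * card (irreg \<theta> V (G g0) p)"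
        proof -
          have "\<theta>^4 * (\<theta> * (card V)^2) \<le> \<theta>^4 * card (irreg \<theta> V (G g0) p)"
            using g0 \<theta> by (intro mult_left_mono) auto
          then show ?thesis by (simp add: eval_nat_numeral algebra_simps)
        qed
        also have "\<dots> \<le> (\<Sum>g<3::nat. energy V (G g) p) + (\<Sum>g<3::nat. \<theta>^4 * card (irreg \<theta> V (G g) p))"
          using member_le_sum[of g0 "{..<3}" "\<lambda>g. \<theta>^4 * card (irreg \<theta> V (G g) p)"] g0 \<theta> by auto
        also have "\<dots> \<le> (\<Sum>g<3::nat. energy V (G g) q)"
          unfolding sum.distrib[symmetric] using q(2) by (intro sum_mono) auto
        finally have "Suc t * \<theta>^5 * (card V)^2 \<le> (\<Sum>g<3::nat. energy V (G g) q)"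
          using p(2) by (simp add: algebra_simps)
        then show ?thesis using q(1) by blast
      qed
    qed
    from this[of T] show ?thesis
    proof
      assume "\<exists>p. p ` V \<subseteq> {..<reg_bound T} \<and> T * \<theta>^5 * (card V)^2 \<le> (\<Sum>g<3::nat. energy V (G g) p)"
      then obtain p where p: "p ` V \<subseteq> {..<reg_bound T}" "T * \<theta>^5 * (card V)^2 \<le> (\<Sum>g<3::nat. energy V (G g) p)"
        by blast
      have "(\<Sum>g<3::nat. energy V (G g) p) \<le> (\<Sum>g<3::nat. real ((card V)^2))"
        using energy_le[OF fin] by (intro sum_mono) auto
      then have "T * \<theta>^5 * (card V)^2 \<le> 3 * (card V)^2" using p by simp
      then have "card V = 0" using T by (auto simp: mult_le_cancel_right)
      then have "V = {}" using fin by simp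
      then show ?thesis by (intro exI[of _ "\<lambda>_. 0"]) (auto simp: irreg_def)
    qed
  qed
  then show ?thesis using that pos by blast
qed

section \<open>Triangle counting and triangle removal\<close>

text \<open>Otherwise the set of low-degree vertices is itself a witness: its density to
  \<open>Y\<close> is below \<theta>, whereas regularity forces at least
  \<open>2 * \<theta> - \<theta>\<close>.\<close>

lemma reg_pair_low_degree:
  fixes \<theta> :: real
  assumes "finite X" "finite Y" "Y \<noteq> {}" "reg_pair \<theta> G X Y" "2 * \<theta> \<le> edens G X Y" "0 < \<theta>" "\<theta> \<le> 1"
  shows "card {x\<in>X. card {y\<in>Y. (x, y) \<in> G} < \<theta> * card Y} < \<theta> * card X \<or> X = {}"
proof (rule ccontr)
  define X' where "X' = {x\<in>X. card {y\<in>Y. (x, y) \<in> G} < \<theta> * card Y}"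
  assume "\<not> ?thesis"
  then have big: "\<theta> * card X \<le> card X'" and ne: "X \<noteq> {}" by (auto simp: X'_def)
  have X': "X' \<subseteq> X" "finite X'" using assms by (auto simp: X'_def)
  have "0 < \<theta> * card X" using ne assms by (simp add: card_gt_0_iff)
  then have cX': "card X' > 0" using big by linarith
  have cY: "card Y > 0" using assms by (simp add: card_gt_0_iff)
  have le: "\<theta> * card Y \<le> card Y" using \<open>\<theta> \<le> 1\<close> by (simp add: mult_left_le_one_le assms less_imp_le)
  have "G \<inter> X' \<times> Y = (\<Union>x\<in>X'. {x} \<times> {y\<in>Y. (x, y) \<in> G})" by auto
  then have "card (G \<inter> X' \<times> Y) = (\<Sum>x\<in>X'. card ({x} \<times> {y\<in>Y. (x, y) \<in> G}))"
    using X' assms by (simp only:) (intro card_UN_disjoint, auto)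
  also have "\<dots> = (\<Sum>x\<in>X'. card {y\<in>Y. (x, y) \<in> G})" by (simp add: card_cartesian_product)
  finally have "real (card (G \<inter> X' \<times> Y)) = (\<Sum>x\<in>X'. real (card {y\<in>Y. (x, y) \<in> G}))" by simp
  also have "\<dots> < (\<Sum>x\<in>X'. \<theta> * card Y)"
    using X' cX' by (intro sum_strict_mono) (auto simp: X'_def card_gt_0_iff)
  finally have "edens G X' Y < \<theta>" using cX' cY by (simp add: edens_def field_simps)
  moreover have "\<bar>edens G X' Y - edens G X Y\<bar> \<le> \<theta>"
    using assms(4) X' big le unfolding reg_pair_def by blast
  ultimately show False using assms(5) by linarith
qed

text \<open>Since \<theta> is at most 1/4, at least half of the vertices of \<open>X\<close> have
  neighbourhoods of relative size \<theta> in both \<open>Y\<close> and \<open>Z\<close>. These are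
  large enough for regularity of \<open>Y\<close>, \<open>Z\<close> to apply, so a \<theta>^3 share
  of \<open>Y \<times> Z\<close> closes to triangles over such a vertex.\<close>

lemma triangle_counting:
  fixes X Y Z :: "'v set" and \<theta> :: real
  assumes fin: "finite X" "finite Y" "finite Z" and ne: "X \<noteq> {}" "Y \<noteq> {}" "Z \<noteq> {}"
    and reg: "reg_pair \<theta> G1 X Y" "reg_pair \<theta> G2 Y Z" "reg_pair \<theta> G3 X Z"
    and dens: "2 * \<theta> \<le> edens G1 X Y" "2 * \<theta> \<le> edens G2 Y Z" "2 * \<theta> \<le> edens G3 X Z"
    and \<theta>: "0 < \<theta>" "\<theta> \<le> 1/4"
  shows "\<theta>^3 / 2 * card X * card Y * card Z
     \<le> card {(x, y, z). x \<in> X \<and> y \<in> Y \<and> z \<in> Z \<and> (x, y) \<in> G1 \<and> (y, z) \<in> G2 \<and> (x, z) \<in> G3}"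
proof -
  define X1 where "X1 = {x\<in>X. card {y\<in>Y. (x, y) \<in> G1} < \<theta> * card Y}"
  define X2 where "X2 = {x\<in>X. card {z\<in>Z. (x, z) \<in> G3} < \<theta> * card Z}"
  have 1: "card X1 < \<theta> * card X"
    unfolding X1_def using reg_pair_low_degree[OF fin(1,2) ne(2) reg(1) dens(1)] ne \<theta> by auto
  have 2: "card X2 < \<theta> * card X"
    unfolding X2_def using reg_pair_low_degree[OF fin(1,3) ne(3) reg(3) dens(3)] ne \<theta> by auto
  define X' where "X' = X - X1 - X2"
  have "card X \<le> card (X' \<union> (X1 \<union> X2))" using fin by (intro card_mono) (auto simp: X'_def X1_def X2_def)
  also have "\<dots> \<le> card X' + (card X1 + card X2)"
    using card_Un_le[of X' "X1 \<union> X2"] card_Un_le[of X1 X2] by linarith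
  finally have "real (card X) \<le> card X' + card X1 + card X2" by linarith
  moreover have "\<theta> * card X \<le> 1/4 * card X" using \<theta> by (intro mult_right_mono) auto
  ultimately have X': "card X' \<ge> card X / 2" using 1 2 by linarith
  define NY NZ where "NY x = {y\<in>Y. (x, y) \<in> G1}" and "NZ x = {z\<in>Z. (x, z) \<in> G3}" for x
  have fib: "\<theta>^3 * card Y * card Z \<le> card (G2 \<inter> NY x \<times> NZ x)" if x: "x \<in> X'" for x
  proof -
    have ny: "\<theta> * card Y \<le> card (NY x)" "\<theta> * card Z \<le> card (NZ x)"
      using x by (auto simp: X'_def X1_def X2_def NY_def NZ_def)
    have "\<bar>edens G2 (NY x) (NZ x) - edens G2 Y Z\<bar> \<le> \<theta>"
    proof -
      have "NY x \<subseteq> Y" "NZ x \<subseteq> Z" by (auto simp: NY_def NZ_def)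
      then show ?thesis using reg(2) ny unfolding reg_pair_def by simp
    qed
    then have e: "\<theta> \<le> edens G2 (NY x) (NZ x)" using dens(2) by linarith
    then have pos: "card (NY x) * card (NZ x) > 0" using \<theta> by (auto simp: edens_def intro!: Nat.gr0I)
    have "\<theta> * (card (NY x) * card (NZ x)) \<le> card (G2 \<inter> NY x \<times> NZ x)"
      using e pos by (simp add: edens_def field_simps flip: of_nat_mult)
    moreover have "(\<theta> * card Y) * (\<theta> * card Z) \<le> card (NY x) * card (NZ x)"
      unfolding of_nat_mult using ny \<theta> by (intro mult_mono) auto
    then have "\<theta> * ((\<theta> * card Y) * (\<theta> * card Z)) \<le> \<theta> * (card (NY x) * card (NZ x))"
      using \<theta> by (intro mult_left_mono) auto
    ultimately show ?thesis by (simp add: power3_eq_cube algebra_simps)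
  qed
  let ?T = "{(x, y, z). x \<in> X \<and> y \<in> Y \<and> z \<in> Z \<and> (x, y) \<in> G1 \<and> (y, z) \<in> G2 \<and> (x, z) \<in> G3}"
  have finT: "finite ?T" by (rule finite_subset[of _ "X \<times> Y \<times> Z"]) (use fin in auto)
  have "\<theta>^3 / 2 * card X * card Y * card Z \<le> (\<Sum>x\<in>X'. \<theta>^3 * card Y * card Z)"
  proof -
    have "(card X / 2) * (\<theta>^3 * card Y * card Z) \<le> card X' * (\<theta>^3 * card Y * card Z)"
      using X' \<theta> by (intro mult_right_mono) auto
    then show ?thesis by (simp add: algebra_simps)
  qed
  also have "\<dots> \<le> (\<Sum>x\<in>X'. real (card ({x} \<times> (G2 \<inter> NY x \<times> NZ x))))"
    using fib by (intro sum_mono) (simp add: card_cartesian_product)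
  also have "\<dots> = card (\<Union>x\<in>X'. {x} \<times> (G2 \<inter> NY x \<times> NZ x))"
    using fin by (subst card_UN_disjoint) (auto simp: X'_def NY_def NZ_def)
  also have "\<dots> \<le> card ?T"
    by (intro of_nat_mono card_mono finT) (auto simp: X'_def NY_def NZ_def)
  finally show ?thesis .
qed

text \<open>Delete the edges in irregular pairs, in sparse pairs and at small cells. A triangle that
  survives lies in a regular, dense triple of large cells, where counting produces more triangles
  than there are.\<close>

theorem triangle_removal:
  fixes \<eta> :: real
  assumes \<eta>: "0 < \<eta>"
  shows "\<exists>\<epsilon>::real. \<epsilon> > 0 \<and> (\<forall>(V::'v set) G1 G2 G3. finite V \<and> G1 \<subseteq> V \<times> V \<and> G2 \<subseteq> V \<times> V \<and> G3 \<subseteq> V \<times> V \<and>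
      card {(x, y, z). (x, y) \<in> G1 \<and> (y, z) \<in> G2 \<and> (x, z) \<in> G3} \<le> \<epsilon> * (card V)^3 \<longrightarrow>
      (\<exists>R1 R2 R3. R1 \<subseteq> V \<times> V \<and> R2 \<subseteq> V \<times> V \<and> R3 \<subseteq> V \<times> V \<and>
       card R1 \<le> \<eta> * (card V)^2 \<and> card R2 \<le> \<eta> * (card V)^2 \<and> card R3 \<le> \<eta> * (card V)^2 \<and>
       (\<forall>x y z. (x, y) \<in> G1 - R1 \<longrightarrow> (y, z) \<in> G2 - R2 \<longrightarrow> (x, z) \<notin> G3 - R3)))"
proof -
  \<comment> \<open>Five shares of \<theta>: one for irregular pairs, two for sparse pairs, and one
    for small cells on either side.\<close>
  define \<theta> where "\<theta> = min (\<eta> / 5) (1/4)"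
  have \<theta>: "0 < \<theta>" "\<theta> \<le> 1/4" "5 * \<theta> \<le> \<eta>" using \<eta> by (auto simp: \<theta>_def)
  obtain K :: nat where K: "K > 0"
    "\<And>(V::'v set) G. finite V \<Longrightarrow> \<exists>p. p ` V \<subseteq> {..<K} \<and> (\<forall>g<3::nat. card (irreg \<theta> V (G g) p) \<le> \<theta> * (card V)^2)"
    using regularity_lemma[OF \<theta>(1)] by blast
  \<comment> \<open>Half of what \<open>triangle_counting\<close> yields for three cells of size
    \<open>\<theta> * card V / K\<close>, so that a surviving triangle contradicts the hypothesis
    strictly.\<close>
  define \<epsilon> where "\<epsilon> = \<theta>^6 / (4 * K^3)"
  have \<epsilon>: "\<epsilon> > 0" using \<theta> K by (simp add: \<epsilon>_def)
  show ?thesis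
  proof (intro exI[of _ \<epsilon>] conjI allI impI \<epsilon>, elim conjE)
    fix V :: "'v set" and G1 G2 G3
    assume fin: "finite V" and G: "G1 \<subseteq> V \<times> V" "G2 \<subseteq> V \<times> V" "G3 \<subseteq> V \<times> V"
      and few: "card {(x, y, z). (x, y) \<in> G1 \<and> (y, z) \<in> G2 \<and> (x, z) \<in> G3} \<le> \<epsilon> * (card V)^3"
    define G where "G g = (if g = 0 then G1 else if g = 1 then G2 else G3)" for g :: nat
    obtain p where p: "p ` V \<subseteq> {..<K}" "\<And>g. g < 3 \<Longrightarrow> card (irreg \<theta> V (G g) p) \<le> \<theta> * (card V)^2"
      using K(2)[OF fin, of G] by blast
    let ?c = "\<lambda>x. lab V p (p x)"
    define small where "small x \<longleftrightarrow> card (?c x) < \<theta> * card V / K" for x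
    define R where "R H = {(x, y). x \<in> V \<and> y \<in> V \<and> (x, y) \<in> H \<and> (\<not> reg_pair \<theta> H (?c x) (?c y) \<or>
        edens H (?c x) (?c y) < 2 * \<theta> \<or> small x \<or> small y)}" for H
    have finVV: "finite (V \<times> V)" using fin by simp
    have smallc: "card {x\<in>V. small x} \<le> \<theta> * card V"
    proof -
      have "{x\<in>V. small x} \<subseteq> (\<Union>i\<in>{i\<in>{..<K}. card (lab V p i) < \<theta> * card V / K}. lab V p i)"
        using p(1) by (auto simp: small_def lab_def)
      then have "card {x\<in>V. small x} \<le> card (\<Union>i\<in>{i\<in>{..<K}. card (lab V p i) < \<theta> * card V / K}. lab V p i)"
        using fin by (intro card_mono) (auto simp: lab_def)
      also have "\<dots> \<le> (\<Sum>i\<in>{i\<in>{..<K}. card (lab V p i) < \<theta> * card V / K}. card (lab V p i))"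
        by (intro card_UN_le) auto
      finally have "real (card {x\<in>V. small x}) \<le> (\<Sum>i\<in>{i\<in>{..<K}. card (lab V p i) < \<theta> * card V / K}. real (card (lab V p i)))"
        by (simp only: of_nat_sum[symmetric] of_nat_le_iff)
      also have "\<dots> \<le> (\<Sum>i\<in>{i\<in>{..<K}. card (lab V p i) < \<theta> * card V / K}. \<theta> * card V / K)"
        by (intro sum_mono) auto
      also have "\<dots> \<le> (\<Sum>i\<in>{..<K}. \<theta> * card V / K)"
        using \<theta> by (intro sum_mono2) auto
      also have "\<dots> = \<theta> * card V" using K by simp
      finally show ?thesis .
    qed
    have Rcard: "card (R H) \<le> \<eta> * (card V)^2" if irr: "card (irreg \<theta> V H p) \<le> \<theta> * (card V)^2" for H
    proof -
      define S where "S = {x\<in>V. small x}"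
      define T where "T = {(x, y). x \<in> V \<and> y \<in> V \<and> edens H (?c x) (?c y) < 2 * \<theta>}"
      let ?f = "\<lambda>s. if s \<in> H then 1 else (0::real)"
      have TV: "T \<subseteq> V \<times> V" by (auto simp: T_def)
      have finT: "finite T" using TV finVV finite_subset by blast
      have "card (T \<inter> H) = (\<Sum>s\<in>T. ?f s)" using finT by (simp add: sum.If_cases)
      also have "\<dots> = (\<Sum>s\<in>T. fibre_avg (V \<times> V) (map_prod p p) ?f s)"
        by (rule sum_fibre_avg_saturated[OF finVV TV, symmetric]) (auto simp: T_def)
      also have "\<dots> \<le> (\<Sum>s\<in>T. 2 * \<theta>)"
      proof (rule sum_mono)
        fix s assume "s \<in> T"
        then obtain x y where s: "s = (x, y)" "x \<in> V" "y \<in> V" "edens H (?c x) (?c y) < 2 * \<theta>"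
          by (auto simp: T_def)
        then show "fibre_avg (V \<times> V) (map_prod p p) ?f s \<le> 2 * \<theta>"
          using edens_eq_fibre_avg[OF fin s(2,3), of p H] by simp
      qed
      also have "\<dots> \<le> (\<Sum>s\<in>V \<times> V. 2 * \<theta>)" using finVV TV \<theta> by (intro sum_mono2) auto
      finally have TH: "card (T \<inter> H) \<le> 2 * \<theta> * (card V)^2"
        by (simp add: card_cartesian_product power2_eq_square algebra_simps)
      have SV: "card (S \<times> V) \<le> \<theta> * (card V)^2" "card (V \<times> S) \<le> \<theta> * (card V)^2"
        using mult_right_mono[OF smallc, of "card V"]
        by (simp_all add: card_cartesian_product power2_eq_square S_def algebra_simps)
      have "R H \<subseteq> irreg \<theta> V H p \<union> (T \<inter> H) \<union> (S \<times> V) \<union> (V \<times> S)"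
        by (auto simp: R_def irreg_def T_def S_def)
      moreover have "finite (irreg \<theta> V H p)" by (rule finite_subset[OF _ finVV]) (auto simp: irreg_def)
      ultimately have "card (R H) \<le> card (irreg \<theta> V H p \<union> (T \<inter> H) \<union> (S \<times> V) \<union> (V \<times> S))"
        using finT fin by (intro card_mono) (auto simp: S_def)
      also have "\<dots> \<le> card (irreg \<theta> V H p) + card (T \<inter> H) + card (S \<times> V) + card (V \<times> S)"
        by (meson add_le_mono card_Un_le le_refl le_trans)
      finally have "real (card (R H)) \<le> card (irreg \<theta> V H p) + card (T \<inter> H) + card (S \<times> V) + card (V \<times> S)"
        by linarith
      also have "\<dots> \<le> 5 * \<theta> * (card V)^2" using irr TH SV by linarith
      also have "\<dots> \<le> \<eta> * (card V)^2" using \<theta> by (intro mult_right_mono) auto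
      finally show ?thesis .
    qed
    have notri: "(x, z) \<notin> G3 - R G3" if h: "(x, y) \<in> G1 - R G1" "(y, z) \<in> G2 - R G2" for x y z
    proof
      assume h3: "(x, z) \<in> G3 - R G3"
      have V: "x \<in> V" "y \<in> V" "z \<in> V" using h G by auto
      have r1: "reg_pair \<theta> G1 (?c x) (?c y)" "2 * \<theta> \<le> edens G1 (?c x) (?c y)" "\<not> small x" "\<not> small y"
        using h(1) V by (auto simp: R_def)
      have r2: "reg_pair \<theta> G2 (?c y) (?c z)" "2 * \<theta> \<le> edens G2 (?c y) (?c z)" "\<not> small z"
        using h(2) V by (auto simp: R_def)
      have r3: "reg_pair \<theta> G3 (?c x) (?c z)" "2 * \<theta> \<le> edens G3 (?c x) (?c z)"
        using h3 V by (auto simp: R_def)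
      have cpos: "card V > 0" using V fin by (auto simp: card_gt_0_iff)
      have "\<theta>^3 / 2 * (\<theta> * card V / K) * (\<theta> * card V / K) * (\<theta> * card V / K)
         \<le> \<theta>^3 / 2 * card (?c x) * card (?c y) * card (?c z)"
        using r1 r2 \<theta> by (intro mult_mono) (auto simp: small_def)
      also have "\<dots> \<le> card {(x', y', z'). x' \<in> ?c x \<and> y' \<in> ?c y \<and> z' \<in> ?c z \<and> (x', y') \<in> G1 \<and> (y', z') \<in> G2 \<and> (x', z') \<in> G3}"
        using V fin r1 r2 r3 \<theta> by (intro triangle_counting) (auto simp: lab_def)
      also have "\<dots> \<le> card {(x, y, z). (x, y) \<in> G1 \<and> (y, z) \<in> G2 \<and> (x, z) \<in> G3}"
        by (intro of_nat_mono card_mono finite_subset[of "{(x, y, z). (x, y) \<in> G1 \<and> (y, z) \<in> G2 \<and> (x, z) \<in> G3}" "V \<times> V \<times> V"])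
           (use G fin in auto)
      also have "\<dots> \<le> \<epsilon> * (card V)^3" by (rule few)
      finally have "2 * \<epsilon> * (card V)^3 \<le> \<epsilon> * (card V)^3"
        by (simp add: \<epsilon>_def eval_nat_numeral field_simps)
      moreover have "\<epsilon> * (card V)^3 > 0" using \<epsilon> cpos by simp
      ultimately show False by linarith
    qed
    have "R H \<subseteq> V \<times> V" for H by (auto simp: R_def)
    moreover have "card (R G1) \<le> \<eta> * (card V)^2" "card (R G2) \<le> \<eta> * (card V)^2" "card (R G3) \<le> \<eta> * (card V)^2"
      using Rcard[of G1] Rcard[of G2] Rcard[of G3] p(2)[of 0] p(2)[of 1] p(2)[of 2] by (simp_all add: G_def)
    ultimately show "\<exists>R1 R2 R3. R1 \<subseteq> V \<times> V \<and> R2 \<subseteq> V \<times> V \<and> R3 \<subseteq> V \<times> V \<and>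
       card R1 \<le> \<eta> * (card V)^2 \<and> card R2 \<le> \<eta> * (card V)^2 \<and> card R3 \<le> \<eta> * (card V)^2 \<and>
       (\<forall>x y z. (x, y) \<in> G1 - R1 \<longrightarrow> (y, z) \<in> G2 - R2 \<longrightarrow> (x, z) \<notin> G3 - R3)"
      using notri by (intro exI[of _ "R G1"] exI[of _ "R G2"] exI[of _ "R G3"] conjI allI impI)
  qed
qed

section \<open>Mann's theorem\<close>

text \<open>Counting starts at 1, as in Schnirelmann density: the common element 0 is left
  out.\<close>

definition pcount :: "nat set \<Rightarrow> nat \<Rightarrow> nat" where
  "pcount A t = card (A \<inter> {1..t})"

text \<open>If \<open>B\<close> has no point in \<open>{1..t}\<close>, the joint hypothesis is one
  about \<open>A\<close> alone. Otherwise cut at its least point \<open>b\<close>: below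
  \<open>b\<close> again only \<open>A\<close> counts, and beyond it a translate of \<open>A\<close>
  by \<open>b\<close> lies in \<open>A\<close>. The point \<open>b = 0 + b\<close> gives an extra 1,
  which pays for the cut because \<open>g \<le> 1\<close>.\<close>

lemma pcount_closed_bound:
  fixes A B :: "nat set" and g :: real
  assumes "0 \<in> A" and "g \<le> 1"
    and pre: "\<And>t. 1 \<le> t \<Longrightarrow> t \<le> n \<Longrightarrow> g * t \<le> pcount A t + pcount B t"
    and closed: "\<And>a b. a \<in> A \<Longrightarrow> b \<in> B \<Longrightarrow> a + b \<le> n \<Longrightarrow> a + b \<in> A"
  shows "t \<le> n \<Longrightarrow> g * t \<le> pcount A t"
proof (induction t rule: less_induct)
  case (less t)
  show ?case
  proof (cases "B \<inter> {1..t} = {}")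
    case True
    then show ?thesis using pre[of t] less.prems by (cases "t = 0") (auto simp: pcount_def)
  next
    case False
    define b where "b = Min (B \<inter> {1..t})"
    have b: "b \<in> B" "1 \<le> b" "b \<le> t"
      using Min_in[OF _ False] unfolding b_def by auto
    have nob: "B \<inter> {1..b-1} = {}"
    proof -
      have "x \<notin> B" if "1 \<le> x" "x \<le> b - 1" for x
        using Min_le[of "B \<inter> {1..t}" x] that b unfolding b_def[symmetric] by force
      then show ?thesis by auto
    qed
    have 1: "g * (b - 1) \<le> pcount A (b - 1)"
      using pre[of "b - 1"] nob less.prems b by (cases "b = 1") (auto simp: pcount_def)
    have 2: "g * (t - b) \<le> pcount A (t - b)"
      using less.IH[of "t - b"] less.prems b by auto
    have sub: "(A \<inter> {1..b-1}) \<union> (\<lambda>a. a + b) ` (insert 0 (A \<inter> {1..t-b})) \<subseteq> A \<inter> {1..t}"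
      using b less.prems closed[OF _ b(1)] closed[OF assms(1) b(1)] by auto
    have "card ((A \<inter> {1..b-1}) \<union> (\<lambda>a. a + b) ` (insert 0 (A \<inter> {1..t-b})))
       = card (A \<inter> {1..b-1}) + card ((\<lambda>a. a + b) ` (insert 0 (A \<inter> {1..t-b})))"
      using b by (intro card_Un_disjoint) auto
    also have "card ((\<lambda>a. a + b) ` (insert 0 (A \<inter> {1..t-b}))) = card (insert 0 (A \<inter> {1..t-b}))"
      by (intro card_image) (auto simp: inj_on_def)
    also have "\<dots> = 1 + card (A \<inter> {1..t-b})" by (subst card_insert_disjoint) auto
    finally have "pcount A (b-1) + 1 + pcount A (t-b) \<le> pcount A t"
      using card_mono[OF _ sub] by (simp add: pcount_def)
    then have "real (pcount A t) \<ge> g * (b - 1) + 1 + g * (t - b)" using 1 2 by linarith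
    moreover have "g * real (b - 1) + 1 + g * real (t - b) = g * t + (1 - g)"
      using b by (simp add: of_nat_diff algebra_simps)
    ultimately show ?thesis using assms(2) by linarith
  qed
qed

text \<open>Dyson's transform. If \<open>A + B\<close> leaves \<open>A\<close> within
  \<open>{..n}\<close>, take the least \<open>e\<close> in \<open>A\<close> for which this happens
  and replace each offending \<open>b\<close> by the new element \<open>e + b\<close> of
  \<open>A\<close>. The sumset up to \<open>n\<close> does not grow, \<open>B\<close> shrinks, and
  the minimality of \<open>e\<close> preserves the density hypothesis.\<close>

theorem mann_theorem:
  fixes A B :: "nat set" and g :: real
  assumes "0 \<in> A" "0 \<in> B" and "g \<le> 1"
    and "\<And>t. 1 \<le> t \<Longrightarrow> t \<le> n \<Longrightarrow> g * t \<le> pcount A t + pcount B t"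
  shows "g * n \<le> card ({x. \<exists>a\<in>A. \<exists>b\<in>B. x = a + b} \<inter> {1..n})"
  using assms
proof (induction "pcount B n" arbitrary: A B rule: less_induct)
  case less
  note A0 = less.prems(1) and B0 = less.prems(2) and pre = less.prems(4)
  show ?case
  proof (cases "\<forall>a\<in>A. \<forall>b\<in>B. a + b \<le> n \<longrightarrow> a + b \<in> A")
    case True
    then have "g * n \<le> pcount A n"
      using pcount_closed_bound[OF A0 \<open>g \<le> 1\<close> pre] by blast
    also have "pcount A n \<le> card ({x. \<exists>a\<in>A. \<exists>b\<in>B. x = a + b} \<inter> {1..n})"
      unfolding pcount_def using B0 by (intro card_mono) force+
    finally show ?thesis by simp
  next
    case False
    define Q where "Q a \<longleftrightarrow> a \<in> A \<and> (\<exists>b\<in>B. a + b \<le> n \<and> a + b \<notin> A)" for a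
    define e where "e = (LEAST a. Q a)"
    have exQ: "\<exists>a. Q a" using False by (auto simp: Q_def)
    have Qe: "Q e" unfolding e_def using exQ by (rule LeastI_ex)
    have emin: "\<not> Q a" if "a < e" for a using that unfolding e_def by (rule not_less_Least)
    define B1 where "B1 = {b\<in>B. e + b \<le> n \<and> e + b \<notin> A}"
    define A2 where "A2 = A \<union> (\<lambda>b. e + b) ` B1"
    define B2 where "B2 = B - B1"
    have B1pos: "b \<ge> 1" if "b \<in> B1" for b
      using that Qe by (cases b) (auto simp: B1_def Q_def)
    have B1n: "b \<le> n" if "b \<in> B1" for b using that by (auto simp: B1_def)
    have B1ne: "B1 \<noteq> {}" using Qe by (auto simp: Q_def B1_def)
    have fin[simp]: "finite B1" using B1n by (meson finite_nat_set_iff_bounded_le)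
    have 1: "0 \<in> A2" "0 \<in> B2" using A0 B0 B1pos by (auto simp: A2_def B2_def)
    have less: "pcount B2 n < pcount B n"
    proof -
      obtain b where "b \<in> B1" using B1ne by blast
      then have "b \<in> B \<inter> {1..n}" "b \<notin> B2"
        using B1pos[of b] B1n[of b] by (simp_all add: B2_def B1_def)
      then have "B2 \<inter> {1..n} \<subset> B \<inter> {1..n}" unfolding B2_def by blast
      then show ?thesis unfolding pcount_def by (intro psubset_card_mono) auto
    qed
    have pA2: "pcount A2 t = pcount A t + card {b\<in>B1. e + b \<le> t}" for t
    proof -
      have "A2 \<inter> {1..t} = (A \<inter> {1..t}) \<union> (\<lambda>b. e + b) ` {b\<in>B1. e + b \<le> t}"
      proof -
        have "1 \<le> e + b" if "b \<in> B1" for b using B1pos[OF that] by simp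
        then show ?thesis unfolding A2_def by auto
      qed
      moreover have "(A \<inter> {1..t}) \<inter> (\<lambda>b. e + b) ` {b\<in>B1. e + b \<le> t} = {}"
        by (auto simp: B1_def)
      moreover have "card ((\<lambda>b. e + b) ` {b\<in>B1. e + b \<le> t}) = card {b\<in>B1. e + b \<le> t}"
        by (intro card_image) (auto simp: inj_on_def)
      ultimately show ?thesis unfolding pcount_def by (simp add: card_Un_disjoint)
    qed
    have pB2: "pcount B t = pcount B2 t + card {b\<in>B1. b \<le> t}" for t
    proof -
      have "B \<inter> {1..t} = (B2 \<inter> {1..t}) \<union> {b\<in>B1. b \<le> t}"
      proof -
        have "b \<in> B" "1 \<le> b" if "b \<in> B1" for b using B1pos[OF that] that by (simp_all add: B1_def)
        then show ?thesis unfolding B2_def by auto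
      qed
      moreover have "(B2 \<inter> {1..t}) \<inter> {b\<in>B1. b \<le> t} = {}" by (auto simp: B2_def)
      ultimately show ?thesis unfolding pcount_def by (simp add: card_Un_disjoint)
    qed
    \<comment> \<open>The count up to \<open>t\<close> can only drop through points
      \<open>b \<le> t\<close> taken from \<open>B\<close> whose images \<open>e + b\<close> still
      exceed \<open>t\<close>. For the least such \<open>b\<close> put \<open>r = t - b\<close>,
      which is less than \<open>e\<close>. By minimality of \<open>e\<close>, \<open>A\<close> is
      closed under adding \<open>B\<close> up to \<open>r\<close>, and \<open>a' + b\<close> is in
      \<open>A\<close> for every \<open>a' \<le> r\<close> in \<open>A\<close>. So the part below
      \<open>b\<close> is covered by induction and the part from \<open>b\<close> on by a translate
      of \<open>A\<close>.\<close>
    have pre2: "t \<le> n \<Longrightarrow> g * t \<le> pcount A2 t + pcount B2 t" for t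
    proof (induction t rule: less_induct)
      case (less t)
      let ?X = "{b\<in>B1. t < e + b \<and> b \<le> t}"
      show ?case
      proof (cases "?X = {}")
        case True
        then have "{b\<in>B1. e + b \<le> t} = {b\<in>B1. b \<le> t}" by force
        then have "pcount A2 t + pcount B2 t = pcount A t + pcount B t"
          using pA2[of t] pB2[of t] by simp
        then show ?thesis using pre[of t] less.prems by (cases "t = 0") auto
      next
        case False
        define b where "b = Min ?X"
        have b: "b \<in> B1" "t < e + b" "b \<le> t"
          using Min_in[OF _ False] unfolding b_def by auto
        have b1: "1 \<le> b" using B1pos[OF b(1)] .
        define r where "r = t - b"
        have re: "r < e" "r + b = t" using b by (auto simp: r_def)
        have "g * r \<le> pcount A r"
        proof (rule pcount_closed_bound[OF A0 \<open>g \<le> 1\<close>, where n = r and B = B])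
          show "g * t' \<le> pcount A t' + pcount B t'" if "1 \<le> t'" "t' \<le> r" for t'
            using pre[of t'] that less.prems re by auto
          show "a' + b' \<in> A" if "a' \<in> A" "b' \<in> B" "a' + b' \<le> r" for a' b'
            using emin[of a'] that re less.prems by (auto simp: Q_def)
        qed simp
        moreover have "g * (b - 1) \<le> pcount A2 (b-1) + pcount B2 (b-1)"
          using less.IH[of "b - 1"] b b1 less.prems by auto
        moreover have "pcount A2 (b-1) + (1 + pcount A r) \<le> pcount A2 t"
        proof -
          have shift: "a' + b \<in> A" if "a' \<in> A" "a' \<le> r" for a'
            using emin[of a'] that re less.prems b by (auto simp: Q_def B1_def)
          have sub: "(A2 \<inter> {1..b-1}) \<union> (\<lambda>a. a + b) ` (insert 0 (A \<inter> {1..r})) \<subseteq> A2 \<inter> {1..t}"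
            using b re b1 shift shift[OF A0] by (auto simp: A2_def)
          have "card ((A2 \<inter> {1..b-1}) \<union> (\<lambda>a. a + b) ` (insert 0 (A \<inter> {1..r})))
             = card (A2 \<inter> {1..b-1}) + card ((\<lambda>a. a + b) ` (insert 0 (A \<inter> {1..r})))"
            using b1 by (intro card_Un_disjoint) auto
          also have "card ((\<lambda>a. a + b) ` (insert 0 (A \<inter> {1..r}))) = card (insert 0 (A \<inter> {1..r}))"
            by (intro card_image) (auto simp: inj_on_def)
          also have "\<dots> = 1 + card (A \<inter> {1..r})" by (subst card_insert_disjoint) auto
          finally show ?thesis using card_mono[OF _ sub] by (simp add: pcount_def)
        qed
        moreover have "pcount B2 (b-1) \<le> pcount B2 t"
          unfolding pcount_def using b by (intro card_mono) auto
        ultimately have "real (pcount A2 t + pcount B2 t) \<ge> g * (b - 1) + 1 + g * r" by linarith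
        moreover have "g * real (b - 1) + 1 + g * r = g * t + (1 - g)"
          using b1 re(2) by (auto simp: of_nat_diff algebra_simps)
        ultimately show ?thesis using \<open>g \<le> 1\<close> by linarith
      qed
    qed
    have "g * n \<le> card ({x. \<exists>a\<in>A2. \<exists>b\<in>B2. x = a + b} \<inter> {1..n})"
      using less.hyps[OF less 1 \<open>g \<le> 1\<close>] pre2 by blast
    also have "card ({x. \<exists>a\<in>A2. \<exists>b\<in>B2. x = a + b} \<inter> {1..n}) \<le> card ({x. \<exists>a\<in>A. \<exists>b\<in>B. x = a + b} \<inter> {1..n})"
    proof -
      \<comment> \<open>A new element \<open>e + b1\<close> plus an untransformed \<open>b\<close>
        can be read as \<open>(e + b) + b1\<close>, where \<open>e + b\<close> is in
        \<open>A\<close> since \<open>b\<close> was not offending.\<close>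
      have "\<exists>a'\<in>A. \<exists>b'\<in>B. a + b = a' + b'" if h: "a \<in> A2" "b \<in> B2" "a + b \<le> n" for a b
      proof (cases "a \<in> A")
        case True
        then show ?thesis using h by (auto simp: B2_def)
      next
        case False
        then obtain b1 where b1: "b1 \<in> B1" "a = e + b1" using h by (auto simp: A2_def)
        then have "e + b \<in> A" using h by (auto simp: B2_def B1_def)
        then show ?thesis using b1 by (intro bexI[of _ "e + b"] bexI[of _ b1]) (auto simp: B1_def)
      qed
      then show ?thesis by (intro of_nat_mono card_mono) auto
    qed
    finally show ?thesis by simp
  qed
qed

section \<open>An approximate form of Mann's theorem\<close>

text \<open>A pair \<open>(x, x + a)\<close> determines \<open>a\<close>, so the removed pairs
  belonging to different shifts are disjoint.\<close>

lemma many_shifts_bound: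
  fixes \<eta> :: real and S X :: "nat set"
  assumes "finite S" "finite R" "finite X" and n: "n > 0"
    and many: "\<And>a. a \<in> S \<Longrightarrow> n / 3 \<le> card {x\<in>X. (x, x + a) \<in> R}"
    and R: "card R \<le> \<eta> / 27 * (3 * n)^2"
  shows "card S \<le> \<eta> * (n::nat)"
proof -
  let ?U = "SIGMA a:S. {x\<in>X. (x, x + a) \<in> R}"
  have "card ?U \<le> card R"
  proof (rule card_inj_on_le)
    show "inj_on (\<lambda>(a, x). (x, x + a)) ?U" by (auto simp: inj_on_def)
    show "(\<lambda>(a, x). (x, x + a)) ` ?U \<subseteq> R" by auto
  qed fact
  moreover have "card ?U = (\<Sum>a\<in>S. card {x\<in>X. (x, x + a) \<in> R})"
    using assms by (intro card_SigmaI) auto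
  ultimately have "(\<Sum>a\<in>S. real (card {x\<in>X. (x, x + a) \<in> R})) \<le> card R"
    by (simp only: of_nat_sum[symmetric] of_nat_le_iff)
  moreover have "(\<Sum>a\<in>S. n / 3) \<le> (\<Sum>a\<in>S. real (card {x\<in>X. (x, x + a) \<in> R}))"
    using many by (intro sum_mono) auto
  ultimately have "card S * (n / 3) \<le> \<eta> / 27 * (3 * n)^2" using R by simp
  then have "card S * (n / 3) \<le> (\<eta> * n) * (n / 3)" by (simp add: power2_eq_square)
  then show ?thesis using n by (simp add: field_simps)
qed

text \<open>Encode sums as triangles on \<open>{..<3*n}\<close> with edges
  \<open>(x, x + a)\<close>, \<open>(y, y + b)\<close> and \<open>(x, z)\<close> for
  \<open>z - x\<close> outside \<open>E\<close>: a triangle is a bad pair \<open>(a, b)\<close> with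
  a base point \<open>x < n\<close>. After removal, discard the elements for which at least a third
  of the \<open>n\<close> base points lost their edge. A bad pair of kept elements would have
  \<open>n\<close> triangles, each missing an edge, but fewer than a third of \<open>n\<close> are
  lost through each of the three sides.\<close>

theorem arithmetic_removal:
  fixes \<eta> :: real
  assumes \<eta>: "0 < \<eta>"
  shows "\<exists>\<epsilon>::real. \<epsilon> > 0 \<and> (\<forall>n::nat. n > 0 \<longrightarrow> (\<forall>A B E. A \<subseteq> {..<n} \<and> B \<subseteq> {..<n} \<and> E \<subseteq> {..<n} \<and>
      card {(a, b). a \<in> A \<and> b \<in> B \<and> a + b < n \<and> a + b \<notin> E} \<le> \<epsilon> * n^2 \<longrightarrow>
      (\<exists>A' B' E'. A' \<subseteq> A \<and> B' \<subseteq> B \<and> E \<subseteq> E' \<and> E' \<subseteq> {..<n} \<and>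
       card (A - A') \<le> \<eta> * n \<and> card (B - B') \<le> \<eta> * n \<and> card (E' - E) \<le> \<eta> * n \<and>
       (\<forall>a\<in>A'. \<forall>b\<in>B'. a + b < n \<longrightarrow> a + b \<in> E'))))"
proof -
  have \<eta>27: "0 < \<eta> / 27" using \<eta> by simp
  obtain \<epsilon> :: real where \<epsilon>: "\<epsilon> > 0" and rem:
    "\<forall>(V::nat set) G1 G2 G3. finite V \<and> G1 \<subseteq> V \<times> V \<and> G2 \<subseteq> V \<times> V \<and> G3 \<subseteq> V \<times> V \<and>
      card {(x, y, z). (x, y) \<in> G1 \<and> (y, z) \<in> G2 \<and> (x, z) \<in> G3} \<le> \<epsilon> * (card V)^3 \<longrightarrow>
      (\<exists>R1 R2 R3. R1 \<subseteq> V \<times> V \<and> R2 \<subseteq> V \<times> V \<and> R3 \<subseteq> V \<times> V \<and>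
       card R1 \<le> \<eta> / 27 * (card V)^2 \<and> card R2 \<le> \<eta> / 27 * (card V)^2 \<and> card R3 \<le> \<eta> / 27 * (card V)^2 \<and>
       (\<forall>x y z. (x, y) \<in> G1 - R1 \<longrightarrow> (y, z) \<in> G2 - R2 \<longrightarrow> (x, z) \<notin> G3 - R3))"
    using triangle_removal[OF \<eta>27] by (elim exE conjE)
  show ?thesis
  proof (intro exI[of _ \<epsilon>] conjI allI impI \<epsilon>, elim conjE)
    fix n :: nat and A B E :: "nat set"
    assume A: "A \<subseteq> {..<n}" and B: "B \<subseteq> {..<n}" and E: "E \<subseteq> {..<n}" and n: "n > 0"
      and few: "card {(a, b). a \<in> A \<and> b \<in> B \<and> a + b < n \<and> a + b \<notin> E} \<le> \<epsilon> * n^2"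
    let ?bad = "{(a, b). a \<in> A \<and> b \<in> B \<and> a + b < n \<and> a + b \<notin> E}"
    define V where "V = {..<3*n}"
    define G1 where "G1 = {(x, y). x < n \<and> x \<le> y \<and> y - x \<in> A}"
    define G2 where "G2 = {(y, z). y < 2*n \<and> y \<le> z \<and> z - y \<in> B}"
    define G3 where "G3 = {(x, z). x < n \<and> x \<le> z \<and> z - x < n \<and> z - x \<notin> E}"
    let ?T = "{(x, y, z). (x, y) \<in> G1 \<and> (y, z) \<in> G2 \<and> (x, z) \<in> G3}"
    have GV: "G1 \<subseteq> V \<times> V" "G2 \<subseteq> V \<times> V" "G3 \<subseteq> V \<times> V"
    proof -
      have hA: "a < n" if "a \<in> A" for a using that A by blast
      have hB: "a < n" if "a \<in> B" for a using that B by blast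
      show "G1 \<subseteq> V \<times> V"
      proof
        fix p assume "p \<in> G1"
        then obtain x y where p: "p = (x, y)" "x < n" "x \<le> y" "y - x \<in> A" by (auto simp: G1_def)
        then have "x < 3 * n" "y < 3 * n" using hA[of "y - x"] by linarith+
        then show "p \<in> V \<times> V" using p by (simp add: V_def)
      qed
      show "G2 \<subseteq> V \<times> V"
      proof
        fix p assume "p \<in> G2"
        then obtain x y where p: "p = (x, y)" "x < 2 * n" "x \<le> y" "y - x \<in> B" by (auto simp: G2_def)
        then have "x < 3 * n" "y < 3 * n" using hB[of "y - x"] by linarith+
        then show "p \<in> V \<times> V" using p by (simp add: V_def)
      qed
      show "G3 \<subseteq> V \<times> V" by (auto simp: G3_def V_def)
    qed
    have finbad: "finite ?bad" by (rule finite_subset[of _ "{..<n} \<times> {..<n}"]) (use A B in auto)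
    have "card ?T \<le> card ({..<n} \<times> ?bad)"
    proof (rule card_inj_on_le)
      show "inj_on (\<lambda>(x, y, z). (x, y - x, z - y)) ?T"
        unfolding inj_on_def G1_def G2_def by auto
      show "(\<lambda>(x, y, z). (x, y - x, z - y)) ` ?T \<subseteq> {..<n} \<times> ?bad"
        by (auto simp: G1_def G2_def G3_def)
      show "finite ({..<n} \<times> ?bad)" using finbad by simp
    qed
    then have "real (card ?T) \<le> n * card ?bad" by (simp add: card_cartesian_product flip: of_nat_mult)
    also have "\<dots> \<le> n * (\<epsilon> * n^2)" using few by (simp add: mult_left_mono)
    also have "\<dots> \<le> \<epsilon> * (card V)^3" using \<epsilon> by (simp add: V_def power2_eq_square power3_eq_cube)
    finally obtain R1 R2 R3 where R: "R1 \<subseteq> V \<times> V" "R2 \<subseteq> V \<times> V" "R3 \<subseteq> V \<times> V"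
       "card R1 \<le> \<eta> / 27 * (card V)^2" "card R2 \<le> \<eta> / 27 * (card V)^2" "card R3 \<le> \<eta> / 27 * (card V)^2"
       and notri: "\<And>x y z. (x, y) \<in> G1 - R1 \<Longrightarrow> (y, z) \<in> G2 - R2 \<Longrightarrow> (x, z) \<notin> G3 - R3"
      using rem[rule_format, of V G1 G2 G3] GV by (auto simp: V_def)
    have cV: "card V = 3 * n" by (simp add: V_def)
    have finR: "finite R1" "finite R2" "finite R3"
      using R(1-3) finite_subset[of _ "V \<times> V"] by (auto simp: V_def)
    define A' where "A' = {a\<in>A. card {x\<in>{..<n}. (x, x + a) \<in> R1} < n / 3}"
    define B' where "B' = {b\<in>B. card {y\<in>{..<2*n}. (y, y + b) \<in> R2} < n / 3}"
    define Z where "Z = {c\<in>{..<n} - E. n / 3 \<le> card {x\<in>{..<n}. (x, x + c) \<in> R3}}"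
    have finA: "finite A" "finite B" "finite Z" using A B finite_subset[of _ "{..<n}"] by (auto simp: Z_def)
    have cA: "card (A - A') \<le> \<eta> * n"
      using many_shifts_bound[of "A - A'" R1 "{..<n}" n \<eta>] finA finR n R cV by (auto simp: A'_def not_less)
    have cB: "card (B - B') \<le> \<eta> * n"
      using many_shifts_bound[of "B - B'" R2 "{..<2*n}" n \<eta>] finA finR n R cV by (auto simp: B'_def not_less)
    have cZ: "card Z \<le> \<eta> * n"
      using many_shifts_bound[of Z R3 "{..<n}" n \<eta>] finA finR n R cV by (auto simp: Z_def)
    have exact: "a + b \<in> E \<union> Z" if ab: "a \<in> A'" "b \<in> B'" "a + b < n" for a b
    proof (rule ccontr)
      assume no: "a + b \<notin> E \<union> Z"
      let ?X1 = "{x\<in>{..<n}. (x, x + a) \<in> R1}" and ?X2 = "{x\<in>{..<n}. (x + a, x + a + b) \<in> R2}"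
        and ?X3 = "{x\<in>{..<n}. (x, x + (a + b)) \<in> R3}"
      have aA: "a \<in> A" "b \<in> B" "a < n" using ab A by (auto simp: A'_def B'_def)
      have "{..<n} \<subseteq> ?X1 \<union> ?X2 \<union> ?X3"
      proof
        fix x assume x: "x \<in> {..<n}"
        have "(x, x + a) \<in> G1" "(x + a, x + a + b) \<in> G2" "(x, x + a + b) \<in> G3"
          using x aA ab no by (auto simp: G1_def G2_def G3_def)
        then have "(x, x + a) \<in> R1 \<or> (x + a, x + a + b) \<in> R2 \<or> (x, x + a + b) \<in> R3"
          using notri[of x "x + a" "x + a + b"] by blast
        then show "x \<in> ?X1 \<union> ?X2 \<union> ?X3" using x by (auto simp: add.assoc)
      qed
      then have "card {..<n} \<le> card (?X1 \<union> ?X2 \<union> ?X3)" by (intro card_mono) auto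
      also have "\<dots> \<le> card ?X1 + card ?X2 + card ?X3"
        by (meson add_le_mono card_Un_le le_refl le_trans)
      finally have "real n \<le> card ?X1 + card ?X2 + card ?X3" by simp
      moreover have "card ?X1 < n / 3" using ab by (simp add: A'_def)
      moreover have "card ?X2 \<le> card {y\<in>{..<2*n}. (y, y + b) \<in> R2}"
        by (rule card_inj_on_le[of "\<lambda>x. x + a"]) (use aA in \<open>auto simp: inj_on_def\<close>)
      moreover have "card {y\<in>{..<2*n}. (y, y + b) \<in> R2} < n / 3" using ab by (simp add: B'_def)
      moreover have "card ?X3 < n / 3" using no ab by (auto simp: Z_def)
      ultimately show False by linarith
    qed
    show "\<exists>A' B' E'. A' \<subseteq> A \<and> B' \<subseteq> B \<and> E \<subseteq> E' \<and> E' \<subseteq> {..<n} \<and>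
       card (A - A') \<le> \<eta> * n \<and> card (B - B') \<le> \<eta> * n \<and> card (E' - E) \<le> \<eta> * n \<and>
       (\<forall>a\<in>A'. \<forall>b\<in>B'. a + b < n \<longrightarrow> a + b \<in> E')"
    proof (rule exI[of _ A'], rule exI[of _ B'], rule exI[of _ "E \<union> Z"], intro conjI)
      have "(E \<union> Z) - E = Z" by (auto simp: Z_def)
      then show "card ((E \<union> Z) - E) \<le> \<eta> * n" using cZ by simp
    qed (use cA cB exact E in \<open>auto simp: A'_def B'_def Z_def\<close>)
  qed
qed

section \<open>Thickened sets and the approximate Mann theorem\<close>

text \<open>Removal discards arbitrary points, and Mann's theorem tolerates no gap near the origin.
  Replacing points by windows of length \<open>P\<close> makes both harmless: few discarded points
  spoil few windows, and a surviving window is a gapless start.\<close>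

definition thick :: "nat \<Rightarrow> nat \<Rightarrow> nat set \<Rightarrow> nat set" where
  "thick n P A = {x. x < n \<and> (\<exists>a\<in>A. a \<le> x \<and> x < a + P)}"

text \<open>A window may be cut off at \<open>n\<close>, and its left end \<open>a\<close> is free,
  so it need not be one of the windows by which a set was thickened.\<close>

definition thick_core :: "nat \<Rightarrow> nat \<Rightarrow> nat set \<Rightarrow> nat set" where
  "thick_core n P A = {x. x < n \<and> (\<exists>a. a \<le> x \<and> x < a + P \<and> (\<forall>z. a \<le> z \<and> z < a + P \<and> z < n \<longrightarrow> z \<in> A))}"

lemma thick_core_subset: "thick_core n P A \<subseteq> A" by (auto simp: thick_core_def)

text \<open>A point that drops out of the core has a discarded point within distance
  \<open>P\<close>, on one side or the other.\<close>

lemma card_thick_core: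
  assumes "A' \<subseteq> thick n P A"
  shows "card (thick n P A - thick_core n P A') \<le> 2 * P * card (thick n P A - A')"
proof -
  let ?D = "thick n P A - A'"
  have fin: "finite (thick n P A)" by (rule finite_subset[of _ "{..<n}"]) (auto simp: thick_def)
  have "thick n P A - thick_core n P A' \<subseteq> (\<Union>z\<in>?D. {z - P..<z + P})"
  proof
    fix x assume x: "x \<in> thick n P A - thick_core n P A'"
    then obtain a where a: "a \<in> A" "a \<le> x" "x < a + P" "x < n" by (auto simp: thick_def)
    then obtain z where z: "a \<le> z" "z < a + P" "z < n" "z \<notin> A'"
      using x by (auto simp: thick_core_def)
    then have "z \<in> ?D" using a by (auto simp: thick_def)
    moreover have "x \<in> {z - P..<z + P}" using a z by auto
    ultimately show "x \<in> (\<Union>z\<in>?D. {z - P..<z + P})" by blast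
  qed
  then have "card (thick n P A - thick_core n P A') \<le> card (\<Union>z\<in>?D. {z - P..<z + P})"
    using fin by (intro card_mono) auto
  also have "\<dots> \<le> (\<Sum>z\<in>?D. card {z - P..<z + P})" using fin by (intro card_UN_le) auto
  also have "\<dots> \<le> (\<Sum>z\<in>?D. 2 * P)" by (intro sum_mono) auto
  finally show ?thesis by (simp add: mult.commute)
qed

text \<open>Shifting to the last minimiser of the drift-corrected counting function turns an approximate
  density lower bound into one that is exact at every scale.\<close>

lemma dense_start:
  fixes \<sigma> \<xi> \<kappa> :: real
  assumes S: "S = thick_core n P A" and n: "n > 0" and \<xi>: "0 < \<xi>" "\<xi> < \<sigma>" and \<kappa>: "0 \<le> \<kappa>" "\<kappa> < \<xi>"
    and dens: "\<And>t. t \<le> n \<Longrightarrow> \<sigma> * t - \<kappa> * n \<le> card (S \<inter> {..<t})"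
  obtains a where "a \<le> \<kappa> / \<xi> * n" "a \<in> S" "\<And>z. a \<le> z \<Longrightarrow> z < a + P \<Longrightarrow> z < n \<Longrightarrow> z \<in> S"
    "\<And>t. a + t \<le> n \<Longrightarrow> (\<sigma> - \<xi>) * t \<le> card (S \<inter> {a..<a + t})"
proof -
  define s where "s = \<sigma> - \<xi>"
  define F where "F t = card (S \<inter> {..<t}) - s * t" for t :: nat
  have F_Suc: "F (Suc t) = F t + (if t \<in> S then 1 else 0) - s" for t
  proof -
    have "S \<inter> {..<Suc t} = (if t \<in> S then insert t (S \<inter> {..<t}) else S \<inter> {..<t})"
      by (auto simp: less_Suc_eq)
    then show ?thesis by (simp add: F_def algebra_simps)
  qed
  have s0: "0 < s" using \<xi> by (simp add: s_def)
  have s1: "s < 1"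
  proof -
    have "card (S \<inter> {..<n}) \<le> card {..<n}" by (intro card_mono) auto
    then have "\<sigma> * n - \<kappa> * n \<le> 1 * n" using dens[of n] by simp
    then have "(\<sigma> - \<kappa>) * n \<le> 1 * real n" by (simp add: left_diff_distrib)
    then have "\<sigma> - \<kappa> \<le> 1" using n by (subst (asm) mult_le_cancel_right) auto
    then show ?thesis using \<kappa> by (simp add: s_def)
  qed
  define m where "m = Min (F ` {..n})"
  have mle: "m \<le> F t" if "t \<le> n" for t unfolding m_def using that by (intro Min_le) auto
  have "m \<in> F ` {..n}" unfolding m_def by (intro Min_in) auto
  then have ne: "{t. t \<le> n \<and> F t = m} \<noteq> {}" by auto
  \<comment> \<open>The last minimiser: \<open>F\<close> must rise right after it, so it belongs to
    \<open>S\<close>, while from the first minimiser this would not follow.\<close>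
  define a where "a = Max {t. t \<le> n \<and> F t = m}"
  have a: "a \<le> n" "F a = m" using Max_in[OF _ ne] unfolding a_def by auto
  have last: "F t > F a" if "a < t" "t \<le> n" for t
  proof -
    have "F t \<noteq> m" using that Max_ge[of "{t. t \<le> n \<and> F t = m}" t] unfolding a_def[symmetric] by auto
    then show ?thesis using mle[OF that(2)] a by simp
  qed
  have "F a \<le> F 0" using mle[of 0] a by simp
  then have "F a \<le> 0" by (simp add: F_def)
  moreover have "F a \<ge> \<xi> * a - \<kappa> * n" using dens[OF a(1)] by (simp add: F_def s_def algebra_simps)
  ultimately have "\<xi> * a \<le> \<kappa> * n" by linarith
  then have abound: "a \<le> \<kappa> / \<xi> * n" using \<xi> by (simp add: field_simps)
  have "\<kappa> * n < \<xi> * n" using \<kappa> n by simp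
  then have "\<xi> * a < \<xi> * n" using \<open>\<xi> * a \<le> \<kappa> * n\<close> by linarith
  then have an: "a < n" using \<xi> by simp
  have aS: "a \<in> S"
    using last[of "Suc a"] an F_Suc[of a] s0 by (auto split: if_splits)
  \<comment> \<open>If \<open>a - 1\<close> were in \<open>S\<close>, then \<open>F\<close> would be
    smaller there than at \<open>a\<close>, as \<open>s < 1\<close>. Hence a window of
    \<open>S\<close> that contains \<open>a\<close> has to begin at \<open>a\<close>, and
    \<open>S\<close> contains a full run of length \<open>P\<close> from \<open>a\<close>
    on.\<close>
  have before: "a = 0 \<or> a - 1 \<notin> S"
  proof (cases a)
    case (Suc b)
    have "F a \<le> F b" using mle[of b] a Suc by simp
    then show ?thesis using F_Suc[of b] Suc s1 by (auto split: if_splits)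
  qed auto
  have win: "z \<in> S" if z: "a \<le> z" "z < a + P" "z < n" for z
  proof -
    obtain c where c: "c \<le> a" "a < c + P" and cw: "\<And>z. c \<le> z \<Longrightarrow> z < c + P \<Longrightarrow> z < n \<Longrightarrow> z \<in> A"
      using aS unfolding S thick_core_def by blast
    have cS: "z \<in> S" if "c \<le> z" "z < c + P" "z < n" for z
      unfolding S thick_core_def using cw that by blast
    have "c = a"
    proof (rule ccontr)
      assume "c \<noteq> a"
      then have "a - 1 \<in> S" "a \<noteq> 0" using cS[of "a - 1"] c an by auto
      then show False using before by simp
    qed
    then show ?thesis using cS z by simp
  qed
  have "(\<sigma> - \<xi>) * t \<le> card (S \<inter> {a..<a + t})" if t: "a + t \<le> n" for t
  proof -
    have "F a \<le> F (a + t)" using mle[OF t] a by simp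
    moreover have "card (S \<inter> {..<a + t}) = card (S \<inter> {..<a}) + card (S \<inter> {a..<a + t})"
    proof -
      have "S \<inter> {..<a + t} = (S \<inter> {..<a}) \<union> (S \<inter> {a..<a + t})" by auto
      moreover have "card ((S \<inter> {..<a}) \<union> (S \<inter> {a..<a + t})) = card (S \<inter> {..<a}) + card (S \<inter> {a..<a + t})"
        by (intro card_Un_disjoint) auto
      ultimately show ?thesis by simp
    qed
    ultimately show ?thesis by (simp add: F_def s_def algebra_simps)
  qed
  then show ?thesis using that[of a] abound aS win by blast
qed

text \<open>Passing to \<open>pcount\<close> forgets the origin \<open>a\<close>, a loss of 1. For
  \<open>t < P\<close> the initial run makes the count full anyway, and for \<open>t \<ge> P\<close>
  the loss is at most \<open>t / P\<close>.\<close>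

lemma shifted_pcount:
  fixes s :: real and P :: nat
  assumes "P > 0" and a: "\<And>z. a \<le> z \<Longrightarrow> z < a + P \<Longrightarrow> z < n \<Longrightarrow> z \<in> S"
    and d: "\<And>t. a + t \<le> n \<Longrightarrow> s * t \<le> card (S \<inter> {a..<a + t})" and "0 < s"
    and t: "1 \<le> t" "a + t < n"
  shows "t < P \<and> pcount {x. a + x \<in> S} t = t \<or> (s - 1 / P) * t \<le> pcount {x. a + x \<in> S} t"
proof (cases "t < P")
  case True
  have "{x. a + x \<in> S} \<inter> {1..t} = {1..t}" using a True t by auto
  then show ?thesis using True by (simp add: pcount_def)
next
  case False
  have "card (S \<inter> {a..<a + (t + 1)}) \<le> card (insert a ((\<lambda>x. a + x) ` ({x. a + x \<in> S} \<inter> {1..t})))"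
  proof (rule card_mono)
    show "S \<inter> {a..<a + (t + 1)} \<subseteq> insert a ((\<lambda>x. a + x) ` ({x. a + x \<in> S} \<inter> {1..t}))"
    proof
      fix z assume "z \<in> S \<inter> {a..<a + (t + 1)}"
      then show "z \<in> insert a ((\<lambda>x. a + x) ` ({x. a + x \<in> S} \<inter> {1..t}))"
        by (cases "z = a") (auto intro!: image_eqI[of _ _ "z - a"])
    qed
  qed auto
  also have "\<dots> \<le> 1 + pcount {x. a + x \<in> S} t"
    unfolding pcount_def using card_image_le[of "{x. a + x \<in> S} \<inter> {1..t}" "\<lambda>x. a + x"]
    by (simp add: card_insert_if)
  finally have "s * (t + 1) \<le> 1 + pcount {x. a + x \<in> S} t" using d[of "t + 1"] t by linarith
  moreover have "1 \<le> t / P" using False \<open>P > 0\<close> by (simp add: field_simps)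
  ultimately show ?thesis using \<open>0 < s\<close> by (simp add: algebra_simps)
qed

text \<open>The thickened sets have few bad pairs, so removal makes the sumset inclusion exact on
  large subsets. The cores of these keep the densities up to \<open>\<kappa> * n\<close>; after
  \<open>dense_start\<close> the densities hold at every scale and Mann's theorem applies. The
  target \<open>E\<close> grows only by the points that removal adds.\<close>

theorem approximate_mann:
  fixes \<zeta> \<sigma>\<^sub>0 :: real
  assumes \<zeta>: "0 < \<zeta>" and \<sigma>0: "0 < \<sigma>\<^sub>0"
  shows "\<exists>P::nat. \<exists>\<epsilon>::real. \<exists>n\<^sub>0::nat. P > 0 \<and> \<epsilon> > 0 \<and> (\<forall>n::nat. n\<^sub>0 \<le> n \<longrightarrow> (\<forall>A B E \<sigma> \<tau>.
      A \<subseteq> {..<n} \<and> B \<subseteq> {..<n} \<and> E \<subseteq> {..<n} \<and> \<sigma>\<^sub>0 \<le> \<sigma> \<and> \<sigma>\<^sub>0 \<le> \<tau> \<and>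
      (\<forall>t\<le>n. \<sigma> * t - \<epsilon> * n \<le> card (A \<inter> {..<t})) \<and>
      (\<forall>t\<le>n. \<tau> * t - \<epsilon> * n \<le> card (B \<inter> {..<t})) \<and>
      (\<forall>b\<in>B. card {x. x < n \<and> x \<notin> E \<and> (\<exists>a\<in>A. a + b \<le> x \<and> x < a + b + 2 * P)} \<le> \<epsilon> * n) \<longrightarrow>
      (min 1 (\<sigma> + \<tau>) - \<zeta>) * n \<le> card E))"
proof -
  define P where "P = nat \<lceil>8 / \<zeta>\<rceil>"
  have "8 / \<zeta> \<le> P" unfolding P_def by linarith
  then have P8: "8 \<le> \<zeta> * P" using \<zeta> by (simp add: field_simps)
  then have P0: "P > 0" by (intro Nat.gr0I) auto
  then have P: "P > 0" "1 / P \<le> \<zeta> / 8" using P8 by (auto simp: field_simps)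
  define \<xi> where "\<xi> = min (\<zeta> / 8) (\<sigma>\<^sub>0 / 2)"
  have \<xi>: "0 < \<xi>" "\<xi> \<le> \<zeta> / 8" "\<xi> < \<sigma>\<^sub>0" using \<zeta> \<sigma>0 by (auto simp: \<xi>_def)
  \<comment> \<open>The dense starts lie below \<open>\<kappa> / \<xi> * n\<close>, so this ratio
    has to be small against \<zeta>. Next, \<eta> is taken so small that the up to
    \<open>2 * P\<close> core points lost with each removed point stay within half of
    \<open>\<kappa> * n\<close>.\<close>
  define \<kappa> where "\<kappa> = min (\<xi> / 2) (\<xi> * \<zeta> / 32)"
  have \<kappa>: "0 < \<kappa>" "\<kappa> < \<xi>" "\<kappa> / \<xi> \<le> \<zeta> / 32" using \<xi> \<zeta> by (auto simp: \<kappa>_def field_simps min_def)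
  define \<eta> where "\<eta> = min (\<zeta> / 8) (\<kappa> / (4 * P))"
  have \<eta>: "0 < \<eta>" "\<eta> \<le> \<zeta> / 8" "2 * P * \<eta> \<le> \<kappa> / 2"
    using \<zeta> \<kappa> P by (auto simp: \<eta>_def min_def field_simps)
  obtain \<epsilon>\<^sub>1 :: real where \<epsilon>1: "\<epsilon>\<^sub>1 > 0" and removal:
    "\<forall>n::nat. n > 0 \<longrightarrow> (\<forall>A B E. A \<subseteq> {..<n} \<and> B \<subseteq> {..<n} \<and> E \<subseteq> {..<n} \<and>
      card {(a, b). a \<in> A \<and> b \<in> B \<and> a + b < n \<and> a + b \<notin> E} \<le> \<epsilon>\<^sub>1 * n^2 \<longrightarrow>
      (\<exists>A' B' E'. A' \<subseteq> A \<and> B' \<subseteq> B \<and> E \<subseteq> E' \<and> E' \<subseteq> {..<n} \<and>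
       card (A - A') \<le> \<eta> * n \<and> card (B - B') \<le> \<eta> * n \<and> card (E' - E) \<le> \<eta> * n \<and>
       (\<forall>a\<in>A'. \<forall>b\<in>B'. a + b < n \<longrightarrow> a + b \<in> E')))"
    using arithmetic_removal[OF \<eta>(1)] by (elim exE conjE)
  define \<epsilon> where "\<epsilon> = min \<epsilon>\<^sub>1 (\<kappa> / 2)"
  have \<epsilon>: "\<epsilon> > 0" "\<epsilon> \<le> \<epsilon>\<^sub>1" "\<epsilon> \<le> \<kappa> / 2" using \<epsilon>1 \<kappa> by (auto simp: \<epsilon>_def)
  define n\<^sub>0 where "n\<^sub>0 = nat \<lceil>8 / \<zeta>\<rceil> + 1"
  show ?thesis
  proof (rule exI[of _ P], rule exI[of _ \<epsilon>], rule exI[of _ n\<^sub>0], intro conjI allI impI P(1) \<epsilon>(1), elim conjE)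
    fix n and A B E :: "nat set" and \<sigma> \<tau> :: real
    assume n0: "n\<^sub>0 \<le> n" and A: "A \<subseteq> {..<n}" and B: "B \<subseteq> {..<n}" and E: "E \<subseteq> {..<n}"
      and \<sigma>: "\<sigma>\<^sub>0 \<le> \<sigma>" and \<tau>: "\<sigma>\<^sub>0 \<le> \<tau>"
      and dA': "\<forall>t\<le>n. \<sigma> * t - \<epsilon> * n \<le> card (A \<inter> {..<t})"
      and dB': "\<forall>t\<le>n. \<tau> * t - \<epsilon> * n \<le> card (B \<inter> {..<t})"
      and sh': "\<forall>b\<in>B. card {x. x < n \<and> x \<notin> E \<and> (\<exists>a\<in>A. a + b \<le> x \<and> x < a + b + 2 * P)} \<le> \<epsilon> * n"
    note dA = dA'[rule_format] and dB = dB'[rule_format] and sh = bspec[OF sh']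
    have n: "n > 0" "1 \<le> \<zeta> / 8 * n"
    proof -
      have "8 / \<zeta> \<le> n" using n0 unfolding n\<^sub>0_def by linarith
      then show "1 \<le> \<zeta> / 8 * n" using \<zeta> by (simp add: field_simps)
      show "n > 0" using n0 by (simp add: n\<^sub>0_def)
    qed
    define AP BP where "AP = thick n P A" and "BP = thick n P B"
    have APn: "AP \<subseteq> {..<n}" "BP \<subseteq> {..<n}" by (auto simp: AP_def BP_def thick_def)
    have finAP: "finite AP" "finite BP" using APn finite_subset by blast+
    let ?bad = "{(a, b). a \<in> AP \<and> b \<in> BP \<and> a + b < n \<and> a + b \<notin> E}"
    \<comment> \<open>A point of \<open>AP\<close> is less than \<open>P\<close> above some
      \<open>a\<close>, and \<open>y\<close> is less than \<open>P\<close> above \<open>b\<close>,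
      so their sum lies in the window of length \<open>2 * P\<close> at
      \<open>a + b\<close>.\<close>
    have fib: "card {a. a \<in> AP \<and> a + y < n \<and> a + y \<notin> E} \<le> \<epsilon> * n" if y: "y \<in> BP" for y
    proof -
      obtain b where b: "b \<in> B" "b \<le> y" "y < b + P" using y by (auto simp: BP_def thick_def)
      have "card {a. a \<in> AP \<and> a + y < n \<and> a + y \<notin> E} \<le> card {x. x < n \<and> x \<notin> E \<and> (\<exists>a\<in>A. a + b \<le> x \<and> x < a + b + 2 * P)}"
      proof (rule card_inj_on_le[of "\<lambda>a. a + y"])
        show "(\<lambda>a. a + y) ` {a. a \<in> AP \<and> a + y < n \<and> a + y \<notin> E} \<subseteq> {x. x < n \<and> x \<notin> E \<and> (\<exists>a\<in>A. a + b \<le> x \<and> x < a + b + 2 * P)}"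
        proof clarsimp
          fix x assume "x \<in> AP"
          then obtain a where "a \<in> A" "a \<le> x" "x < a + P" by (auto simp: AP_def thick_def)
          then show "\<exists>a\<in>A. a + b \<le> x + y \<and> x + y < a + b + 2 * P" using b by (intro bexI[of _ a]) auto
        qed
      qed (auto simp: inj_on_def)
      then show ?thesis using sh[OF b(1)] by linarith
    qed
    have "card ?bad \<le> card (SIGMA y:BP. {a. a \<in> AP \<and> a + y < n \<and> a + y \<notin> E})"
    proof (rule card_inj_on_le[of "\<lambda>(a, b). (b, a)"])
      show "finite (SIGMA y:BP. {a. a \<in> AP \<and> a + y < n \<and> a + y \<notin> E})" using finAP by auto
    qed (auto simp: inj_on_def)
    also have "\<dots> = (\<Sum>y\<in>BP. card {a. a \<in> AP \<and> a + y < n \<and> a + y \<notin> E})"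
      using finAP by (intro card_SigmaI) auto
    finally have "real (card ?bad) \<le> (\<Sum>y\<in>BP. real (card {a. a \<in> AP \<and> a + y < n \<and> a + y \<notin> E}))"
      by (simp only: of_nat_sum[symmetric] of_nat_le_iff)
    also have "\<dots> \<le> (\<Sum>y\<in>BP. \<epsilon> * n)" using fib by (intro sum_mono) auto
    also have "\<dots> \<le> n * (\<epsilon> * n)"
      using card_mono[OF _ APn(2)] \<epsilon> by (auto intro!: mult_right_mono)
    also have "\<dots> \<le> \<epsilon>\<^sub>1 * n^2" using mult_right_mono[OF \<epsilon>(2), of "(real n)^2"] by (simp add: power2_eq_square algebra_simps)
    finally have few: "card ?bad \<le> \<epsilon>\<^sub>1 * n^2" by simp
    obtain A' B' E' where E'_all: "A' \<subseteq> AP \<and> B' \<subseteq> BP \<and> E \<subseteq> E' \<and> E' \<subseteq> {..<n} \<and>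
       card (AP - A') \<le> \<eta> * n \<and> card (BP - B') \<le> \<eta> * n \<and> card (E' - E) \<le> \<eta> * n \<and>
       (\<forall>a\<in>A'. \<forall>b\<in>B'. a + b < n \<longrightarrow> a + b \<in> E')"
      using removal[rule_format, OF n(1), of AP BP E, OF conjI[OF APn(1) conjI[OF APn(2) conjI[OF E few]]]]
      by (elim exE)
    then have E': "A' \<subseteq> AP" "B' \<subseteq> BP" "E \<subseteq> E'" "E' \<subseteq> {..<n}"
       "card (AP - A') \<le> \<eta> * n" "card (BP - B') \<le> \<eta> * n" "card (E' - E) \<le> \<eta> * n" by simp_all
    have exact: "a + b \<in> E'" if "a \<in> A'" "b \<in> B'" "a + b < n" for a b using E'_all that by simp
    have core: "\<rho> * t - \<kappa> * n \<le> card (thick_core n P C' \<inter> {..<t})"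
      if C: "C \<subseteq> {..<n}" "C' \<subseteq> thick n P C" "card (thick n P C - C') \<le> \<eta> * n"
        and d: "\<rho> * t - \<epsilon> * n \<le> card (C \<inter> {..<t})" for \<rho> :: real and t C C'
    proof -
      have fin: "finite (thick n P C)" by (rule finite_subset[of _ "{..<n}"]) (auto simp: thick_def)
      have "C \<inter> {..<t} \<subseteq> (thick_core n P C' \<inter> {..<t}) \<union> (thick n P C - thick_core n P C')"
        using C(1) P(1) by (auto simp: thick_def)
      then have "card (C \<inter> {..<t}) \<le> card ((thick_core n P C' \<inter> {..<t}) \<union> (thick n P C - thick_core n P C'))"
        using fin by (intro card_mono) auto
      also have "\<dots> \<le> card (thick_core n P C' \<inter> {..<t}) + card (thick n P C - thick_core n P C')"
        by (rule card_Un_le)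
      also have "\<dots> \<le> card (thick_core n P C' \<inter> {..<t}) + 2 * P * card (thick n P C - C')"
        using card_thick_core[OF C(2)] by simp
      finally have "real (card (C \<inter> {..<t})) \<le> card (thick_core n P C' \<inter> {..<t}) + 2 * P * real (card (thick n P C - C'))"
        by (metis of_nat_add of_nat_le_iff of_nat_mult of_nat_numeral)
      moreover have "2 * P * real (card (thick n P C - C')) \<le> 2 * P * (\<eta> * n)"
        using C(3) by (intro mult_left_mono) auto
      moreover have "2 * P * (\<eta> * n) \<le> \<kappa> / 2 * n"
        using mult_right_mono[OF \<eta>(3), of "real n"] by (simp add: mult.assoc)
      moreover have "\<epsilon> * n \<le> \<kappa> / 2 * n" using \<epsilon> by (intro mult_right_mono) auto
      ultimately show ?thesis using d by (simp add: field_simps)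
    qed
    define SA SB where "SA = thick_core n P A'" and "SB = thick_core n P B'"
    obtain a where a: "a \<le> \<kappa> / \<xi> * n" "a \<in> SA" "\<And>z. a \<le> z \<Longrightarrow> z < a + P \<Longrightarrow> z < n \<Longrightarrow> z \<in> SA"
      "\<And>t. a + t \<le> n \<Longrightarrow> (\<sigma> - \<xi>) * t \<le> card (SA \<inter> {a..<a + t})"
      using dense_start[OF SA_def n(1) \<xi>(1), of \<sigma> \<kappa>] core[OF A E'(1)[unfolded AP_def] E'(5)[unfolded AP_def] dA]
        \<xi> \<kappa> \<sigma> by (auto simp: SA_def)
    obtain b where b: "b \<le> \<kappa> / \<xi> * n" "b \<in> SB" "\<And>z. b \<le> z \<Longrightarrow> z < b + P \<Longrightarrow> z < n \<Longrightarrow> z \<in> SB"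
      "\<And>t. b + t \<le> n \<Longrightarrow> (\<tau> - \<xi>) * t \<le> card (SB \<inter> {b..<b + t})"
      using dense_start[OF SB_def n(1) \<xi>(1), of \<tau> \<kappa>] core[OF B E'(2)[unfolded BP_def] E'(6)[unfolded BP_def] dB]
        \<xi> \<kappa> \<tau> by (auto simp: SB_def)
    \<comment> \<open>With this bound, \<open>u + v \<le> N\<close> keeps
      \<open>(a + u) + (b + v)\<close> below \<open>n\<close>.\<close>
    define N where "N = n - a - b - 1"
    \<comment> \<open>Each of the two sets loses \<open>1 / P\<close> for its uncounted
      origin.\<close>
    define g where "g = min 1 ((\<sigma> - \<xi>) + (\<tau> - \<xi>) - 2 / P)"
    have gN: "g * N \<le> card ({x. \<exists>u\<in>{x. a + x \<in> SA}. \<exists>v\<in>{x. b + x \<in> SB}. x = u + v} \<inter> {1..N})"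
    proof (rule mann_theorem)
      show "0 \<in> {x. a + x \<in> SA}" "0 \<in> {x. b + x \<in> SB}" "g \<le> 1" using a b by (auto simp: g_def)
      fix t assume t: "1 \<le> t" "t \<le> N"
      have tn: "a + t < n" "b + t < n" using t by (auto simp: N_def)
      have 1: "t < P \<and> pcount {x. a + x \<in> SA} t = t \<or> ((\<sigma> - \<xi>) - 1 / P) * t \<le> pcount {x. a + x \<in> SA} t"
        using a \<xi> \<sigma> t tn by (intro shifted_pcount[OF P(1)]) auto
      have 2: "t < P \<and> pcount {x. b + x \<in> SB} t = t \<or> ((\<tau> - \<xi>) - 1 / P) * t \<le> pcount {x. b + x \<in> SB} t"
        using b \<xi> \<tau> t tn by (intro shifted_pcount[OF P(1)]) auto
      have g1: "g * t \<le> t" using mult_right_mono[of g 1 "real t"] by (simp add: g_def)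
      have g2: "g * t \<le> ((\<sigma> - \<xi>) - 1 / P) * t + ((\<tau> - \<xi>) - 1 / P) * t"
        unfolding distrib_right[symmetric] g_def by (intro mult_right_mono) (auto simp: field_simps)
      show "g * t \<le> pcount {x. a + x \<in> SA} t + pcount {x. b + x \<in> SB} t"
        using 1 2 g1 g2 by auto
    qed
    also have "card ({x. \<exists>u\<in>{x. a + x \<in> SA}. \<exists>v\<in>{x. b + x \<in> SB}. x = u + v} \<inter> {1..N}) \<le> card E'"
    proof (rule card_inj_on_le[of "\<lambda>x. x + a + b"])
      show "(\<lambda>x. x + a + b) ` ({x. \<exists>u\<in>{x. a + x \<in> SA}. \<exists>v\<in>{x. b + x \<in> SB}. x = u + v} \<inter> {1..N}) \<subseteq> E'"
      proof clarsimp
        fix u v assume uv: "a + u \<in> SA" "b + v \<in> SB" "u + v \<le> N" "Suc 0 \<le> u + v"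
        have "(a + u) + (b + v) \<in> E'"
          using uv thick_core_subset by (intro exact) (auto simp: SA_def SB_def N_def)
        then show "u + v + a + b \<in> E'" by (simp add: algebra_simps)
      qed
      show "finite E'" using E' finite_subset by blast
    qed (auto simp: inj_on_def)
    finally have 1: "g * N \<le> card E'" by simp
    have "card E' \<le> card E + card (E' - E)"
      using card_Un_le[of E "E' - E"] E'(3) by (simp add: Un_absorb1)
    then have 2: "card E' \<le> card E + \<eta> * n" using E'(7) by linarith
    show "(min 1 (\<sigma> + \<tau>) - \<zeta>) * n \<le> card E"
    proof (cases "g \<le> 0")
      case True
      have "\<sigma> + \<tau> - \<zeta> \<le> 0" using True \<xi> P \<zeta> by (auto simp: g_def min_def split: if_splits)
      then have "(min 1 (\<sigma> + \<tau>) - \<zeta>) * n \<le> 0" by (intro mult_nonpos_nonneg) auto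
      then show ?thesis by linarith
    next
      case False
      have "real N \<ge> n - a - b - 1" unfolding N_def by linarith
      moreover have "\<kappa> / \<xi> * n \<le> \<zeta> / 32 * n" using \<kappa> by (intro mult_right_mono) auto
      ultimately have N: "N \<ge> n - \<zeta> / 16 * n - \<zeta> / 8 * n" using a(1) b(1) n(2) by linarith
      have g: "0 < g" "g \<le> 1" using False by (auto simp: g_def)
      have "g * N \<ge> g * (n - \<zeta> / 16 * n - \<zeta> / 8 * n)" using N g by (intro mult_left_mono) auto
      moreover have "g * (\<zeta> / 16 * n + \<zeta> / 8 * n) \<le> 1 * (\<zeta> / 16 * n + \<zeta> / 8 * n)"
        using g \<zeta> by (intro mult_right_mono) auto
      ultimately have gn: "g * N \<ge> g * n - (\<zeta> / 16 * n + \<zeta> / 8 * n)" by (simp add: algebra_simps)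
      have "min 1 (\<sigma> + \<tau>) - \<zeta> / 2 \<le> g" using \<xi> P \<zeta> by (auto simp: g_def min_def)
      then have "(min 1 (\<sigma> + \<tau>) - \<zeta> / 2) * n \<le> g * n" by (intro mult_right_mono) auto
      moreover have "\<eta> * n \<le> \<zeta> / 8 * n" using \<eta> by (intro mult_right_mono) auto
      moreover have "\<zeta> * n \<ge> 0" using \<zeta> by simp
      ultimately show ?thesis using gn 1 2 by (simp add: left_diff_distrib)
    qed
  qed
qed

section \<open>Littlewood--Offord\<close>

text \<open>The recursion copies the exchange step of \<open>littlewood_offord\<close>: two families
  of \<open>r + 1\<close> cells are traded for one of \<open>r + 2\<close> and one of
  \<open>r\<close>. The values are bounded by sums of \<open>r\<close> central binomial coefficients
  of order \<open>q\<close>.\<close>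

fun lo_count :: "nat \<Rightarrow> nat \<Rightarrow> nat" where
  "lo_count 0 r = (if r = 0 then 0 else 1)"
| "lo_count (Suc q) 0 = 0"
| "lo_count (Suc q) (Suc r) = lo_count q (Suc (Suc r)) + lo_count q r"

text \<open>With an integer lower index and value 0 below zero, Pascal's rule has no boundary
  case.\<close>

definition ibinom :: "nat \<Rightarrow> int \<Rightarrow> nat" where
  "ibinom q j = (if j < 0 then 0 else q choose (nat j))"

lemma ibinom_Suc: "ibinom (Suc q) j = ibinom q j + ibinom q (j - 1)"
proof (cases "j \<le> 0")
  case True then show ?thesis by (auto simp: ibinom_def)
next
  case False
  then have "nat j = Suc (nat (j - 1))" by simp
  then show ?thesis using False by (simp add: ibinom_def)
qed

text \<open>The hypothesis says that the block of \<open>r\<close> indices from \<open>a\<close> on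
  is centred at \<open>q / 2\<close> up to rounding. By Pascal's rule such a block of order
  \<open>q + 1\<close> is the sum of blocks of lengths \<open>r + 1\<close> and \<open>r - 1\<close>
  of order \<open>q\<close>, both centred again.\<close>

lemma lo_count_le_ibinom:
  "2 * a + int r - 1 - int q \<in> {0, 1} \<Longrightarrow> lo_count q r \<le> (\<Sum>j\<in>{a..<a + int r}. ibinom q j)"
proof (induction q arbitrary: a r)
  case 0
  show ?case
  proof (cases "r = 0")
    case False
    then have "0 \<in> {a..<a + int r}" using 0 by auto
    then have "ibinom 0 0 \<le> (\<Sum>j\<in>{a..<a + int r}. ibinom 0 j)"
      by (intro member_le_sum) auto
    then show ?thesis by (simp add: ibinom_def)
  qed auto
next
  case (Suc q)
  show ?case
  proof (cases r)
    case 0 then show ?thesis by simp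
  next
    case (Suc r')
    have 1: "lo_count q (Suc (Suc r')) \<le> (\<Sum>j\<in>{a-1..<a - 1 + int (Suc (Suc r'))}. ibinom q j)"
      using Suc.prems Suc by (intro Suc.IH) auto
    have 2: "lo_count q r' \<le> (\<Sum>j\<in>{a..<a + int r'}. ibinom q j)"
      using Suc.prems Suc by (intro Suc.IH) auto
    have "(\<Sum>j\<in>{a..<a + int r}. ibinom (Suc q) j)
        = (\<Sum>j\<in>{a..<a + int r}. ibinom q j) + (\<Sum>j\<in>{a..<a + int r}. ibinom q (j - 1))"
      by (simp add: ibinom_Suc sum.distrib)
    also have "(\<Sum>j\<in>{a..<a + int r}. ibinom q (j - 1)) = (\<Sum>j\<in>{a-1..<a - 1 + int r}. ibinom q j)"
      by (rule sum.reindex_bij_witness[of _ "\<lambda>j. j + 1" "\<lambda>j. j - 1"]) auto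
    also have "{a-1..<a - 1 + int r} = insert (a-1) {a..<a + int r'}" using Suc by auto
    also have "(\<Sum>j\<in>insert (a-1) {a..<a + int r'}. ibinom q j) = ibinom q (a-1) + (\<Sum>j\<in>{a..<a + int r'}. ibinom q j)"
      by simp
    also have "(\<Sum>j\<in>{a..<a + int r}. ibinom q j) + (ibinom q (a-1) + (\<Sum>j\<in>{a..<a + int r'}. ibinom q j))
      = (\<Sum>j\<in>insert (a-1) {a..<a + int r}. ibinom q j) + (\<Sum>j\<in>{a..<a + int r'}. ibinom q j)"
      by simp
    also have "insert (a-1) {a..<a + int r} = {a-1..<a - 1 + int (Suc (Suc r'))}" using Suc by auto
    finally show ?thesis using 1 2 Suc by simp
  qed
qed

lemma lo_count_even: "lo_count (2 * u) 1 \<le> (2 * u) choose u"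
proof -
  have "{int u..<int u + int 1} = {int u}" by auto
  then show ?thesis using lo_count_le_ibinom[of "int u" 1 "2*u"] by (simp add: ibinom_def)
qed

text \<open>Squared, this is an induction whose step is
  \<open>(2 * u + 1) * (2 * u + 3) \<le> (2 * u + 2)^2\<close>.\<close>

lemma central_binomial_upper: "real ((2 * u) choose u) * sqrt (2 * u + 1) \<le> 2 ^ (2 * u)"
proof -
  have "real ((2 * u) choose u) ^ 2 * (2 * u + 1) \<le> 16 ^ u"
  proof (induction u)
    case (Suc u)
    have "Suc u * ((2 * Suc u) choose Suc u) = 2 * (2 * u + 1) * ((2 * u) choose u)"
    proof -
      define X Y Z where XYZ: "X = Suc (Suc (2*u)) choose Suc u" "Y = (2*u) choose u" "Z = Suc (2*u) choose u"
      have X: "Suc u * X = Suc (Suc (2*u)) * Z" unfolding XYZ by (rule Suc_times_binomial)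
      have "Suc (2*u) choose Suc u = Z"
        using binomial_symmetric[of u "Suc (2*u)"] by (simp add: XYZ del: binomial_Suc_Suc)
      then have Z: "Suc u * Z = Suc (2*u) * Y"
        using Suc_times_binomial[of u "2*u"] by (simp only: XYZ)
      have "Suc u * (Suc u * X) = Suc (Suc (2*u)) * (Suc u * Z)"
        unfolding X by (rule mult.left_commute)
      also have "\<dots> = Suc u * (2 * Suc (2*u) * Y)" unfolding Z by simp
      finally have "Suc u * (Suc u * X) = Suc u * (2 * Suc (2*u) * Y)" .
      then have "Suc u * X = 2 * Suc (2*u) * Y" by (subst (asm) mult_cancel1) simp
      moreover have "2 * Suc u = Suc (Suc (2*u))" by simp
      ultimately show ?thesis unfolding XYZ by (simp del: binomial_Suc_Suc)
    qed
    then have "real (Suc u * ((2 * Suc u) choose Suc u)) = real (2 * (2 * u + 1) * ((2 * u) choose u))"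
      by (simp only:)
    moreover define x y U where "x = real ((2 * Suc u) choose Suc u)" and "y = real ((2 * u) choose u)" and "U = real u"
    ultimately have e: "(U + 1) * x = 2 * (2 * U + 1) * y" by (simp add: algebra_simps del: binomial_Suc_Suc)
    have IH: "y^2 * (2 * U + 1) \<le> 16 ^ u" using Suc by (simp add: y_def U_def add.commute)
    have U0: "U \<ge> 0" by (simp add: U_def)
    have "(U + 1)^2 * (x^2 * (2 * U + 3)) = ((U + 1) * x)^2 * (2 * U + 3)"
      by (simp add: power_mult_distrib)
    also have "\<dots> = 4 * ((2 * U + 1) * (2 * U + 3)) * (y^2 * (2 * U + 1))"
      unfolding e power2_eq_square by algebra
    also have "\<dots> \<le> 4 * (4 * (U + 1)^2) * 16 ^ u"
      by (rule mult_mono[OF _ IH]) (use U0 in \<open>auto simp: power2_eq_square algebra_simps\<close>)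
    finally have "(U + 1)^2 * (x^2 * (2 * U + 3)) \<le> (U + 1)^2 * 16 ^ Suc u" by simp
    moreover have "0 < (U + 1)^2" using U0 by simp
    ultimately have "x^2 * (2 * U + 3) \<le> 16 ^ Suc u" by (simp only: mult_le_cancel_left_pos)
    then show ?case by (simp add: x_def U_def algebra_simps del: binomial_Suc_Suc)
  qed auto
  moreover have "((2::real) ^ (2 * u))^2 = 16 ^ u"
    by (simp add: power_mult power2_eq_square flip: power_mult_distrib)
  ultimately have "(real ((2 * u) choose u) * sqrt (2 * u + 1))^2 \<le> (2 ^ (2 * u))^2"
    by (simp add: power_mult_distrib)
  then show ?thesis by (rule power2_le_imp_le) auto
qed

section \<open>The Littlewood--Offord bound for separated pairs\<close>

definition cells :: "real \<Rightarrow> real set \<Rightarrow> real set" where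
  "cells d L = (\<Union>z\<in>L. {z..<z + d})"

lemma sum_PiE_insert:
  fixes f :: "('i \<Rightarrow> 'a) \<Rightarrow> 'b::comm_monoid_add"
  assumes "i \<notin> I"
  shows "(\<Sum>b\<in>PiE (insert i I) V. f b) = (\<Sum>v\<in>V i. \<Sum>b\<in>PiE I V. f (b(i := v)))"
proof -
  have "(\<Sum>b\<in>PiE (insert i I) V. f b) = (\<Sum>b\<in>(\<lambda>(y, g). g(i := y)) ` (V i \<times> PiE I V). f b)"
    by (simp add: PiE_insert_eq)
  also have "\<dots> = (\<Sum>(v, b)\<in>V i \<times> PiE I V. f (b(i := v)))"
    by (subst sum.reindex[OF inj_combinator[OF assms]]) (simp add: case_prod_unfold o_def)
  finally show ?thesis by (simp add: sum.cartesian_product)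
qed

lemma indicator_cells_shift:
  fixes d s x :: real
  assumes "finite L" "L \<noteq> {}" "d \<le> s" "0 < d"
  shows "indicat_real (cells d L) x + indicat_real (cells d L) (x + s)
     \<le> indicat_real (cells d (insert (Max L) ((\<lambda>z. z - s) ` L))) x + indicat_real (cells d (L - {Max L})) x"
proof -
  have shift: "x \<in> cells d ((\<lambda>z. z - s) ` L)" if "x + s \<in> cells d L"
    using that by (force simp: cells_def)
  have ins: "cells d (insert (Max L) ((\<lambda>z. z - s) ` L)) = {Max L..<Max L + d} \<union> cells d ((\<lambda>z. z - s) ` L)"
    by (auto simp: cells_def)
  have spl: "x \<in> {Max L..<Max L + d} \<or> x \<in> cells d (L - {Max L})" if "x \<in> cells d L"
    using that by (force simp: cells_def)
  show ?thesis
  proof (cases "x \<in> {Max L..<Max L + d}")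
    case True
    have "x + s \<notin> cells d L"
    proof
      assume "x + s \<in> cells d L"
      then obtain z where "z \<in> L" "x + s < z + d" by (auto simp: cells_def)
      then show False using True Max_ge[OF assms(1), of z] assms(3) by auto
    qed
    then show ?thesis using True unfolding ins by (auto simp: indicator_def)
  next
    case False
    then show ?thesis using shift spl unfolding ins by (auto simp: indicator_def)
  qed
qed

text \<open>Under a uniform choice from \<open>V\<close>, such a matching exhibits the value of
  \<open>g\<close> as a random pair followed by a fair coin between two values at distance at least
  \<open>d\<close>.\<close>

definition split_pairs :: "real \<Rightarrow> ('a \<Rightarrow> real) \<Rightarrow> 'a set \<Rightarrow> bool" where
  "split_pairs d g V \<longleftrightarrow> (\<exists>V1 V2 \<pi>. V = V1 \<union> V2 \<and> V1 \<inter> V2 = {} \<and> bij_betw \<pi> V1 V2 \<and>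
     (\<forall>v\<in>V1. d \<le> \<bar>g (\<pi> v) - g v\<bar>))"

text \<open>Revealing coordinate \<open>i\<close> translates the family of cells. For
  \<open>i\<close> in \<open>Q\<close> the translates come in pairs at distance at least
  \<open>d\<close>, and the exchange of one cell turns a pair into families of sizes
  \<open>r + 1\<close> and \<open>r - 1\<close>, matching the recursion of \<open>lo_count\<close>.
  Allowing every \<open>r\<close> is what makes the induction close.\<close>

theorem littlewood_offord:
  fixes g :: "'i \<Rightarrow> 'a \<Rightarrow> real"
  assumes "finite I" "Q \<subseteq> I" "\<And>i. i \<in> I \<Longrightarrow> finite (V i)" "0 < d"
    and "\<And>i. i \<in> Q \<Longrightarrow> split_pairs d (g i) (V i)" and "finite L" "card L \<le> r"
  shows "(\<Sum>b\<in>PiE I V. indicat_real (cells d L) (\<Sum>i\<in>I. g i (b i))) * 2 ^ card Q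
     \<le> (\<Prod>i\<in>I. card (V i)) * lo_count (card Q) r"
  using assms
proof (induction I arbitrary: Q L r rule: finite_induct)
  case empty
  have "indicat_real (cells d L) 0 \<le> lo_count 0 r"
  proof (cases "r = 0")
    case True then have "L = {}" using empty.prems by simp
    then show ?thesis by (simp add: cells_def)
  qed (auto simp: indicator_def)
  then show ?case using empty.prems by simp
next
  case (insert i I)
  note d = insert.prems(3)
  define F where "F L = (\<Sum>b\<in>PiE I V. indicat_real (cells d L) (\<Sum>i\<in>I. g i (b i)))" for L
  define P where "P = real (\<Prod>i\<in>I. card (V i))"
  have P0: "P \<ge> 0" unfolding P_def by (simp add: prod_nonneg)
  have IH: "F L' * 2 ^ card Q' \<le> P * lo_count (card Q') r'"
    if "Q' \<subseteq> I" "Q' \<subseteq> Q" "finite L'" "card L' \<le> r'" for Q' L' r'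
    unfolding F_def P_def using insert.IH[OF that(1) _ d _ that(3,4)] insert.prems(2,4) that by auto
  have F0: "F {} = 0" by (simp add: F_def cells_def)
  have split: "(\<Sum>b\<in>PiE (insert i I) V. indicat_real (cells d L) (\<Sum>i\<in>insert i I. g i (b i)))
     = (\<Sum>v\<in>V i. F ((\<lambda>z. z - g i v) ` L))"
  proof -
    have "indicat_real (cells d L) (\<Sum>j\<in>insert i I. g j ((b(i := v)) j))
       = indicat_real (cells d ((\<lambda>z. z - g i v) ` L)) (\<Sum>j\<in>I. g j (b j))" for b v
    proof -
      have "(\<Sum>j\<in>I. g j ((b(i := v)) j)) = (\<Sum>j\<in>I. g j (b j))"
        using insert.hyps by (intro sum.cong) auto
      then have "(\<Sum>j\<in>insert i I. g j ((b(i := v)) j)) = g i v + (\<Sum>j\<in>I. g j (b j))"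
        using insert.hyps by simp
      moreover have "(g i v + x \<in> cells d L) = (x \<in> cells d ((\<lambda>z. z - g i v) ` L))" for x
        unfolding cells_def by (auto simp: algebra_simps)
      ultimately show ?thesis by (simp add: indicator_def)
    qed
    then show ?thesis using insert.hyps by (simp add: sum_PiE_insert F_def)
  qed
  have cardim: "card ((\<lambda>z. z - x) ` L) \<le> r" for x :: real
    using card_image_le[OF insert.prems(5)] insert.prems(6) le_trans by blast
  have prodI: "real (\<Prod>j\<in>insert i I. card (V j)) = real (card (V i)) * P"
    using insert.hyps by (simp add: P_def)
  show ?case
  proof (cases "i \<in> Q")
    case False
    then have QI: "Q \<subseteq> I" using insert.prems by auto
    have "(\<Sum>v\<in>V i. F ((\<lambda>z. z - g i v) ` L)) * 2 ^ card Q = (\<Sum>v\<in>V i. F ((\<lambda>z. z - g i v) ` L) * 2 ^ card Q)"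
      by (simp add: sum_distrib_right)
    also have "\<dots> \<le> (\<Sum>v\<in>V i. P * lo_count (card Q) r)"
      using IH[OF QI] insert.prems cardim by (intro sum_mono) auto
    finally show ?thesis using split prodI by (simp add: algebra_simps)
  next
    case True
    define Q' where "Q' = Q - {i}"
    have finQ: "finite Q" using insert.prems(1) insert.hyps finite_subset by blast
    have cQ: "card Q = Suc (card Q')" unfolding Q'_def using True finQ by (metis card_Suc_Diff1)
    have Q': "Q' \<subseteq> I" "Q' \<subseteq> Q" using insert.prems(1) by (auto simp: Q'_def)
    have pair0: "(F ((\<lambda>z. z - x) ` L) + F ((\<lambda>z. z - y) ` L)) * 2 ^ card Q' \<le> P * lo_count (card Q) r"
      if "d \<le> y - x" for x y
    proof (cases "L = {}")
      case True then show ?thesis using F0 P0 by simp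
    next
      case False
      define L' where "L' = (\<lambda>z. z - x) ` L"
      have fL': "finite L'" "L' \<noteq> {}" using insert.prems False by (auto simp: L'_def)
      obtain r' where r': "r = Suc r'" using False insert.prems by (cases r) auto
      have img: "(\<lambda>z. z - y) ` L = (\<lambda>z. z - (y - x)) ` L'" by (force simp: L'_def)
      have sh: "indicat_real (cells d ((\<lambda>z. z - (y - x)) ` L')) w = indicat_real (cells d L') (w + (y - x))" for w
        by (force simp: cells_def indicator_def)
      have "F L' + F ((\<lambda>z. z - (y - x)) ` L') =
         (\<Sum>b\<in>PiE I V. indicat_real (cells d L') (\<Sum>i\<in>I. g i (b i)) + indicat_real (cells d L') ((\<Sum>i\<in>I. g i (b i)) + (y - x)))"
        unfolding F_def sh by (simp add: sum.distrib)
      also have "\<dots> \<le> (\<Sum>b\<in>PiE I V. indicat_real (cells d (insert (Max L') ((\<lambda>z. z - (y - x)) ` L'))) (\<Sum>i\<in>I. g i (b i))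
           + indicat_real (cells d (L' - {Max L'})) (\<Sum>i\<in>I. g i (b i)))"
        using indicator_cells_shift[OF fL' that d] by (intro sum_mono) auto
      also have "\<dots> = F (insert (Max L') ((\<lambda>z. z - (y - x)) ` L')) + F (L' - {Max L'})"
        unfolding F_def by (simp add: sum.distrib)
      finally have "(F L' + F ((\<lambda>z. z - (y - x)) ` L')) * 2 ^ card Q' \<le>
          F (insert (Max L') ((\<lambda>z. z - (y - x)) ` L')) * 2 ^ card Q' + F (L' - {Max L'}) * 2 ^ card Q'"
        unfolding distrib_right[symmetric] by (intro mult_right_mono) auto
      also have "\<dots> \<le> P * lo_count (card Q') (Suc (Suc r')) + P * lo_count (card Q') r'"
      proof (intro add_mono IH Q')
        have "card ((\<lambda>z. z - (y - x)) ` L') \<le> Suc r'"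
          using cardim[of y] r' img by simp
        then show "card (insert (Max L') ((\<lambda>z. z - (y - x)) ` L')) \<le> Suc (Suc r')"
          using fL' by (simp add: card_insert_if)
        show "card (L' - {Max L'}) \<le> r'"
          using cardim[of x] r' fL' by (simp add: L'_def[symmetric])
      qed (use fL' in auto)
      also have "\<dots> = P * lo_count (card Q) r" unfolding cQ r' by (simp add: algebra_simps)
      finally show ?thesis unfolding img L'_def[symmetric] .
    qed
    have pair: "(F ((\<lambda>z. z - x) ` L) + F ((\<lambda>z. z - y) ` L)) * 2 ^ card Q' \<le> P * lo_count (card Q) r"
      if "d \<le> \<bar>y - x\<bar>" for x y
      using pair0[of x y] pair0[of y x] that by (cases "y \<ge> x") (auto simp: add.commute)
    obtain V1 V2 \<pi> where V: "V i = V1 \<union> V2" "V1 \<inter> V2 = {}" "bij_betw \<pi> V1 V2"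
      "\<forall>v\<in>V1. d \<le> \<bar>g i (\<pi> v) - g i v\<bar>"
      using insert.prems(4)[OF True] unfolding split_pairs_def by auto
    have finV: "finite V1" "finite V2" using insert.prems(2)[of i] V by auto
    have "(\<Sum>v\<in>V i. F ((\<lambda>z. z - g i v) ` L)) = (\<Sum>v\<in>V1. F ((\<lambda>z. z - g i v) ` L)) + (\<Sum>v\<in>V2. F ((\<lambda>z. z - g i v) ` L))"
      unfolding V(1) using finV V(2) by (simp add: sum.union_disjoint)
    also have "(\<Sum>v\<in>V2. F ((\<lambda>z. z - g i v) ` L)) = (\<Sum>v\<in>V1. F ((\<lambda>z. z - g i (\<pi> v)) ` L))"
      using sum.reindex_bij_betw[OF V(3), of "\<lambda>v. F ((\<lambda>z. z - g i v) ` L)"] by simp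
    finally have "(\<Sum>v\<in>V i. F ((\<lambda>z. z - g i v) ` L)) * 2 ^ card Q =
       2 * (\<Sum>v\<in>V1. (F ((\<lambda>z. z - g i v) ` L) + F ((\<lambda>z. z - g i (\<pi> v)) ` L)) * 2 ^ card Q')"
      unfolding cQ by (simp add: sum.distrib sum_distrib_right sum_distrib_left algebra_simps)
    also have "\<dots> \<le> 2 * (\<Sum>v\<in>V1. P * lo_count (card Q) r)"
      using V(4) by (intro mult_left_mono sum_mono pair) auto
    also have "\<dots> = (2 * card V1) * P * lo_count (card Q) r" by simp
    also have "2 * card V1 = card (V i)"
      using V finV bij_betw_same_card[OF V(3)] by (simp add: card_Un_disjoint)
    finally show ?thesis using split prodI by simp
  qed
qed

section \<open>Exponential potentials\<close>

lemma sum_half_power_int: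
  assumes "finite (X :: int set)"
  shows "(\<Sum>r\<in>X. (1/2::real) ^ nat \<bar>r\<bar>) \<le> 4"
proof -
  have geo: "(\<Sum>j\<in>J. (1/2::real) ^ j) \<le> 2" if "finite J" for J :: "nat set"
  proof -
    have "(\<Sum>j\<in>J. (1/2::real) ^ j) \<le> (\<Sum>j. (1/2) ^ j)"
      using that by (intro sum_le_suminf) (auto simp: summable_geometric)
    also have "\<dots> = 2" by (simp add: suminf_geometric)
    finally show ?thesis .
  qed
  have part: "(\<Sum>r\<in>Y. (1/2::real) ^ nat \<bar>r\<bar>) \<le> 2" if "finite Y" "inj_on (\<lambda>r. nat \<bar>r\<bar>) Y" for Y :: "int set"
    using geo[of "(\<lambda>r. nat \<bar>r\<bar>) ` Y"] that by (simp add: sum.reindex)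
  have "(\<Sum>r\<in>X. (1/2::real) ^ nat \<bar>r\<bar>) = (\<Sum>r\<in>{r\<in>X. r \<ge> 0}. (1/2::real) ^ nat \<bar>r\<bar>) + (\<Sum>r\<in>{r\<in>X. \<not> r \<ge> 0}. (1/2::real) ^ nat \<bar>r\<bar>)"
  proof -
    have "X = {r\<in>X. r \<ge> 0} \<union> {r\<in>X. \<not> r \<ge> 0}" by auto
    moreover have "(\<Sum>r\<in>{r\<in>X. r \<ge> 0} \<union> {r\<in>X. \<not> r \<ge> 0}. (1/2::real) ^ nat \<bar>r\<bar>) = (\<Sum>r\<in>{r\<in>X. r \<ge> 0}. (1/2::real) ^ nat \<bar>r\<bar>) + (\<Sum>r\<in>{r\<in>X. \<not> r \<ge> 0}. (1/2::real) ^ nat \<bar>r\<bar>)"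
      using assms by (intro sum.union_disjoint) auto
    ultimately show ?thesis by simp
  qed
  also have "\<dots> \<le> 2 + 2"
    using assms by (intro add_mono part) (auto simp: inj_on_def)
  finally show ?thesis by simp
qed

lemma exp_le_quadratic:
  assumes "\<bar>x::real\<bar> \<le> 1"
  shows "exp x \<le> 1 + x + x^2"
proof (cases "x \<ge> 0")
  case True
  then show ?thesis using exp_bound[of x] assms by simp
next
  case False
  have "1 \<le> (1 + x + x^2) * (1 - x)"
  proof -
    have "(1 + x + x^2) * (1 - x) = 1 + (-x)^3" by (simp add: algebra_simps power2_eq_square power3_eq_cube)
    moreover have "(-x)^3 \<ge> 0" using False by simp
    ultimately show ?thesis by linarith
  qed
  also have "\<dots> \<le> (1 + x + x^2) * exp (- x)"
  proof (intro mult_left_mono)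
    show "1 - x \<le> exp (- x)" using exp_ge_add_one_self[of "- x"] by simp
    show "0 \<le> 1 + x + x^2" using assms by (smt (verit) zero_le_power2)
  qed
  finally show ?thesis by (simp add: exp_minus field_simps)
qed

text \<open>In \<open>exp x \<le> 1 + x + x^2\<close> the linear term sums to zero, and the bound on
  \<mu> makes the quadratic one at most \<open>1 / card I\<close>. The product of the factors is
  then at most \<open>exp 1\<close>.\<close>

lemma exp_moment_bound:
  fixes g :: "'i \<Rightarrow> 'a \<Rightarrow> real" and \<mu> R :: real
  assumes "finite I" "I \<noteq> {}" and fin: "\<And>i. i \<in> I \<Longrightarrow> finite (V i)"
    and zero: "\<And>i. i \<in> I \<Longrightarrow> (\<Sum>v\<in>V i. g i v) = 0"
    and bd: "\<And>i v. i \<in> I \<Longrightarrow> v \<in> V i \<Longrightarrow> \<bar>g i v\<bar> \<le> R" and R: "R > 0"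
    and \<mu>: "\<bar>\<mu>\<bar> * (sqrt (card I) * R) \<le> 1"
  shows "(\<Sum>b\<in>PiE I V. exp (\<mu> * (\<Sum>i\<in>I. g i (b i)))) \<le> 3 * (\<Prod>i\<in>I. real (card (V i)))"
proof -
  define k where "k = real (card I)"
  have k: "k \<ge> 1" using assms(1,2) by (simp add: k_def Suc_leI card_gt_0_iff)
  have \<mu>R2: "(\<mu> * R)^2 * k \<le> 1"
  proof -
    have "(\<bar>\<mu>\<bar> * (sqrt k * R))^2 \<le> 1^2" using \<mu> R k by (intro power_mono) (auto simp: k_def)
    then show ?thesis using k by (simp add: power_mult_distrib algebra_simps)
  qed
  have "(\<mu> * R)^2 * 1 \<le> (\<mu> * R)^2 * k" using k by (intro mult_left_mono) auto
  then have "(\<mu> * R)^2 \<le> 1^2" using \<mu>R2 by simp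
  then have \<mu>R: "\<bar>\<mu> * R\<bar> \<le> 1" using abs_le_square_iff[of "\<mu> * R" 1] by simp
  have one: "(\<Sum>v\<in>V i. exp (\<mu> * g i v)) \<le> card (V i) * exp (1 / k)" if i: "i \<in> I" for i
  proof -
    have "(\<Sum>v\<in>V i. exp (\<mu> * g i v)) \<le> (\<Sum>v\<in>V i. 1 + \<mu> * g i v + 1 / k)"
    proof (rule sum_mono)
      fix v assume v: "v \<in> V i"
      have le: "\<bar>\<mu> * g i v\<bar> \<le> \<bar>\<mu> * R\<bar>" using bd[OF i v] R by (simp add: abs_mult mult_left_mono)
      then have "exp (\<mu> * g i v) \<le> 1 + \<mu> * g i v + (\<mu> * g i v)^2" using \<mu>R by (intro exp_le_quadratic) auto
      moreover have "(\<mu> * g i v)^2 \<le> (\<mu> * R)^2" using le abs_le_square_iff by blast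
      moreover have "(\<mu> * R)^2 \<le> 1 / k" using \<mu>R2 k by (simp add: field_simps)
      ultimately show "exp (\<mu> * g i v) \<le> 1 + \<mu> * g i v + 1 / k" by linarith
    qed
    also have "\<dots> = card (V i) * (1 + 1 / k)"
      using zero[OF i] by (simp add: sum.distrib algebra_simps flip: sum_distrib_left)
    also have "\<dots> \<le> card (V i) * exp (1 / k)"
      using exp_ge_add_one_self[of "1 / k"] by (intro mult_left_mono) auto
    finally show ?thesis .
  qed
  have "(\<Sum>b\<in>PiE I V. exp (\<mu> * (\<Sum>i\<in>I. g i (b i)))) = (\<Prod>i\<in>I. \<Sum>v\<in>V i. exp (\<mu> * g i v))"
    using assms(1) fin by (simp add: prod_sum_PiE exp_sum sum_distrib_left)
  also have "\<dots> \<le> (\<Prod>i\<in>I. card (V i) * exp (1 / k))"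
    using one by (intro prod_mono) (auto intro!: sum_nonneg)
  also have "\<dots> = (\<Prod>i\<in>I. real (card (V i))) * exp (1 / k) ^ card I" by (simp add: prod.distrib)
  also have "exp (1 / k) ^ card I = exp 1" using k by (simp add: k_def flip: exp_of_nat_mult)
  also have "(\<Prod>i\<in>I. real (card (V i))) * exp 1 \<le> (\<Prod>i\<in>I. real (card (V i))) * 3"
    using exp_le by (intro mult_left_mono prod_nonneg) auto
  finally show ?thesis by simp
qed

text \<open>Each cell of length \<open>d\<close> carries at most a
  \<open>1 / sqrt (2 * u + 1)\<close> share of the tuples, and the weight of the cell with index
  \<open>x\<close> is at most 3 times \<open>(1/2) ^ \<bar>x\<bar>\<close>, with sum at most
  12.\<close>

lemma concentration_exp_sum:
  fixes g :: "'i \<Rightarrow> 'a \<Rightarrow> real" and d y :: real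
  assumes "finite I" "Q \<subseteq> I" and fin: "\<And>i. i \<in> I \<Longrightarrow> finite (V i)" and d: "0 < d"
    and sp: "\<And>i. i \<in> Q \<Longrightarrow> split_pairs d (g i) (V i)" and Q: "card Q = 2 * u"
  shows "(\<Sum>b\<in>PiE I V. exp (- \<bar>y + (\<Sum>i\<in>I. g i (b i))\<bar> / d)) \<le> 12 / sqrt (2 * u + 1) * (\<Prod>i\<in>I. real (card (V i)))"
proof -
  define P where "P = (\<Prod>i\<in>I. real (card (V i)))"
  have P0: "P \<ge> 0" unfolding P_def by (intro prod_nonneg) auto
  define v where "v b = y + (\<Sum>i\<in>I. g i (b i))" for b
  define r where "r b = \<lfloor>v b / d\<rfloor>" for b
  have finP: "finite (PiE I V)" using assms(1) fin by (intro finite_PiE) auto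
  have cell: "card {b\<in>PiE I V. r b = x} \<le> P / sqrt (2 * u + 1)" for x
  proof -
    define z where "z = d * x - y"
    have iff: "r b = x \<longleftrightarrow> (\<Sum>i\<in>I. g i (b i)) \<in> cells d {z}" for b
      unfolding r_def v_def z_def cells_def floor_eq_iff using d by (auto simp: field_simps)
    have "real (card {b\<in>PiE I V. r b = x}) = (\<Sum>b\<in>PiE I V. indicat_real (cells d {z}) (\<Sum>i\<in>I. g i (b i)))"
      using finP by (simp add: iff indicator_def sum.If_cases Int_def)
    moreover have "(\<Sum>b\<in>PiE I V. indicat_real (cells d {z}) (\<Sum>i\<in>I. g i (b i))) * 2 ^ (2 * u) \<le> P * lo_count (2 * u) 1"
      using littlewood_offord[OF assms(1,2) fin d sp, where L = "{z}" and r = 1] Q by (simp add: P_def)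
    moreover have "P * lo_count (2 * u) 1 \<le> P * (2 ^ (2 * u) / sqrt (2 * u + 1))"
    proof (intro mult_left_mono P0)
      have "real (lo_count (2 * u) 1) * sqrt (2 * u + 1) \<le> real ((2 * u) choose u) * sqrt (2 * u + 1)"
        using lo_count_even[of u] by (intro mult_right_mono) auto
      also have "\<dots> \<le> 2 ^ (2 * u)" by (rule central_binomial_upper)
      finally show "real (lo_count (2 * u) 1) \<le> 2 ^ (2 * u) / sqrt (2 * u + 1)"
        by (simp add: field_simps)
    qed
    ultimately have "card {b\<in>PiE I V. r b = x} * 2 ^ (2 * u) \<le> P * (2 ^ (2 * u) / sqrt (2 * u + 1))"
      by simp
    also have "\<dots> = P / sqrt (2 * u + 1) * 2 ^ (2 * u)" by simp
    finally have "card {b\<in>PiE I V. r b = x} * (2::real) ^ (2 * u) \<le> P / sqrt (2 * u + 1) * 2 ^ (2 * u)" by simp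
    then show ?thesis by (subst (asm) mult_le_cancel_right) auto
  qed
  have "(\<Sum>b\<in>PiE I V. exp (- \<bar>v b\<bar> / d)) \<le> (\<Sum>b\<in>PiE I V. 3 * (1/2) ^ nat \<bar>r b\<bar>)"
  proof (rule sum_mono)
    fix b
    define t where "t = real_of_int \<bar>r b\<bar>"
    have 1: "t - 1 \<le> \<bar>v b\<bar> / d"
    proof -
      have "r b \<le> v b / d" "v b / d < r b + 1" unfolding r_def by linarith+
      moreover have "\<bar>v b\<bar> / d = \<bar>v b / d\<bar>" using d by simp
      ultimately show ?thesis unfolding t_def by linarith
    qed
    have "exp (- \<bar>v b\<bar> / d) \<le> exp (1 - t)" using 1 by simp
    also have "\<dots> = exp 1 * exp (- 1) ^ nat \<bar>r b\<bar>"
      by (simp add: t_def flip: exp_of_nat_mult exp_add)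
    also have "\<dots> \<le> 3 * (1/2) ^ nat \<bar>r b\<bar>"
    proof (intro mult_mono power_mono)
      show "exp (- 1) \<le> (1/2::real)" using exp_ge_add_one_self[of 1] by (simp add: exp_minus field_simps)
    qed (use exp_le in auto)
    finally show "exp (- \<bar>v b\<bar> / d) \<le> 3 * (1/2) ^ nat \<bar>r b\<bar>" .
  qed
  also have "\<dots> = (\<Sum>x\<in>r ` PiE I V. \<Sum>b\<in>{b\<in>PiE I V. r b = x}. 3 * (1/2) ^ nat \<bar>r b\<bar>)"
    by (rule sum.image_gen[OF finP])
  also have "\<dots> = (\<Sum>x\<in>r ` PiE I V. card {b\<in>PiE I V. r b = x} * (3 * (1/2) ^ nat \<bar>x\<bar>))"
    by (intro sum.cong refl) simp
  also have "\<dots> \<le> (\<Sum>x\<in>r ` PiE I V. P / sqrt (2 * u + 1) * (3 * (1/2) ^ nat \<bar>x\<bar>))"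
    using cell by (intro sum_mono mult_right_mono) auto
  also have "\<dots> = 3 * P / sqrt (2 * u + 1) * (\<Sum>x\<in>r ` PiE I V. (1/2) ^ nat \<bar>x\<bar>)"
    by (simp add: sum_distrib_left algebra_simps)
  also have "\<dots> \<le> 3 * P / sqrt (2 * u + 1) * 4"
    using P0 finP by (intro mult_left_mono sum_half_power_int) auto
  finally show ?thesis by (simp add: v_def P_def)
qed

text \<open>Since \<open>2 * \<tau>\<close> is at most both \<open>d\<close> and \<tau>', one half
  of the exponent is spent on scale \<open>d\<close>, where the sum is anticoncentrated, and the
  other half on scale \<tau>', to get back to \<open>y\<close>. The latter costs
  \<open>exp (\<bar>D b\<bar> / \<tau>')\<close>: at most \<open>exp s\<close> for small
  displacements, while large ones are rare by exponential moments.\<close>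

theorem potential_step:
  fixes g :: "'i \<Rightarrow> 'a \<Rightarrow> real" and d y R h s \<tau> \<tau>' :: real
  assumes "finite I" "I \<noteq> {}" "Q \<subseteq> I" and fin: "\<And>i. i \<in> I \<Longrightarrow> finite (V i)"
    and zero: "\<And>i. i \<in> I \<Longrightarrow> (\<Sum>v\<in>V i. g i v) = 0"
    and bd: "\<And>i v. i \<in> I \<Longrightarrow> v \<in> V i \<Longrightarrow> \<bar>g i v\<bar> \<le> R" and R: "R > 0"
    and sp: "\<And>i. i \<in> Q \<Longrightarrow> split_pairs d (g i) (V i)" and Q: "card Q = 2 * u"
    and \<tau>: "0 < \<tau>" "2 * \<tau> \<le> d" "2 * \<tau> \<le> \<tau>'" and \<tau>': "\<tau>' = (1 + h) * (sqrt (card I) * R)" and h: "h > 0" and s: "s \<ge> 0"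
  shows "(\<Sum>b\<in>PiE I V. exp (- \<bar>y + (\<Sum>i\<in>I. g i (b i))\<bar> / \<tau>))
     \<le> (12 * exp s / sqrt (2 * u + 1) + 6 * exp (- h * s)) * (\<Prod>i\<in>I. real (card (V i))) * exp (- \<bar>y\<bar> / \<tau>')"
proof -
  define P where "P = (\<Prod>i\<in>I. real (card (V i)))"
  define D where "D b = (\<Sum>i\<in>I. g i (b i))" for b
  \<comment> \<open>The largest rate allowed by \<open>exp_moment_bound\<close>. It exceeds
    \<open>1 / \<tau>'\<close> by \<open>h / \<tau>'\<close>, so for displacements beyond
    \<open>s * \<tau>'\<close> there is a factor \<open>exp (- h * s)\<close> to spare.\<close>
  define \<mu> where "\<mu> = (1 + h) / \<tau>'"
  have \<tau>'0: "\<tau>' > 0" using \<tau> by linarith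
  have d: "d > 0" using \<tau> by linarith
  have \<mu>0: "\<mu> > 0" using h \<tau>'0 by (simp add: \<mu>_def)
  have \<mu>1: "\<mu> * (sqrt (card I) * R) \<le> 1"
    using \<tau>' \<tau>'0 h by (auto simp: \<mu>_def)
  have pw: "exp (- \<bar>y + D b\<bar> / \<tau>) \<le> exp (- \<bar>y\<bar> / \<tau>') *
      (exp s * exp (- \<bar>y + D b\<bar> / d) + exp (- h * s) * (exp (\<mu> * D b) + exp (- \<mu> * D b)))" for b
  proof -
    let ?w = "\<bar>y + D b\<bar>"
    have e1: "?w / d \<le> ?w / (2 * \<tau>)" using \<tau> d by (intro divide_left_mono) auto
    have e2: "?w / \<tau>' \<le> ?w / (2 * \<tau>)" using \<tau> \<tau>'0 by (intro divide_left_mono) auto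
    have e3: "\<bar>y\<bar> / \<tau>' \<le> ?w / \<tau>' + \<bar>D b\<bar> / \<tau>'"
      using \<tau>'0 by (simp add: divide_right_mono flip: add_divide_distrib)
    have e4: "?w / \<tau> = ?w / (2 * \<tau>) + ?w / (2 * \<tau>)" using \<tau> by (simp add: field_simps)
    have w0: "?w / d \<ge> 0" using d by simp
    have main: "- ?w / \<tau> \<le> - \<bar>y\<bar> / \<tau>' + (\<bar>D b\<bar> / \<tau>' - ?w / d)"
      using e1 e2 e3 e4 by linarith
    show ?thesis
    proof (cases "\<bar>D b\<bar> / \<tau>' \<le> s")
      case True
      have "exp (- ?w / \<tau>) \<le> exp (- \<bar>y\<bar> / \<tau>' + (s - ?w / d))" using main True by simp
      also have "\<dots> = exp (- \<bar>y\<bar> / \<tau>') * (exp s * exp (- ?w / d))"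
        by (simp flip: exp_add)
      also have "\<dots> \<le> exp (- \<bar>y\<bar> / \<tau>') * (exp s * exp (- ?w / d) + exp (- h * s) * (exp (\<mu> * D b) + exp (- \<mu> * D b)))"
        by (intro mult_left_mono) auto
      finally show ?thesis .
    next
      case False
      have "h * s \<le> h * (\<bar>D b\<bar> / \<tau>')" using False h by (intro mult_left_mono) auto
      then have "\<bar>D b\<bar> / \<tau>' \<le> - h * s + \<mu> * \<bar>D b\<bar>" by (simp add: \<mu>_def algebra_simps add_divide_distrib)
      then have "exp (- ?w / \<tau>) \<le> exp (- \<bar>y\<bar> / \<tau>' + (- h * s + \<mu> * \<bar>D b\<bar>))" using main w0 by simp
      also have "\<dots> = exp (- \<bar>y\<bar> / \<tau>') * (exp (- h * s) * exp (\<mu> * \<bar>D b\<bar>))" by (simp flip: exp_add)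
      also have "\<dots> \<le> exp (- \<bar>y\<bar> / \<tau>') * (exp s * exp (- ?w / d) + exp (- h * s) * (exp (\<mu> * D b) + exp (- \<mu> * D b)))"
      proof (intro mult_left_mono)
        have "exp (\<mu> * \<bar>D b\<bar>) \<le> exp (\<mu> * D b) + exp (- \<mu> * D b)"
          by (cases "D b \<ge> 0") (auto simp: abs_if)
        then have "exp (- h * s) * exp (\<mu> * \<bar>D b\<bar>) \<le> exp (- h * s) * (exp (\<mu> * D b) + exp (- \<mu> * D b))"
          by (intro mult_left_mono) auto
        then show "exp (- h * s) * exp (\<mu> * \<bar>D b\<bar>) \<le> exp s * exp (- ?w / d) + exp (- h * s) * (exp (\<mu> * D b) + exp (- \<mu> * D b))"
          by (smt (verit) exp_gt_zero mult_pos_pos)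
      qed auto
      finally show ?thesis .
    qed
  qed
  have S1: "(\<Sum>b\<in>PiE I V. exp (- \<bar>y + D b\<bar> / d)) \<le> 12 / sqrt (2 * u + 1) * P"
    unfolding D_def P_def by (rule concentration_exp_sum[OF assms(1,3) fin d sp Q])
  have S2: "(\<Sum>b\<in>PiE I V. exp (\<mu> * D b)) \<le> 3 * P" "(\<Sum>b\<in>PiE I V. exp (- \<mu> * D b)) \<le> 3 * P"
    unfolding D_def P_def using \<mu>0 \<mu>1
    by (intro exp_moment_bound[OF assms(1,2) fin zero bd R]; simp)+
  have "(\<Sum>b\<in>PiE I V. exp (- \<bar>y + D b\<bar> / \<tau>)) \<le> (\<Sum>b\<in>PiE I V. exp (- \<bar>y\<bar> / \<tau>') *
      (exp s * exp (- \<bar>y + D b\<bar> / d) + exp (- h * s) * (exp (\<mu> * D b) + exp (- \<mu> * D b))))"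
    by (intro sum_mono pw)
  also have "\<dots> = exp (- \<bar>y\<bar> / \<tau>') * (exp s * (\<Sum>b\<in>PiE I V. exp (- \<bar>y + D b\<bar> / d))
      + exp (- h * s) * ((\<Sum>b\<in>PiE I V. exp (\<mu> * D b)) + (\<Sum>b\<in>PiE I V. exp (- \<mu> * D b))))"
    by (simp add: sum.distrib sum_distrib_left algebra_simps)
  also have "\<dots> \<le> exp (- \<bar>y\<bar> / \<tau>') * (exp s * (12 / sqrt (2 * u + 1) * P) + exp (- h * s) * (3 * P + 3 * P))"
    using S1 S2 by (intro mult_left_mono add_mono) auto
  also have "\<dots> = (12 * exp s / sqrt (2 * u + 1) + 6 * exp (- h * s)) * P * exp (- \<bar>y\<bar> / \<tau>')"
    by (simp add: algebra_simps)
  finally show ?thesis by (simp add: D_def P_def)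
qed

section \<open>Uniform trees\<close>

definition node :: "nat \<Rightarrow> nat set \<Rightarrow> nat \<Rightarrow> nat \<Rightarrow> nat set" where
  "node D X i x = {y\<in>X. y div D ^ i = x div D ^ i}"

definition children :: "nat \<Rightarrow> nat set \<Rightarrow> nat \<Rightarrow> nat \<Rightarrow> nat set" where
  "children D X i x = (\<lambda>y. y div D ^ i) ` node D X (Suc i) x"

text \<open>Equal parity puts distinct children at index distance at least 2, so points in different
  children are at least \<open>D ^ i\<close> apart. Powers of two as numbers of children allow an
  exact halving. Only the heights below \<open>n\<close> are constrained.\<close>

definition uniform_below :: "nat \<Rightarrow> nat set \<Rightarrow> (nat \<Rightarrow> nat) \<Rightarrow> nat \<Rightarrow> bool" where
  "uniform_below D X a n \<longleftrightarrow> (\<forall>i<n. \<forall>x\<in>X. card (children D X i x) = 2 ^ a i \<and>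
     (\<forall>y\<in>node D X (Suc i) x. (y div D ^ i) mod 2 = (x div D ^ i) mod 2))"

lemma node_refl: "x \<in> X \<Longrightarrow> x \<in> node D X i x" by (simp add: node_def)

lemma node_subset: "node D X i x \<subseteq> X" by (auto simp: node_def)

lemma node_eq: "y \<in> node D X i x \<Longrightarrow> node D X i y = node D X i x" by (auto simp: node_def)

lemma div_pow_Suc: "x div (D::nat) ^ Suc i = (x div D ^ i) div D"
  by (metis div_mult2_eq power_Suc2)

lemma div_pow_mono:
  assumes "i \<le> j" "x div (D::nat) ^ i = y div D ^ i"
  shows "x div D ^ j = y div D ^ j"
  using assms by (induction j rule: dec_induct) (auto simp: div_pow_Suc simp del: power_Suc)

lemma node_mono: "i \<le> j \<Longrightarrow> node D X i x \<subseteq> node D X j x"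
  unfolding node_def using div_pow_mono by blast

lemma card_node:
  assumes fin: "finite X" and u: "uniform_below D X a n" and "x \<in> X" "i \<le> n" and D: "D > 0"
  shows "card (node D X i x) = 2 ^ (\<Sum>j<i. a j)"
  using assms(3,4)
proof (induction i arbitrary: x)
  case 0
  then have "node D X 0 x = {x}" by (auto simp: node_def)
  then show ?case by simp
next
  case (Suc i)
  let ?N = "node D X (Suc i) x"
  have finN: "finite ?N" using fin node_subset finite_subset by metis
  have fib: "card {y\<in>?N. y div D ^ i = c} = 2 ^ (\<Sum>j<i. a j)" if c: "c \<in> children D X i x" for c
  proof -
    obtain z where z: "z \<in> ?N" "c = z div D ^ i" using c by (auto simp: children_def)
    have "{y\<in>?N. y div D ^ i = c} = node D X i z"
    proof -
      have "node D X i z \<subseteq> ?N" using node_mono[of i "Suc i" D X z] node_eq[OF z(1)] by auto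
      then show ?thesis using z node_subset[of D X "Suc i" x] by (auto simp: node_def)
    qed
    then show ?thesis using Suc.IH[of z] z node_subset[of D X "Suc i" x] Suc.prems by auto
  qed
  have "card ?N = (\<Sum>c\<in>children D X i x. card {y\<in>?N. y div D ^ i = c})"
    using finN card_eq_sum sum.image_gen[OF finN, of "\<lambda>_. 1::nat" "\<lambda>y. y div D ^ i"]
    by (simp add: children_def)
  also have "\<dots> = card (children D X i x) * 2 ^ (\<Sum>j<i. a j)" using fib by simp
  also have "card (children D X i x) = 2 ^ a i" using u Suc.prems by (auto simp: uniform_below_def)
  finally show ?case by (simp add: power_add)
qed

text \<open>A factor 2 is lost for the parity class and another for rounding down to a power of
  two.\<close>

lemma trim_children:
  assumes fin: "finite (S :: nat set)" "S \<noteq> {}"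
  shows "\<exists>T a. T \<subseteq> S \<and> card T = 2 ^ a \<and> card S \<le> 4 * card T \<and> (\<forall>x\<in>T. \<forall>y\<in>T. x mod 2 = y mod 2)"
proof -
  have "\<exists>e. card S \<le> 2 * card {x\<in>S. x mod 2 = e} \<and> {x\<in>S. x mod 2 = e} \<noteq> {}"
  proof -
    have "S = {x\<in>S. x mod 2 = 0} \<union> {x\<in>S. x mod 2 = 1}" by auto
    then have "card S \<le> card {x\<in>S. x mod 2 = 0} + card {x\<in>S. x mod 2 = 1}" by (metis card_Un_le)
    moreover have "card S > 0" using fin by (simp add: card_gt_0_iff)
    ultimately have "\<exists>e. card S \<le> 2 * card {x\<in>S. x mod 2 = e}"
      by (cases "card {x\<in>S. x mod 2 = 1} \<le> card {x\<in>S. x mod 2 = 0}") (auto intro: exI[of _ 0] exI[of _ 1])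
    then obtain e where e: "card S \<le> 2 * card {x\<in>S. x mod 2 = e}" by blast
    then have "card {x\<in>S. x mod 2 = e} > 0" using \<open>card S > 0\<close> by linarith
    then have "{x\<in>S. x mod 2 = e} \<noteq> {}" by (metis card_gt_0_iff)
    then show ?thesis using e by blast
  qed
  then obtain e where e: "card S \<le> 2 * card {x\<in>S. x mod 2 = e}" "{x\<in>S. x mod 2 = e} \<noteq> {}" by blast
  let ?R = "{x\<in>S. x mod 2 = e}"
  have "card ?R \<ge> 1" using e(2) fin by (simp add: Suc_leI card_gt_0_iff)
  then obtain a where a: "2 ^ a \<le> card ?R" "card ?R < 2 ^ Suc a"
    using ex_power_ivl1[of 2 "card ?R"] by auto
  obtain T where T: "T \<subseteq> ?R" "card T = 2 ^ a" using obtain_subset_with_card_n[OF a(1)] by metis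
  have "card S \<le> 4 * card T" using e(1) a(2) T(2) by simp
  then show ?thesis using T by (intro exI[of _ T] exI[of _ a]) auto
qed

text \<open>Trees are made uniform from the leaves upwards: discarding whole subtrees of height
  \<open>i\<close> leaves all lower levels intact. These subtrees all have \<open>Q\<close> leaves,
  so counting children is counting leaves. The exponent of a node of height \<open>i + 1\<close>
  takes at most \<open>W + 1\<close> values, and the most popular one is kept.\<close>

lemma uniform_extend:
  assumes fin: "finite Y" "Y \<noteq> {}" and u: "uniform_below D Y a i" and D: "D = 2 ^ W"
  shows "\<exists>Z e. Z \<subseteq> Y \<and> Z \<noteq> {} \<and> uniform_below D Z (a(i := e)) (Suc i) \<and> card Y \<le> 4 * (W + 1) * card Z"
proof -
  note [simp del] = power_Suc
  have D0: "D > 0" using D by simp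
  define Q :: nat where "Q = 2 ^ (\<Sum>j<i. a j)"
  define K where "K = (\<lambda>y. y div D ^ Suc i) ` Y"
  define ch where "ch v = (\<lambda>y. y div D ^ i) ` {y\<in>Y. y div D ^ Suc i = v}" for v
  have finK: "finite K" using fin by (simp add: K_def)
  have ch: "finite (ch v)" "v \<in> K \<Longrightarrow> ch v \<noteq> {}" for v using fin by (auto simp: ch_def K_def)
  have ex: "\<exists>T. \<exists>e. v \<in> K \<longrightarrow> T \<subseteq> ch v \<and> card T = 2 ^ e \<and> card (ch v) \<le> 4 * card T \<and> (\<forall>x\<in>T. \<forall>y\<in>T. x mod 2 = y mod 2)" for v
    using trim_children[OF ch(1)[of v]] ch(2)[of v] by blast
  then obtain T e where Te: "\<And>v. v \<in> K \<Longrightarrow> T v \<subseteq> ch v \<and> card (T v) = 2 ^ e v \<and> card (ch v) \<le> 4 * card (T v) \<and> (\<forall>x\<in>T v. \<forall>y\<in>T v. x mod 2 = y mod 2)"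
    by metis
  have Tch: "T v \<subseteq> ch v" if "v \<in> K" for v by (rule Te[OF that, THEN conjunct1])
  have Tcard: "card (T v) = 2 ^ e v" if "v \<in> K" for v by (rule Te[OF that, THEN conjunct2, THEN conjunct1])
  have Tlarge: "card (ch v) \<le> 4 * card (T v)" if "v \<in> K" for v
    by (rule Te[OF that, THEN conjunct2, THEN conjunct2, THEN conjunct1])
  have Tpar: "x mod 2 = y mod 2" if "v \<in> K" "x \<in> T v" "y \<in> T v" for v x y
    by (rule Te[OF that(1), THEN conjunct2, THEN conjunct2, THEN conjunct2, rule_format, OF that(2,3)])
  have chD: "card (ch v) \<le> D" if "v \<in> K" for v
  proof -
    have "ch v \<subseteq> {v * D..<v * D + D}"
    proof
      fix c assume "c \<in> ch v"
      then obtain y where y: "y div D ^ Suc i = v" "c = y div D ^ i" by (auto simp: ch_def)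
      then have "c div D = v" by (simp only: div_pow_Suc)
      then have "c = v * D + c mod D" using div_mult_mod_eq[of c D] by simp
      moreover have "c mod D < D" using D0 by simp
      ultimately show "c \<in> {v * D..<v * D + D}" by auto
    qed
    then show ?thesis using card_mono[of "{v * D..<v * D + D}" "ch v"] by simp
  qed
  have eW: "e v \<le> W" if "v \<in> K" for v
  proof -
    have "2 ^ e v \<le> card (ch v)" using Tch[OF that] Tcard[OF that] card_mono[OF ch(1)[of v], of "T v"] by simp
    then have "(2::nat) ^ e v \<le> 2 ^ W" using le_trans[OF _ chD[OF that]] unfolding D by blast
    then show ?thesis by simp
  qed
  define Z where "Z w = {y\<in>Y. e (y div D ^ Suc i) = w \<and> y div D ^ i \<in> T (y div D ^ Suc i)}" for w
  have leaf: "card {y\<in>Y. y div D ^ i = c} = Q" if c: "c \<in> ch v" for c v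
  proof -
    obtain z where z: "z \<in> Y" "c = z div D ^ i" using c by (auto simp: ch_def)
    have "{y\<in>Y. y div D ^ i = c} = node D Y i z" using z by (auto simp: node_def)
    then show ?thesis using card_node[OF fin(1) u z(1) _ D0, of i] by (simp add: Q_def)
  qed
  have cv: "card {y\<in>Y. y div D ^ Suc i = v \<and> y div D ^ i \<in> S} = card S * Q" if hS: "S \<subseteq> ch v" for S v
  proof -
    let ?A = "{y\<in>Y. y div D ^ Suc i = v \<and> y div D ^ i \<in> S}"
    have finA: "finite ?A" using fin by simp
    have im: "(\<lambda>y. y div D ^ i) ` ?A = S" using hS by (auto simp: ch_def)
    have "card ?A = (\<Sum>c\<in>(\<lambda>y. y div D ^ i) ` ?A. card {y\<in>?A. y div D ^ i = c})"
      using sum.image_gen[OF finA, of "\<lambda>_. 1::nat" "\<lambda>y. y div D ^ i"] finA by simp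
    also have "\<dots> = (\<Sum>c\<in>S. Q)" unfolding im
    proof (rule sum.cong[OF refl])
      fix c assume c: "c \<in> S"
      then obtain z where z: "z \<in> Y" "z div D ^ Suc i = v" "c = z div D ^ i" using hS by (auto simp: ch_def)
      have key: "y div D ^ Suc i = v" if "y div D ^ i = c" for y
        using div_pow_mono[of i "Suc i" y D z] z that by simp
      have eq: "{y\<in>?A. y div D ^ i = c} = {y\<in>Y. y div D ^ i = c}"
        using c key by blast
      show "card {y\<in>?A. y div D ^ i = c} = Q" unfolding eq by (rule leaf[OF subsetD[OF hS c]])
    qed
    finally show ?thesis by simp
  qed
  have cY: "card Y \<le> 4 * (\<Sum>w\<le>W. card (Z w))"
  proof -
    have "card Y = (\<Sum>v\<in>K. card {y\<in>Y. y div D ^ Suc i = v})"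
      using sum.image_gen[OF fin(1), of "\<lambda>_. 1::nat" "\<lambda>y. y div D ^ Suc i"] fin by (simp add: K_def)
    also have "\<dots> = (\<Sum>v\<in>K. card (ch v) * Q)"
    proof (rule sum.cong[OF refl])
      fix v
      have "{y\<in>Y. y div D ^ Suc i = v} = {y\<in>Y. y div D ^ Suc i = v \<and> y div D ^ i \<in> ch v}" by (auto simp: ch_def)
      then show "card {y\<in>Y. y div D ^ Suc i = v} = card (ch v) * Q" using cv[of "ch v" v] by simp
    qed
    also have "\<dots> \<le> (\<Sum>v\<in>K. 4 * (card (T v) * Q))" 
    proof (rule sum_mono)
      fix v assume "v \<in> K"
      then have "card (ch v) \<le> 4 * card (T v)" by (rule Tlarge)
      from mult_le_mono1[OF this, of Q] show "card (ch v) * Q \<le> 4 * (card (T v) * Q)" by (simp only: mult.assoc)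
    qed
    also have "\<dots> = 4 * (\<Sum>v\<in>K. card (T v) * Q)" by (simp add: sum_distrib_left)
    also have "(\<Sum>v\<in>K. card (T v) * Q) = (\<Sum>w\<le>W. card (Z w))"
    proof -
      have "card (Z w) = (\<Sum>v\<in>{v\<in>K. e v = w}. card (T v) * Q)" for w
      proof -
        have finZ: "finite (Z w)" using fin by (simp add: Z_def)
        have Zeq: "Z w = (\<Union>v\<in>{v\<in>K. e v = w}. {y\<in>Y. y div D ^ Suc i = v \<and> y div D ^ i \<in> T v})"
          by (auto simp: Z_def K_def)
        have "card (Z w) = (\<Sum>v\<in>{v\<in>K. e v = w}. card {y\<in>Y. y div D ^ Suc i = v \<and> y div D ^ i \<in> T v})"
          unfolding Zeq using finK fin by (intro card_UN_disjoint) auto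
        also have "\<dots> = (\<Sum>v\<in>{v\<in>K. e v = w}. card (T v) * Q)"
        proof (rule sum.cong[OF refl])
          fix v assume "v \<in> {v\<in>K. e v = w}"
          then have "T v \<subseteq> ch v" using Tch by simp
          then show "card {y\<in>Y. y div D ^ Suc i = v \<and> y div D ^ i \<in> T v} = card (T v) * Q" by (rule cv)
        qed
        finally show ?thesis .
      qed
      then have "(\<Sum>w\<le>W. card (Z w)) = (\<Sum>w\<le>W. \<Sum>v\<in>{v\<in>K. e v = w}. card (T v) * Q)" by simp
      also have "\<dots> = (\<Sum>v\<in>K. card (T v) * Q)"
        using sum.group[OF finK, of "{..W}" e "\<lambda>v. card (T v) * Q"] eW by auto
      finally show ?thesis by simp
    qed
    finally show ?thesis .
  qed
  obtain w where w: "w \<le> W" "card Y \<le> 4 * (W + 1) * card (Z w)"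
  proof -
    have "\<exists>w\<le>W. card Y \<le> 4 * (W + 1) * card (Z w)"
    proof (rule ccontr)
      assume "\<not> ?thesis"
      then have "4 * (W + 1) * card (Z w) < card Y" if "w \<le> W" for w using that by (meson not_le)
      then have "(\<Sum>w\<le>W. 4 * (W + 1) * card (Z w)) < (\<Sum>w\<le>W. card Y)" by (intro sum_strict_mono) auto
      then have "4 * (W + 1) * (\<Sum>w\<le>W. card (Z w)) < (W + 1) * card Y"
        unfolding sum_distrib_left[symmetric] by simp
      also have "\<dots> \<le> (W + 1) * (4 * (\<Sum>w\<le>W. card (Z w)))" by (rule mult_le_mono2[OF cY])
      finally show False by (simp add: algebra_simps)
    qed
    then show ?thesis using that by blast
  qed
  have "card Y > 0" using fin by (simp add: card_gt_0_iff)
  then have "card (Z w) > 0" using w(2) by (auto intro!: Nat.gr0I)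
  then have Zne: "Z w \<noteq> {}" by auto
  have ZY: "Z w \<subseteq> Y" by (auto simp: Z_def)
  have nodeZ: "node D (Z w) j x = node D Y j x" if "x \<in> Z w" "j \<le> i" for j x
  proof -
    have "y \<in> Z w" if "y \<in> Y" "y div D ^ j = x div D ^ j" for y
    proof -
      have "y div D ^ i = x div D ^ i" "y div D ^ Suc i = x div D ^ Suc i"
        using div_pow_mono[OF \<open>j \<le> i\<close> that(2)] div_pow_mono[of j "Suc i" y D x] that(2) \<open>j \<le> i\<close> by simp_all
      then show ?thesis using \<open>x \<in> Z w\<close> that(1) by (simp add: Z_def)
    qed
    then show ?thesis using ZY by (auto simp: node_def)
  qed
  have "uniform_below D (Z w) (a(i := w)) (Suc i)"
    unfolding uniform_below_def
  proof (intro allI impI ballI)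
    fix j x assume j: "j < Suc i" and x: "x \<in> Z w"
    show "card (children D (Z w) j x) = 2 ^ (a(i := w)) j \<and>
      (\<forall>y\<in>node D (Z w) (Suc j) x. y div D ^ j mod 2 = x div D ^ j mod 2)"
    proof (cases "j = i")
      case False
      then have "Suc j \<le> i" "j < i" using j by auto
      then show ?thesis using u x ZY nodeZ[OF x \<open>Suc j \<le> i\<close>] unfolding uniform_below_def children_def by auto
    next
      case True
      define v where "v = x div D ^ Suc i"
      have v: "v \<in> K" "e v = w" "x div D ^ i \<in> T v" using x by (auto simp: Z_def K_def v_def)
      have N: "node D (Z w) (Suc i) x = {y\<in>Y. y div D ^ Suc i = v \<and> y div D ^ i \<in> T v}"
        using v by (auto simp: node_def Z_def v_def)
      have "(\<lambda>y. y div D ^ i) ` {y\<in>Y. y div D ^ Suc i = v \<and> y div D ^ i \<in> T v} = T v"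
        using Tch[OF v(1)] by (auto simp: ch_def)
      then have 1: "children D (Z w) i x = T v" unfolding children_def N by simp
      have 2: "y div D ^ i mod 2 = x div D ^ i mod 2" if "y \<in> node D (Z w) (Suc i) x" for y
        using that Tpar[OF v(1) _ v(3)] unfolding N by simp
      show ?thesis using 1 2 True Tcard[OF v(1)] v(2) by simp
    qed
  qed
  then show ?thesis using w ZY Zne by blast
qed

theorem uniform_subset:
  assumes fin: "finite X" "X \<noteq> {}" and D: "D = 2 ^ W"
  shows "\<exists>Y a. Y \<subseteq> X \<and> Y \<noteq> {} \<and> uniform_below D Y a n \<and> card X \<le> (4 * (W + 1)) ^ n * card Y"
proof (induction n)
  case 0
  then show ?case using fin by (intro exI[of _ X]) (auto simp: uniform_below_def)
next
  case (Suc n)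
  then obtain Y a where Y: "Y \<subseteq> X" "Y \<noteq> {}" "uniform_below D Y a n" "card X \<le> (4 * (W + 1)) ^ n * card Y" by blast
  have "finite Y" using Y fin finite_subset by blast
  then obtain Z e where Z: "Z \<subseteq> Y" "Z \<noteq> {}" "uniform_below D Z (a(n := e)) (Suc n)" "card Y \<le> 4 * (W + 1) * card Z"
    using uniform_extend[OF _ Y(2,3) D] by blast
  have "card X \<le> (4 * (W + 1)) ^ n * (4 * (W + 1) * card Z)"
    using Y(4) mult_le_mono2[OF Z(4), of "(4 * (W + 1)) ^ n"] by linarith
  then have "card X \<le> (4 * (W + 1)) ^ Suc n * card Z" by (simp only: power_Suc2 mult.assoc)
  then show ?case using Z Y by blast
qed

lemma uniform_node:
  assumes u: "uniform_below D X a n" and "x \<in> X" "i \<le> n"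
  shows "uniform_below D (node D X i x) a i"
  unfolding uniform_below_def
proof (intro allI impI ballI)
  fix j y assume j: "j < i" and y: "y \<in> node D X i x"
  have yX: "y \<in> X" using y node_subset by blast
  have "node D (node D X i x) (Suc j) y = node D X (Suc j) y"
  proof -
    have "node D X (Suc j) y \<subseteq> node D X i y" using j by (intro node_mono) auto
    then have "node D X (Suc j) y \<subseteq> node D X i x" using node_eq[OF y] by simp
    then show ?thesis unfolding node_def by blast
  qed
  then show "card (children D (node D X i x) j y) = 2 ^ a j \<and>
     (\<forall>z\<in>node D (node D X i x) (Suc j) y. z div D ^ j mod 2 = y div D ^ j mod 2)"
    using u yX j assms(3) unfolding uniform_below_def children_def by simp
qed

lemma children_card_le:
  assumes "D > 0"
  shows "card (children D X i x) \<le> D"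
proof -
  have "children D X i x \<subseteq> {(x div D ^ Suc i) * D..<(x div D ^ Suc i) * D + D}"
  proof
    fix c assume "c \<in> children D X i x"
    then obtain y where y: "y div D ^ Suc i = x div D ^ Suc i" "c = y div D ^ i"
      by (auto simp: children_def node_def)
    then have "c div D = x div D ^ Suc i" by (simp only: div_pow_Suc)
    then have "c = (x div D ^ Suc i) * D + c mod D" using div_mult_mod_eq[of c D] by simp
    moreover have "c mod D < D" using assms by simp
    ultimately show "c \<in> {(x div D ^ Suc i) * D..<(x div D ^ Suc i) * D + D}"
      unfolding atLeastLessThan_iff by linarith
  qed
  then show ?thesis using card_mono[of "{(x div D ^ Suc i) * D..<(x div D ^ Suc i) * D + D}"] by simp
qed

lemma card_children_leaves:
  assumes fin: "finite X" and u: "uniform_below D X a n" and x: "x \<in> X" and i: "i < n" and D: "D > 0"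
    and S: "S \<subseteq> children D X i x"
  shows "card {v\<in>node D X (Suc i) x. v div D ^ i \<in> S} = card S * 2 ^ (\<Sum>j<i. a j)"
proof -
  let ?A = "{v\<in>node D X (Suc i) x. v div D ^ i \<in> S}"
  have finA: "finite ?A" using finite_subset[OF node_subset fin] by simp
  have im: "(\<lambda>y. y div D ^ i) ` ?A = S" using S by (auto simp: children_def)
  have "card ?A = (\<Sum>c\<in>(\<lambda>y. y div D ^ i) ` ?A. card {y\<in>?A. y div D ^ i = c})"
    using sum.image_gen[OF finA, of "\<lambda>_. 1::nat" "\<lambda>y. y div D ^ i"] finA by simp
  also have "\<dots> = (\<Sum>c\<in>S. 2 ^ (\<Sum>j<i. a j))" unfolding im
  proof (rule sum.cong[OF refl])
    fix c assume c: "c \<in> S"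
    then obtain z where z: "z \<in> node D X (Suc i) x" "c = z div D ^ i" using S by (auto simp: children_def)
    have sub: "node D X i z \<subseteq> node D X (Suc i) x" using node_mono[of i "Suc i" D X z] node_eq[OF z(1)] by simp
    have eq: "{y\<in>?A. y div D ^ i = c} = node D X i z"
    proof
      show "{y\<in>?A. y div D ^ i = c} \<subseteq> node D X i z" using z node_subset by (auto simp: node_def)
      show "node D X i z \<subseteq> {y\<in>?A. y div D ^ i = c}" using sub c z by (auto simp: node_def)
    qed
    show "card {y\<in>?A. y div D ^ i = c} = 2 ^ (\<Sum>j<i. a j)"
      unfolding eq using card_node[OF fin u _ _ D, of z i] z(1) node_subset[of D X "Suc i" x] i by auto
  qed
  finally show ?thesis by simp
qed

lemma div_interval:
  fixes x D :: nat
  assumes "D > 0"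
  shows "real (x div D ^ i) * D ^ i \<le> x" "x < real (x div D ^ i) * D ^ i + D ^ i"
proof -
  have e: "x = (x div D ^ i) * D ^ i + x mod D ^ i" by (rule div_mult_mod_eq[symmetric])
  have "x mod D ^ i < D ^ i" using assms by simp
  then have "(x div D ^ i) * D ^ i \<le> x" "x < (x div D ^ i) * D ^ i + D ^ i" using e by linarith+
  then show "real (x div D ^ i) * D ^ i \<le> x" "x < real (x div D ^ i) * D ^ i + D ^ i"
    by (metis of_nat_mult of_nat_le_iff of_nat_power, metis of_nat_add of_nat_mult of_nat_less_iff of_nat_power)
qed

lemma same_node_diff:
  fixes x y D :: nat
  assumes "D > 0" "x div D ^ i = y div D ^ i"
  shows "\<bar>real x - real y\<bar> < D ^ i"
  using div_interval[OF assms(1), of x i] div_interval[OF assms(1), of y i] assms(2) by (simp add: abs_if)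

lemma separated_values:
  fixes p q :: real and c d D :: nat
  assumes D: "D > 0" and "c mod 2 = d mod 2" "c \<noteq> d"
    and p: "real c * D ^ i \<le> p" "p \<le> real c * D ^ i + D ^ i" and q: "real d * D ^ i \<le> q" "q \<le> real d * D ^ i + D ^ i"
  shows "D ^ i \<le> \<bar>p - q\<bar>"
proof -
  have "c + 2 \<le> d \<or> d + 2 \<le> c" using assms(2,3) by presburger
  then show ?thesis
  proof
    assume "c + 2 \<le> d"
    then have "real c + 2 \<le> d" by linarith
    then have "(real c + 2) * D ^ i \<le> real d * D ^ i" by (intro mult_right_mono) auto
    then show ?thesis using p q by (simp add: algebra_simps)
  next
    assume "d + 2 \<le> c"
    then have "real d + 2 \<le> c" by linarith
    then have "(real d + 2) * D ^ i \<le> real c * D ^ i" by (intro mult_right_mono) auto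
    then show ?thesis using p q by (simp add: algebra_simps)
  qed
qed

text \<open>An active node has an even number of children with equally many leaves each; match the
  leaves of one half of the children with those of the other. \<open>G\<close> may be any value
  within the interval of the child, because the lemma is applied to conditional means rather than to
  the points.\<close>

lemma uniform_split_pairs:
  fixes G :: "nat \<Rightarrow> real" and r s :: real
  assumes fin: "finite X" and u: "uniform_below D X a n" and x: "x \<in> X" and i: "i < n" and D: "D > 0" and act: "a i \<ge> 1"
    and G: "\<And>v. v \<in> node D X (Suc i) x \<Longrightarrow> real (v div D ^ i) * D ^ i \<le> G v \<and> G v \<le> real (v div D ^ i) * D ^ i + D ^ i"
    and s: "s \<le> \<bar>r\<bar> * D ^ i"
  shows "split_pairs s (\<lambda>v. r * (G v - c)) (node D X (Suc i) x)"
proof -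
  let ?V = "node D X (Suc i) x" and ?Ch = "children D X i x"
  have cCh: "card ?Ch = 2 ^ a i" using u x i by (auto simp: uniform_below_def)
  obtain b where b: "a i = Suc b" using act by (cases "a i") auto
  have finV: "finite ?V" using finite_subset[OF node_subset fin] .
  have "2 ^ b \<le> card ?Ch" using cCh b by simp
  then obtain S where S: "S \<subseteq> ?Ch" "card S = 2 ^ b" by (metis obtain_subset_with_card_n)
  have finCh: "finite ?Ch" using finV by (simp add: children_def)
  define V1 V2 where "V1 = {v\<in>?V. v div D ^ i \<in> S}" and "V2 = {v\<in>?V. v div D ^ i \<in> ?Ch - S}"
  have "card (?Ch - S) = 2 ^ b" using S cCh b finCh by (simp add: card_Diff_subset finite_subset)
  then have "card V1 = card V2"
    using card_children_leaves[OF fin u x i D S(1)] card_children_leaves[OF fin u x i D, of "?Ch - S"] S(2)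
    by (simp add: V1_def V2_def)
  moreover have "finite V1" "finite V2" using finV by (auto simp: V1_def V2_def)
  ultimately obtain \<pi> where \<pi>: "bij_betw \<pi> V1 V2" using finite_same_card_bij by blast
  have un: "?V = V1 \<union> V2" "V1 \<inter> V2 = {}" by (auto simp: V1_def V2_def children_def)
  have far: "s \<le> \<bar>r * (G (\<pi> v) - c) - r * (G v - c)\<bar>" if v: "v \<in> V1" for v
  proof -
    have pv: "\<pi> v \<in> V2" using \<pi> v bij_betwE by blast
    have vV: "v \<in> ?V" "\<pi> v \<in> ?V" and ne: "\<pi> v div D ^ i \<noteq> v div D ^ i"
      using v pv by (auto simp: V1_def V2_def)
    have par: "w div D ^ i mod 2 = x div D ^ i mod 2" if "w \<in> ?V" for w
      using u x i that unfolding uniform_below_def by blast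
    have "D ^ i \<le> \<bar>G (\<pi> v) - G v\<bar>"
      using G[OF vV(1)] G[OF vV(2)] par[OF vV(1)] par[OF vV(2)] ne by (intro separated_values[OF D]) auto
    then have "\<bar>r\<bar> * D ^ i \<le> \<bar>r\<bar> * \<bar>G (\<pi> v) - G v\<bar>" by (intro mult_left_mono) auto
    also have "\<dots> = \<bar>r * (G (\<pi> v) - c) - r * (G v - c)\<bar>"
      by (simp add: abs_mult[symmetric] algebra_simps)
    finally show ?thesis using s by linarith
  qed
  show ?thesis unfolding split_pairs_def using un \<pi> far by blast
qed

section \<open>Heights with a prescribed slope below them\<close>

text \<open>Below its top height \<open>g\<close> has average slope greater than \<open>s\<close> towards every lower height.\<close>

definition top_height :: "(nat \<Rightarrow> real) \<Rightarrow> nat \<Rightarrow> real \<Rightarrow> nat" where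
  "top_height g n s = (LEAST i. i \<le> n \<and> (\<forall>i'\<le>n. g i' - s * i' \<le> g i - s * i))"

lemma top_height:
  shows "top_height g n s \<le> n" "\<And>i. i \<le> n \<Longrightarrow> g i - s * i \<le> g (top_height g n s) - s * top_height g n s"
    "\<And>i. i < top_height g n s \<Longrightarrow> s * (real (top_height g n s) - i) < g (top_height g n s) - g i"
proof -
  let ?Q = "\<lambda>i. i \<le> n \<and> (\<forall>i'\<le>n. g i' - s * i' \<le> g i - s * i)"
  define F where "F i = g i - s * i" for i :: nat
  have "Max (F ` {..n}) \<in> F ` {..n}" by (intro Max_in) auto
  then obtain i0 where i0: "i0 \<le> n" "F i0 = Max (F ` {..n})" by (metis (no_types) atMost_iff imageE)
  have "F i' \<le> F i0" if "i' \<le> n" for i' unfolding i0(2) using that by (intro Max_ge) auto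
  then have "?Q i0" using i0(1) unfolding F_def by blast
  then have Q: "?Q (top_height g n s)" unfolding top_height_def by (rule LeastI)
  then show 1: "top_height g n s \<le> n" "\<And>i. i \<le> n \<Longrightarrow> g i - s * i \<le> g (top_height g n s) - s * top_height g n s" by auto
  fix i assume i: "i < top_height g n s"
  then have "\<not> ?Q i" unfolding top_height_def by (rule not_less_Least)
  then obtain i' where "i' \<le> n" "g i - s * i < g i' - s * i'" using i 1(1) by (auto simp: not_le)
  then show "s * (real (top_height g n s) - i) < g (top_height g n s) - g i"
    using 1(2)[of i'] by (simp add: algebra_simps)
qed

text \<open>\<open>\<phi> t\<close> is the maximum of \<open>g i - t * i\<close>, a Legendre
  transform whose derivative in \<open>t\<close> is minus the top height. It falls from at least
  \<open>g n\<close> at slope 0 to at most 0 at slope \<open>s\<close>; the sum is the Riemann sum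
  of its descent.\<close>

lemma sum_top_heights:
  fixes s :: real and R :: nat
  assumes "\<And>i. i \<le> n \<Longrightarrow> g i \<le> s * i" and "R > 0" and "g 0 = 0"
  shows "g n \<le> s / R * (\<Sum>j<R. top_height g n (s * j / R))"
proof -
  define \<phi> where "\<phi> t = g (top_height g n t) - t * top_height g n t" for t
  have "\<phi> (s * j / R) - \<phi> (s * (Suc j) / R) \<le> s / R * top_height g n (s * j / R)" for j
  proof -
    define h \<theta> where "h = real (top_height g n (s * j / R))" and "\<theta> = s * j / R"
    have e: "s * (Suc j) / R = \<theta> + s / R" by (simp add: \<theta>_def add_divide_distrib algebra_simps)
    have "g (top_height g n \<theta>) - (\<theta> + s / R) * h \<le> \<phi> (\<theta> + s / R)"
      unfolding \<phi>_def h_def \<theta>_def using top_height(1,2) by blast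
    then show ?thesis unfolding e unfolding \<theta>_def[symmetric] unfolding \<phi>_def[of \<theta>]
      unfolding \<theta>_def h_def[symmetric] distrib_right by linarith
  qed
  then have "(\<Sum>j<R. \<phi> (s * j / R) - \<phi> (s * (Suc j) / R)) \<le> (\<Sum>j<R. s / R * top_height g n (s * j / R))"
    by (intro sum_mono) auto
  moreover have "(\<Sum>j<R. \<phi> (s * j / R) - \<phi> (s * (Suc j) / R)) = \<phi> (s * real 0 / R) - \<phi> (s * R / R)"
    by (rule sum_lessThan_telescope')
  moreover have "g n \<le> \<phi> (s * real 0 / R)" unfolding \<phi>_def using top_height(2)[of n n g 0] by simp
  moreover have "\<phi> (s * R / R) \<le> 0"
    unfolding \<phi>_def using assms(1)[OF top_height(1)] \<open>R > 0\<close> by simp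
  ultimately show ?thesis by (simp add: sum_distrib_left)
qed

lemma level_selection:
  fixes s t \<eta> :: real and R :: nat
  assumes f: "\<And>i. i \<le> n \<Longrightarrow> f i \<le> s * i" "f 0 = 0" and g: "\<And>i. i \<le> n \<Longrightarrow> g i \<le> t * i" "g 0 = 0"
    and st: "s > 0" "t > 0" and big: "(1 + \<eta>) * n \<le> f n / s + g n / t" and R: "R \<ge> 2" "8 < \<eta> * R" and n: "n > 0"
  obtains j where "1 \<le> j" "j + 2 \<le> R"
    "(1 + \<eta> / 2) * n \<le> top_height f n (s * j / R) + top_height g n (t * (R - 1 - j) / R)"
proof -
  have R0: "R > 0" using R by simp
  let ?x = "\<lambda>j. real (top_height f n (s * j / R))" and ?y = "\<lambda>j. real (top_height g n (t * j / R))"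
  have fx: "f n / s \<le> (\<Sum>j<R. ?x j) / R"
    using sum_top_heights[OF f(1) R0 f(2)] st R0 by (simp add: field_simps)
  have gy: "g n / t \<le> (\<Sum>j<R. ?y j) / R"
    using sum_top_heights[OF g(1) R0 g(2)] st R0 by (simp add: field_simps)
  have rev: "(\<Sum>j<R. ?y j) = (\<Sum>j<R. ?y (R - 1 - j))"
    using sum.nat_diff_reindex[of ?y R] by simp
  define z where "z j = ?x j + ?y (R - 1 - j)" for j
  have z2: "z j \<le> 2 * n" for j
  proof -
    have "?x j \<le> n" "?y (R - 1 - j) \<le> n" using top_height(1) by (auto simp: of_nat_le_iff)
    then show ?thesis unfolding z_def by linarith
  qed
  have "(1 + \<eta>) * n * R \<le> (\<Sum>j<R. z j)"
  proof -
    have "(1 + \<eta>) * n \<le> (\<Sum>j<R. z j) / R"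
      using big fx gy unfolding z_def sum.distrib rev[symmetric] add_divide_distrib by linarith
    then show ?thesis using R0 by (simp add: field_simps)
  qed
  have "\<exists>j. 1 \<le> j \<and> j + 2 \<le> R \<and> (1 + \<eta> / 2) * n \<le> z j"
  proof (rule ccontr)
    assume "\<not> ?thesis"
    then have small: "z j \<le> (1 + \<eta> / 2) * n" if "1 \<le> j" "j + 2 \<le> R" for j using that by force
    have "(\<Sum>j<R. z j) \<le> (\<Sum>j<R. (1 + \<eta> / 2) * n + (if j = 0 \<or> j = R - 1 then 2 * n else 0))"
    proof (rule sum_mono)
      fix j assume "j \<in> {..<R}"
      have "\<eta> > 0" using R by (smt (verit) mult_nonpos_nonneg of_nat_0_le_iff)
      then have p: "(1 + \<eta> / 2) * n \<ge> 0" by simp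
      show "z j \<le> (1 + \<eta> / 2) * n + (if j = 0 \<or> j = R - 1 then 2 * n else 0)"
      proof (cases "j = 0 \<or> j = R - 1")
        case True then show ?thesis using z2[of j] p by simp
      next
        case False
        then have "1 \<le> j" "j + 2 \<le> R" using \<open>j \<in> {..<R}\<close> by auto
        then show ?thesis using small False by simp
      qed
    qed
    also have "\<dots> = R * ((1 + \<eta> / 2) * n) + (\<Sum>j<R. (if j = 0 \<or> j = R - 1 then 2 * n else 0))"
      by (simp add: sum.distrib)
    also have "(\<Sum>j<R. (if j = 0 \<or> j = R - 1 then 2 * n else 0)) \<le> 2 * (2 * n)"
    proof -
      have "card ({..<R} \<inter> {j. j = 0 \<or> j = R - 1}) \<le> card {0, R - 1}" by (intro card_mono) auto
      also have "\<dots> \<le> 2" by (simp add: card_insert_if)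
      finally have "card ({..<R} \<inter> {j. j = 0 \<or> j = R - 1}) * (2 * n) \<le> 2 * (2 * n)" by (rule mult_le_mono1)
      then show ?thesis by (simp add: sum.If_cases)
    qed
    finally have "(\<Sum>j<R. z j) \<le> R * ((1 + \<eta> / 2) * n) + 4 * n" using R by auto
    then have "(1 + \<eta>) * n * R \<le> R * ((1 + \<eta> / 2) * n) + 4 * n" using \<open>(1 + \<eta>) * n * R \<le> (\<Sum>j<R. z j)\<close> by linarith
    then have "\<eta> * R / 2 * n \<le> 4 * real n" by (simp add: algebra_simps)
    then have "\<eta> * R / 2 \<le> 4" using n by (subst (asm) mult_le_cancel_right) auto
    then show False using R(2) by linarith
  qed
  then show ?thesis using that unfolding z_def by force
qed

section \<open>Zigzags\<close>

text \<open>All points share a node of height \<open>i + 1\<close> but consecutive ones never share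
  a child. In a uniform tree every step therefore has size between \<open>D ^ i\<close> and
  \<open>D ^ (i + 1)\<close>.\<close>

definition zigzags :: "nat \<Rightarrow> nat \<Rightarrow> nat \<Rightarrow> nat set \<Rightarrow> (nat \<Rightarrow> nat) set" where
  "zigzags D q i S = {f\<in>PiE {..q} (\<lambda>_. S). (\<forall>j\<le>q. f j div D ^ Suc i = f 0 div D ^ Suc i) \<and>
     (\<forall>j<q. f j div D ^ i \<noteq> f (Suc j) div D ^ i)}"

lemma finite_zigzags: "finite S \<Longrightarrow> finite (zigzags D q i S)"
  unfolding zigzags_def by (rule finite_subset[of _ "PiE {..q} (\<lambda>_. S)"]) (auto intro!: finite_PiE)

lemma card_zigzags_le:
  assumes fin: "finite C" and u: "uniform_below D C a N" and i: "i < N" and D: "D > 0"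
  shows "card (zigzags D q i C) \<le> card C * (2 ^ (\<Sum>j<Suc i. a j)) ^ q"
proof -
  have "zigzags D q i C \<subseteq> (\<Union>c\<in>C. PiE {..q} (\<lambda>j. if j = 0 then {c} else node D C (Suc i) c))"
  proof
    fix f assume f: "f \<in> zigzags D q i C"
    then have fC: "f \<in> PiE {..q} (\<lambda>_. C)" and n: "\<And>j. j \<le> q \<Longrightarrow> f j div D ^ Suc i = f 0 div D ^ Suc i"
      unfolding zigzags_def by blast+
    have "f \<in> PiE {..q} (\<lambda>j. if j = 0 then {f 0} else node D C (Suc i) (f 0))"
    proof (rule PiE_I)
      fix j assume "j \<in> {..q}"
      then have "f j \<in> C" "f j div D ^ Suc i = f 0 div D ^ Suc i" using fC n[of j] by (auto simp: PiE_iff)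
      then show "f j \<in> (if j = 0 then {f 0} else node D C (Suc i) (f 0))" by (simp only: node_def) simp
    next
      fix j assume "j \<notin> {..q}"
      then show "f j = undefined" using fC by (auto simp: PiE_iff extensional_def)
    qed
    moreover have "f 0 \<in> C" using fC by auto
    ultimately show "f \<in> (\<Union>c\<in>C. PiE {..q} (\<lambda>j. if j = 0 then {c} else node D C (Suc i) c))" by blast
  qed
  moreover have finP: "finite (PiE {..q} (\<lambda>j. if j = 0 then {c} else node D C (Suc i) c))" for c
    using finite_subset[OF node_subset fin] by (intro finite_PiE) auto
  ultimately have "card (zigzags D q i C) \<le> card (\<Union>c\<in>C. PiE {..q} (\<lambda>j. if j = 0 then {c} else node D C (Suc i) c))"
    using fin by (intro card_mono) auto
  also have "\<dots> \<le> (\<Sum>c\<in>C. card (PiE {..q} (\<lambda>j. if j = 0 then {c} else node D C (Suc i) c)))"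
    using fin by (rule card_UN_le)
  also have "\<dots> = (\<Sum>c\<in>C. (2 ^ (\<Sum>j<Suc i. a j)) ^ q)"
  proof (rule sum.cong[OF refl])
    fix c assume c: "c \<in> C"
    have "card (PiE {..q} (\<lambda>j. if j = 0 then {c} else node D C (Suc i) c)) = (\<Prod>j\<in>{..q}. card (if j = 0 then {c} else node D C (Suc i) c))"
      by (rule card_PiE) simp
    also have "\<dots> = (\<Prod>j\<in>{1..q}. card (node D C (Suc i) c))"
      by (rule prod.mono_neutral_cong_right) auto
    also have "\<dots> = (2 ^ (\<Sum>j<Suc i. a j)) ^ q"
      using card_node[OF fin u c _ D, of "Suc i"] i by simp
    finally show "card (PiE {..q} (\<lambda>j. if j = 0 then {c} else node D C (Suc i) c)) = (2 ^ (\<Sum>j<Suc i. a j)) ^ q" .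
  qed
  finally show ?thesis by simp
qed

section \<open>Branching of dense subsets of a uniform tree\<close>

definition single :: "nat \<Rightarrow> nat set \<Rightarrow> nat \<Rightarrow> nat \<Rightarrow> bool" where
  "single D S i c \<longleftrightarrow> children D S i c \<subseteq> {c div D ^ i}"

text \<open>A Kraft inequality. At a height in \<open>L\<close> the tree \<open>C\<close> has at
  least two children; where \<open>S\<close> keeps just one, the weight doubles, and the factor
  \<open>2 ^ a h\<close> still pays for it. Hence a subset that stays unbranched at many heights of
  \<open>L\<close> for many of its points cannot be dense.\<close>

lemma kraft_weight:
  assumes fin: "finite C" and u: "uniform_below D C a N" and D: "D > 0" and SC: "S \<subseteq> C"
    and act: "\<And>i. i \<in> L \<Longrightarrow> a i \<ge> 1" and "h \<le> N" "c \<in> S"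
  shows "(\<Sum>x\<in>node D S h c. 2 ^ card {i\<in>L. i < h \<and> single D S i x}) \<le> (2::nat) ^ (\<Sum>j<h. a j)"
  using assms(6,7)
proof (induction h arbitrary: c)
  case 0
  have "node D S 0 c = {c}" using 0 by (auto simp: node_def)
  then show ?case by simp
next
  case (Suc h)
  let ?w = "\<lambda>h x. (2::nat) ^ card {i\<in>L. i < h \<and> single D S i x}"
  let ?V = "node D S (Suc h) c"
  have finS: "finite S" using fin SC finite_subset by blast
  have finV: "finite ?V" using finite_subset[OF node_subset finS] .
  have finL: "finite {i\<in>L. i < k \<and> P i}" for k P by (rule finite_subset[of _ "{..<k}"]) auto
  have Vch: "children D S h x = children D S h c" if "x \<in> ?V" for x
    using node_eq[OF that] by (simp add: children_def)
  have sum_h: "(\<Sum>x\<in>?V. ?w h x) = (\<Sum>d\<in>children D S h c. \<Sum>x\<in>{x\<in>?V. x div D ^ h = d}. ?w h x)"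
    unfolding children_def by (rule sum.image_gen[OF finV])
  have each: "(\<Sum>x\<in>{x\<in>?V. x div D ^ h = d}. ?w h x) \<le> 2 ^ (\<Sum>j<h. a j)" if d: "d \<in> children D S h c" for d
  proof -
    obtain z where z: "z \<in> ?V" "d = z div D ^ h" using d by (auto simp: children_def)
    have sub: "node D S h z \<subseteq> ?V" using node_mono[of h "Suc h" D S z] node_eq[OF z(1)] by simp
    have "{x\<in>?V. x div D ^ h = d} = node D S h z"
    proof
      show "{x\<in>?V. x div D ^ h = d} \<subseteq> node D S h z" using z node_subset by (auto simp: node_def)
      show "node D S h z \<subseteq> {x\<in>?V. x div D ^ h = d}" using sub z by (auto simp: node_def)
    qed
    moreover have "z \<in> S" using z(1) node_subset by blast
    ultimately show ?thesis using Suc.IH[of z] Suc.prems by simp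
  qed
  have cC: "c \<in> C" using Suc.prems SC by blast
  have chC: "card (children D C h c) = 2 ^ a h" using u cC Suc.prems by (auto simp: uniform_below_def)
  have "children D S h c \<subseteq> children D C h c" unfolding children_def node_def using SC by blast
  moreover have "finite (children D C h c)"
    unfolding children_def using finite_subset[OF node_subset fin] by simp
  ultimately have chle: "card (children D S h c) \<le> 2 ^ a h" using chC card_mono by metis
  show ?case
  proof (cases "h \<in> L \<and> single D S h c")
    case True
    have w: "?w (Suc h) x = 2 * ?w h x" if x: "x \<in> ?V" for x
    proof -
      have "x div D ^ h \<in> children D S h c" using Vch[OF x] x unfolding children_def by blast
      moreover from True have ch: "children D S h c \<subseteq> {c div D ^ h}" by (simp add: single_def)
      ultimately have "x div D ^ h = c div D ^ h" by blast
      then have sx: "single D S h x" unfolding single_def Vch[OF x] using ch by simp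
      then have "{i\<in>L. i < Suc h \<and> single D S i x} = insert h {i\<in>L. i < h \<and> single D S i x}"
        using True sx by (auto simp: less_Suc_eq)
      then show ?thesis using finL by simp
    qed
    have "children D S h c = {c div D ^ h}"
      using True node_refl[OF Suc.prems(2)] unfolding single_def children_def by blast
    then have "(\<Sum>x\<in>?V. ?w h x) \<le> 2 ^ (\<Sum>j<h. a j)" using sum_h each by simp
    then have "(\<Sum>x\<in>?V. ?w (Suc h) x) \<le> 2 * 2 ^ (\<Sum>j<h. a j)"
      using w by (simp add: sum_distrib_left[symmetric])
    also have "\<dots> \<le> 2 ^ a h * 2 ^ (\<Sum>j<h. a j)"
      using act[of h] True power_increasing[of 1 "a h" "2::nat"] by (intro mult_le_mono1) auto
    finally show ?thesis by (simp add: power_add mult.commute)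
  next
    case False
    have w: "?w (Suc h) x = ?w h x" if x: "x \<in> ?V" for x
    proof -
      have "\<not> (h \<in> L \<and> single D S h x)"
      proof
        assume h: "h \<in> L \<and> single D S h x"
        have "c div D ^ h \<in> children D S h c" using node_refl[OF Suc.prems(2)] unfolding children_def by blast
        moreover from h have ch: "children D S h c \<subseteq> {x div D ^ h}" unfolding single_def Vch[OF x] by blast
        ultimately have "c div D ^ h = x div D ^ h" by blast
        then have "single D S h c" unfolding single_def using ch by simp
        then show False using False h by blast
      qed
      then have "{i\<in>L. i < Suc h \<and> single D S i x} = {i\<in>L. i < h \<and> single D S i x}"
        by (auto simp: less_Suc_eq)
      then show ?thesis by simp
    qed
    have "(\<Sum>x\<in>?V. ?w (Suc h) x) = (\<Sum>x\<in>?V. ?w h x)" using w by simp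
    also have "\<dots> \<le> (\<Sum>d\<in>children D S h c. 2 ^ (\<Sum>j<h. a j))" unfolding sum_h using each by (rule sum_mono)
    also have "\<dots> \<le> 2 ^ a h * 2 ^ (\<Sum>j<h. a j)" using chle by simp
    finally show ?thesis by (simp add: power_add mult.commute)
  qed
qed

lemma card_node_values:
  assumes fin: "finite C" and u: "uniform_below D C a N" and D: "D > 0" and "i \<le> N"
  shows "card ((\<lambda>c. c div D ^ i) ` C) * 2 ^ (\<Sum>j<i. a j) = card C"
proof -
  have "card C = (\<Sum>v\<in>(\<lambda>c. c div D ^ i) ` C. card {c\<in>C. c div D ^ i = v})"
    using sum.image_gen[OF fin, of "\<lambda>_. 1::nat" "\<lambda>c. c div D ^ i"] fin by simp
  also have "\<dots> = (\<Sum>v\<in>(\<lambda>c. c div D ^ i) ` C. 2 ^ (\<Sum>j<i. a j))"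
  proof (rule sum.cong[OF refl])
    fix v assume "v \<in> (\<lambda>c. c div D ^ i) ` C"
    then obtain c where c: "c \<in> C" "v = c div D ^ i" by blast
    then have "{c\<in>C. c div D ^ i = v} = node D C i c" by (auto simp: node_def)
    then show "card {c\<in>C. c div D ^ i = v} = 2 ^ (\<Sum>j<i. a j)"
      using card_node[OF fin u c(1) assms(4) D] by simp
  qed
  finally show ?thesis by simp
qed

text \<open>By \<open>kraft_weight\<close> many points of \<open>S\<close> see it branch at half of
  the heights in \<open>L\<close> or more, so some height serves half of these points. In each node
  found there, zigzags alternate between two children, and both contain many points of
  \<open>S\<close> because points in thin nodes were removed beforehand.\<close>

theorem many_zigzags:
  fixes \<rho> :: real
  assumes fin: "finite C" and u: "uniform_below D C a N" and D: "D > 0" and SC: "S \<subseteq> C"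
    and one: "\<And>x y. x \<in> C \<Longrightarrow> y \<in> C \<Longrightarrow> x div D ^ N = y div D ^ N"
    and \<rho>: "0 < \<rho>" and dens: "\<rho> * card C \<le> card S" and ne: "C \<noteq> {}"
    and L: "L \<subseteq> {..<N}" "\<And>i. i \<in> L \<Longrightarrow> a i \<ge> 1" and big: "(4 / \<rho>)^2 \<le> 2 ^ card L" and Lne: "L \<noteq> {}"
  obtains i where "i \<in> L"
    "\<rho> / 8 * (\<rho> / (2 * (N + 1) * D)) ^ Suc q * (card C * (2 ^ (\<Sum>j<Suc i. a j)) ^ q) \<le> card (zigzags D q i S)"
proof -
  define cn where "cn i = (2::real) ^ (\<Sum>j<i. a j)" for i
  have cn0: "cn i > 0" for i by (simp add: cn_def)
  \<comment> \<open>A union bound over the \<open>N + 1\<close> heights: thin nodes then hold at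
    most half of the guaranteed density of \<open>S\<close>.\<close>
  define thr where "thr = \<rho> / (2 * (N + 1))"
  have thr0: "thr > 0" using \<rho> by (simp add: thr_def)
  have finS: "finite S" using SC fin finite_subset by blast
  have cC: "card C > 0" using fin ne by (simp add: card_gt_0_iff)
  define S' where "S' = {c\<in>S. \<forall>i\<le>N. thr * cn i \<le> card (node D S i c)}"
  have S'S: "S' \<subseteq> S" by (auto simp: S'_def)
  have finS': "finite S'" using S'S finS finite_subset by blast
  have bad: "card {c\<in>S. card (node D S i c) < thr * cn i} \<le> thr * card C" if i: "i \<le> N" for i
  proof -
    let ?B = "{c\<in>S. card (node D S i c) < thr * cn i}"
    have finB: "finite ?B" using finS by simp
    have "card ?B = (\<Sum>v\<in>(\<lambda>c. c div D ^ i) ` ?B. card {c\<in>?B. c div D ^ i = v})"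
      using sum.image_gen[OF finB, of "\<lambda>_. 1::nat" "\<lambda>c. c div D ^ i"] finB by simp
    then have "real (card ?B) = (\<Sum>v\<in>(\<lambda>c. c div D ^ i) ` ?B. real (card {c\<in>?B. c div D ^ i = v}))" by simp
    also have "\<dots> \<le> (\<Sum>v\<in>(\<lambda>c. c div D ^ i) ` ?B. thr * cn i)"
    proof (rule sum_mono)
      fix v assume "v \<in> (\<lambda>c. c div D ^ i) ` ?B"
      then obtain c where c: "c \<in> ?B" "v = c div D ^ i" by blast
      have "card {c\<in>?B. c div D ^ i = v} \<le> card (node D S i c)"
      proof (rule card_mono)
        show "finite (node D S i c)" by (rule finite_subset[OF node_subset finS])
        show "{c\<in>?B. c div D ^ i = v} \<subseteq> node D S i c" using c unfolding node_def by blast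
      qed
      then show "real (card {c\<in>?B. c div D ^ i = v}) \<le> thr * cn i" using c by auto
    qed
    also have "\<dots> = card ((\<lambda>c. c div D ^ i) ` ?B) * (thr * cn i)" by simp
    also have "\<dots> \<le> card ((\<lambda>c. c div D ^ i) ` C) * (thr * cn i)"
      using fin SC thr0 cn0[of i] by (intro mult_right_mono of_nat_mono card_mono) auto
    also have "\<dots> = thr * real (card ((\<lambda>c. c div D ^ i) ` C) * 2 ^ (\<Sum>j<i. a j))" by (simp add: cn_def)
    also have "\<dots> = thr * card C" using card_node_values[OF fin u D i] by simp
    finally show ?thesis .
  qed
  have S'card: "\<rho> / 2 * card C \<le> card S'"
  proof -
    have "S - S' \<subseteq> (\<Union>i\<in>{..N}. {c\<in>S. card (node D S i c) < thr * cn i})"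
      by (auto simp: S'_def not_le)
    then have "card (S - S') \<le> card (\<Union>i\<in>{..N}. {c\<in>S. card (node D S i c) < thr * cn i})"
      using finS by (intro card_mono) auto
    also have "\<dots> \<le> (\<Sum>i\<in>{..N}. card {c\<in>S. card (node D S i c) < thr * cn i})" by (rule card_UN_le) simp
    finally have "real (card (S - S')) \<le> (\<Sum>i\<in>{..N}. real (card {c\<in>S. card (node D S i c) < thr * cn i}))"
      by (simp only: of_nat_sum[symmetric] of_nat_le_iff)
    also have "\<dots> \<le> (\<Sum>i\<in>{..N}. thr * card C)" using bad by (intro sum_mono) auto
    also have "\<dots> = (N + 1) * thr * card C" by simp
    also have "(N + 1) * thr = \<rho> / 2" by (simp add: thr_def field_simps)
    finally have "card (S - S') \<le> \<rho> / 2 * card C" .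
    moreover have "card S = card S' + card (S - S')"
      using finS S'S by (simp add: card_Diff_subset finite_subset card_mono)
    ultimately show ?thesis using dens by linarith
  qed
  have S'ne: "S' \<noteq> {}"
  proof
    assume "S' = {}"
    then have "\<rho> / 2 * card C \<le> 0" using S'card by simp
    moreover have "\<rho> / 2 * card C > 0" using \<rho> cC by simp
    ultimately show False by linarith
  qed
  then obtain c0 where c0: "c0 \<in> S'" by blast
  have finL: "finite L" using L finite_subset by blast
  define w where "w x = card {i\<in>L. single D S' i x}" for x
  have W: "(\<Sum>x\<in>S'. (2::real) ^ w x) \<le> card C"
  proof -
    have "(\<Sum>x\<in>node D S' N c0. 2 ^ card {i\<in>L. i < N \<and> single D S' i x}) \<le> (2::nat) ^ (\<Sum>j<N. a j)"
      using S'S SC L c0 by (intro kraft_weight[OF fin u D]) auto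
    moreover have "node D S' N c0 = S'" using one S'S SC c0 by (auto simp: node_def)
    moreover have "{i\<in>L. i < N \<and> single D S' i x} = {i\<in>L. single D S' i x}" for x using L by auto
    moreover have "node D C N c0 = C" using one S'S SC c0 by (auto simp: node_def)
    then have "card C = 2 ^ (\<Sum>j<N. a j)" using card_node[OF fin u _ _ D, of c0 N] S'S SC c0 by auto
    ultimately have "(\<Sum>x\<in>S'. 2 ^ w x) \<le> card C" by (simp add: w_def)
    then have "real (\<Sum>x\<in>S'. 2 ^ w x) \<le> card C" by (simp only: of_nat_le_iff)
    then show ?thesis by simp
  qed
  \<comment> \<open>Weight above \<open>4 / \<rho>\<close> is possible for at most
    \<open>\<rho> / 4 * card C\<close> points. On the rest \<open>2 ^ w x\<close> is at most the
    square root of \<open>2 ^ card L\<close>, so \<open>S'\<close> is single at no more than half of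
    \<open>L\<close>.\<close>
  define X where "X = {x\<in>S'. 2 ^ w x \<le> 4 / \<rho>}"
  have X: "\<rho> / 4 * card C \<le> card X"
  proof -
    have "card (S' - X) * (4 / \<rho>) = (\<Sum>x\<in>S' - X. 4 / \<rho>)" by simp
    also have "\<dots> \<le> (\<Sum>x\<in>S' - X. 2 ^ w x)" by (intro sum_mono) (auto simp: X_def)
    also have "\<dots> \<le> (\<Sum>x\<in>S'. 2 ^ w x)" using finS' by (intro sum_mono2) auto
    finally have "card (S' - X) * (4 / \<rho>) \<le> card C" using W by linarith
    then have "card (S' - X) \<le> \<rho> / 4 * card C" using \<rho> by (simp add: field_simps)
    moreover have "card S' = card X + card (S' - X)"
      using finS' by (simp add: X_def card_Diff_subset card_mono)
    ultimately show ?thesis using S'card by (simp add: field_simps)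
  qed
  have wL: "2 * w x \<le> card L" if "x \<in> X" for x
  proof -
    have "((2::real) ^ w x)^2 \<le> (4 / \<rho>)^2" using that by (intro power_mono) (auto simp: X_def)
    moreover have "((2::real) ^ w x)^2 = 2 ^ (2 * w x)" by (simp add: power_mult[symmetric] mult.commute)
    ultimately have "(2::real) ^ (2 * w x) \<le> 2 ^ card L" using order_trans[OF _ big] by metis
    then show ?thesis by (simp only: power_increasing_iff one_less_numeral_iff semiring_norm(76))
  qed
  have "\<exists>i\<in>L. card X \<le> 2 * card {x\<in>X. \<not> single D S' i x}"
  proof (rule ccontr)
    assume "\<not> ?thesis"
    then have neg: "2 * card {x\<in>X. \<not> single D S' i x} < card X" if "i \<in> L" for i using that by (meson not_le)
    have finX: "finite X" using finS' by (simp add: X_def)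
    have "(\<Sum>i\<in>L. 2 * card {x\<in>X. \<not> single D S' i x}) < (\<Sum>i\<in>L. card X)"
      using neg finL Lne by (intro sum_strict_mono) auto
    then have 1: "2 * (\<Sum>i\<in>L. card {x\<in>X. \<not> single D S' i x}) < card L * card X" by (simp add: sum_distrib_left)
    have "(\<Sum>i\<in>L. card {x\<in>X. \<not> single D S' i x}) = (\<Sum>x\<in>X. card {i\<in>L. \<not> single D S' i x})"
      using sum_multicount_gen[OF finL finX, of "\<lambda>i x. \<not> single D S' i x" "\<lambda>x. card {i\<in>L. \<not> single D S' i x}"] by simp
    moreover have "card L * card X \<le> 2 * (\<Sum>x\<in>X. card {i\<in>L. \<not> single D S' i x})"
    proof -
      have "card L \<le> 2 * card {i\<in>L. \<not> single D S' i x}" if "x \<in> X" for x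
      proof -
        have "L = {i\<in>L. single D S' i x} \<union> {i\<in>L. \<not> single D S' i x}" by auto
        then have "card L \<le> w x + card {i\<in>L. \<not> single D S' i x}" unfolding w_def by (metis card_Un_le)
        then show ?thesis using wL[OF that] by linarith
      qed
      then have "(\<Sum>x\<in>X. card L) \<le> (\<Sum>x\<in>X. 2 * card {i\<in>L. \<not> single D S' i x})" by (rule sum_mono)
      then show ?thesis by (simp add: sum_distrib_left mult.commute)
    qed
    ultimately show False using 1 by linarith
  qed
  then obtain i where iL: "i \<in> L" and iX: "card X \<le> 2 * card {x\<in>X. \<not> single D S' i x}" by blast
  have iN: "i < N" using iL L by auto
  define Y where "Y = {x\<in>X. \<not> single D S' i x}"
  have YS': "Y \<subseteq> S'" by (auto simp: Y_def X_def)
  have Ycard: "\<rho> / 8 * card C \<le> card Y" using iX X by (simp add: Y_def)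
  define K where "K = (\<lambda>c. c div D ^ Suc i) ` Y"
  have finY: "finite Y" using YS' finS' finite_subset by blast
  have finK: "finite K" using finY by (simp add: K_def)
  have Kcard: "card Y \<le> card K * cn (Suc i)"
  proof -
    have "card Y = (\<Sum>v\<in>K. card {c\<in>Y. c div D ^ Suc i = v})"
      using sum.image_gen[OF finY, of "\<lambda>_. 1::nat" "\<lambda>c. c div D ^ Suc i"] finY by (simp add: K_def)
    also have "\<dots> \<le> (\<Sum>v\<in>K. 2 ^ (\<Sum>j<Suc i. a j))"
    proof (rule sum_mono)
      fix v assume "v \<in> K"
      then obtain c where c: "c \<in> Y" "v = c div D ^ Suc i" unfolding K_def by blast
      have "card {c\<in>Y. c div D ^ Suc i = v} \<le> card (node D C (Suc i) c)"
      proof (rule card_mono)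
        show "finite (node D C (Suc i) c)" by (rule finite_subset[OF node_subset fin])
        show "{c\<in>Y. c div D ^ Suc i = v} \<subseteq> node D C (Suc i) c" using c YS' S'S SC unfolding node_def by blast
      qed
      moreover have "c \<in> C" using c(1) YS' S'S SC by blast
      then have "card (node D C (Suc i) c) = 2 ^ (\<Sum>j<Suc i. a j)"
        using card_node[OF fin u _ _ D, of c "Suc i"] iN by (simp only: Suc_leI)
      ultimately show "card {c\<in>Y. c div D ^ Suc i = v} \<le> 2 ^ (\<Sum>j<Suc i. a j)" by (simp only:)
    qed
    finally have "card Y \<le> card K * 2 ^ (\<Sum>j<Suc i. a j)" by simp
    then have "real (card Y) \<le> real (card K * 2 ^ (\<Sum>j<Suc i. a j))" by (simp only: of_nat_le_iff)
    then show ?thesis by (simp add: cn_def)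
  qed
  \<comment> \<open>Branching is tested in \<open>S'\<close>, not in \<open>S\<close>: thus both
    points \<open>u\<close> and \<open>v\<close> lie in \<open>S'\<close>, and their nodes of height
    \<open>i\<close> are thick in \<open>S\<close>.\<close>
  have exuv: "\<exists>u v. u \<in> S' \<and> v \<in> S' \<and> u div D ^ Suc i = k \<and> v div D ^ Suc i = k \<and> u div D ^ i \<noteq> v div D ^ i" if k: "k \<in> K" for k
  proof -
    obtain c where c: "c \<in> Y" "k = c div D ^ Suc i" using k unfolding K_def by blast
    then have "\<not> children D S' i c \<subseteq> {c div D ^ i}" by (simp add: Y_def single_def)
    then obtain v where "v \<in> node D S' (Suc i) c" "v div D ^ i \<noteq> c div D ^ i" by (auto simp: children_def)
    then show ?thesis using c YS' by (intro exI[of _ c] exI[of _ v]) (auto simp: node_def)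
  qed
  then obtain U V where UV: "\<And>k. k \<in> K \<Longrightarrow> U k \<in> S' \<and> V k \<in> S' \<and> U k div D ^ Suc i = k \<and> V k div D ^ Suc i = k \<and> U k div D ^ i \<noteq> V k div D ^ i"
    by metis
  define Z where "Z k = PiE {..q} (\<lambda>j. if even j then node D S i (U k) else node D S i (V k))" for k
  have finZ: "finite (Z k)" for k
    unfolding Z_def using finite_subset[OF node_subset finS] by (intro finite_PiE) auto
  have Zval: "f j div D ^ i = (if even j then U k else V k) div D ^ i \<and> f j div D ^ Suc i = k \<and> f j \<in> S"
    if f: "f \<in> Z k" and k: "k \<in> K" and j: "j \<le> q" for f k j
  proof -
    have "f j \<in> (if even j then node D S i (U k) else node D S i (V k))" using f j unfolding Z_def by (auto simp: PiE_iff)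
    then have fj: "f j \<in> node D S i (if even j then U k else V k)" by (auto split: if_splits)
    then have "f j div D ^ i = (if even j then U k else V k) div D ^ i" "f j \<in> S" by (auto simp: node_def)
    moreover from this(1) have "f j div D ^ Suc i = (if even j then U k else V k) div D ^ Suc i"
      by (rule div_pow_mono[rotated]) simp
    ultimately show ?thesis using UV[OF k] by (auto split: if_splits)
  qed
  have sub: "(\<Union>k\<in>K. Z k) \<subseteq> zigzags D q i S"
  proof
    fix f assume "f \<in> (\<Union>k\<in>K. Z k)"
    then obtain k where k: "k \<in> K" and f: "f \<in> Z k" by blast
    have "f \<in> PiE {..q} (\<lambda>_. S)" using f Zval[OF f k] unfolding Z_def by (auto simp: PiE_iff)
    moreover have "f j div D ^ Suc i = f 0 div D ^ Suc i" if "j \<le> q" for j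
      using Zval[OF f k that] Zval[OF f k, of 0] by simp
    moreover have "f j div D ^ i \<noteq> f (Suc j) div D ^ i" if "j < q" for j
      using Zval[OF f k, of j] Zval[OF f k, of "Suc j"] that UV[OF k] by (auto split: if_splits)
    ultimately show "f \<in> zigzags D q i S" unfolding zigzags_def by blast
  qed
  have disj: "Z k \<inter> Z k' = {}" if "k \<in> K" "k' \<in> K" "k \<noteq> k'" for k k'
  proof (rule ccontr)
    assume "Z k \<inter> Z k' \<noteq> {}"
    then obtain f where "f \<in> Z k" "f \<in> Z k'" by blast
    then show False using Zval[of f k 0] Zval[of f k' 0] that by auto
  qed
  have Zcard: "(thr / D * cn (Suc i)) ^ Suc q \<le> card (Z k)" if k: "k \<in> K" for k
  proof -
    have cnD: "cn (Suc i) \<le> D * cn i"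
    proof -
      have "2 ^ a i = card (children D C i c0)" using u c0 S'S SC iN by (auto simp: uniform_below_def)
      also have "\<dots> \<le> D" by (rule children_card_le[OF D])
      finally have "real (2 ^ a i) \<le> D" by (simp only: of_nat_le_iff)
      then show ?thesis using cn0[of i] by (simp add: cn_def power_add mult.commute)
    qed
    have one: "thr / D * cn (Suc i) \<le> card (node D S i x)" if "x \<in> S'" for x
    proof -
      have "thr / D * cn (Suc i) \<le> thr / D * (D * cn i)" using cnD thr0 by (intro mult_left_mono) auto
      also have "\<dots> = thr * cn i" using D by simp
      also have "\<dots> \<le> card (node D S i x)" using that iN by (auto simp: S'_def)
      finally show ?thesis .
    qed
    have "(thr / D * cn (Suc i)) ^ Suc q = (\<Prod>j\<in>{..q}. thr / D * cn (Suc i))" by simp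
    also have "\<dots> \<le> (\<Prod>j\<in>{..q}. real (card (if even j then node D S i (U k) else node D S i (V k))))"
      using one UV[OF k] thr0 cn0[of "Suc i"] by (intro prod_mono) auto
    also have "\<dots> = card (Z k)" unfolding Z_def by (simp add: card_PiE)
    finally show ?thesis .
  qed
  have "\<rho> / 8 * (thr / D) ^ Suc q * (card C * cn (Suc i) ^ q) = (\<rho> / 8 * card C) * ((thr / D) ^ Suc q * cn (Suc i) ^ q)"
    by simp
  also have "\<dots> \<le> (card K * cn (Suc i)) * ((thr / D) ^ Suc q * cn (Suc i) ^ q)"
    using Ycard Kcard thr0 cn0[of "Suc i"] by (intro mult_right_mono) auto
  also have "\<dots> = card K * (thr / D * cn (Suc i)) ^ Suc q"
    unfolding power_mult_distrib[of "thr / D"] by (simp only: power_Suc mult_ac)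
  also have "\<dots> = (\<Sum>k\<in>K. (thr / D * cn (Suc i)) ^ Suc q)" by simp
  also have "\<dots> \<le> (\<Sum>k\<in>K. real (card (Z k)))" using Zcard by (rule sum_mono)
  also have "\<dots> = card (\<Union>k\<in>K. Z k)" using finK finZ disj by (simp add: card_UN_disjoint)
  also have "\<dots> \<le> card (zigzags D q i S)" using sub finite_zigzags[OF finS] by (intro of_nat_mono card_mono) auto
  finally have "\<rho> / 8 * (thr / D) ^ Suc q * (card C * cn (Suc i) ^ q) \<le> card (zigzags D q i S)" .
  moreover have e: "thr / D = \<rho> / (2 * (N + 1) * D)" by (simp add: thr_def field_simps)
  ultimately show ?thesis
    by (intro that[OF iL]) (simp only: e[symmetric] cn_def of_nat_mult of_nat_power of_nat_numeral)
qed

section \<open>Walks\<close>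

text \<open>Delete unpopular fibres one at a time. Each deletion removes fewer than \<open>t\<close>
  elements and also a value of some \<open>\<phi> i\<close>, so there are too few deletions to
  exhaust \<open>H\<close>.\<close>

lemma exists_popular_subset:
  fixes t :: real and \<phi> :: "nat \<Rightarrow> 'h \<Rightarrow> 'a"
  assumes fin: "finite H" and t: "t \<ge> 0" and big: "t * (\<Sum>i\<le>k. card (\<phi> i ` H)) < card H"
  shows "\<exists>H'\<subseteq>H. H' \<noteq> {} \<and> (\<forall>i\<le>k. \<forall>h\<in>H'. t \<le> card {h'\<in>H'. \<phi> i h' = \<phi> i h})"
  using fin big
proof (induction "card H" arbitrary: H rule: less_induct)
  case less
  have ne: "H \<noteq> {}" using less.prems t by auto
  show ?case
  proof (cases "\<forall>i\<le>k. \<forall>h\<in>H. t \<le> card {h'\<in>H. \<phi> i h' = \<phi> i h}")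
    case True
    then show ?thesis using ne by blast
  next
    case False
    then obtain i h where ih: "i \<le> k" "h \<in> H" "card {h'\<in>H. \<phi> i h' = \<phi> i h} < t" by (meson not_le)
    define K where "K = {h'\<in>H. \<phi> i h' = \<phi> i h}"
    have KH: "K \<subseteq> H" "h \<in> K" using ih by (auto simp: K_def)
    have finK: "finite K" using KH less.prems finite_subset by blast
    have card: "card (H - K) = card H - card K" "card K \<le> card H"
      using KH finK less.prems by (auto simp: card_Diff_subset card_mono)
    have sm: "card (H - K) < card H" using KH less.prems by (intro psubset_card_mono) auto
    have i1: "card (\<phi> i ` (H - K)) + 1 \<le> card (\<phi> i ` H)"
    proof -
      have "\<phi> i h \<notin> \<phi> i ` (H - K)" "\<phi> i h \<in> \<phi> i ` H" "\<phi> i ` (H - K) \<subseteq> \<phi> i ` H"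
        using ih by (auto simp: K_def)
      then have "\<phi> i ` (H - K) \<subset> \<phi> i ` H" by blast
      then have "card (\<phi> i ` (H - K)) < card (\<phi> i ` H)" using less.prems by (intro psubset_card_mono) auto
      then show ?thesis by simp
    qed
    have le: "card (\<phi> j ` (H - K)) \<le> card (\<phi> j ` H)" for j using less.prems by (intro card_mono) auto
    have "(\<Sum>j\<le>k. card (\<phi> j ` (H - K))) < (\<Sum>j\<le>k. card (\<phi> j ` H))"
      using le i1 ih by (intro sum_strict_mono_ex1) (auto intro!: bexI[of _ i])
    then have "real ((\<Sum>j\<le>k. card (\<phi> j ` (H - K))) + 1) \<le> real (\<Sum>j\<le>k. card (\<phi> j ` H))" by (simp only: of_nat_le_iff Suc_eq_plus1[symmetric] Suc_leI)
    then have "t * real ((\<Sum>j\<le>k. card (\<phi> j ` (H - K))) + 1) \<le> t * real (\<Sum>j\<le>k. card (\<phi> j ` H))" using t by (rule mult_left_mono)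
    then have "t * real (\<Sum>j\<le>k. card (\<phi> j ` (H - K))) + t \<le> t * real (\<Sum>j\<le>k. card (\<phi> j ` H))"
      by (simp only: of_nat_add of_nat_1 distrib_left mult_1_right)
    moreover have "real (card (H - K)) = real (card H) - real (card K)" using card by simp
    moreover have "real (card K) < t" using ih(3) by (simp add: K_def)
    ultimately have "t * real (\<Sum>j\<le>k. card (\<phi> j ` (H - K))) < card (H - K)" using less.prems(2) by linarith
    then have "\<exists>H'\<subseteq>H - K. H' \<noteq> {} \<and> (\<forall>i\<le>k. \<forall>h\<in>H'. t \<le> card {h'\<in>H'. \<phi> i h' = \<phi> i h})"
      using less.hyps[OF sm] less.prems(1) by blast
    then show ?thesis by (meson Diff_subset order_trans)
  qed
qed

text \<open>With \<open>\<phi> i = twist M (c i)\<close>, the triple \<open>f i\<close> is an edge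
  from the vertex \<open>\<phi> i (f i)\<close> to the vertex \<open>\<phi> (Suc i) (f i)\<close>,
  and consecutive edges share a vertex.\<close>

definition walks :: "(nat \<Rightarrow> 'h \<Rightarrow> 'a) \<Rightarrow> 'h set \<Rightarrow> 'a \<Rightarrow> nat \<Rightarrow> (nat \<Rightarrow> 'h) set" where
  "walks \<phi> H a k = {f\<in>PiE {..<k} (\<lambda>_. H). (0 < k \<longrightarrow> \<phi> 0 (f 0) = a) \<and>
     (\<forall>i. Suc i < k \<longrightarrow> \<phi> (Suc i) (f (Suc i)) = \<phi> (Suc i) (f i))}"

lemma finite_walks: "finite H \<Longrightarrow> finite (walks \<phi> H a k)"
  unfolding walks_def by (rule finite_subset[of _ "PiE {..<k} (\<lambda>_. H)"]) (auto intro!: finite_PiE)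

lemma card_walks_ge:
  fixes t :: real
  assumes fin: "finite H" and t: "t \<ge> 0" and h0: "h0 \<in> H"
    and pop: "\<And>i h. i < k \<Longrightarrow> h \<in> H \<Longrightarrow> t \<le> card {h'\<in>H. \<phi> i h' = \<phi> i h}"
  shows "t ^ k \<le> card (walks \<phi> H (\<phi> 0 h0) k)"
  using pop
proof (induction k)
  case 0
  have "walks \<phi> H (\<phi> 0 h0) 0 = {\<lambda>_. undefined}" by (auto simp: walks_def)
  then show ?case by simp
next
  case (Suc k)
  let ?W = "walks \<phi> H (\<phi> 0 h0)"
  define N where "N w = {h'\<in>H. \<phi> k h' = \<phi> k (if k = 0 then h0 else w (k - 1))}" for w
  have memH: "(if k = 0 then h0 else w (k - 1)) \<in> H" if "w \<in> ?W k" for w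
    using that h0 by (auto simp: walks_def PiE_iff)
  have finN: "finite (N w)" for w using fin by (simp add: N_def)
  have "t ^ Suc k \<le> card (?W k) * t" using Suc t by (simp add: mult.commute mult_left_mono)
  also have "\<dots> = (\<Sum>w\<in>?W k. t)" by simp
  also have "\<dots> \<le> (\<Sum>w\<in>?W k. real (card (N w)))"
    unfolding N_def using Suc.prems memH by (intro sum_mono) blast
  also have "\<dots> = card (Sigma (?W k) N)"
  proof -
    have "card (Sigma (?W k) N) = (\<Sum>w\<in>?W k. card (N w))"
    proof (rule card_SigmaI)
      show "finite (?W k)" by (rule finite_walks[OF fin])
      show "\<forall>w\<in>?W k. finite (N w)" by (intro ballI finN)
    qed
    then show ?thesis by (simp only: of_nat_sum)
  qed
  also have "\<dots> \<le> card (?W (Suc k))"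
  proof (rule of_nat_mono, rule card_inj_on_le)
    show "finite (?W (Suc k))" by (rule finite_walks[OF fin])
    show "inj_on (\<lambda>(w, h). w(k := h)) (Sigma (?W k) N)"
    proof (rule inj_onI)
      fix x y assume x: "x \<in> Sigma (?W k) N" and y: "y \<in> Sigma (?W k) N"
        and eq: "(case x of (w, h) \<Rightarrow> w(k := h)) = (case y of (w, h) \<Rightarrow> w(k := h))"
      obtain w h w' h' where xy: "x = (w, h)" "y = (w', h')" by fastforce
      have e: "w(k := h) = w'(k := h')" using eq xy by simp
      then have "h = h'" by (metis fun_upd_same)
      moreover have "w j = w' j" for j
      proof (cases "j = k")
        case True
        have "w k = undefined" "w' k = undefined"
          using x y xy by (auto simp: walks_def PiE_iff extensional_def)
        then show ?thesis using True by simp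
      next
        case False
        then show ?thesis using e by (metis fun_upd_other)
      qed
      ultimately show "x = y" using xy by auto
    qed
    show "(\<lambda>(w, h). w(k := h)) ` Sigma (?W k) N \<subseteq> ?W (Suc k)"
    proof
      fix x assume "x \<in> (\<lambda>(w, h). w(k := h)) ` Sigma (?W k) N"
      then obtain w h where w: "w \<in> ?W k" and h: "h \<in> N w" and x: "x = w(k := h)" by auto
      have hH: "h \<in> H" and hk: "\<phi> k h = \<phi> k (if k = 0 then h0 else w (k - 1))" using h by (auto simp: N_def)
      have "x \<in> PiE {..<Suc k} (\<lambda>_. H)" using w hH unfolding x walks_def by (auto simp: PiE_iff extensional_def)
      moreover have "\<phi> 0 (x 0) = \<phi> 0 h0" using w hk unfolding x walks_def by (cases "k = 0") auto
      moreover have "\<phi> (Suc i) (x (Suc i)) = \<phi> (Suc i) (x i)" if i: "Suc i < Suc k" for i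
      proof (cases "Suc i = k")
        case True
        then have "x (Suc i) = h" "x i = w (k - 1)" unfolding x by auto
        then show ?thesis using hk True by auto
      next
        case False
        then have "x (Suc i) = w (Suc i)" "x i = w i" "Suc i < k" using i unfolding x by auto
        then show ?thesis using w unfolding walks_def by auto
      qed
      ultimately show "x \<in> ?W (Suc k)" unfolding walks_def by blast
    qed
  qed
  finally show ?case .
qed

section \<open>Walks along twists\<close>

text \<open>For \<open>h = (a', b, b')\<close> this is the \<open>a\<close> with \<open>a +
  \<lfloor>c * b / M\<rfloor> = a' + \<lfloor>c * b' / M\<rfloor>\<close>, a coincidence of cells.
  \<open>M\<close> plays the part of \<open>1 / \<delta>\<close>.\<close>

definition twist :: "nat \<Rightarrow> nat \<Rightarrow> int \<times> nat \<times> nat \<Rightarrow> int" where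
  "twist M c h = fst h + int (c * snd (snd h) div M) - int (c * fst (snd h) div M)"

lemma walk_endpoint:
  assumes f: "f \<in> walks (\<lambda>i. twist M (c i)) H a (Suc k)"
  shows "twist M (c (Suc k)) (f k) = a + (\<Sum>i\<le>k. twist M (c (Suc i)) (f i) - twist M (c i) (f i))"
proof -
  have "twist M (c (Suc j)) (f j) = a + (\<Sum>i\<le>j. twist M (c (Suc i)) (f i) - twist M (c i) (f i))" if "j \<le> k" for j
    using that
  proof (induction j)
    case 0
    then show ?case using f by (simp add: walks_def)
  next
    case (Suc j)
    have "twist M (c (Suc j)) (f (Suc j)) = twist M (c (Suc j)) (f j)"
      using f Suc.prems unfolding walks_def by auto
    then show ?case using Suc by simp
  qed
  then show ?thesis by simp
qed

text \<open>For given \<open>b\<close> and \<open>b'\<close> a twist is a translation of its first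
  component, so each vertex fixes the next edge.\<close>

lemma walk_determined:
  assumes f: "f \<in> walks (\<lambda>i. twist M (c i)) H a k" and g: "g \<in> walks (\<lambda>i. twist M (c i)) H a k"
    and eq: "\<And>i. i < k \<Longrightarrow> snd (f i) = snd (g i)"
  shows "f = g"
proof
  fix j
  have "f j = g j" if "j < k" for j using that
  proof (induction j)
    case 0
    have "twist M (c 0) (f 0) = twist M (c 0) (g 0)" using f g 0 by (simp add: walks_def)
    then show ?case using eq[OF 0] unfolding twist_def by (intro prod_eqI) auto
  next
    case (Suc j)
    have "twist M (c (Suc j)) (f (Suc j)) = twist M (c (Suc j)) (g (Suc j))"
      using f g Suc unfolding walks_def by auto
    then show ?case using eq[OF Suc.prems] unfolding twist_def by (intro prod_eqI) auto
  qed
  moreover have "f j = g j" if "\<not> j < k" using f g that by (auto simp: walks_def PiE_iff extensional_def)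
  ultimately show "f j = g j" by blast
qed

text \<open>Four floors enter, two with either sign, so the rounding errors add up to at most
  2.\<close>

lemma twist_difference:
  assumes M: "M > 0"
  shows "\<bar>real_of_int (twist M c' h - twist M c h) -
      (real c' - real c) / M * (real (snd (snd h)) - real (fst (snd h)))\<bar> \<le> 2"
proof -
  have fl: "real (x * y) / M - 1 \<le> real (x * y div M)" "real (x * y div M) \<le> real (x * y) / M" for x y
  proof -
    have "real (x * y div M) = of_int \<lfloor>real (x * y) / real M\<rfloor>" unfolding floor_divide_of_nat_eq by simp
    then show "real (x * y) / M - 1 \<le> real (x * y div M)" "real (x * y div M) \<le> real (x * y) / M" by linarith+
  qed
  define b b' where "b = fst (snd h)" and "b' = snd (snd h)"
  have "real_of_int (twist M c' h - twist M c h) =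
      real (c' * b' div M) - real (c' * b div M) - real (c * b' div M) + real (c * b div M)"
    by (simp add: twist_def b_def b'_def)
  moreover have "(real c' - real c) / M * (real b' - real b) =
      real (c' * b') / M - real (c' * b) / M - real (c * b') / M + real (c * b) / M"
    using M by (simp add: field_simps)
  ultimately show ?thesis using fl[of c' b'] fl[of c' b] fl[of c b'] fl[of c b]
    unfolding b_def[symmetric] b'_def[symmetric] by linarith
qed

text \<open>A walk from a fixed start is encoded by its end point and the two strings of
  \<open>b\<close> and \<open>b'\<close>. On a popular part of \<open>H\<close> there are at least
  \<open>t ^ k\<close> walks, and the codes are bounded by end points times strings \<open>b\<close>
  times the concentration bound \<open>U\<close>.\<close>

theorem walk_count:
  fixes t r U :: real and c :: "nat \<Rightarrow> nat" and A :: "int set" and B :: "nat set"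
  assumes fin: "finite A" "finite B" and HA: "H \<subseteq> UNIV \<times> B \<times> B" "finite H" and M: "M > 0" and k: "k > 0" and t: "t \<ge> 0"
    and im: "\<And>i h. i \<le> k \<Longrightarrow> h \<in> H \<Longrightarrow> twist M (c i) h \<in> A"
    and big: "t * ((k + 1) * card A) < card H"
    and r: "\<And>i b b'. i < k \<Longrightarrow> b \<in> B \<Longrightarrow> b' \<in> B \<Longrightarrow> \<bar>(real (c (Suc i)) - real (c i)) / M * (real b' - real b)\<bar> \<le> r"
    and U: "\<And>z. card {b\<in>PiE {..<k} (\<lambda>_. B). \<bar>(\<Sum>i<k. (real (c (Suc i)) - real (c i)) / M * real (b i)) - z\<bar> \<le> 2 * k} \<le> U"
  shows "\<exists>a0\<in>A. t ^ k \<le> card {a\<in>A. \<bar>real_of_int a - a0\<bar> \<le> k * (r + 2)} * card B ^ k * U"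
proof -
  define \<phi> where "\<phi> i = twist M (c i)" for i
  define X where "X i = (real (c (Suc i)) - real (c i)) / M" for i
  have "(\<Sum>i\<le>k. card (\<phi> i ` H)) \<le> (\<Sum>i\<le>k. card A)"
    using im fin by (intro sum_mono card_mono) (auto simp: \<phi>_def)
  then have "(\<Sum>i\<le>k. card (\<phi> i ` H)) \<le> (k + 1) * card A" by simp
  then have "t * real (\<Sum>i\<le>k. card (\<phi> i ` H)) \<le> t * real ((k + 1) * card A)"
    using t by (intro mult_left_mono) (simp_all only: of_nat_le_iff)
  then have "t * (\<Sum>i\<le>k. card (\<phi> i ` H)) < card H" using big by linarith
  then obtain H' where H': "H' \<subseteq> H" "H' \<noteq> {}" "\<And>i h. i \<le> k \<Longrightarrow> h \<in> H' \<Longrightarrow> t \<le> card {h'\<in>H'. \<phi> i h' = \<phi> i h}"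
    using exists_popular_subset[OF HA(2) t, of \<phi> k] by blast
  obtain h0 where h0: "h0 \<in> H'" using H' by blast
  define a0 where "a0 = \<phi> 0 h0"
  have a0: "a0 \<in> A" using h0 H'(1) im[of 0 h0] by (auto simp: a0_def \<phi>_def)
  have finH': "finite H'" using H' HA finite_subset by blast
  define W where "W = walks \<phi> H' a0 k"
  have "t ^ k \<le> card W"
    unfolding W_def a0_def using H'(3) by (intro card_walks_ge[OF finH' t h0]) simp
  define BB where "BB = PiE {..<k} (\<lambda>_. B)"
  define E where "E = {a\<in>A. \<bar>real_of_int a - a0\<bar> \<le> k * (r + 2)}"
  have finBB: "finite BB" unfolding BB_def using fin by (intro finite_PiE) auto
  have finE: "finite E" using fin by (simp add: E_def)
  \<comment> \<open>Once the end point and \<open>b\<close> are known, the sum over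
    \<open>b'\<close> is determined up to \<open>2 * k\<close>, an error of 2 for each step.\<close>
  define S where "S e b = {b'\<in>BB. \<bar>(\<Sum>i<k. X i * real (b' i)) - (real_of_int (e - a0) + (\<Sum>i<k. X i * real (b i)))\<bar> \<le> 2 * k}" for e b
  define proj where "proj f = (\<phi> k (f (k - 1)), (\<lambda>i\<in>{..<k}. fst (snd (f i))), (\<lambda>i\<in>{..<k}. snd (snd (f i))))" for f :: "nat \<Rightarrow> int \<times> nat \<times> nat"
  let ?T = "SIGMA e:E. SIGMA b:BB. S e b"
  have finS: "finite (S e b)" for e b using finBB by (simp add: S_def)
  obtain k' where k': "k = Suc k'" using k by (cases k) auto
  have "card W \<le> card ?T"
  proof (rule card_inj_on_le)
    show "finite ?T" using finE finBB finS by simp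
    show "inj_on proj W"
    proof (rule inj_onI)
      fix f g assume f: "f \<in> W" and g: "g \<in> W" and e: "proj f = proj g"
      have "snd (f i) = snd (g i)" if "i < k" for i
      proof (rule prod_eqI)
        have "(\<lambda>i\<in>{..<k}. fst (snd (f i))) i = (\<lambda>i\<in>{..<k}. fst (snd (g i))) i" using e unfolding proj_def by simp
        then show "fst (snd (f i)) = fst (snd (g i))" using that by simp
        have "(\<lambda>i\<in>{..<k}. snd (snd (f i))) i = (\<lambda>i\<in>{..<k}. snd (snd (g i))) i" using e unfolding proj_def by simp
        then show "snd (snd (f i)) = snd (snd (g i))" using that by simp
      qed
      then show "f = g" using f g unfolding W_def \<phi>_def by (intro walk_determined[where k = k]) auto
    qed
    show "proj ` W \<subseteq> ?T"
    proof
      fix x assume "x \<in> proj ` W"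
      then obtain f where f: "f \<in> W" and x: "x = proj f" by blast
      have fH: "f i \<in> H" if "i < k" for i using f that H'(1) unfolding W_def walks_def by (auto simp: PiE_iff)
      then have "f i \<in> UNIV \<times> B \<times> B" if "i < k" for i using that HA(1) by blast
      then have fB: "fst (snd (f i)) \<in> B" "snd (snd (f i)) \<in> B" if "i < k" for i
        using that by (simp_all only: mem_Times_iff)
      define e where "e = \<phi> k (f (k - 1))"
      define b b' where "b = (\<lambda>i\<in>{..<k}. fst (snd (f i)))" and "b' = (\<lambda>i\<in>{..<k}. snd (snd (f i)))"
      have x': "x = (e, b, b')" by (simp add: x proj_def e_def b_def b'_def)
      have bB: "b \<in> BB" "b' \<in> BB" using fB by (auto simp: BB_def b_def b'_def)
      have eA: "e \<in> A" using im[of k "f (k - 1)"] fH[of "k - 1"] k by (simp add: e_def \<phi>_def)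
      have bi: "b i = fst (snd (f i))" "b' i = snd (snd (f i))" if "i < k" for i using that by (auto simp: b_def b'_def)
      have "e = a0 + (\<Sum>i<k. \<phi> (Suc i) (f i) - \<phi> i (f i))"
        using walk_endpoint[of f M c H' a0 k'] f unfolding W_def \<phi>_def e_def k' lessThan_Suc_atMost by simp
      then have e1: "real_of_int (e - a0) = (\<Sum>i<k. real_of_int (\<phi> (Suc i) (f i) - \<phi> i (f i)))" by simp
      have "\<bar>real_of_int (e - a0) - (\<Sum>i<k. X i * (real (b' i) - real (b i)))\<bar> \<le> (\<Sum>i<k. 2)"
        unfolding e1 sum_subtractf[symmetric]
      proof (rule order_trans[OF sum_abs], rule sum_mono)
        fix i assume "i \<in> {..<k}"
        then show "\<bar>real_of_int (\<phi> (Suc i) (f i) - \<phi> i (f i)) - X i * (real (b' i) - real (b i))\<bar> \<le> 2"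
          using twist_difference[OF M, of "c (Suc i)" "f i" "c i"] bi[of i] by (simp add: \<phi>_def X_def)
      qed
      then have e2: "\<bar>real_of_int (e - a0) - (\<Sum>i<k. X i * (real (b' i) - real (b i)))\<bar> \<le> 2 * k" by simp
      have "\<bar>\<Sum>i<k. X i * (real (b' i) - real (b i))\<bar> \<le> (\<Sum>i<k. r)"
      proof (rule order_trans[OF sum_abs], rule sum_mono)
        fix i assume i: "i \<in> {..<k}"
        then have "b i \<in> B" "b' i \<in> B" using bB unfolding BB_def by (auto simp: PiE_iff)
        then show "\<bar>X i * (real (b' i) - real (b i))\<bar> \<le> r" unfolding X_def using r i by blast
      qed
      then have "\<bar>\<Sum>i<k. X i * (real (b' i) - real (b i))\<bar> \<le> k * r" by simp
      then have "\<bar>real_of_int (e - a0)\<bar> \<le> k * r + 2 * k" using e2 by linarith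
      then have eE: "e \<in> E" using eA by (simp add: E_def algebra_simps)
      have "(\<Sum>i<k. X i * (real (b' i) - real (b i))) = (\<Sum>i<k. X i * real (b' i)) - (\<Sum>i<k. X i * real (b i))"
        by (simp add: right_diff_distrib sum_subtractf)
      then have "b' \<in> S e b" using e2 bB unfolding S_def by (simp add: abs_minus_commute algebra_simps)
      then show "x \<in> ?T" using x' eE bB by blast
    qed
  qed
  then have "real (card W) \<le> card ?T" by simp
  also have "\<dots> = (\<Sum>e\<in>E. \<Sum>b\<in>BB. real (card (S e b)))"
    using finE finBB finS by (simp add: card_SigmaI)
  also have "\<dots> \<le> (\<Sum>e\<in>E. \<Sum>b\<in>BB. U)" unfolding S_def BB_def X_def
    by (intro sum_mono) (use U in simp)
  also have "\<dots> = card E * card B ^ k * U" by (simp add: BB_def card_PiE)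
  finally have "t ^ k \<le> card E * card B ^ k * U" using \<open>t ^ k \<le> card W\<close> by linarith
  then show ?thesis using a0 unfolding E_def by blast
qed

section \<open>Anticoncentration\<close>

lemma average_in_interval:
  assumes "finite F" "F \<noteq> {}" and D: "D > 0" and "\<And>x. x \<in> F \<Longrightarrow> x div D ^ e = w"
  shows "real w * D ^ e \<le> (\<Sum>x\<in>F. real x) / card F" "(\<Sum>x\<in>F. real x) / card F \<le> real w * D ^ e + D ^ e"
proof -
  have c: "real (card F) > 0" using assms by (simp add: card_gt_0_iff)
  have b: "real w * D ^ e \<le> x" "x \<le> real w * D ^ e + D ^ e" if "x \<in> F" for x
    using div_interval[OF D, of x e] assms(4)[OF that] by auto
  have "(\<Sum>x\<in>F. real w * D ^ e) \<le> (\<Sum>x\<in>F. real x)" using b(1) by (rule sum_mono)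
  then show "real w * D ^ e \<le> (\<Sum>x\<in>F. real x) / card F" using c by (simp add: field_simps)
  have "(\<Sum>x\<in>F. real x) \<le> (\<Sum>x\<in>F. real w * D ^ e + D ^ e)" using b(2) by (rule sum_mono)
  then show "(\<Sum>x\<in>F. real x) / card F \<le> real w * D ^ e + D ^ e" using c by (simp add: field_simps)
qed

text \<open>As the height \<open>e\<close> decreases, these conditional expectations form a
  martingale revealing \<open>b\<close> digit by digit.\<close>

definition node_mean :: "nat \<Rightarrow> nat set \<Rightarrow> nat \<Rightarrow> nat \<Rightarrow> real" where
  "node_mean D B e = fibre_avg B (\<lambda>b. b div D ^ e) real"

lemma fibre_node: "fibre B (\<lambda>b. b div D ^ e) x = node D B e x"
  by (simp add: fibre_def node_def)

lemma node_mean_interval: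
  assumes fin: "finite B" and D: "D > 0" and x: "x \<in> B" and e: "e' \<le> e"
  shows "real (x div D ^ e) * D ^ e \<le> node_mean D B e' x" "node_mean D B e' x \<le> real (x div D ^ e) * D ^ e + D ^ e"
proof -
  have 1: "y div D ^ e = x div D ^ e" if "y \<in> node D B e' x" for y
  proof (rule div_pow_mono[OF e])
    show "y div D ^ e' = x div D ^ e'" using that by (simp add: node_def)
  qed
  have 2: "finite (node D B e' x)" by (rule finite_subset[OF node_subset fin])
  have 3: "node D B e' x \<noteq> {}" using node_refl[OF x] by blast
  show "real (x div D ^ e) * D ^ e \<le> node_mean D B e' x" "node_mean D B e' x \<le> real (x div D ^ e) * D ^ e + D ^ e"
    unfolding node_mean_def fibre_avg_def fibre_node using average_in_interval[OF 2 3 D 1] by simp_all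
qed

lemma node_mean_diff:
  assumes fin: "finite B" and D: "D > 0" and "x \<in> B" "y \<in> B" "x div D ^ e = y div D ^ e" and "e' \<le> e"
  shows "\<bar>node_mean D B e' x - node_mean D B e y\<bar> \<le> D ^ e"
proof -
  have "node_mean D B e y \<ge> real (x div D ^ e) * D ^ e" "node_mean D B e y \<le> real (x div D ^ e) * D ^ e + D ^ e"
    using node_mean_interval[OF fin D assms(4) order_refl, of e] assms(5) by simp_all
  then show ?thesis using node_mean_interval[OF fin D assms(3,6)] by linarith
qed

lemma sum_node_mean:
  assumes fin: "finite B" and e: "e' \<le> e" and x: "x \<in> B"
  shows "(\<Sum>v\<in>node D B e x. node_mean D B e' v - node_mean D B e x) = 0"
proof -
  have "(\<Sum>v\<in>node D B e x. node_mean D B e' v) = (\<Sum>v\<in>node D B e x. real v)"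
    unfolding node_mean_def
  proof (rule sum_fibre_avg_saturated[OF fin node_subset])
    fix v v' assume v: "v \<in> B" "v' \<in> B" "v div D ^ e' = v' div D ^ e'" "v \<in> node D B e x"
    have "v div D ^ e = v' div D ^ e" using e v(3) by (rule div_pow_mono)
    then show "v' \<in> node D B e x" using v by (simp add: node_def)
  qed
  moreover have "finite (node D B e x)" by (rule finite_subset[OF node_subset fin])
  moreover have "node D B e x \<noteq> {}" using node_refl[OF x] by blast
  ultimately show ?thesis unfolding sum_subtractf by (simp add: node_mean_def fibre_avg_def fibre_node)
qed

text \<open>Products of nodes partition the tuples, so an inequality on each such product adds up;
  the height may differ from coordinate to coordinate.\<close>

lemma sum_node_tuples:
  fixes f f' :: "('i \<Rightarrow> nat) \<Rightarrow> real"
  assumes fin: "finite B" "finite I"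
    and le: "\<And>b. b \<in> PiE I (\<lambda>_. B) \<Longrightarrow> (\<Sum>b'\<in>PiE I (\<lambda>i. node D B (e i) (b i)). f' b') \<le> K * (\<Sum>b'\<in>PiE I (\<lambda>i. node D B (e i) (b i)). f b')"
  shows "(\<Sum>b\<in>PiE I (\<lambda>_. B). f' b) \<le> K * (\<Sum>b\<in>PiE I (\<lambda>_. B). f b)"
proof -
  let ?BB = "PiE I (\<lambda>_. B)"
  define r where "r b = (\<lambda>i\<in>I. b i div D ^ e i)" for b :: "'i \<Rightarrow> nat"
  have finBB: "finite ?BB" using fin by (intro finite_PiE) auto
  have cell: "{b'\<in>?BB. r b' = r b} = PiE I (\<lambda>i. node D B (e i) (b i))" if b: "b \<in> ?BB" for b
  proof (intro set_eqI iffI)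
    fix b' assume b': "b' \<in> {b'\<in>?BB. r b' = r b}"
    have "b' i div D ^ e i = b i div D ^ e i" if "i \<in> I" for i
    proof -
      have "r b' i = r b i" using b' by simp
      then show ?thesis using that by (simp add: r_def)
    qed
    then show "b' \<in> PiE I (\<lambda>i. node D B (e i) (b i))" using b' by (auto simp: node_def PiE_iff)
  next
    fix b' assume b': "b' \<in> PiE I (\<lambda>i. node D B (e i) (b i))"
    then have "r b' = r b" by (auto simp: r_def node_def PiE_iff intro!: restrict_ext)
    then show "b' \<in> {b'\<in>?BB. r b' = r b}" using b' by (auto simp: node_def PiE_iff)
  qed
  have "(\<Sum>b\<in>?BB. f' b) = (\<Sum>l\<in>r ` ?BB. \<Sum>b\<in>{b\<in>?BB. r b = l}. f' b)" by (rule sum.image_gen[OF finBB])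
  also have "\<dots> \<le> (\<Sum>l\<in>r ` ?BB. K * (\<Sum>b\<in>{b\<in>?BB. r b = l}. f b))"
  proof (rule sum_mono)
    fix l assume "l \<in> r ` ?BB"
    then obtain b where b: "b \<in> ?BB" "l = r b" by blast
    show "(\<Sum>b\<in>{b\<in>?BB. r b = l}. f' b) \<le> K * (\<Sum>b\<in>{b\<in>?BB. r b = l}. f b)"
      unfolding b(2) cell[OF b(1)] by (rule le[OF b(1)])
  qed
  also have "\<dots> = K * (\<Sum>l\<in>r ` ?BB. \<Sum>b\<in>{b\<in>?BB. r b = l}. f b)" by (rule sum_distrib_left[symmetric])
  also have "\<dots> = K * (\<Sum>b\<in>?BB. f b)" by (simp only: sum.image_gen[OF finBB, of f r])
  finally show ?thesis .
qed

text \<open>At time \<open>t\<close> the coordinate \<open>b i\<close> is known up to its node of height \<open>nb - (t - l i)\<close>, so that every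
  summand \<open>X i * b i\<close> is known with the same precision \<open>R0 / D ^ t\<close>.\<close>

theorem anticoncentration:
  fixes X :: "nat \<Rightarrow> real" and R0 h s :: real and T l :: "nat \<Rightarrow> nat" and k :: nat
  assumes fin: "finite B" and u: "uniform_below D B a nb" and D: "D > 1" and k: "k > 0" and R0: "R0 > 0"
    and X: "\<And>i. i < k \<Longrightarrow> \<bar>X i\<bar> * D ^ nb \<le> R0 / D ^ l i"
    and h: "h > 0" and s: "s \<ge> 0" and g: "2 * (1 + h) * sqrt k * D ^ 3 \<le> D ^ g"
    and T: "\<And>r. r < N \<Longrightarrow> T r + g \<le> T (Suc r)" "T N \<le> nb" "D ^ T N \<le> R0"
    and chk: "\<And>r. r < N \<Longrightarrow> \<exists>Q e. Q \<subseteq> {..<k} \<and> card Q = 2 * v \<and> e < nb \<and> a (nb - 1 - e) \<ge> 1 \<and>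
        (\<forall>i\<in>Q. l i + e = T r \<and> R0 / D ^ (l i + 2) \<le> \<bar>X i\<bar> * D ^ nb)"
  shows "card {b\<in>PiE {..<k} (\<lambda>_. B). \<bar>(\<Sum>i<k. X i * real (b i)) - z\<bar> \<le> 2 * k} \<le>
    exp (3 * k) * (12 * exp s / sqrt (2 * v + 1) + 6 * exp (- h * s)) ^ N * card B ^ k"
proof -
  define K where "K = 12 * exp s / sqrt (2 * v + 1) + 6 * exp (- h * s)"
  have K0: "K \<ge> 0" by (simp add: K_def)
  let ?BB = "PiE {..<k} (\<lambda>_. B)"
  have finBB: "finite ?BB" using fin by (intro finite_PiE) auto
  have D0: "D > 0" using D by simp
  \<comment> \<open>Truncated subtraction matters: before time \<open>l i\<close> the height stays
    at \<open>nb\<close>, and nothing of the coordinate is revealed yet.\<close>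
  define ht where "ht t i = nb - (t - l i)" for t i
  define R where "R t = R0 / D ^ t" for t
  have Rpos: "R t > 0" for t using R0 D0 by (simp add: R_def)
  define \<tau> where "\<tau> t = (1 + h) * (sqrt k * R t)" for t
  have k1: "sqrt k \<ge> 1" using k by simp
  have hk: "(1 + h) * sqrt k \<ge> 1" using mult_mono[of 1 "1 + h" 1 "sqrt k"] h k1 by simp
  have tpos: "\<tau> t > 0" for t using Rpos[of t] h k by (simp add: \<tau>_def)
  define Y where "Y t b = (\<Sum>i<k. X i * node_mean D B (ht t i) (b i))" for t b
  \<comment> \<open>The potential measures how close the conditional expectation of the sum is to
    \<open>z\<close>, on a scale \<tau> slightly above the typical size of what is still
    unrevealed.\<close>
  define \<Psi> where "\<Psi> t b = exp (- \<bar>Y t b - z\<bar> / \<tau> t)" for t b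
  have TN: "T r \<le> T N" if "r \<le> N" for r
    using that
  proof (induction rule: inc_induct)
    case (step r)
    then show ?case using T(1)[of r] by linarith
  qed simp
  have Xht: "\<bar>X i\<bar> * D ^ ht t i \<le> R t" if i: "i < k" and t: "t \<le> nb" for i t
  proof (cases "l i \<le> t")
    case True
    have "real D ^ nb = D ^ ht t i * D ^ (t - l i)" using t by (simp add: ht_def flip: power_add)
    then have "\<bar>X i\<bar> * D ^ ht t i = \<bar>X i\<bar> * D ^ nb / D ^ (t - l i)" using D0 by simp
    also have "\<dots> \<le> R0 / D ^ l i / D ^ (t - l i)" using X[OF i] D0 by (intro divide_right_mono) auto
    also have "\<dots> = R t" using True by (simp add: R_def flip: power_add)
    finally show ?thesis .
  next
    case False
    have "\<bar>X i\<bar> * D ^ ht t i \<le> R0 / D ^ l i" using X[OF i] False by (simp add: ht_def)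
    also have "\<dots> \<le> R t" unfolding R_def using R0 D False by (intro divide_left_mono power_increasing) auto
    finally show ?thesis .
  qed
  have step: "(\<Sum>b\<in>?BB. \<Psi> (T (Suc r)) b) \<le> K * (\<Sum>b\<in>?BB. \<Psi> (T r) b)" if r: "r < N" for r
  proof (rule sum_node_tuples[OF fin, where e = "ht (T r)"])
    define t t' where "t = T r" and "t' = T (Suc r)"
    have tn: "t \<le> nb" using TN[of r] r T(2) by (simp add: t_def)
    have D3: "2 \<le> (real D) ^ g"
    proof -
      have "(1::real) * 1 \<le> ((1 + h) * sqrt k) * real D ^ 3" using hk D by (intro mult_mono) auto
      moreover have "2 * (((1 + h) * sqrt k) * real D ^ 3) \<le> real D ^ g" using g by (simp only: mult.assoc)
      ultimately show ?thesis by linarith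
    qed
    have gpos: "g > 0" using D3 by (cases g) auto
    have tt': "t + g \<le> t'" using T(1)[OF r] by (simp add: t_def t'_def)
    have htle: "ht t' i \<le> ht t i" for i using tt' by (auto simp: ht_def)
    \<comment> \<open>This is what the gap \<open>g\<close> is for: at the next checkpoint the scale
      has fallen below half of the separation \<open>R t / D ^ 3\<close> used for
      Littlewood--Offord.\<close>
    have \<tau>': "2 * \<tau> t' \<le> R t / D ^ 3"
    proof -
      have "R t' \<le> R t / D ^ g"
      proof -
        have "R t' \<le> R (t + g)" unfolding R_def using R0 D tt' by (intro divide_left_mono power_increasing) auto
        then show ?thesis by (simp add: R_def power_add)
      qed
      then have "(2 * (1 + h) * sqrt k) * R t' \<le> (2 * (1 + h) * sqrt k) * (R t / real D ^ g)"
        using h by (intro mult_left_mono) auto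
      also have "\<dots> = (2 * (1 + h) * sqrt k) / real D ^ g * R t" by simp
      also have "\<dots> \<le> 1 / real D ^ 3 * R t"
      proof (rule mult_right_mono)
        show "2 * (1 + h) * sqrt k / real D ^ g \<le> 1 / real D ^ 3" using g D0 by (simp add: divide_simps)
        show "0 \<le> R t" using Rpos[of t] by simp
      qed
      finally show ?thesis by (simp only: \<tau>_def mult.assoc) simp
    qed
    from chk[OF r] obtain Q e where Qe: "Q \<subseteq> {..<k} \<and> card Q = 2 * v \<and> e < nb \<and> a (nb - 1 - e) \<ge> 1 \<and>
        (\<forall>i\<in>Q. l i + e = T r \<and> R0 / real D ^ (l i + 2) \<le> \<bar>X i\<bar> * real D ^ nb)"
      by (elim exE)
    then have Q: "Q \<subseteq> {..<k}" "card Q = 2 * v" and e: "e < nb" "a (nb - 1 - e) \<ge> 1" by simp_all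
    have Qi: "l i + e = t" "R0 / D ^ (l i + 2) \<le> \<bar>X i\<bar> * D ^ nb" if "i \<in> Q" for i
      using Qe that by (simp_all add: t_def)
    fix b assume b: "b \<in> ?BB"
    have bB: "b i \<in> B" if "i < k" for i using b that by (auto simp: PiE_iff)
    define V where "V i = node D B (ht t i) (b i)" for i
    have finV: "finite (V i)" for i unfolding V_def by (rule finite_subset[OF node_subset fin])
    have VB: "V i \<subseteq> B" for i unfolding V_def by (rule node_subset)
    have Vdiv: "w div D ^ ht t i = b i div D ^ ht t i" if "w \<in> V i" for w i using that by (simp add: V_def node_def)
    define G where "G i w = X i * (node_mean D B (ht t' i) w - node_mean D B (ht t i) (b i))" for i w
    have G0: "(\<Sum>w\<in>V i. G i w) = 0" if "i \<in> {..<k}" for i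
      unfolding G_def V_def sum_distrib_left[symmetric] using sum_node_mean[OF fin htle bB] that by simp
    have Gle: "\<bar>G i w\<bar> \<le> R t" if i: "i \<in> {..<k}" and w: "w \<in> V i" for i w
    proof -
      have "\<bar>node_mean D B (ht t' i) w - node_mean D B (ht t i) (b i)\<bar> \<le> D ^ ht t i"
        using node_mean_diff[OF fin D0 subsetD[OF VB w] bB Vdiv[OF w] htle] i by simp
      then have "\<bar>G i w\<bar> \<le> \<bar>X i\<bar> * D ^ ht t i" unfolding G_def abs_mult by (intro mult_left_mono) auto
      then show ?thesis using Xht[OF _ tn, of i] i by simp
    qed
    \<comment> \<open>The three powers of \<open>D\<close>: the coefficient \<open>X i\<close> may
      be smaller by \<open>D ^ 2\<close> than its nominal size, and going from a node to its
      children costs one more.\<close>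
    have split: "split_pairs (R t / D ^ 3) (G i) (V i)" if iQ: "i \<in> Q" for i
    proof -
      have i: "i < k" using iQ Q by auto
      have h1: "ht t i = Suc (nb - 1 - e)" using Qi(1)[OF iQ] e by (auto simp: ht_def)
      have h2: "ht t' i \<le> nb - 1 - e" using Qi(1)[OF iQ] tt' gpos by (auto simp: ht_def)
      have "R t / D ^ 3 = R0 / D ^ (l i + 2) / D ^ (e + 1)"
        unfolding R_def Qi(1)[OF iQ, symmetric] by (simp add: power_add power2_eq_square power3_eq_cube)
      also have "\<dots> \<le> \<bar>X i\<bar> * D ^ nb / D ^ (e + 1)" using Qi(2)[OF iQ] by (intro divide_right_mono) auto
      also have "\<dots> = \<bar>X i\<bar> * real D ^ (nb - 1 - e)"
      proof -
        have "real D ^ nb = real D ^ (nb - 1 - e) * real D ^ (e + 1)" using e by (simp flip: power_add power_Suc)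
        then show ?thesis using D0 by simp
      qed
      finally have "R t / D ^ 3 \<le> \<bar>X i\<bar> * D ^ (nb - 1 - e)" by simp
      then have "split_pairs (R t / D ^ 3) (\<lambda>w. X i * (node_mean D B (ht t' i) w - node_mean D B (ht t i) (b i))) (node D B (Suc (nb - 1 - e)) (b i))"
      proof (intro uniform_split_pairs[OF fin u bB[OF i] _ D0 e(2)])
        fix w assume "w \<in> node D B (Suc (nb - 1 - e)) (b i)"
        then have "w \<in> B" by (rule subsetD[OF node_subset])
        then show "real (w div D ^ (nb - 1 - e)) * D ^ (nb - 1 - e) \<le> node_mean D B (ht t' i) w \<and>
            node_mean D B (ht t' i) w \<le> real (w div D ^ (nb - 1 - e)) * D ^ (nb - 1 - e) + D ^ (nb - 1 - e)"
          using node_mean_interval[OF fin D0 _ h2] by simp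
      qed (use e in auto)
      then show ?thesis unfolding G_def V_def by (simp only: h1[symmetric])
    qed
    have ps: "(\<Sum>b'\<in>PiE {..<k} V. exp (- \<bar>(Y t b - z) + (\<Sum>i\<in>{..<k}. G i (b' i))\<bar> / \<tau> t'))
        \<le> (12 * exp s / sqrt (2 * v + 1) + 6 * exp (- h * s)) * (\<Prod>i\<in>{..<k}. real (card (V i))) * exp (- \<bar>Y t b - z\<bar> / \<tau> t)"
    proof (rule potential_step[where Q = Q and d = "R t / D ^ 3" and R = "R t"])
      show "2 * \<tau> t' \<le> \<tau> t"
      proof -
        have "R t / D ^ 3 \<le> R t" using Rpos[of t] D by (simp add: divide_le_eq_1 field_simps)
        also have "\<dots> \<le> ((1 + h) * sqrt k) * R t" using mult_right_mono[OF hk, of "R t"] Rpos[of t] by simp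
        finally show ?thesis using \<tau>' by (simp add: \<tau>_def mult.assoc)
      qed
      show "\<tau> t = (1 + h) * (sqrt (card {..<k}) * R t)" by (simp add: \<tau>_def)
    qed (use Q finV G0 Gle Rpos split tpos \<tau>' h s k in auto)
    have eY: "(Y t b - z) + (\<Sum>i\<in>{..<k}. G i (b' i)) = Y t' b' - z" for b'
      unfolding Y_def G_def by (simp add: right_diff_distrib sum_subtractf)
    have const: "\<Psi> t b' = \<Psi> t b" if "b' \<in> PiE {..<k} V" for b'
    proof -
      have "node_mean D B (ht t i) (b' i) = node_mean D B (ht t i) (b i)" if "i < k" for i
        unfolding node_mean_def using Vdiv[of "b' i" i] \<open>b' \<in> PiE {..<k} V\<close> that
        by (intro fibre_avg_const) (auto simp: PiE_iff)
      then show ?thesis by (simp add: \<Psi>_def Y_def)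
    qed
    have "(\<Sum>b'\<in>PiE {..<k} V. \<Psi> t b') = (\<Prod>i\<in>{..<k}. real (card (V i))) * \<Psi> t b"
      using const by (simp add: card_PiE)
    moreover have "(\<Sum>b'\<in>PiE {..<k} V. \<Psi> t' b') \<le> K * (\<Prod>i\<in>{..<k}. real (card (V i))) * \<Psi> t b"
      using ps unfolding eY by (simp add: \<Psi>_def K_def)
    ultimately have "(\<Sum>b'\<in>PiE {..<k} V. \<Psi> t' b') \<le> K * (\<Sum>b'\<in>PiE {..<k} V. \<Psi> t b')" by (simp only: mult.assoc)
    then show "(\<Sum>b'\<in>PiE {..<k} (\<lambda>i. node D B (ht (T r) i) (b i)). \<Psi> (T (Suc r)) b') \<le> K * (\<Sum>b'\<in>PiE {..<k} (\<lambda>i. node D B (ht (T r) i) (b i)). \<Psi> (T r) b')"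
      unfolding V_def t_def t'_def .
  qed simp
  have "(\<Sum>b\<in>?BB. \<Psi> (T r) b) \<le> K ^ r * card B ^ k" if "r \<le> N" for r using that
  proof (induction r)
    case 0
    have "(\<Sum>b\<in>?BB. \<Psi> (T 0) b) \<le> (\<Sum>b\<in>?BB. 1)"
      using tpos[of "T 0"] by (intro sum_mono) (simp add: \<Psi>_def)
    then show ?case by (simp add: card_PiE)
  next
    case (Suc r)
    have "(\<Sum>b\<in>?BB. \<Psi> (T (Suc r)) b) \<le> K * (\<Sum>b\<in>?BB. \<Psi> (T r) b)" using step Suc by simp
    also have "\<dots> \<le> K * (K ^ r * card B ^ k)" using Suc K0 by (intro mult_left_mono) auto
    finally show ?case by simp
  qed
  then have S: "(\<Sum>b\<in>?BB. \<Psi> (T N) b) \<le> K ^ N * card B ^ k" by simp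
  define E where "E = {b\<in>?BB. \<bar>(\<Sum>i<k. X i * real (b i)) - z\<bar> \<le> 2 * k}"
  have R1: "R (T N) \<ge> 1" using T(3) D0 by (simp add: R_def)
  \<comment> \<open>At time \<open>T N\<close> the remaining uncertainty is \<open>k * R t\<close>
    with \<open>R t \<ge> 1\<close>, so a tuple whose sum is within \<open>2 * k\<close> of
    \<open>z\<close> still has potential at least \<open>exp (- 3 * k)\<close>.\<close>
  have big: "1 \<le> exp (3 * k) * \<Psi> (T N) b" if b: "b \<in> E" for b
  proof -
    define t where "t = T N"
    have bB: "b i \<in> B" if "i < k" for i using b that by (auto simp: E_def PiE_iff)
    have "\<bar>Y t b - (\<Sum>i<k. X i * real (b i))\<bar> \<le> (\<Sum>i<k. R t)"
      unfolding Y_def sum_subtractf[symmetric]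
    proof (rule order_trans[OF sum_abs], rule sum_mono)
      fix i assume i: "i \<in> {..<k}"
      have "\<bar>node_mean D B (ht t i) (b i) - real (b i)\<bar> \<le> D ^ ht t i"
        using node_mean_interval[OF fin D0 bB order_refl, of i "ht t i"] div_interval[OF D0, of "b i" "ht t i"] i by (auto simp: abs_le_iff)
      then have "\<bar>X i * (node_mean D B (ht t i) (b i) - real (b i))\<bar> \<le> \<bar>X i\<bar> * D ^ ht t i"
        unfolding abs_mult by (intro mult_left_mono) auto
      also have "\<dots> \<le> R t" using Xht[of i t] i T(2) by (simp add: t_def)
      finally show "\<bar>X i * node_mean D B (ht t i) (b i) - X i * real (b i)\<bar> \<le> R t" by (simp add: right_diff_distrib)
    qed
    moreover have "\<bar>(\<Sum>i<k. X i * real (b i)) - z\<bar> \<le> 2 * k" using b by (simp add: E_def)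
    ultimately have "\<bar>Y t b - z\<bar> \<le> k * R t + 2 * k" by simp
    also have "\<dots> \<le> 3 * k * R t" using R1 k by (simp add: t_def)
    also have "\<dots> \<le> 3 * k * \<tau> t"
      unfolding \<tau>_def mult.assoc[symmetric, of "1 + h"]
      using mult_right_mono[OF hk, of "R t"] Rpos[of t] by (intro mult_left_mono) auto
    finally have "\<bar>Y t b - z\<bar> / \<tau> t \<le> 3 * k" using tpos[of t] by (simp add: field_simps)
    then have "exp 0 \<le> exp (3 * k + - \<bar>Y t b - z\<bar> / \<tau> t)" by (subst exp_le_cancel_iff) simp
    then show ?thesis unfolding \<Psi>_def exp_add t_def by simp
  qed
  have finE: "finite E" using finBB by (simp add: E_def)
  have "real (card E) = (\<Sum>b\<in>E. 1)" by simp
  also have "\<dots> \<le> (\<Sum>b\<in>E. exp (3 * k) * \<Psi> (T N) b)" using big by (rule sum_mono)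
  also have "\<dots> \<le> (\<Sum>b\<in>?BB. exp (3 * k) * \<Psi> (T N) b)"
    using finBB by (intro sum_mono2) (auto simp: E_def \<Psi>_def)
  also have "\<dots> = exp (3 * k) * (\<Sum>b\<in>?BB. \<Psi> (T N) b)" by (simp only: sum_distrib_left)
  also have "\<dots> \<le> exp (3 * k) * (K ^ N * card B ^ k)" using S by (intro mult_left_mono) auto
  finally show ?thesis unfolding E_def K_def
    by (simp only: mult.assoc of_nat_add of_nat_mult of_nat_1 of_nat_numeral of_nat_power)
qed

section \<open>Greedy choice of levels\<close>

lemma exists_ge_average:
  fixes f :: "'a \<Rightarrow> real" and c :: real
  assumes "finite S" "S \<noteq> {}" "c * card S \<le> (\<Sum>s\<in>S. f s)"
  shows "\<exists>s\<in>S. c \<le> f s"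
proof (rule ccontr)
  assume "\<not> ?thesis"
  then have "(\<Sum>s\<in>S. f s) < (\<Sum>s\<in>S. c)" using assms by (intro sum_strict_mono) (auto simp: not_le)
  then show False using assms by (simp add: mult.commute)
qed

lemma popular_value:
  fixes g :: "'a \<Rightarrow> 'b"
  assumes "finite H" "finite L" "L \<noteq> {}" and g: "\<And>h. h \<in> H \<Longrightarrow> g h \<in> L"
  shows "\<exists>i\<in>L. real (card H) / card L \<le> card {h\<in>H. g h = i}"
proof -
  have "card H = (\<Sum>i\<in>L. card {h\<in>H. g h = i})"
    using sum.group[OF assms(1,2), of g "\<lambda>_. 1::nat"] g assms(1) by (simp add: image_subset_iff)
  then have "real (card H) = (\<Sum>i\<in>L. real (card {h\<in>H. g h = i}))" by simp
  moreover have "card L > 0" using assms by (simp add: card_gt_0_iff)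
  ultimately have "real (card H) / card L * card L \<le> (\<Sum>i\<in>L. real (card {h\<in>H. g h = i}))" by simp
  then show ?thesis by (rule exists_ge_average[OF assms(2,3)])
qed

lemma popular_point:
  fixes S :: "'h \<Rightarrow> 'f set" and \<kappa> :: real
  assumes "finite H" "H \<noteq> {}" "finite Z" "Z \<noteq> {}" and S: "\<And>h. h \<in> H \<Longrightarrow> S h \<subseteq> Z" "\<And>h. h \<in> H \<Longrightarrow> \<kappa> * card Z \<le> card (S h)"
  shows "\<exists>f\<in>Z. \<kappa> * card H \<le> card {h\<in>H. f \<in> S h}"
proof (rule exists_ge_average[OF assms(3,4)])
  have "\<kappa> * card H * card Z = (\<Sum>h\<in>H. \<kappa> * card Z)" by simp
  also have "\<dots> \<le> (\<Sum>h\<in>H. real (card {f\<in>Z. f \<in> S h}))"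
  proof (rule sum_mono)
    fix h assume h: "h \<in> H"
    have "{f\<in>Z. f \<in> S h} = S h" using S(1)[OF h] by blast
    then show "\<kappa> * card Z \<le> card {f\<in>Z. f \<in> S h}" using S(2)[OF h] by simp
  qed
  also have "\<dots> = real (\<Sum>h\<in>H. card {f\<in>Z. f \<in> S h})" by simp
  also have "(\<Sum>h\<in>H. card {f\<in>Z. f \<in> S h}) = (\<Sum>f\<in>Z. card {h\<in>H. f \<in> S h})"
    using sum_multicount_gen[OF assms(1,3), of "\<lambda>h f. f \<in> S h" "\<lambda>f. card {h\<in>H. f \<in> S h}"] by simp
  finally show "\<kappa> * card H * card Z \<le> (\<Sum>f\<in>Z. real (card {h\<in>H. f \<in> S h}))" by simp
qed

text \<open>The share of \<open>H\<close> that survives one greedy stage: the relative number of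
  zigzags given by \<open>many_zigzags\<close>, divided by \<open>N + 1\<close> for the choice of a
  common height.\<close>

definition stage_loss :: "real \<Rightarrow> nat \<Rightarrow> nat \<Rightarrow> nat \<Rightarrow> real" where
  "stage_loss \<rho> N D q = \<rho> / 8 * (\<rho> / (2 * (real N + 1) * real D)) ^ Suc q / (real N + 1)"

text \<open>Two pigeonholes. Every \<open>h\<close> has a height at which \<open>S h\<close> has
  many zigzags; a popular height is fixed first. At that height \<open>card_zigzags_le\<close>
  bounds the number of all zigzags, so double counting finds one shared by many
  \<open>h\<close>.\<close>

lemma common_zigzag:
  fixes \<rho> :: real and S :: "'h \<Rightarrow> nat set"
  assumes fin: "finite C" and u: "uniform_below D C a N" and D: "D > 0"
    and one: "\<And>x y. x \<in> C \<Longrightarrow> y \<in> C \<Longrightarrow> x div D ^ N = y div D ^ N"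
    and \<rho>: "0 < \<rho>" and ne: "C \<noteq> {}" and H: "finite H" "H \<noteq> {}"
    and S: "\<And>h. h \<in> H \<Longrightarrow> S h \<subseteq> C" "\<And>h. h \<in> H \<Longrightarrow> \<rho> * card C \<le> card (S h)"
    and L: "L \<subseteq> {..<N}" "\<And>i. i \<in> L \<Longrightarrow> a i \<ge> 1" and big: "(4 / \<rho>)^2 \<le> 2 ^ card L" and Lne: "L \<noteq> {}"
  shows "\<exists>i\<in>L. \<exists>f\<in>zigzags D q i C. stage_loss \<rho> N D q * card H \<le> card {h\<in>H. \<forall>j\<le>q. f j \<in> S h}"
proof -
  define \<kappa> where "\<kappa> = \<rho> / 8 * (\<rho> / (2 * (real N + 1) * real D)) ^ Suc q"
  have \<kappa>0: "\<kappa> > 0" using \<rho> D by (simp add: \<kappa>_def)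
  define W where "W i = real (card C * (2 ^ (\<Sum>j<Suc i. a j)) ^ q)" for i
  have W0: "W i > 0" for i using fin ne by (simp add: W_def card_gt_0_iff)
  have ex: "\<exists>i. i \<in> L \<and> \<kappa> * W i \<le> card (zigzags D q i (S h))" if h: "h \<in> H" for h
  proof -
    obtain i where "i \<in> L"
      "\<rho> / 8 * (\<rho> / (2 * (N + 1) * D)) ^ Suc q * (card C * (2 ^ (\<Sum>j<Suc i. a j)) ^ q) \<le> card (zigzags D q i (S h))"
      by (rule many_zigzags[OF fin u D S(1)[OF h] one \<rho> S(2)[OF h] ne L big Lne])
    then show ?thesis by (intro exI[of _ i]) (simp add: \<kappa>_def W_def algebra_simps)
  qed
  define g where "g h = (SOME i. i \<in> L \<and> \<kappa> * W i \<le> card (zigzags D q i (S h)))" for h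
  have g: "g h \<in> L" "\<kappa> * W (g h) \<le> card (zigzags D q (g h) (S h))" if "h \<in> H" for h
    using someI_ex[OF ex[OF that]] unfolding g_def by blast+
  have finL: "finite L" using L(1) finite_subset by blast
  obtain i where i: "i \<in> L" and Hi: "real (card H) / card L \<le> card {h\<in>H. g h = i}"
    using popular_value[of H L g] H(1) finL Lne g(1) by blast
  define Hi where "Hi = {h\<in>H. g h = i}"
  have finHi: "finite Hi" using H by (simp add: Hi_def)
  have cL: "card L > 0" using finL Lne by (simp add: card_gt_0_iff)
  have cH: "card H > 0" using H by (simp add: card_gt_0_iff)
  have "real (card H) / card L > 0" using cL cH by simp
  then have "card Hi > 0" using Hi unfolding Hi_def by linarith
  then have Hine: "Hi \<noteq> {}" by auto
  let ?Z = "zigzags D q i C"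
  have finZ: "finite ?Z" by (rule finite_zigzags[OF fin])
  have iN: "i < N" using i L by auto
  have cZ: "real (card ?Z) \<le> W i" unfolding W_def using card_zigzags_le[OF fin u iN D] by (simp only: of_nat_le_iff)
  have sub: "zigzags D q i (S h) \<subseteq> ?Z" if "h \<in> H" for h
    unfolding zigzags_def using PiE_mono[of "{..q}" "\<lambda>_. S h" "\<lambda>_. C"] S(1)[OF that] by blast
  have Sz: "\<kappa> * card ?Z \<le> card (zigzags D q i (S h))" if "h \<in> Hi" for h
  proof -
    have "\<kappa> * card ?Z \<le> \<kappa> * W i" using cZ \<kappa>0 by simp
    also have "\<dots> \<le> card (zigzags D q i (S h))" using g(2)[of h] that by (simp add: Hi_def)
    finally show ?thesis .
  qed
  obtain h1 where h1: "h1 \<in> Hi" using Hine by blast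
  have "\<kappa> * W i > 0" using \<kappa>0 W0 by simp
  then have "card (zigzags D q i (S h1)) > 0" using g(2)[of h1] h1 unfolding Hi_def by auto
  then have "zigzags D q i (S h1) \<noteq> {}" by auto
  then have Zne: "?Z \<noteq> {}" using sub[of h1] h1 by (auto simp: Hi_def)
  have subHi: "zigzags D q i (S h) \<subseteq> ?Z" if "h \<in> Hi" for h using sub that by (simp add: Hi_def)
  have "\<exists>f\<in>?Z. \<kappa> * card Hi \<le> card {h\<in>Hi. f \<in> zigzags D q i (S h)}"
    by (rule popular_point[OF finHi Hine finZ Zne subHi Sz])
  then obtain f where f: "f \<in> ?Z" "\<kappa> * card Hi \<le> card {h\<in>Hi. f \<in> zigzags D q i (S h)}" by blast
  have "card {h\<in>Hi. f \<in> zigzags D q i (S h)} \<le> card {h\<in>H. \<forall>j\<le>q. f j \<in> S h}"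
    using H by (intro card_mono) (auto simp: Hi_def zigzags_def PiE_iff)
  then have 1: "\<kappa> * card Hi \<le> card {h\<in>H. \<forall>j\<le>q. f j \<in> S h}" using f(2) by linarith
  have "card L \<le> N" using card_mono[OF _ L(1)] by simp
  then have "real (card H) / (real N + 1) \<le> real (card H) / card L" using cL by (intro divide_left_mono) auto
  then have "real (card H) / (real N + 1) \<le> card Hi" using Hi by (simp add: Hi_def)
  then have "\<kappa> * (real (card H) / (real N + 1)) \<le> \<kappa> * card Hi" using \<kappa>0 by (intro mult_left_mono) auto
  moreover have "stage_loss \<rho> N D q * card H = \<kappa> * (real (card H) / (real N + 1))" by (simp add: stage_loss_def \<kappa>_def)
  ultimately have "stage_loss \<rho> N D q * card H \<le> card {h\<in>H. \<forall>j\<le>q. f j \<in> S h}" using 1 by linarith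
  then show ?thesis using i f(1) by blast
qed

text \<open>The scales \<open>s + l\<close> reached from active levels \<open>s\<close> of
  \<open>B\<close> and chosen levels \<open>l\<close> of \<open>C\<close>, widened to windows of
  length \<open>2 * P\<close> as \<open>approximate_mann\<close> requires.\<close>

definition cover :: "nat \<Rightarrow> nat \<Rightarrow> nat set \<Rightarrow> nat set \<Rightarrow> nat set" where
  "cover n P A F = {x. x < n \<and> (\<exists>l\<in>F. \<exists>a\<in>A. a + l \<le> x \<and> x < a + l + 2 * P)}"

lemma finite_cover: "finite (cover n P A F)" and card_cover: "card (cover n P A F) \<le> n"
proof -
  have "cover n P A F \<subseteq> {..<n}" by (auto simp: cover_def)
  then show "finite (cover n P A F)" "card (cover n P A F) \<le> n"
    using finite_subset card_mono[of "{..<n}" "cover n P A F"] by auto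
qed

text \<open>The levels still worth choosing. Once these are few, the remaining levels satisfy the
  hypothesis of \<open>approximate_mann\<close> with \<open>cover n P A F\<close> as the
  target.\<close>

definition bad_levels :: "nat \<Rightarrow> nat \<Rightarrow> nat set \<Rightarrow> nat set \<Rightarrow> real \<Rightarrow> nat set \<Rightarrow> nat set" where
  "bad_levels n P A SC \<epsilon> F = {l\<in>SC. \<epsilon> * n < card {x. x < n \<and> x \<notin> cover n P A F \<and> (\<exists>a\<in>A. a + l \<le> x \<and> x < a + l + 2 * P)}}"

text \<open>While there are more than \<open>\<epsilon> * n\<close> bad levels, they are numerous
  enough for \<open>common_zigzag\<close> to work at one of them, and choosing it adds more than
  \<open>\<epsilon> * n\<close> scales to the cover. The cover has at most \<open>n\<close> scales
  and \<open>r * \<epsilon> > 1\<close>, so this stops within \<open>r\<close> stages whatever the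
  size of \<open>n\<close>.\<close>

theorem greedy_zigzags:
  fixes \<rho> \<epsilon> :: real and S :: "'h \<Rightarrow> nat set"
  assumes fin: "finite C" and u: "uniform_below D C a N" and D: "D > 0"
    and one: "\<And>x y. x \<in> C \<Longrightarrow> y \<in> C \<Longrightarrow> x div D ^ N = y div D ^ N"
    and \<rho>: "0 < \<rho>" "\<rho> \<le> 1" and ne: "C \<noteq> {}" and H: "finite H" "H \<noteq> {}"
    and S: "\<And>h. h \<in> H \<Longrightarrow> S h \<subseteq> C" "\<And>h. h \<in> H \<Longrightarrow> \<rho> * card C \<le> card (S h)"
    and \<epsilon>: "\<epsilon> > 0" and n: "n > 0" and SC: "SC \<subseteq> {..<N}" "\<And>l. l \<in> SC \<Longrightarrow> a (N - 1 - l) \<ge> 1"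
    and big: "\<And>y::nat. \<epsilon> * n < y \<Longrightarrow> (4 / \<rho>)^2 \<le> 2 ^ y"
    and r: "1 < r * \<epsilon>"
  shows "\<exists>F f H'. F \<subseteq> SC \<and> card F \<le> r \<and> H' \<subseteq> H \<and> H' \<noteq> {} \<and> stage_loss \<rho> N D q ^ r * card H \<le> card H' \<and>
     (\<forall>l\<in>F. f l \<in> zigzags D q (N - 1 - l) C \<and> (\<forall>h\<in>H'. \<forall>j\<le>q. f l j \<in> S h)) \<and>
     card (bad_levels n P A SC \<epsilon> F) \<le> \<epsilon> * n"
proof -
  let ?\<kappa> = "stage_loss \<rho> N D q"
  have \<kappa>: "0 < ?\<kappa>" "?\<kappa> \<le> 1"
  proof -
    show "0 < ?\<kappa>" using \<rho> D by (simp add: stage_loss_def)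
    have "\<rho> / (2 * (real N + 1) * real D) \<le> 1"
    proof -
      have "1 * 1 \<le> (2 * (real N + 1)) * real D" using D by (intro mult_mono) auto
      then show ?thesis using \<rho> by (simp add: divide_le_eq_1)
    qed
    then have "(\<rho> / (2 * (real N + 1) * real D)) ^ Suc q \<le> 1" using \<rho> by (intro power_le_one) auto
    then have "\<rho> / 8 * (\<rho> / (2 * (real N + 1) * real D)) ^ Suc q \<le> 1 * 1"
      using \<rho> by (intro mult_mono) auto
    then have "\<rho> / 8 * (\<rho> / (2 * (real N + 1) * real D)) ^ Suc q / (real N + 1) \<le> 1 / (real N + 1)"
      by (intro divide_right_mono) auto
    also have "\<dots> \<le> 1" by simp
    finally show "?\<kappa> \<le> 1" by (simp add: stage_loss_def)
  qed
  let ?ok = "\<lambda>F f H' t. F \<subseteq> SC \<and> card F \<le> t \<and> H' \<subseteq> H \<and> H' \<noteq> {} \<and> ?\<kappa> ^ t * card H \<le> card H' \<and>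
     (\<forall>l\<in>F. f l \<in> zigzags D q (N - 1 - l) C \<and> (\<forall>h\<in>H'. \<forall>j\<le>q. f l j \<in> S h))"
  let ?cl = "\<lambda>F. card (bad_levels n P A SC \<epsilon> F) \<le> \<epsilon> * n"
  have main: "\<exists>F f H'. ?ok F f H' t \<and> (?cl F \<or> t * \<epsilon> * n \<le> card (cover n P A F))" for t
  proof (induction t)
    case 0
    show ?case
      by (rule exI[of _ "{}"], rule exI[of _ "\<lambda>_ _. 0"], rule exI[of _ H]) (use H in auto)
  next
    case (Suc t)
    then obtain F f H' where ok: "?ok F f H' t" and alt: "?cl F \<or> t * \<epsilon> * n \<le> card (cover n P A F)" by (elim exE conjE) blast
    show ?case
    proof (cases "?cl F")
      case True
      have "?\<kappa> ^ Suc t * card H \<le> ?\<kappa> ^ t * card H"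
        using \<kappa> by (intro mult_right_mono power_decreasing) auto
      then have "?\<kappa> ^ Suc t * card H \<le> card H'" using ok by linarith
      then show ?thesis using ok True
        by (intro exI[of _ F], intro exI[of _ f], intro exI[of _ H']) (auto simp del: power_Suc)
    next
      case False
      define Bd where "Bd = bad_levels n P A SC \<epsilon> F"
      define L where "L = (\<lambda>l. N - 1 - l) ` Bd"
      have BdS: "Bd \<subseteq> SC" by (auto simp: Bd_def bad_levels_def)
      have inj: "inj_on (\<lambda>l. N - 1 - l) Bd"
      proof (rule inj_onI)
        fix x y assume "x \<in> Bd" "y \<in> Bd" and e: "N - 1 - x = N - 1 - y"
        then have "x < N" "y < N" using BdS SC(1) by blast+
        then show "x = y" using e by linarith
      qed
      have "\<epsilon> * n < card Bd" using False by (simp add: Bd_def)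
      then have Lb: "(4 / \<rho>)^2 \<le> 2 ^ card L" unfolding L_def card_image[OF inj] by (rule big)
      have "\<epsilon> * n \<ge> 0" using \<epsilon> by simp
      then have "card Bd > 0" using \<open>\<epsilon> * n < card Bd\<close> by linarith
      then have Lne: "L \<noteq> {}" by (auto simp: L_def)
      have LN: "L \<subseteq> {..<N}" using BdS SC(1) by (auto simp: L_def)
      have La: "a i \<ge> 1" if "i \<in> L" for i using that SC(2) BdS by (auto simp: L_def)
      have H'H: "H' \<subseteq> H" "H' \<noteq> {}" using ok by blast+
      have finH': "finite H'" using H'H H finite_subset by blast
      have S1: "S h \<subseteq> C" "\<rho> * card C \<le> card (S h)" if "h \<in> H'" for h using S that H'H by blast+
      have "\<exists>i\<in>L. \<exists>f\<in>zigzags D q i C. ?\<kappa> * card H' \<le> card {h\<in>H'. \<forall>j\<le>q. f j \<in> S h}"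
        by (rule common_zigzag[OF fin u D one \<rho>(1) ne finH' H'H(2) S1 LN La Lb Lne])
      then obtain i f' where i: "i \<in> L" and f': "f' \<in> zigzags D q i C"
        and c: "?\<kappa> * card H' \<le> card {h\<in>H'. \<forall>j\<le>q. f' j \<in> S h}" by blast
      obtain l where l: "l \<in> Bd" "i = N - 1 - l" using i unfolding L_def by blast
      define H'' where "H'' = {h\<in>H'. \<forall>j\<le>q. f' j \<in> S h}"
      have lS: "l \<in> SC" using l BdS by blast
      have c2: "?\<kappa> ^ Suc t * card H \<le> card H''"
      proof -
        have "?\<kappa> ^ Suc t * card H = ?\<kappa> * (?\<kappa> ^ t * card H)" by simp
        also have "\<dots> \<le> ?\<kappa> * card H'" using ok \<kappa> by (intro mult_left_mono) auto
        finally show ?thesis using c by (simp add: H''_def)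
      qed
      have "card H > 0" using H by (simp add: card_gt_0_iff)
      then have "?\<kappa> ^ Suc t * card H > 0" using \<kappa> by simp
      then have H''ne: "H'' \<noteq> {}" using c2 by auto
      have cov: "Suc t * \<epsilon> * n \<le> card (cover n P A (insert l F))"
      proof -
        let ?new = "{x. x < n \<and> x \<notin> cover n P A F \<and> (\<exists>a\<in>A. a + l \<le> x \<and> x < a + l + 2 * P)}"
        have finnew: "finite ?new" by (rule finite_subset[of _ "{..<n}"]) auto
        have dj: "cover n P A F \<inter> ?new = {}" by auto
        have "card (cover n P A F) + card ?new = card (cover n P A F \<union> ?new)"
          by (rule card_Un_disjoint[OF finite_cover finnew dj, symmetric])
        also have "\<dots> \<le> card (cover n P A (insert l F))"
          by (rule card_mono[OF finite_cover]) (auto simp: cover_def)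
        finally have "real (card (cover n P A F)) + real (card ?new) \<le> card (cover n P A (insert l F))"
          by (simp only: of_nat_add[symmetric] of_nat_le_iff)
        moreover have "\<epsilon> * n < card ?new" using l(1) by (simp add: Bd_def bad_levels_def)
        moreover have "t * \<epsilon> * n \<le> card (cover n P A F)" using alt False by blast
        ultimately show ?thesis by (simp add: algebra_simps)
      qed
      have zz: "(f(l := f')) l' \<in> zigzags D q (N - 1 - l') C \<and> (\<forall>h\<in>H''. \<forall>j\<le>q. (f(l := f')) l' j \<in> S h)"
        if l': "l' \<in> insert l F" for l'
      proof (cases "l' = l")
        case True
        then show ?thesis using f' l by (simp add: H''_def)
      next
        case False
        then have "l' \<in> F" using l' by blast
        then have "f l' \<in> zigzags D q (N - 1 - l') C" "\<And>h j. h \<in> H' \<Longrightarrow> j \<le> q \<Longrightarrow> f l' j \<in> S h"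
          using ok by blast+
        then show ?thesis using False by (simp add: H''_def)
      qed
      have "finite F" using ok SC(1) finite_subset[of F "{..<N}"] by blast
      moreover have "card F \<le> t" using ok by blast
      ultimately have cF: "card (insert l F) \<le> Suc t" by (simp add: card_insert_if)
      have "?ok (insert l F) (f(l := f')) H'' (Suc t)"
        using ok lS cF c2 H''ne zz by (simp only: H''_def insert_subset) blast
      then show ?thesis using cov by blast
    qed
  qed
  from main[of r] obtain F f H' where ok: "?ok F f H' r" and alt: "?cl F \<or> r * \<epsilon> * n \<le> card (cover n P A F)" by (elim exE conjE) blast
  have "real (card (cover n P A F)) \<le> n" using card_cover by simp
  also have "n < r * \<epsilon> * n" using mult_strict_right_mono[OF r, of n] n by simp
  finally have "?cl F" using alt by linarith
  then show ?thesis using ok by blast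
qed

text \<open>Keep the least element of \<open>G\<close> and discard everything less than
  \<open>g\<close> above it: the discarded windows fit into one of length
  \<open>g + w\<close>.\<close>

lemma spaced_checkpoints:
  fixes g w :: nat
  assumes "finite G" "E \<subseteq> (\<Union>t\<in>G. {t..<t + w})" "g > 0"
  shows "\<exists>N T. (\<forall>r<N. T r \<in> G) \<and> (\<forall>r. Suc r < N \<longrightarrow> T r + g \<le> T (Suc r)) \<and> card E \<le> N * (g + w)"
  using assms(1,2)
proof (induction "card G" arbitrary: G E rule: less_induct)
  case less
  show ?case
  proof (cases "G = {}")
    case True
    then have "E = {}" using less.prems by simp
    then show ?thesis by (intro exI[of _ 0]) simp
  next
    case False
    define t0 where "t0 = Min G"
    have t0: "t0 \<in> G" "\<And>t. t \<in> G \<Longrightarrow> t0 \<le> t" using False less.prems by (auto simp: t0_def)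
    define G' where "G' = {t\<in>G. t0 + g \<le> t}"
    define E' where "E' = E - {t0..<t0 + (g + w)}"
    have "t0 \<notin> G'" "G' \<subseteq> G" using assms(3) by (simp_all add: G'_def)
    then have "G' \<subset> G" using t0(1) by blast
    then have c: "card G' < card G" "finite G'"
      using psubset_card_mono[OF less.prems(1)] finite_subset[OF _ less.prems(1)] by blast+
    have "E' \<subseteq> (\<Union>t\<in>G'. {t..<t + w})"
    proof
      fix x assume x: "x \<in> E'"
      then obtain t where t: "t \<in> G" "t \<le> x" "x < t + w" using less.prems by (auto simp: E'_def)
      have "t0 + g \<le> t"
      proof (rule ccontr)
        assume "\<not> t0 + g \<le> t"
        then have "x < t0 + (g + w)" "t0 \<le> x" using t t0(2)[OF t(1)] by linarith+
        then show False using x by (simp add: E'_def)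
      qed
      then show "x \<in> (\<Union>t\<in>G'. {t..<t + w})" using t by (auto simp: G'_def)
    qed
    from less.hyps[OF c this] obtain N T where NT: "\<forall>r<N. T r \<in> G'" "\<forall>r. Suc r < N \<longrightarrow> T r + g \<le> T (Suc r)" "card E' \<le> N * (g + w)"
      by (elim exE conjE)
    define T' where "T' = case_nat t0 T"
    have 1: "\<forall>r<Suc N. T' r \<in> G"
    proof (intro allI impI)
      fix r assume "r < Suc N"
      then show "T' r \<in> G" using NT(1) t0(1) by (cases r) (auto simp: T'_def G'_def)
    qed
    have 2: "\<forall>r. Suc r < Suc N \<longrightarrow> T' r + g \<le> T' (Suc r)"
    proof (intro allI impI)
      fix r assume "Suc r < Suc N"
      then show "T' r + g \<le> T' (Suc r)" using NT(1,2) by (cases r) (auto simp: T'_def G'_def)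
    qed
    have finE: "finite E" using less.prems by (intro finite_subset[OF less.prems(2)]) auto
    have "card E \<le> card (E' \<union> {t0..<t0 + (g + w)})" using finE by (intro card_mono) (auto simp: E'_def)
    also have "\<dots> \<le> card E' + card {t0..<t0 + (g + w)}" by (rule card_Un_le)
    finally have "card E \<le> Suc N * (g + w)" using NT(3) by simp
    then show ?thesis using 1 2 by blast
  qed
qed

lemma zigzag_gap:
  assumes u: "uniform_below D C a N" and i: "i < N" and D: "D > 0" and f: "f \<in> zigzags D q i C" and j: "j < q"
  shows "real D ^ i \<le> \<bar>real (f (Suc j)) - real (f j)\<bar>"
proof -
  have fC: "f x \<in> C" if "x \<le> q" for x using f that by (auto simp: zigzags_def PiE_iff)
  have same: "f x div D ^ Suc i = f 0 div D ^ Suc i" if "x \<le> q" for x using f that unfolding zigzags_def by blast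
  have ne: "f j div D ^ i \<noteq> f (Suc j) div D ^ i" using f j unfolding zigzags_def by blast
  have "f (Suc j) div D ^ Suc i = f j div D ^ Suc i" using same[of "Suc j"] same[of j] j by (metis Suc_leI less_imp_le_nat)
  then have mem: "f (Suc j) \<in> node D C (Suc i) (f j)" using fC[of "Suc j"] j unfolding node_def by simp
  have fj: "f j \<in> C" using fC[of j] j by simp
  have par: "f (Suc j) div D ^ i mod 2 = f j div D ^ i mod 2"
    by (rule bspec[OF mp[OF spec[OF u[unfolded uniform_below_def], of i] i] fj, THEN conjunct2, THEN bspec, OF mem])
  show ?thesis
    using separated_values[OF D par ne[symmetric], of i "real (f (Suc j))" "real (f j)"]
      div_interval[OF D, of "f (Suc j)" i] div_interval[OF D, of "f j" i] by simp
qed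

text \<open>The zigzags of all levels in \<open>F\<close> are concatenated to one tuple
  \<open>c\<close>. Then \<open>walk_count\<close> compares the walks along it with the end points,
  bounded by \<open>KT\<close>, and with the concentration from
  \<open>anticoncentration\<close>.\<close>

theorem zigzag_walks_bound:
  fixes A :: "int set" and B C :: "nat set" and h s R0 \<alpha> :: real and T :: "nat \<Rightarrow> nat" and k q v :: nat
  assumes fin: "finite A" "finite B" "finite C" and D: "D > 1" and M: "M > 0"
    and uB: "uniform_below D B a nb" and oneB: "\<And>x y. x \<in> B \<Longrightarrow> y \<in> B \<Longrightarrow> x div D ^ nb = y div D ^ nb"
    and uC: "uniform_below D C a' nc" and oneC: "\<And>x y. x \<in> C \<Longrightarrow> y \<in> C \<Longrightarrow> x div D ^ nc = y div D ^ nc"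
    and F: "F \<subseteq> {..<nc}" "F \<noteq> {}" and f: "\<And>l. l \<in> F \<Longrightarrow> f l \<in> zigzags D q (nc - 1 - l) C" and q: "q = 2 * v" "q > 0"
    and H: "H \<subseteq> UNIV \<times> B \<times> B" "finite H" "H \<noteq> {}" and tw: "\<And>l j x. l \<in> F \<Longrightarrow> j \<le> q \<Longrightarrow> x \<in> H \<Longrightarrow> twist M (f l j) x \<in> A"
    and KT: "\<And>a0 r. r \<ge> 1 \<Longrightarrow> card {x\<in>A. \<bar>real_of_int x - real_of_int a0\<bar> \<le> r} \<le> r powr \<alpha>" and \<alpha>: "\<alpha> \<ge> 0"
    and R0: "R0 = real D ^ (nb + nc) / M"
    and T: "\<And>r. r < N \<Longrightarrow> \<exists>e l. T r = l + e \<and> e < nb \<and> a (nb - 1 - e) \<ge> 1 \<and> l \<in> F"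
      "\<And>r. r < N \<Longrightarrow> T r + g \<le> T (Suc r)" "T N \<le> nb" "D ^ T N \<le> R0"
    and k: "k = card F * (q + 1) - 1" and h: "h > 0" and s: "s \<ge> 0" and g: "2 * (1 + h) * sqrt k * D ^ 3 \<le> D ^ g"
  shows "(card H / (2 * (real k + 1) * card A)) ^ k \<le>
     (3 * k * R0) powr \<alpha> * (exp (3 * k) * (12 * exp s / sqrt (2 * real v + 1) + 6 * exp (- h * s)) ^ N) * (card B ^ k)\<^sup>2"
proof -
  have D0: "D > 0" using D by simp
  have finF: "finite F" using F finite_subset by blast
  have cF: "card F > 0" using finF F by (simp add: card_gt_0_iff)
  have k1: "k + 1 = card F * (q + 1)" using k cF by simp
  have "1 * 2 \<le> card F * (q + 1)" using cF q by (intro mult_le_mono) auto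
  then have k0: "k > 0" using k1 by linarith
  obtain lv where lv: "bij_betw lv {..<card F} F" using ex_bij_betw_nat_finite[OF finF] by (auto simp: atLeast0LessThan)
  define c where "c i = f (lv (i div (q + 1))) (i mod (q + 1))" for i
  \<comment> \<open>The joints between consecutive zigzags get level 0: for them only the trivial
    bound \<open>D ^ nc\<close> on the step is available, and no lower bound is asked.\<close>
  define lev where "lev i = (if i mod (q + 1) < q then lv (i div (q + 1)) else 0)" for i
  define X where "X i = (real (c (Suc i)) - real (c i)) / M" for i
  have idx: "lv (i div (q + 1)) \<in> F" if "i \<le> k" for i
  proof -
    have "i < card F * (q + 1)" using that k1 by linarith
    then have "i div (q + 1) < card F" by (simp add: less_mult_imp_div_less)
    then show ?thesis using lv by (auto simp: bij_betw_def)
  qed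
  have mq: "i mod (q + 1) \<le> q" for i using mod_less_divisor[of "q + 1" i] by linarith
  have cC: "c i \<in> C" if "i \<le> k" for i
    using f[OF idx[OF that]] mq[of i] unfolding c_def zigzags_def by (auto simp: PiE_iff)
  have tA: "twist M (c i) x \<in> A" if "i \<le> k" "x \<in> H" for i x
    unfolding c_def using tw[OF idx[OF that(1)] mq that(2)] .
  have R0': "R0 > 0" using R0 D0 M by simp
  have R1: "R0 \<ge> 1"
  proof -
    have "(1::real) \<le> real D ^ T N" using D by simp
    then show ?thesis using T(4) by linarith
  qed
  have special: "real D ^ (nc - 1 - lev i) \<le> \<bar>real (c (Suc i)) - real (c i)\<bar> \<and> \<bar>real (c (Suc i)) - real (c i)\<bar> \<le> real D ^ (nc - lev i) \<and> lev i < nc"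
    if i: "i < k" and sp: "i mod (q + 1) < q" for i
  proof -
    have e: "Suc i div (q + 1) = i div (q + 1)" "Suc i mod (q + 1) = Suc (i mod (q + 1))"
      using sp by (auto simp: div_Suc mod_Suc)
    define j l where "j = i mod (q + 1)" and "l = lv (i div (q + 1))"
    have l: "l \<in> F" "lev i = l" using idx[of i] i sp by (auto simp: l_def lev_def)
    have lnc: "l < nc" using l F by auto
    have c2: "c (Suc i) = f l (Suc j)" "c i = f l j" unfolding c_def e by (simp_all add: j_def l_def)
    have jq: "j < q" using sp by (simp add: j_def)
    have lt: "nc - 1 - l < nc" "Suc (nc - 1 - l) = nc - l" using lnc by auto
    have "real D ^ (nc - 1 - l) \<le> \<bar>real (f l (Suc j)) - real (f l j)\<bar>" by (rule zigzag_gap[OF uC lt(1) D0 f[OF l(1)] jq])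
    moreover have "f l (Suc j) div D ^ (nc - l) = f l j div D ^ (nc - l)"
    proof -
      have "f l x div D ^ Suc (nc - 1 - l) = f l 0 div D ^ Suc (nc - 1 - l)" if "x \<le> q" for x
        using f[OF l(1)] that unfolding zigzags_def by blast
      then have "f l (Suc j) div D ^ (nc - l) = f l 0 div D ^ (nc - l)" "f l j div D ^ (nc - l) = f l 0 div D ^ (nc - l)"
        using jq unfolding lt(2) by (metis Suc_leI, metis less_imp_le_nat)
      then show ?thesis by (simp only:)
    qed
    then have "\<bar>real (f l (Suc j)) - real (f l j)\<bar> < real (D ^ (nc - l))" using same_node_diff[OF D0] by simp
    ultimately show ?thesis using l(2) lnc c2 by simp
  qed
  have Xle: "\<bar>X i\<bar> * real D ^ nb \<le> R0 / real D ^ lev i" if i: "i < k" for i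
  proof -
    have "\<bar>real (c (Suc i)) - real (c i)\<bar> \<le> real D ^ (nc - lev i) \<and> lev i \<le> nc"
    proof (cases "i mod (q + 1) < q")
      case True
      then show ?thesis using special[OF i] by simp
    next
      case False
      have "c (Suc i) div D ^ nc = c i div D ^ nc" by (rule oneC) (use cC i in auto)
      then show ?thesis using False same_node_diff[OF D0, of "c (Suc i)" nc "c i"] by (simp add: lev_def)
    qed
    then have "\<bar>real (c (Suc i)) - real (c i)\<bar> \<le> real D ^ nc / real D ^ lev i"
      using power_diff[of "real D" "lev i" nc] D0 by simp
    then have "\<bar>real (c (Suc i)) - real (c i)\<bar> * (real D ^ nb / M) \<le> real D ^ nc / real D ^ lev i * (real D ^ nb / M)"
      by (rule mult_right_mono) simp
    then show ?thesis by (simp add: X_def R0 power_add mult.commute abs_divide)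
  qed
  have Xge: "R0 / real D ^ (lev i + 2) \<le> \<bar>X i\<bar> * real D ^ nb" if i: "i < k" and sp: "i mod (q + 1) < q" for i
  proof -
    have s: "real D ^ (nc - 1 - lev i) \<le> \<bar>real (c (Suc i)) - real (c i)\<bar>" "lev i < nc" using special[OF i sp] by auto
    have "real D ^ nc / real D ^ (lev i + 2) \<le> real D ^ nc / real D ^ (lev i + 1)"
      using D by (intro divide_left_mono power_increasing) auto
    also have "\<dots> = real D ^ (nc - (lev i + 1))" using s(2) D0 by (simp add: power_diff)
    also have "nc - (lev i + 1) = nc - 1 - lev i" by simp
    finally have "real D ^ nc / real D ^ (lev i + 2) \<le> \<bar>real (c (Suc i)) - real (c i)\<bar>" using s(1) by linarith
    then have "real D ^ nc / real D ^ (lev i + 2) * (real D ^ nb / M) \<le> \<bar>real (c (Suc i)) - real (c i)\<bar> * (real D ^ nb / M)"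
      by (rule mult_right_mono) simp
    moreover have "real D ^ nc / real D ^ (lev i + 2) * (real D ^ nb / M) = R0 / real D ^ (lev i + 2)"
      by (simp only: R0 power_add times_divide_eq_right times_divide_eq_left divide_divide_eq_left mult_ac)
    moreover have "\<bar>real (c (Suc i)) - real (c i)\<bar> * (real D ^ nb / M) = \<bar>X i\<bar> * real D ^ nb"
      by (simp add: X_def abs_divide)
    ultimately show ?thesis by (simp only: of_nat_power)
  qed
  have chk: "\<exists>Q e. Q \<subseteq> {..<k} \<and> card Q = 2 * v \<and> e < nb \<and> a (nb - 1 - e) \<ge> 1 \<and>
        (\<forall>i\<in>Q. lev i + e = T r \<and> R0 / real D ^ (lev i + 2) \<le> \<bar>X i\<bar> * real D ^ nb)" if r: "r < N" for r
  proof -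
    from T(1)[OF r] obtain e l where el: "T r = l + e" "e < nb" "a (nb - 1 - e) \<ge> 1" "l \<in> F" by (elim exE conjE)
    obtain x where x: "x < card F" "lv x = l" using bij_betw_imp_surj_on[OF lv] el(4) by (metis imageE lessThan_iff)
    \<comment> \<open>The \<open>2 * v\<close> steps inside the zigzag of level \<open>l\<close>. At
      time \<open>l + e\<close> all of them reveal level \<open>e\<close> of \<open>B\<close>
      simultaneously, which is active.\<close>
    define Q where "Q = (\<lambda>y. x * (q + 1) + y) ` {..<q}"
    have Qi: "i div (q + 1) = x \<and> i mod (q + 1) < q \<and> i < k" if iQ: "i \<in> Q" for i
    proof -
      obtain y where y: "y < q" "i = x * (q + 1) + y" using iQ unfolding Q_def by blast
      have "(x + 1) * (q + 1) \<le> card F * (q + 1)" using x(1) by (intro mult_le_mono1) simp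
      then have "x * (q + 1) + (q + 1) \<le> k + 1" using k1 by (simp add: algebra_simps)
      then have "i < k" using y by linarith
      moreover have "i div (q + 1) = x" unfolding y(2) using y(1) by (subst mult.commute, subst div_mult_self4) simp_all
      moreover have "i mod (q + 1) = y" unfolding y(2) using y(1) by (subst mult.commute, subst mod_mult_self4) simp_all
      ultimately show ?thesis using y(1) by simp
    qed
    have "card Q = 2 * v" unfolding Q_def using q(1) by (subst card_image) (auto simp: inj_on_def)
    moreover have "lev i + e = T r" if "i \<in> Q" for i using Qi[OF that] x(2) el(1) by (simp add: lev_def)
    moreover have "R0 / real D ^ (lev i + 2) \<le> \<bar>X i\<bar> * real D ^ nb" if "i \<in> Q" for i using Xge Qi[OF that] by blast
    moreover have "Q \<subseteq> {..<k}" using Qi by auto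
    ultimately show ?thesis using el(2,3) by (intro exI[of _ Q] exI[of _ e]) simp
  qed
  define K where "K = 12 * exp s / sqrt (2 * real v + 1) + 6 * exp (- h * s)"
  have conc: "card {b\<in>PiE {..<k} (\<lambda>_. B). \<bar>(\<Sum>i<k. X i * real (b i)) - z\<bar> \<le> 2 * k} \<le> exp (3 * k) * K ^ N * card B ^ k" for z
    unfolding K_def
    by (rule anticoncentration[OF fin(2) uB D k0 R0' _ h s g T(2-4), where l = lev]) (rule Xle, assumption, assumption, rule chk)
  obtain x0 where x0: "x0 \<in> H" using H by blast
  then have "A \<noteq> {}" using tA[of 0 x0] by blast
  then have cA: "card A > 0" using fin by (simp add: card_gt_0_iff)
  have cH: "card H > 0" using H by (simp add: card_gt_0_iff)
  \<comment> \<open>Half of the average fibre size over the \<open>k + 1\<close> maps, to make the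
    inequality required by \<open>walk_count\<close> strict.\<close>
  define t where "t = card H / (2 * (real k + 1) * card A)"
  have t0: "t \<ge> 0" by (simp add: t_def)
  have tb: "t * real ((k + 1) * card A) < card H"
  proof -
    have "(real k + 1) * card A > 0" using cA by simp
    then have "t * ((real k + 1) * card A) = card H / 2" unfolding t_def using cA by (simp only: mult.assoc) simp
    then have "t * real ((k + 1) * card A) = card H / 2"
      by (simp only: of_nat_mult of_nat_add of_nat_1)
    then show ?thesis using cH by simp
  qed
  have rad: "\<bar>(real (c (Suc i)) - real (c i)) / M * (real b' - real b)\<bar> \<le> R0" if "i < k" "b \<in> B" "b' \<in> B" for i b b'
  proof -
    have "\<bar>real b' - real b\<bar> \<le> real D ^ nb" using same_node_diff[OF D0 oneB[OF that(3,2)]] by simp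
    then have "\<bar>X i\<bar> * \<bar>real b' - real b\<bar> \<le> \<bar>X i\<bar> * real D ^ nb" by (intro mult_left_mono) auto
    also have "\<dots> \<le> R0 / D ^ lev i" using Xle[OF that(1)] by simp
    also have "\<dots> \<le> R0 / 1" using R0' D by (intro divide_left_mono) auto
    finally show ?thesis by (simp add: X_def abs_mult)
  qed
  have "\<exists>a0\<in>A. t ^ k \<le> card {x\<in>A. \<bar>real_of_int x - a0\<bar> \<le> k * (R0 + 2)} * card B ^ k * (exp (3 * k) * K ^ N * card B ^ k)"
  proof (rule walk_count[OF fin(1,2) H(1,2) M k0 t0])
    show "t * real ((k + 1) * card A) < card H" by (rule tb)
    show "real (card {b\<in>PiE {..<k} (\<lambda>_. B). \<bar>(\<Sum>i<k. (real (c (Suc i)) - real (c i)) / M * real (b i)) - z\<bar> \<le> 2 * real k}) \<le> exp (3 * k) * K ^ N * card B ^ k" for z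
      using conc[of z] unfolding X_def by simp
  qed (rule tA, assumption+, rule rad, assumption+)
  then obtain a0 where a0: "t ^ k \<le> card {x\<in>A. \<bar>real_of_int x - real_of_int a0\<bar> \<le> k * (R0 + 2)} * card B ^ k * (exp (3 * k) * K ^ N * card B ^ k)" by blast
  have K0: "K \<ge> 0" by (simp add: K_def)
  have k1': "real k \<ge> 1" using k0 by simp
  have r3: "k * (R0 + 2) \<le> 3 * k * R0" using R1 k1' by (simp add: algebra_simps)
  have "1 * 1 \<le> k * (R0 + 2)" using R1 k1' by (intro mult_mono) auto
  then have "card {x\<in>A. \<bar>real_of_int x - real_of_int a0\<bar> \<le> k * (R0 + 2)} \<le> (k * (R0 + 2)) powr \<alpha>" by (intro KT) simp
  also have "\<dots> \<le> (3 * k * R0) powr \<alpha>" using r3 \<alpha> R1 k1' by (intro powr_mono2) auto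
  finally have cE: "card {x\<in>A. \<bar>real_of_int x - real_of_int a0\<bar> \<le> k * (R0 + 2)} \<le> (3 * k * R0) powr \<alpha>" .
  have "t ^ k \<le> card {x\<in>A. \<bar>real_of_int x - real_of_int a0\<bar> \<le> k * (R0 + 2)} * ((exp (3 * k) * K ^ N) * (card B ^ k)\<^sup>2)"
    using a0 by (simp add: power2_eq_square mult_ac)
  also have "\<dots> \<le> (3 * k * R0) powr \<alpha> * ((exp (3 * k) * K ^ N) * (card B ^ k)\<^sup>2)"
    using cE K0 by (intro mult_right_mono) auto
  finally show ?thesis unfolding t_def K_def by (simp add: mult.assoc)
qed

section \<open>The contradiction\<close>

text \<open>Heights are counted from the leaves, levels from the root: level \<open>s\<close> of \<open>B\<close> is height \<open>nb - 1 - s\<close>.\<close>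

locale twist_config =
  fixes \<alpha> \<epsilon>1 \<sigma>0 \<eta>1 :: real and D n :: nat and A :: "int set" and B C :: "nat set" and a a' :: "nat \<Rightarrow> nat"
    and nb nc nn M :: nat and S :: "int \<times> nat \<times> nat \<Rightarrow> nat set" and H :: "(int \<times> nat \<times> nat) set" and \<rho> \<sigma> \<tau> :: real
  assumes fin: "finite A" "finite B" "finite C" "finite H" and ne: "C \<noteq> {}" "H \<noteq> {}"
    and uB: "uniform_below D B a nb" and oneB: "\<And>x y. x \<in> B \<Longrightarrow> y \<in> B \<Longrightarrow> x div D ^ nb = y div D ^ nb"
    and uC: "uniform_below D C a' nc" and oneC: "\<And>x y. x \<in> C \<Longrightarrow> y \<in> C \<Longrightarrow> x div D ^ nc = y div D ^ nc"
    and heights: "nb \<le> n" "nc \<le> n" "nn \<le> nb" "nn \<le> nc" "\<eta>1 * n \<le> nn"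
    and M: "M > 0" "real D ^ nn \<le> real D ^ (nb + nc) / M" "real D ^ (nb + nc) / M \<le> real D ^ (nn + 1)"
    and H: "H \<subseteq> UNIV \<times> B \<times> B" "\<rho> * (card A * (card B)\<^sup>2) \<le> card H"
    and S: "\<And>x. x \<in> H \<Longrightarrow> S x \<subseteq> C" "\<And>x. x \<in> H \<Longrightarrow> \<rho> * card C \<le> card (S x)"
      "\<And>x c. x \<in> H \<Longrightarrow> c \<in> S x \<Longrightarrow> twist M c x \<in> A"
    and \<rho>: "0 < \<rho>" "\<rho> \<le> 1"
    and KT: "\<And>a0 r. r \<ge> 1 \<Longrightarrow> card {x\<in>A. \<bar>real_of_int x - real_of_int a0\<bar> \<le> r} \<le> r powr \<alpha>"
    and slopes: "\<sigma>0 \<le> \<sigma>" "\<sigma>0 \<le> \<tau>" "\<alpha> + \<epsilon>1 \<le> \<sigma> + \<tau>"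
    and active: "\<And>t. t \<le> nn \<Longrightarrow> \<sigma> * t \<le> card {s. s < t \<and> a (nb - 1 - s) \<ge> 1}"
      "\<And>t. t \<le> nn \<Longrightarrow> \<tau> * t \<le> card {s. s < t \<and> a' (nc - 1 - s) \<ge> 1}"
begin

text \<open>Dividing by the powers of \<open>card B\<close> leaves an inequality free of the sets: a
  bounded power of the density on the left, end points times gain on the right. \<open>N + 1\<close>
  checkpoints yield only \<open>N\<close> gains, because the last one merely closes the last
  step.\<close>

lemma walk_inequality:
  fixes P r0 v g :: nat and \<epsilon> \<zeta> h s y :: real
  assumes mann: "\<forall>A B E \<sigma> \<tau>.
      A \<subseteq> {..<nn} \<and> B \<subseteq> {..<nn} \<and> E \<subseteq> {..<nn} \<and> \<sigma>0 \<le> \<sigma> \<and> \<sigma>0 \<le> \<tau> \<and>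
      (\<forall>t\<le>nn. \<sigma> * t - \<epsilon> * nn \<le> card (A \<inter> {..<t})) \<and>
      (\<forall>t\<le>nn. \<tau> * t - \<epsilon> * nn \<le> card (B \<inter> {..<t})) \<and>
      (\<forall>b\<in>B. card {x. x < nn \<and> x \<notin> E \<and> (\<exists>a\<in>A. a + b \<le> x \<and> x < a + b + 2 * P)} \<le> \<epsilon> * nn) \<longrightarrow>
      (min 1 (\<sigma> + \<tau>) - \<zeta>) * nn \<le> card E"
    and \<epsilon>: "\<epsilon> > 0" "1 < r0 * \<epsilon>" and big: "\<And>y::nat. \<epsilon> * nn < y \<Longrightarrow> (4 / \<rho>)^2 \<le> 2 ^ y"
    and v: "v > 0" and h: "h > 0" and s: "s \<ge> 0" and g: "2 * (1 + h) * sqrt (r0 * (2 * v + 1)) * real D ^ 3 \<le> real D ^ g" "g > 0"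
    and K: "12 * exp s / sqrt (2 * real v + 1) + 6 * exp (- h * s) \<le> exp (- y)"
    and nn: "nn > 0" and D: "D > 1" and \<alpha>: "\<alpha> > 0" "\<alpha> + \<epsilon>1 \<le> 1" "\<zeta> < \<alpha> + \<epsilon>1"
  shows "\<exists>k N::nat. 0 < k \<and> k \<le> r0 * (2 * v + 1) \<and> (\<alpha> + \<epsilon>1 - \<zeta>) * nn \<le> (N + 1) * (g + 2 * P) \<and>
     (stage_loss \<rho> nc D (2 * v) ^ r0 * \<rho> / (2 * (real k + 1))) ^ k \<le> (3 * k * real D ^ (nn + 1)) powr \<alpha> * (exp (3 * k) * exp (- y) ^ N)"
proof -
  define SB where "SB = {s. s < nn \<and> a (nb - 1 - s) \<ge> 1}"
  define SC where "SC = {s. s < nn \<and> a' (nc - 1 - s) \<ge> 1}"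
  have D0: "D > 0" using D by simp
  have SCn: "SC \<subseteq> {..<nc}" using heights(4) by (auto simp: SC_def)
  have SCa: "a' (nc - 1 - l) \<ge> 1" if "l \<in> SC" for l using that by (simp add: SC_def)
  have "\<exists>F f H'. F \<subseteq> SC \<and> card F \<le> r0 \<and> H' \<subseteq> H \<and> H' \<noteq> {} \<and> stage_loss \<rho> nc D (2 * v) ^ r0 * card H \<le> card H' \<and>
     (\<forall>l\<in>F. f l \<in> zigzags D (2 * v) (nc - 1 - l) C \<and> (\<forall>x\<in>H'. \<forall>j\<le>2 * v. f l j \<in> S x)) \<and>
     card (bad_levels nn P SB SC \<epsilon> F) \<le> \<epsilon> * nn"
    by (rule greedy_zigzags[OF fin(3) uC D0 oneC \<rho> ne(1) fin(4) ne(2) S(1,2) \<epsilon>(1) nn SCn SCa big \<epsilon>(2)])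
  then obtain F f H' where F: "F \<subseteq> SC" "card F \<le> r0" and H': "H' \<subseteq> H" "H' \<noteq> {}" "stage_loss \<rho> nc D (2 * v) ^ r0 * card H \<le> card H'"
    and f: "\<forall>l\<in>F. f l \<in> zigzags D (2 * v) (nc - 1 - l) C \<and> (\<forall>x\<in>H'. \<forall>j\<le>2 * v. f l j \<in> S x)"
    and bad: "card (bad_levels nn P SB SC \<epsilon> F) \<le> \<epsilon> * nn"
    by (elim exE conjE)
  define Bd where "Bd = bad_levels nn P SB SC \<epsilon> F"
  define E where "E = cover nn P SB F"
  have finBd: "finite Bd" by (rule finite_subset[of _ "{..<nc}"]) (use SCn in \<open>auto simp: Bd_def bad_levels_def\<close>)
  have E1: "(min 1 (\<sigma> + \<tau>) - \<zeta>) * nn \<le> card E"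
  \<comment> \<open>The second set omits the bad levels. There are at most
    \<open>\<epsilon> * nn\<close> of them, exactly the slack that the density hypothesis of
    \<open>mann\<close> leaves.\<close>
  proof (rule mann[rule_format, of SB "SC - Bd" E \<sigma> \<tau>], intro conjI allI impI ballI)
    show "SB \<subseteq> {..<nn}" "SC - Bd \<subseteq> {..<nn}" "E \<subseteq> {..<nn}" by (auto simp: SB_def SC_def E_def cover_def)
    show "\<sigma>0 \<le> \<sigma>" "\<sigma>0 \<le> \<tau>" using slopes by auto
  next
    fix t assume t: "t \<le> nn"
    have "SB \<inter> {..<t} = {s. s < t \<and> a (nb - 1 - s) \<ge> 1}" using t by (auto simp: SB_def)
    moreover have "0 \<le> \<epsilon> * nn" using \<epsilon> by simp
    ultimately show "\<sigma> * t - \<epsilon> * nn \<le> card (SB \<inter> {..<t})" using active(1)[OF t] by simp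
  next
    fix t assume t: "t \<le> nn"
    have "SC \<inter> {..<t} = {s. s < t \<and> a' (nc - 1 - s) \<ge> 1}" using t by (auto simp: SC_def)
    then have "\<tau> * t \<le> card (SC \<inter> {..<t})" using active(2)[OF t] by simp
    moreover have "SC \<inter> {..<t} \<subseteq> ((SC - Bd) \<inter> {..<t}) \<union> Bd" by auto
    then have "card (SC \<inter> {..<t}) \<le> card (((SC - Bd) \<inter> {..<t}) \<union> Bd)" using finBd by (intro card_mono) auto
    then have "card (SC \<inter> {..<t}) \<le> card ((SC - Bd) \<inter> {..<t}) + card Bd" using card_Un_le order_trans by blast
    then have "real (card (SC \<inter> {..<t})) \<le> real (card ((SC - Bd) \<inter> {..<t})) + real (card Bd)" by (simp only: of_nat_add[symmetric] of_nat_le_iff)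
    ultimately show "\<tau> * t - \<epsilon> * nn \<le> card ((SC - Bd) \<inter> {..<t})" using bad unfolding Bd_def by linarith
  next
    fix b assume "b \<in> SC - Bd"
    then show "card {x. x < nn \<and> x \<notin> E \<and> (\<exists>a\<in>SB. a + b \<le> x \<and> x < a + b + 2 * P)} \<le> \<epsilon> * nn"
      unfolding Bd_def bad_levels_def E_def by (simp add: not_less)
  qed
  have "(\<alpha> + \<epsilon>1 - \<zeta>) * nn \<le> (min 1 (\<sigma> + \<tau>) - \<zeta>) * nn" using \<alpha> slopes by (intro mult_right_mono) auto
  then have E2: "(\<alpha> + \<epsilon>1 - \<zeta>) * nn \<le> card E" using E1 by linarith
  moreover have "(\<alpha> + \<epsilon>1 - \<zeta>) * nn > 0" using \<alpha> nn by simp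
  ultimately have "card E > 0" by linarith
  then have Ene: "E \<noteq> {}" by auto
  then have Fne: "F \<noteq> {}" by (auto simp: E_def cover_def)
  define G where "G = {x. x < nn \<and> (\<exists>l\<in>F. \<exists>e\<in>SB. x = e + l)}"
  have finG: "finite G" by (rule finite_subset[of _ "{..<nn}"]) (auto simp: G_def)
  have "E \<subseteq> (\<Union>t\<in>G. {t..<t + 2 * P})"
  proof
    fix x assume "x \<in> E"
    then obtain l e where le: "x < nn" "l \<in> F" "e \<in> SB" "e + l \<le> x" "x < e + l + 2 * P" by (auto simp: E_def cover_def)
    then have "e + l \<in> G" by (auto simp: G_def)
    then show "x \<in> (\<Union>t\<in>G. {t..<t + 2 * P})" using le(4,5) by (intro UN_I[of "e + l"]) auto
  qed
  from spaced_checkpoints[OF finG this g(2)] obtain N' T where T: "\<forall>r<N'. T r \<in> G" "\<forall>r. Suc r < N' \<longrightarrow> T r + g \<le> T (Suc r)"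
    "card E \<le> N' * (g + 2 * P)" by (elim exE conjE)
  have "N' > 0" using T(3) \<open>card E > 0\<close> by (cases N') auto
  then obtain N where N: "N' = Suc N" by (cases N') auto
  define k where "k = card F * (2 * v + 1) - 1"
  have finF: "finite F" using F(1) SCn finite_subset[of F "{..<nc}"] by blast
  have cF: "card F > 0" using finF Fne by (simp add: card_gt_0_iff)
  have "1 * 3 \<le> card F * (2 * v + 1)" using cF v by (intro mult_le_mono) auto
  then have k0: "k > 0" by (simp add: k_def)
  have kle: "k \<le> r0 * (2 * v + 1)"
  proof -
    have "card F * (2 * v + 1) \<le> r0 * (2 * v + 1)" using F(2) by (rule mult_le_mono1)
    then show ?thesis unfolding k_def by linarith
  qed
  let ?K = "12 * exp s / sqrt (2 * real v + 1) + 6 * exp (- h * s)"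
  define R0 where "R0 = real D ^ (nb + nc) / M"
  have finH': "finite H'" using H'(1) fin(4) finite_subset by blast
  have H'B: "H' \<subseteq> UNIV \<times> B \<times> B" using H'(1) H(1) by blast
  have zz: "f l \<in> zigzags D (2 * v) (nc - 1 - l) C" if "l \<in> F" for l using f that by blast
  have tw: "twist M (f l j) x \<in> A" if "l \<in> F" "j \<le> 2 * v" "x \<in> H'" for l j x
  proof (rule S(3))
    show "x \<in> H" using that(3) H'(1) by blast
    show "f l j \<in> S x" using f that by blast
  qed
  have TG: "T r < nn \<and> (\<exists>e l. T r = l + e \<and> e < nb \<and> a (nb - 1 - e) \<ge> 1 \<and> l \<in> F)" if "r \<le> N" for r
  proof -
    have "T r \<in> G" using T(1) that N by simp
    then obtain l e where le: "T r < nn" "l \<in> F" "e \<in> SB" "T r = e + l" by (auto simp: G_def)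
    have "e < nb" "a (nb - 1 - e) \<ge> 1" using le(3) heights(3) by (auto simp: SB_def)
    moreover have "T r = l + e" using le(4) by simp
    ultimately show ?thesis using le(1,2) by blast
  qed
  have T1: "\<exists>e l. T r = l + e \<and> e < nb \<and> a (nb - 1 - e) \<ge> 1 \<and> l \<in> F" if "r < N" for r using TG[of r] that by simp
  have T2: "T r + g \<le> T (Suc r)" if "r < N" for r using T(2) that N by simp
  have T3: "T N \<le> nb" using TG[of N] heights(3) by simp
  have T4: "real D ^ T N \<le> R0"
  proof -
    have "real D ^ T N \<le> real D ^ nn" using TG[of N] D by (intro power_increasing) auto
    then show ?thesis using M(2) by (simp add: R0_def)
  qed
  have gk: "2 * (1 + h) * sqrt k * real D ^ 3 \<le> real D ^ g"
  proof -
    have "sqrt k \<le> sqrt (r0 * (2 * v + 1))" using kle by (simp only: real_sqrt_le_iff of_nat_le_iff)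
    then have "2 * (1 + h) * sqrt k * real D ^ 3 \<le> 2 * (1 + h) * sqrt (r0 * (2 * v + 1)) * real D ^ 3"
      using h by (intro mult_right_mono mult_left_mono) auto
    then show ?thesis using g(1) by simp
  qed
  have FN: "F \<subseteq> {..<nc}" using F(1) SCn by blast
  have v2: "2 * v > 0" using v by simp
  have bound: "(card H' / (2 * (real k + 1) * card A)) ^ k \<le>
     (3 * k * R0) powr \<alpha> * (exp (3 * k) * ?K ^ N) * (card B ^ k)\<^sup>2"
    by (rule zigzag_walks_bound[OF fin(1-3) D M(1) uB oneB uC oneC FN Fne zz refl v2 H'B finH' H'(2) tw KT less_imp_le[OF \<alpha>(1)] R0_def T1 T2 T3 T4 k_def h s gk])
  obtain x0 where x0: "x0 \<in> H'" using H'(2) by blast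
  have x0H: "x0 \<in> H" using x0 H'(1) by blast
  have cC: "card C > 0" using fin(3) ne(1) by (simp add: card_gt_0_iff)
  have "\<rho> * card C > 0" using \<rho> cC by simp
  then have "card (S x0) > 0" using S(2)[OF x0H] by auto
  then obtain c0 where "c0 \<in> S x0" by (metis card.empty equals0I less_irrefl)
  then have "twist M c0 x0 \<in> A" by (rule S(3)[OF x0H])
  then have cA: "card A > 0" using fin(1) by (auto simp: card_gt_0_iff)
  have "B \<noteq> {}" using x0 H'B by auto
  then have cB: "card B > 0" using fin(2) by (simp add: card_gt_0_iff)
  define \<kappa> where "\<kappa> = stage_loss \<rho> nc D (2 * v) ^ r0"
  have \<kappa>0: "\<kappa> \<ge> 0" using \<rho> by (simp add: \<kappa>_def stage_loss_def)
  have R0pos: "R0 > 0" using M(1) D0 by (simp add: R0_def)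
  have lower: "\<kappa> * \<rho> / (2 * (real k + 1)) * (card B)\<^sup>2 \<le> card H' / (2 * (real k + 1) * card A)"
  proof -
    have "\<kappa> * (\<rho> * (card A * (card B)\<^sup>2)) \<le> \<kappa> * card H" using H(2) \<kappa>0 by (intro mult_left_mono) auto
    also have "\<dots> \<le> card H'" using H'(3) by (simp add: \<kappa>_def)
    finally have "(\<kappa> * \<rho> * (card B)\<^sup>2) * card A \<le> card H'" by (simp add: mult_ac)
    then have "\<kappa> * \<rho> * (card B)\<^sup>2 \<le> card H' / card A" using cA by (simp add: pos_le_divide_eq)
    then have "\<kappa> * \<rho> * (card B)\<^sup>2 / (2 * (real k + 1)) \<le> card H' / card A / (2 * (real k + 1))" by (intro divide_right_mono) auto
    then show ?thesis by (simp add: mult.commute)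
  qed
  have "(\<kappa> * \<rho> / (2 * (real k + 1))) ^ k * (card B ^ k)\<^sup>2 = (\<kappa> * \<rho> / (2 * (real k + 1)) * (card B)\<^sup>2) ^ k"
    by (simp only: power_mult_distrib power_commutes of_nat_power power_mult[symmetric] mult.commute)
  also have "\<dots> \<le> (card H' / (2 * (real k + 1) * card A)) ^ k"
    using lower \<kappa>0 \<rho> by (intro power_mono) auto
  also have "\<dots> \<le> (3 * k * R0) powr \<alpha> * (exp (3 * k) * ?K ^ N) * (card B ^ k)\<^sup>2" by (rule bound)
  finally have "(\<kappa> * \<rho> / (2 * (real k + 1))) ^ k \<le> (3 * k * R0) powr \<alpha> * (exp (3 * k) * ?K ^ N)"
    using cB by (simp add: mult_le_cancel_right)
  also have "\<dots> \<le> (3 * k * real D ^ (nn + 1)) powr \<alpha> * (exp (3 * k) * exp (- y) ^ N)"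
  proof (intro mult_mono)
    show "(3 * k * R0) powr \<alpha> \<le> (3 * k * real D ^ (nn + 1)) powr \<alpha>"
      using M(3) R0pos \<alpha> unfolding R0_def by (intro powr_mono2 mult_left_mono) auto
    show "?K ^ N \<le> exp (- y) ^ N" using K by (intro power_mono) auto
  qed auto
  finally have fin_ineq: "(\<kappa> * \<rho> / (2 * (real k + 1))) ^ k \<le> (3 * k * real D ^ (nn + 1)) powr \<alpha> * (exp (3 * k) * exp (- y) ^ N)" .
  have "real (card E) \<le> real (N' * (g + 2 * P))" using T(3) by (simp only: of_nat_le_iff)
  then have "(\<alpha> + \<epsilon>1 - \<zeta>) * nn \<le> (N + 1) * (g + 2 * P)" using E2 N by simp
  then show ?thesis using k0 kle fin_ineq unfolding \<kappa>_def by (intro exI[of _ k] exI[of _ N]) simp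
qed

end

section \<open>Choice of the parameters and the final comparison\<close>

lemma polynomial_below_exp:
  fixes c b Q :: real
  assumes c: "c > 0" and b: "b \<ge> 0" and Q: "Q > 0"
  shows "\<exists>n0::nat. \<forall>n\<ge>n0. Q * (b * (real n + 1)) ^ K < exp (c * n)"
proof -
  define e0 where "e0 = 1 / (Q * ((b / c) ^ K + 1) * exp c)"
  have bc: "(b / c) ^ K \<ge> 0" using b c by simp
  have e0: "e0 > 0" using Q bc by (simp add: e0_def)
  have "\<forall>\<^sub>F x in at_top. \<bar>x ^ K / exp x\<bar> < e0"
    using tendstoD[OF tendsto_power_div_exp_0[of K] e0] by (simp add: dist_real_def)
  then obtain x0 where x0: "\<And>x. x \<ge> x0 \<Longrightarrow> \<bar>x ^ K / exp x\<bar> < e0" by (auto simp: eventually_at_top_linorder)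
  have "Q * (b * (real n + 1)) ^ K < exp (c * n)" if n: "n \<ge> nat \<lceil>x0 / c\<rceil>" for n
  proof -
    define x where "x = c * (real n + 1)"
    have "x0 / c \<le> n" using n by linarith
    then have "x0 \<le> c * n" using c by (simp add: pos_divide_le_eq mult.commute)
    then have "x0 \<le> x" using c by (simp add: x_def algebra_simps)
    then have "x ^ K / exp x < e0" using x0[of x] by linarith
    then have xK: "x ^ K < e0 * exp x" by (simp add: pos_divide_less_eq)
    have ex: "exp x = exp c * exp (c * n)" by (simp add: x_def distrib_left exp_add)
    have xpos: "x > 0" using c by (simp add: x_def)
    have "Q * (b * (real n + 1)) ^ K = Q * ((b / c) ^ K * x ^ K)"
      using c by (simp add: x_def power_mult_distrib power_divide)
    also have "\<dots> \<le> Q * (((b / c) ^ K + 1) * x ^ K)" using Q xpos by (intro mult_left_mono mult_right_mono) auto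
    also have "\<dots> < Q * (((b / c) ^ K + 1) * (e0 * exp x))"
      using xK Q bc by (intro mult_strict_left_mono) auto
    also have "\<dots> = (Q * ((b / c) ^ K + 1) * exp c) * e0 * exp (c * n)" by (simp add: ex)
    also have "\<dots> = exp (c * n)"
    proof -
      have "(b / c) ^ K + 1 \<noteq> 0" using bc by linarith
      then have "(Q * ((b / c) ^ K + 1) * exp c) * e0 = 1" using Q by (simp add: e0_def)
      then show ?thesis by simp
    qed
    finally show ?thesis .
  qed
  then show ?thesis by blast
qed

text \<open>Write \<open>Y = sqrt (2 * v + 1)\<close>. The gain satisfies
  \<open>y = h / (h + 1) * ln Y - ln 18\<close>, whereas \<open>g * ln D\<close> is
  \<open>ln Y\<close> up to a constant. As \<open>v\<close> grows, the ratio of gain to spacing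
  tends to \<open>h / (h + 1)\<close>, and any \<open>x' / x\<close> below that is attained; the
  widening \<open>2 * P\<close> disappears in the constant.\<close>

lemma parameter_choice:
  fixes h x x' :: real and D r0 P :: nat
  assumes D: "D > 1" and h: "h > 0" and r0: "r0 > 0" and x: "0 < x'" "0 < x" "x' < x * (h / (h + 1))"
  shows "\<exists>v g::nat. \<exists>s y::real. v > 0 \<and> g > 0 \<and> s \<ge> 0 \<and> y > 0 \<and>
    2 * (1 + h) * sqrt (r0 * (2 * v + 1)) * real D ^ 3 \<le> real D ^ g \<and>
    12 * exp s / sqrt (2 * real v + 1) + 6 * exp (- h * s) \<le> exp (- y) \<and> x' * (real (g + 2 * P) * ln D) \<le> x * y"
proof -
  define L where "L = ln (real D)"
  have L0: "L > 0" using D by (simp add: L_def)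
  define \<theta> where "\<theta> = h / (h + 1)"
  have \<theta>: "0 < \<theta>" using h by (simp add: \<theta>_def)
  define c0 where "c0 = ln (2 * (1 + h) * sqrt r0) + (4 + 2 * P) * L"
  have xx: "x * \<theta> - x' > 0" using x by (simp add: \<theta>_def)
  \<comment> \<open>A lower bound for \<open>ln Y\<close> serving three purposes:
    \<open>s \<ge> 0\<close>, then \<open>y \<ge> 1\<close>, then the final inequality, solved for
    \<open>Ly\<close>.\<close>
  define Z where "Z = max 1 (max ((ln 18 + 1) / \<theta>) ((x' * c0 + x * ln 18) / (x * \<theta> - x')))"
  have Z: "1 \<le> Z" "(ln 18 + 1) / \<theta> \<le> Z" "(x' * c0 + x * ln 18) / (x * \<theta> - x') \<le> Z" by (auto simp: Z_def)
  define v where "v = nat \<lceil>exp (2 * Z)\<rceil>"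
  define Y where "Y = sqrt (2 * real v + 1)"
  define Ly where "Ly = ln Y"
  have vZ: "exp (2 * Z) \<le> v" by (simp add: v_def real_nat_ceiling_ge)
  have v0: "v > 0" using vZ exp_gt_zero[of "2 * Z"] by (metis of_nat_0 not_gr_zero not_le)
  have Y1: "Y > 1" using v0 by (simp add: Y_def)
  have LyZ: "Z \<le> Ly"
  proof -
    have "exp Z = sqrt (exp (2 * Z))" by (simp add: exp_double)
    also have "\<dots> \<le> Y" unfolding Y_def using vZ by (intro real_sqrt_le_mono) simp
    finally show ?thesis unfolding Ly_def using Y1 by (simp add: ln_ge_iff)
  qed
  have eLy: "exp Ly = Y" using Y1 by (simp add: Ly_def)
  \<comment> \<open>This \<open>s\<close> balances the two error terms,
    \<open>exp s / Y = exp (- h * s)\<close>, and 18 is 12 + 6.\<close>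
  define s y where "s = Ly / (h + 1)" and "y = \<theta> * Ly - ln 18"
  have s0: "s \<ge> 0" using LyZ Z(1) h by (simp add: s_def)
  have y0: "y > 0"
  proof -
    have "ln 18 + 1 \<le> \<theta> * Z" using Z(2) \<theta> by (simp add: pos_divide_le_eq mult.commute)
    also have "\<dots> \<le> \<theta> * Ly" using LyZ \<theta> by simp
    finally show ?thesis by (simp add: y_def)
  qed
  have e1: "exp s / Y = exp (- (\<theta> * Ly))"
  proof -
    have "s - Ly = - (\<theta> * Ly)" using h by (simp add: s_def \<theta>_def field_simps)
    then show ?thesis using exp_diff[of s Ly] eLy by simp
  qed
  have e2: "- h * s = - (\<theta> * Ly)" by (simp add: s_def \<theta>_def)
  have e3: "exp (- y) = 18 * exp (- (\<theta> * Ly))" by (simp add: y_def exp_diff exp_minus field_simps)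
  have K: "12 * exp s / sqrt (2 * real v + 1) + 6 * exp (- h * s) \<le> exp (- y)"
    unfolding e2 e3 Y_def[symmetric] using e1 by simp
  define X where "X = 2 * (1 + h) * sqrt r0 * Y * real D ^ 3"
  have sq: "sqrt (r0 * (2 * v + 1)) = sqrt r0 * Y" by (simp only: Y_def of_nat_mult of_nat_add of_nat_1 of_nat_numeral real_sqrt_mult)
  have X1: "X > 1"
  proof -
    have "1 < (2 * (1 + h)) * sqrt r0" using mult_mono[of 1 "sqrt r0" 2 "2 * (1 + h)"] h r0 by (simp add: mult.commute)
    moreover have "1 \<le> Y * real D ^ 3" using mult_mono[of 1 Y 1 "real D ^ 3"] Y1 D by simp
    ultimately have "1 * 1 < ((2 * (1 + h)) * sqrt r0) * (Y * real D ^ 3)" by (intro mult_less_le_imp_less) auto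
    then show ?thesis by (simp add: X_def mult.assoc)
  qed
  have lnX: "ln X = ln (2 * (1 + h) * sqrt r0) + Ly + 3 * L"
    unfolding X_def using h r0 Y1 D by (simp add: ln_mult Ly_def L_def ln_realpow)
  define g where "g = nat \<lceil>ln X / L\<rceil>"
  have lX0: "ln X / L > 0" using X1 L0 by simp
  have gb: "ln X / L \<le> g" "g < ln X / L + 1" using lX0 unfolding g_def by linarith+
  have g0: "g > 0" using gb(1) lX0 by (metis of_nat_0 not_gr_zero not_le)
  have gD: "X \<le> real D ^ g"
  proof -
    have "ln X \<le> g * L" using gb(1) L0 by (simp add: pos_divide_le_eq)
    then have "exp (ln X) \<le> exp (g * L)" by simp
    moreover have "exp (g * L) = real D ^ g" using D by (simp add: L_def exp_of_nat_mult)
    ultimately show ?thesis using X1 by simp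
  qed
  have "real (g + 2 * P) * L \<le> Ly + c0"
  proof -
    have "g * L \<le> (ln X / L + 1) * L" using gb(2) L0 by (intro mult_right_mono) auto
    also have "\<dots> = ln X + L" using L0 by (simp add: field_simps)
    finally show ?thesis unfolding lnX c0_def by (simp add: algebra_simps)
  qed
  then have "x' * (real (g + 2 * P) * L) \<le> x' * (Ly + c0)" using x by simp
  also have "\<dots> \<le> x * y"
  proof -
    have "x' * c0 + x * ln 18 \<le> Z * (x * \<theta> - x')" using Z(3) xx by (simp add: pos_divide_le_eq)
    also have "\<dots> \<le> Ly * (x * \<theta> - x')" using LyZ xx by (intro mult_right_mono) auto
    finally show ?thesis by (simp add: y_def algebra_simps)
  qed
  finally have "x' * (real (g + 2 * P) * ln D) \<le> x * y" by (simp add: L_def)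
  moreover have "2 * (1 + h) * sqrt (r0 * (2 * v + 1)) * real D ^ 3 \<le> real D ^ g"
    using gD unfolding sq X_def by (simp add: mult.assoc)
  ultimately show ?thesis using v0 g0 s0 y0 K by blast
qed

text \<open>All factors are bounded below by one common base, so that the losses of all stages
  combine to a single power.\<close>

lemma stage_loss_ge:
  assumes \<rho>: "0 < \<rho>" "\<rho> \<le> 1" and N: "N \<le> n" and D: "D > 0"
  shows "(\<rho> / (8 * (real n + 1) * real D)) ^ (q + 3) \<le> stage_loss \<rho> N D q"
proof -
  let ?x = "\<rho> / (8 * (real n + 1) * real D)"
  have D1: "real D \<ge> 1" using D by simp
  have nD: "1 \<le> (real n + 1) * real D" using mult_mono[of 1 "real n + 1" 1 "real D"] D1 by simp
  have x0: "?x \<ge> 0" using \<rho> by simp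
  have x1: "?x \<le> \<rho> / 8"
  proof (rule divide_left_mono)
    show "8 \<le> 8 * (real n + 1) * real D" using nD by (simp only: mult.assoc)
  qed (use \<rho> D1 in auto)
  have x2: "?x \<le> \<rho> / (2 * (real N + 1) * real D)"
  proof (rule divide_left_mono)
    show "2 * (real N + 1) * real D \<le> 8 * (real n + 1) * real D" using N D1 by (intro mult_right_mono) auto
  qed (use \<rho> D1 in auto)
  have x3: "?x \<le> 1 / (real N + 1)"
  proof -
    have "1 * (real N + 1) \<le> real D * (8 * (real n + 1))" using N D1 by (intro mult_mono) auto
    then have "real N + 1 \<le> 8 * (real n + 1) * real D" by (simp add: mult.commute)
    then show ?thesis using \<rho> D1 by (intro frac_le) auto
  qed
  have "z ^ (q + 3) = z * z ^ Suc q * z" for z :: real by (simp add: power_add power3_eq_cube)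
  then have "?x ^ (q + 3) = ?x * ?x ^ Suc q * ?x" .
  also have "\<dots> \<le> \<rho> / 8 * (\<rho> / (2 * (real N + 1) * real D)) ^ Suc q * (1 / (real N + 1))"
    using x0 x1 x2 x3 \<rho> D1 by (intro mult_mono power_mono mult_nonneg_nonneg zero_le_power) auto
  finally show ?thesis by (simp add: stage_loss_def)
qed

text \<open>The number \<open>k\<close> of steps is at most \<open>km\<close>, which does not depend
  on \<open>n\<close>. So the left side of \<open>walk_inequality\<close> is at least a fixed power
  of \<open>\<rho> / w\<close> with \<open>w\<close> linear in \<open>n\<close>, up to a constant,
  whereas the right side decays exponentially in \<open>n\<close>.\<close>

theorem no_twist_config:
  fixes \<alpha> \<epsilon>1 \<sigma>0 \<eta>1 :: real and D :: nat
  assumes \<alpha>: "0 < \<alpha>" and \<epsilon>1: "0 < \<epsilon>1" "\<alpha> + \<epsilon>1 \<le> 1" and \<sigma>0: "0 < \<sigma>0" and \<eta>1: "0 < \<eta>1" and D: "D > 1"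
  shows "\<exists>l::real. \<exists>n0::nat. l > 0 \<and> (\<forall>n A B C a a' nb nc nn M S H \<rho> \<sigma> \<tau>. n0 \<le> n \<and> 2 powr (- l * real n) \<le> \<rho> \<longrightarrow>
     \<not> twist_config \<alpha> \<epsilon>1 \<sigma>0 \<eta>1 D n A B C a a' nb nc nn M S H \<rho> \<sigma> \<tau>)"
proof -
  define \<zeta> where "\<zeta> = \<epsilon>1 / 2"
  have \<zeta>: "\<zeta> > 0" using \<epsilon>1 by (simp add: \<zeta>_def)
  from approximate_mann[OF \<zeta> \<sigma>0] obtain P n1 :: nat and \<epsilon> :: real where P: "P > 0" and \<epsilon>: "\<epsilon> > 0"
    and mann: "\<forall>n::nat. n1 \<le> n \<longrightarrow> (\<forall>A B E \<sigma> \<tau>.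
      A \<subseteq> {..<n} \<and> B \<subseteq> {..<n} \<and> E \<subseteq> {..<n} \<and> \<sigma>0 \<le> \<sigma> \<and> \<sigma>0 \<le> \<tau> \<and>
      (\<forall>t\<le>n. \<sigma> * t - \<epsilon> * n \<le> card (A \<inter> {..<t})) \<and>
      (\<forall>t\<le>n. \<tau> * t - \<epsilon> * n \<le> card (B \<inter> {..<t})) \<and>
      (\<forall>b\<in>B. card {x. x < n \<and> x \<notin> E \<and> (\<exists>a\<in>A. a + b \<le> x \<and> x < a + b + 2 * P)} \<le> \<epsilon> * n) \<longrightarrow>
      (min 1 (\<sigma> + \<tau>) - \<zeta>) * n \<le> card E)"
    by (elim exE conjE) blast
  define r0 where "r0 = nat \<lceil>1 / \<epsilon>\<rceil> + 1"
  have r0: "1 < r0 * \<epsilon>" "r0 > 0"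
  proof -
    have "1 / \<epsilon> < r0" unfolding r0_def by linarith
    then show "1 < r0 * \<epsilon>" using \<epsilon> by (simp add: pos_divide_less_eq)
  qed (simp add: r0_def)
  \<comment> \<open>Three rates above \<alpha>: the scales have density \<open>x\<close>, the gain
    per scale is \<open>D powr x'\<close>, and \<open>x' - \<alpha> = \<epsilon>1 / 4\<close> is the
    final excess. With \<open>h = 8 / \<epsilon>1\<close> the loss from \<open>x\<close> to
    \<open>x * (h / (h + 1))\<close> is below \<open>\<epsilon>1 / 4\<close>.\<close>
  define h x x' where "h = 8 / \<epsilon>1" and "x = \<alpha> + \<epsilon>1 / 2" and "x' = \<alpha> + \<epsilon>1 / 4"
  have h: "h > 0" using \<epsilon>1 by (simp add: h_def)
  have x0: "0 < x'" "0 < x" using \<alpha> \<epsilon>1 by (auto simp: x_def x'_def)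
  have xx': "x' < x * (h / (h + 1))"
  proof -
    have "x / (h + 1) \<le> 1 / (h + 1)" using \<epsilon>1 h by (intro divide_right_mono) (auto simp: x_def)
    also have "\<dots> < 1 / h" using h by (intro divide_strict_left_mono) auto
    also have "\<dots> = \<epsilon>1 / 8" by (simp add: h_def)
    also have "\<epsilon>1 / 8 < \<epsilon>1 / 4" using \<epsilon>1(1) by simp
    finally have "x / (h + 1) < \<epsilon>1 / 4" .
    then have "x - \<epsilon>1 / 4 < x - x / (h + 1)" by (rule diff_strict_left_mono)
    moreover have "x * (h / (h + 1)) = x - x / (h + 1)" using h by (simp add: field_simps)
    moreover have "x' = x - \<epsilon>1 / 4" by (simp add: x_def x'_def)
    ultimately show ?thesis by (simp only:)
  qed
  from parameter_choice[OF D h r0(2) x0 xx', of P] obtain v g :: nat and s y :: real where v: "v > 0" and g0: "g > 0" and s: "s \<ge> 0" and y: "y > 0"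
    and g: "2 * (1 + h) * sqrt (r0 * (2 * v + 1)) * real D ^ 3 \<le> real D ^ g"
    and K: "12 * exp s / sqrt (2 * real v + 1) + 6 * exp (- h * s) \<le> exp (- y)" and xy: "x' * (real (g + 2 * P) * ln D) \<le> x * y"
    by (elim exE conjE) blast
  define L where "L = ln (real D)"
  have L0: "L > 0" using D by (simp add: L_def)
  have DL: "real D ^ i = exp (i * L)" for i using D by (simp add: L_def exp_of_nat_mult)
  define km where "km = r0 * (2 * v + 1)"
  have km: "km \<ge> 1" using r0 by (simp add: km_def)
  \<comment> \<open>Each of the \<open>r0\<close> stages costs the power \<open>2 * v + 3\<close> by
    \<open>stage_loss_ge\<close>, and the density of \<open>H\<close> itself one more.\<close>
  define Ex where "Ex = (2 * v + 3) * r0 + 1"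
  define c where "c = \<epsilon>1 / 8 * \<eta>1 * L"
  have c0: "c > 0" using \<epsilon>1 \<eta>1 L0 by (simp add: c_def)
  define Ek where "Ek = Ex * km"
  have Ek: "Ek \<ge> 1" using km by (simp add: Ek_def Ex_def)
  \<comment> \<open>The first bound makes more than \<open>\<epsilon> * nn\<close> levels enough for
    \<open>many_zigzags\<close>, the second keeps \<open>\<rho> ^ Ek\<close> above
    \<open>exp (- c * n)\<close>, half of the available exponent.\<close>
  define l where "l = min (\<epsilon> * \<eta>1 / 4) (c / (ln 2 * Ek))"
  have l0: "l > 0" using \<epsilon> \<eta>1 c0 Ek by (simp add: l_def)
  define Q1 where "Q1 = 3 * real km * exp (L + 3 * real km + y)"
  define Q where "Q = Q1 * (2 * (real km + 1)) ^ km"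
  have Q1: "Q1 > 0" using km by (simp add: Q1_def)
  have Q: "Q > 0" using Q1 by (simp add: Q_def)
  obtain n2 where n2: "\<And>n. n \<ge> n2 \<Longrightarrow> Q * (8 * real D * (real n + 1)) ^ Ek < exp (c * n)"
    using polynomial_below_exp[OF c0 _ Q, of "8 * real D" Ek] by auto
  define n0 where "n0 = max (max n2 (nat \<lceil>8 / (\<epsilon> * \<eta>1)\<rceil>)) (nat \<lceil>(real n1 + 1) / \<eta>1\<rceil>)"
  have False if n: "n0 \<le> n" and \<rho>l: "2 powr (- l * real n) \<le> \<rho>"
    and tc: "twist_config \<alpha> \<epsilon>1 \<sigma>0 \<eta>1 D n A B C a a' nb nc nn M S H \<rho> \<sigma> \<tau>"
    for n A B C a a' nb nc nn M S H \<rho> \<sigma> \<tau>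
  proof -
    interpret twist_config \<alpha> \<epsilon>1 \<sigma>0 \<eta>1 D n A B C a a' nb nc nn M S H \<rho> \<sigma> \<tau> by (rule tc)
    have nge: "n \<ge> n2" "8 / (\<epsilon> * \<eta>1) \<le> n" "(real n1 + 1) / \<eta>1 \<le> n" using n unfolding n0_def by linarith+
    have "real n1 + 1 \<le> \<eta>1 * n" using nge(3) \<eta>1 by (simp add: pos_divide_le_eq mult.commute)
    then have "real n1 + 1 \<le> nn" using heights(5) by linarith
    then have nn: "n1 \<le> nn" "nn > 0" by linarith+
    have big: "(4 / \<rho>)^2 \<le> 2 ^ z" if z: "\<epsilon> * nn < real z" for z :: nat
    proof -
      have "4 / \<rho> \<le> 4 / 2 powr (- l * real n)" using \<rho>l \<rho>(1) by (intro divide_left_mono) auto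
      also have "\<dots> = 2 powr 2 * 2 powr (l * n)" by (simp add: powr_minus field_simps)
      also have "\<dots> = 2 powr (2 + l * n)" by (rule powr_add[symmetric])
      finally have "(4 / \<rho>)^2 \<le> (2 powr (2 + l * n))^2" using \<rho>(1) by (intro power_mono) auto
      also have "\<dots> = 2 powr (2 * (2 + l * n))" by (simp add: powr_power mult.commute)
      also have "\<dots> \<le> 2 powr z"
      proof (rule powr_mono)
        have "l \<le> \<epsilon> * \<eta>1 / 4" unfolding l_def by (rule min.cobounded1)
        then have "l * n \<le> \<epsilon> * \<eta>1 / 4 * n" by (intro mult_right_mono) simp_all
        moreover have "8 \<le> \<epsilon> * \<eta>1 * n" using nge(2) \<epsilon> \<eta>1 by (simp add: pos_divide_le_eq mult.commute)
        moreover have "\<epsilon> * (\<eta>1 * n) \<le> \<epsilon> * nn" using heights(5) \<epsilon> by simp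
        ultimately show "2 * (2 + l * n) \<le> z" using z by (simp add: algebra_simps)
      qed simp
      also have "\<dots> = 2 ^ z" by (simp add: powr_realpow)
      finally show ?thesis .
    qed
    have \<zeta>a: "\<zeta> < \<alpha> + \<epsilon>1" using \<alpha> \<epsilon>1 by (simp add: \<zeta>_def)
    have "\<exists>k N::nat. 0 < k \<and> k \<le> r0 * (2 * v + 1) \<and> (\<alpha> + \<epsilon>1 - \<zeta>) * nn \<le> (N + 1) * (g + 2 * P) \<and>
        (stage_loss \<rho> nc D (2 * v) ^ r0 * \<rho> / (2 * (real k + 1))) ^ k \<le> (3 * k * real D ^ (nn + 1)) powr \<alpha> * (exp (3 * k) * exp (- y) ^ N)"
      by (rule walk_inequality[OF mp[OF spec[OF mann, of nn] nn(1)] \<epsilon> r0(1) big v h s g g0 K nn(2) D \<alpha> \<epsilon>1(2) \<zeta>a])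
    then obtain k N :: nat where k: "0 < k" "k \<le> km" and N: "(\<alpha> + \<epsilon>1 - \<zeta>) * nn \<le> (N + 1) * (g + 2 * P)"
      and ineq: "(stage_loss \<rho> nc D (2 * v) ^ r0 * \<rho> / (2 * (real k + 1))) ^ k \<le> (3 * k * real D ^ (nn + 1)) powr \<alpha> * (exp (3 * k) * exp (- y) ^ N)"
      unfolding km_def by (elim exE conjE) simp_all
    \<comment> \<open>The additional \<open>y\<close> compensates for having one gain fewer than
      checkpoints.\<close>
    have "exp (- y) ^ N \<le> exp (y - x' * L * nn)"
    proof -
      have "x = \<alpha> + \<epsilon>1 - \<zeta>" by (simp add: x_def \<zeta>_def)
      then have "x * nn \<le> real (N + 1) * real (g + 2 * P)" using N by (simp only: of_nat_mult)
      then have "(x' * L) * (x * nn) \<le> (x' * L) * (real (N + 1) * real (g + 2 * P))" using x0 L0 by (intro mult_left_mono) auto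
      also have "\<dots> = real (N + 1) * (x' * (real (g + 2 * P) * ln D))" by (simp add: L_def mult_ac)
      also have "\<dots> \<le> real (N + 1) * (x * y)" using xy by (intro mult_left_mono) auto
      finally have "x * (x' * L * nn) \<le> x * (real (N + 1) * y)" by (simp add: mult_ac)
      then have "x' * L * nn \<le> real (N + 1) * y" using x0 by simp
      then have "real N * (- y) \<le> y - x' * L * nn" by (simp add: algebra_simps)
      then show ?thesis by (simp add: exp_of_nat_mult[symmetric])
    qed
    moreover have "(3 * k * real D ^ (nn + 1)) powr \<alpha> \<le> 3 * real km * exp (L + \<alpha> * L * nn)"
    proof -
      have "(3 * k * real D ^ (nn + 1)) powr \<alpha> = (3 * real k) powr \<alpha> * (real D ^ (nn + 1)) powr \<alpha>" by (simp add: powr_mult)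
      also have "(real D ^ (nn + 1)) powr \<alpha> = exp (\<alpha> * L * (real nn + 1))"
        unfolding DL by (simp add: powr_def algebra_simps)
      also have "(3 * real k) powr \<alpha> \<le> (3 * real k) powr 1" using k \<alpha> \<epsilon>1 by (intro powr_mono) auto
      also have "(3 * real k) powr 1 = 3 * real k" by simp
      finally have "(3 * k * real D ^ (nn + 1)) powr \<alpha> \<le> (3 * real k) * exp (\<alpha> * L * (real nn + 1))" by simp
      also have "\<dots> \<le> (3 * real km) * exp (L + \<alpha> * L * nn)"
      proof (intro mult_mono)
        have "\<alpha> * L \<le> 1 * L" using \<alpha> \<epsilon>1 L0 by (intro mult_right_mono) auto
        then show "exp (\<alpha> * L * (real nn + 1)) \<le> exp (L + \<alpha> * L * nn)" by (simp add: algebra_simps)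
      qed (use k in auto)
      finally show ?thesis .
    qed
    moreover have "exp (3 * real k) \<le> exp (3 * real km)" using k by simp
    ultimately have "(3 * k * real D ^ (nn + 1)) powr \<alpha> * (exp (3 * k) * exp (- y) ^ N) \<le>
        3 * real km * exp (L + \<alpha> * L * nn) * (exp (3 * real km) * exp (y - x' * L * nn))"
      by (intro mult_mono) auto
    also have "\<dots> = Q1 * exp (- (\<epsilon>1 / 4 * L * nn))"
      by (simp add: Q1_def x'_def exp_add[symmetric] mult.assoc) (simp add: algebra_simps)
    also have "\<dots> \<le> Q1 * exp (- (2 * c * n))"
    proof -
      have "2 * c * n = \<epsilon>1 / 4 * L * (\<eta>1 * n)" by (simp add: c_def)
      also have "\<dots> \<le> \<epsilon>1 / 4 * L * nn" using heights(5) \<epsilon>1 L0 by (intro mult_left_mono) auto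
      finally show ?thesis using Q1 by simp
    qed
    finally have up: "(stage_loss \<rho> nc D (2 * v) ^ r0 * \<rho> / (2 * (real k + 1))) ^ k \<le> Q1 * exp (- (2 * c * n))"
      using ineq by linarith
    define w where "w = 8 * real D * (real n + 1)"
    have w0: "w > 0" using D by (simp add: w_def)
    define z where "z = \<rho> / w"
    have z: "0 < z" "z \<le> 1"
    proof -
      show "0 < z" using \<rho> w0 by (simp add: z_def)
      have "1 * 1 \<le> (8 * real D) * (real n + 1)" using D by (intro mult_mono) auto
      then show "z \<le> 1" using \<rho> w0 by (simp add: z_def w_def divide_le_eq_1)
    qed
    have "z ^ Ek / (2 * (real km + 1)) ^ km = (z ^ Ex / (2 * (real km + 1))) ^ km"
      by (simp add: Ek_def power_mult power_divide)
    also have "\<dots> \<le> (z ^ Ex / (2 * (real km + 1))) ^ k"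
    proof (rule power_decreasing[OF k(2)])
      have "z ^ Ex \<le> 1" using z by (intro power_le_one) auto
      then show "z ^ Ex / (2 * (real km + 1)) \<le> 1" by (simp add: divide_le_eq_1)
    qed (use z in simp)
    also have "\<dots> \<le> (stage_loss \<rho> nc D (2 * v) ^ r0 * \<rho> / (2 * (real k + 1))) ^ k"
    proof (rule power_mono)
      have "z ^ (2 * v + 3) \<le> stage_loss \<rho> nc D (2 * v)"
        using stage_loss_ge[OF \<rho> heights(2), of D "2 * v"] D by (simp add: z_def w_def mult_ac)
      then have "(z ^ (2 * v + 3)) ^ r0 \<le> stage_loss \<rho> nc D (2 * v) ^ r0" using z by (intro power_mono) auto
      moreover have "z \<le> \<rho>"
      proof -
        have "1 * 1 \<le> (8 * real D) * (real n + 1)" using D by (intro mult_mono) auto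
        then have "\<rho> / w \<le> \<rho> / 1" using \<rho> w0 by (intro divide_left_mono) (auto simp: w_def)
        then show ?thesis by (simp add: z_def)
      qed
      moreover have sl0: "0 \<le> stage_loss \<rho> nc D (2 * v)" using \<rho> by (simp add: stage_loss_def)
      ultimately have "(z ^ (2 * v + 3)) ^ r0 * z \<le> stage_loss \<rho> nc D (2 * v) ^ r0 * \<rho>"
        using z by (intro mult_mono) auto
      moreover have "z ^ Ex = (z ^ (2 * v + 3)) ^ r0 * z" by (simp only: Ex_def power_add power_mult power_one_right)
      ultimately show "z ^ Ex / (2 * (real km + 1)) \<le> stage_loss \<rho> nc D (2 * v) ^ r0 * \<rho> / (2 * (real k + 1))"
        using k z \<rho> sl0 by (intro frac_le) auto
    qed (use z in simp)
    finally have "z ^ Ek / (2 * (real km + 1)) ^ km \<le> Q1 * exp (- (2 * c * n))" using up by linarith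
    then have zQ: "z ^ Ek \<le> Q * exp (- (2 * c * n))" by (simp add: Q_def pos_divide_le_eq mult_ac)
    have zw: "exp (- (c * n)) \<le> z ^ Ek * w ^ Ek"
    proof -
      have "l * ln 2 * Ek \<le> c"
      proof -
        have "l \<le> c / (ln 2 * Ek)" unfolding l_def by (rule min.cobounded2)
        then show ?thesis using Ek by (simp add: pos_le_divide_eq mult.assoc)
      qed
      then have "l * ln 2 * Ek * n \<le> c * n" by (intro mult_right_mono) auto
      then have "exp (- (c * n)) \<le> exp (Ek * (- l * real n * ln 2))" by (simp add: algebra_simps)
      also have "\<dots> = (2 powr (- l * real n)) ^ Ek" by (simp only: powr_def exp_of_nat_mult) simp
      also have "\<dots> \<le> \<rho> ^ Ek" using \<rho>l by (intro power_mono) auto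
      also have "\<dots> = z ^ Ek * w ^ Ek" using w0 by (simp add: z_def power_divide)
      finally show ?thesis .
    qed
    have "exp (c * n) = exp (- (c * n)) * exp (2 * c * n)" by (simp add: exp_add[symmetric])
    also have "\<dots> \<le> (z ^ Ek * w ^ Ek) * exp (2 * c * n)" using zw by (intro mult_right_mono) auto
    also have "\<dots> \<le> ((Q * exp (- (2 * c * n))) * w ^ Ek) * exp (2 * c * n)"
      using zQ w0 by (intro mult_right_mono) auto
    also have "\<dots> = Q * w ^ Ek * (exp (- (2 * c * n)) * exp (2 * c * n))" by (simp only: mult_ac)
    also have "exp (- (2 * c * n)) * exp (2 * c * n) = 1" by (simp add: exp_add[symmetric])
    finally have "exp (c * n) \<le> Q * w ^ Ek" by simp
    then show False using n2[OF nge(1)] by (simp add: w_def)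
  qed
  then show ?thesis using l0 by (intro exI[of _ l] exI[of _ n0]) blast
qed

section \<open>From dense graphs to dense sets of twists\<close>

definition cell_values :: "nat \<Rightarrow> nat \<Rightarrow> (int \<times> nat) set \<Rightarrow> int set" where
  "cell_values M c G = (\<lambda>g. fst g + int (c * snd g div M)) ` G"

text \<open>Pairs of edges with the same cell value. The first component of one edge is determined
  by the rest, so a triple suffices, and it has the same format for every \<open>c\<close>; this
  makes different \<open>c\<close> comparable.\<close>

definition twists :: "nat \<Rightarrow> nat \<Rightarrow> (int \<times> nat) set \<Rightarrow> (int \<times> nat \<times> nat) set" where
  "twists M c G = {(a', b, b') |a' b b'. (a', b') \<in> G \<and> (twist M c (a', b, b'), b) \<in> G}"

lemma twists_energy:
  assumes fin: "finite A" "finite B" and G: "G \<subseteq> A \<times> B"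
  shows "(real (card G))\<^sup>2 \<le> card (cell_values M c G) * card (twists M c G)"
    "twists M c G \<subseteq> A \<times> B \<times> B" "\<And>x. x \<in> twists M c G \<Longrightarrow> twist M c x \<in> A"
proof -
  show sub: "twists M c G \<subseteq> A \<times> B \<times> B" using G by (auto simp: twists_def)
  show "twist M c x \<in> A" if "x \<in> twists M c G" for x using that G by (auto simp: twists_def)
  have finG: "finite G" using G fin finite_subset by blast
  have finT: "finite (twists M c G)" using sub fin finite_subset by blast
  define f where "f g = fst g + int (c * snd g div M)" for g :: "int \<times> nat"
  define U where "U = f ` G"
  have U: "cell_values M c G = U" by (simp add: cell_values_def U_def f_def)
  have finU: "finite U" using finG by (simp add: U_def)
  let ?n = "\<lambda>u. real (card {g\<in>G. f g = u})"
  have "card G = (\<Sum>u\<in>U. card {g\<in>G. f g = u})"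
    using sum.image_gen[OF finG, of "\<lambda>_. 1::nat" f] finG by (simp add: U_def)
  then have cG: "real (card G) = (\<Sum>u\<in>U. ?n u)" by simp
  have "(\<Sum>u\<in>U. ?n u)\<^sup>2 \<le> card U * (\<Sum>u\<in>U. (?n u)\<^sup>2)"
    using sum_squared_le_sum_of_squares[of ?n U] by (simp add: mult.commute)
  moreover have "(\<Sum>u\<in>U. (?n u)\<^sup>2) \<le> card (twists M c G)"
  proof -
    let ?S = "SIGMA u:U. {g\<in>G. f g = u} \<times> {g\<in>G. f g = u}"
    have "(\<Sum>u\<in>U. (?n u)\<^sup>2) = real (\<Sum>u\<in>U. card ({g\<in>G. f g = u} \<times> {g\<in>G. f g = u}))"
      by (simp add: card_cartesian_product power2_eq_square)
    also have "(\<Sum>u\<in>U. card ({g\<in>G. f g = u} \<times> {g\<in>G. f g = u})) = card ?S"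
      using finU finG by (intro card_SigmaI[symmetric]) auto
    also have "card ?S \<le> card (twists M c G)"
    proof (rule card_inj_on_le[OF _ _ finT])
      show "inj_on (\<lambda>(u, g, g'). (fst g', snd g, snd g')) ?S"
        by (rule inj_onI) (auto simp: f_def)
      show "(\<lambda>(u, g, g'). (fst g', snd g, snd g')) ` ?S \<subseteq> twists M c G"
      proof
        fix x assume "x \<in> (\<lambda>(u, g, g'). (fst g', snd g, snd g')) ` ?S"
        then obtain g g' where g: "g \<in> G" "g' \<in> G" "f g = f g'" and x: "x = (fst g', snd g, snd g')" by auto
        have "twist M c x = fst g" using g(3) by (simp add: x twist_def f_def)
        then show "x \<in> twists M c G" using g(1,2) by (auto simp: twists_def x)
      qed
    qed
    finally show ?thesis by simp
  qed
  then have "card U * (\<Sum>u\<in>U. (?n u)\<^sup>2) \<le> card U * real (card (twists M c G))" by (intro mult_left_mono) auto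
  ultimately show "(real (card G))\<^sup>2 \<le> card (cell_values M c G) * card (twists M c G)" unfolding U cG by simp
qed

lemma dense_points:
  fixes f :: "'a \<Rightarrow> real" and F p :: real
  assumes fin: "finite S" and F: "F > 0" and le: "\<And>s. s \<in> S \<Longrightarrow> f s \<le> F" and p: "p > 0"
    and sum: "p * F * card S \<le> (\<Sum>s\<in>S. f s)"
  shows "p / 2 * card S \<le> card {s\<in>S. p / 2 * F \<le> f s}"
proof -
  let ?T = "{s\<in>S. p / 2 * F \<le> f s}"
  have "(\<Sum>s\<in>S. f s) = (\<Sum>s\<in>?T. f s) + (\<Sum>s\<in>S - ?T. f s)" using sum.subset_diff[of ?T S f] fin by simp
  also have "(\<Sum>s\<in>?T. f s) \<le> (\<Sum>s\<in>?T. F)" using le by (intro sum_mono) auto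
  also have "(\<Sum>s\<in>S - ?T. f s) \<le> (\<Sum>s\<in>S - ?T. p / 2 * F)" by (intro sum_mono) auto
  also have "(\<Sum>s\<in>S - ?T. p / 2 * F) \<le> card S * (p / 2 * F)"
    using fin p F by (auto intro!: mult_right_mono card_mono)
  finally have "p * F * card S \<le> F * card ?T + card S * (p / 2 * F)" using sum by (simp add: mult.commute)
  then have "F * (p / 2 * card S) \<le> F * card ?T" by (simp add: algebra_simps)
  then show ?thesis using F by simp
qed

lemma exists_dense_node:
  fixes f :: "nat \<Rightarrow> real" and q :: real
  assumes fin: "finite X" "X \<noteq> {}" and q: "q * card X \<le> (\<Sum>x\<in>X. f x)"
  shows "\<exists>x\<in>X. q * card (node D X e x) \<le> (\<Sum>y\<in>node D X e x. f y)"
proof -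
  have "q * card X \<le> (\<Sum>x\<in>X. fibre_avg X (\<lambda>b. b div D ^ e) f x)"
    unfolding sum_fibre_avg[OF fin(1)] by (rule q)
  then obtain x where x: "x \<in> X" "q \<le> fibre_avg X (\<lambda>b. b div D ^ e) f x" using exists_ge_average[OF fin] by blast
  have "card (node D X e x) > 0"
    using node_refl[OF x(1), of D e] finite_subset[OF node_subset fin(1)] by (simp add: card_gt_0_iff) blast
  then have "q * card (node D X e x) \<le> (\<Sum>y\<in>node D X e x. f y)"
    using x(2) unfolding fibre_avg_def fibre_node by (simp add: pos_le_divide_eq)
  then show ?thesis using x(1) by blast
qed

text \<open>Before each set is made uniform, it is restricted to its rich elements. Then every
  subset keeps the density, so the uniform one does too, although nothing is known about which
  subset it is.\<close>

lemma dense_uniform_pair: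
  fixes w :: "nat \<Rightarrow> nat \<Rightarrow> real" and a0 p :: real
  assumes fin: "finite B" "finite C" and ne: "B \<noteq> {}" "C \<noteq> {}" and D: "D = 2 ^ W" and p: "p > 0" and a0: "a0 > 0"
    and w: "\<And>b c. b \<in> B \<Longrightarrow> c \<in> C \<Longrightarrow> w b c \<le> a0"
    and sum: "p * (a0 * card B * card C) \<le> (\<Sum>b\<in>B. \<Sum>c\<in>C. w b c)"
  shows "\<exists>B1 C1 a a'. B1 \<subseteq> B \<and> B1 \<noteq> {} \<and> C1 \<subseteq> C \<and> C1 \<noteq> {} \<and> uniform_below D B1 a n \<and> uniform_below D C1 a' n \<and>
     p / 2 * card B \<le> (4 * (real W + 1)) ^ n * card B1 \<and> p / 4 * card C \<le> (4 * (real W + 1)) ^ n * card C1 \<and>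
     p / 4 * (a0 * card B1 * card C1) \<le> (\<Sum>b\<in>B1. \<Sum>c\<in>C1. w b c)"
proof -
  have cB: "card B > 0" and cC: "card C > 0" using fin ne by (auto simp: card_gt_0_iff)
  define B0 where "B0 = {b\<in>B. p / 2 * (a0 * card C) \<le> (\<Sum>c\<in>C. w b c)}"
  have bd: "(\<Sum>c\<in>X. w b c) \<le> a0 * card X" if "b \<in> B" "X \<subseteq> C" for b X
    using sum_bounded_above[of X "w b" a0] w that by (auto simp: mult.commute)
  have bd2: "(\<Sum>b\<in>X. w b c) \<le> a0 * card X" if "c \<in> C" "X \<subseteq> B" for c X
    using sum_bounded_above[of X "\<lambda>b. w b c" a0] w that by (auto simp: mult.commute)
  have B0: "p / 2 * card B \<le> card B0"
    unfolding B0_def using a0 cC p sum bd by (intro dense_points[OF fin(1)]) (auto simp: mult_ac)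
  have "p / 2 * card B > 0" using p cB by simp
  then have "card B0 > 0" using B0 by linarith
  then have B0ne: "B0 \<noteq> {}" by auto
  have finB0: "finite B0" using fin by (simp add: B0_def)
  from uniform_subset[OF finB0 B0ne D, of n] obtain B1 a where B1: "B1 \<subseteq> B0" "B1 \<noteq> {}" "uniform_below D B1 a n"
    "card B0 \<le> (4 * (W + 1)) ^ n * card B1" by (elim exE conjE)
  have B1B: "B1 \<subseteq> B" using B1(1) by (auto simp: B0_def)
  have finB1: "finite B1" using B1B fin finite_subset by blast
  have cB1: "card B1 > 0" using finB1 B1(2) by (simp add: card_gt_0_iff)
  have conv: "real x \<le> (4 * (real W + 1)) ^ n * real y" if "x \<le> (4 * (W + 1)) ^ n * y" for x y :: nat
  proof -
    have "real x \<le> real ((4 * (W + 1)) ^ n * y)" using that by (simp only: of_nat_le_iff)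
    then show ?thesis by (simp add: add.commute)
  qed
  have lB: "p / 2 * card B \<le> (4 * (real W + 1)) ^ n * card B1" using B0 conv[OF B1(4)] by linarith
  have "p / 2 * (a0 * card C) * card B1 \<le> (\<Sum>b\<in>B1. \<Sum>c\<in>C. w b c)"
    using sum_bounded_below[of B1 "p / 2 * (a0 * card C)" "\<lambda>b. \<Sum>c\<in>C. w b c"] B1(1) by (auto simp: B0_def mult.commute)
  also have "\<dots> = (\<Sum>c\<in>C. \<Sum>b\<in>B1. w b c)" by (rule sum.swap)
  finally have s1: "p / 2 * (a0 * card B1) * card C \<le> (\<Sum>c\<in>C. \<Sum>b\<in>B1. w b c)" by (simp add: mult_ac)
  define C0 where "C0 = {c\<in>C. p / 2 / 2 * (a0 * card B1) \<le> (\<Sum>b\<in>B1. w b c)}"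
  have C0: "p / 2 / 2 * card C \<le> card C0"
    unfolding C0_def using a0 cB1 p s1 bd2[OF _ B1B] by (intro dense_points[OF fin(2)]) auto
  have "p / 2 / 2 * card C > 0" using p cC by simp
  then have "card C0 > 0" using C0 by linarith
  then have C0ne: "C0 \<noteq> {}" by auto
  have finC0: "finite C0" using fin by (simp add: C0_def)
  from uniform_subset[OF finC0 C0ne D, of n] obtain C1 a' where C1: "C1 \<subseteq> C0" "C1 \<noteq> {}" "uniform_below D C1 a' n"
    "card C0 \<le> (4 * (W + 1)) ^ n * card C1" by (elim exE conjE)
  have C1C: "C1 \<subseteq> C" using C1(1) by (auto simp: C0_def)
  have lC: "p / 4 * card C \<le> (4 * (real W + 1)) ^ n * card C1" using C0 conv[OF C1(4)] by simp
  have "p / 2 / 2 * (a0 * card B1) * card C1 \<le> (\<Sum>c\<in>C1. \<Sum>b\<in>B1. w b c)"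
    using sum_bounded_below[of C1 "p / 2 / 2 * (a0 * card B1)" "\<lambda>c. \<Sum>b\<in>B1. w b c"] C1(1) by (auto simp: C0_def mult.commute)
  also have "\<dots> = (\<Sum>b\<in>B1. \<Sum>c\<in>C1. w b c)" by (rule sum.swap)
  finally have "p / 4 * (a0 * card B1 * card C1) \<le> (\<Sum>b\<in>B1. \<Sum>c\<in>C1. w b c)" by (simp add: mult_ac)
  then show ?thesis using B1B B1(2,3) C1C C1(2,3) lB lC by blast
qed

lemma localize_pair:
  fixes w :: "nat \<Rightarrow> nat \<Rightarrow> real" and q :: real
  assumes fin: "finite B" "finite C" and ne: "B \<noteq> {}" "C \<noteq> {}"
    and sum: "q * (card B * card C) \<le> (\<Sum>b\<in>B. \<Sum>c\<in>C. w b c)"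
  shows "\<exists>x\<in>B. \<exists>y\<in>C. q * (card (node D B i x) * card (node D C j y)) \<le> (\<Sum>b\<in>node D B i x. \<Sum>c\<in>node D C j y. w b c)"
proof -
  have "(q * card C) * card B \<le> (\<Sum>b\<in>B. \<Sum>c\<in>C. w b c)" using sum by (simp add: mult_ac)
  from exists_dense_node[OF fin(1) ne(1) this, of D i] obtain x where x: "x \<in> B"
    "(q * card C) * card (node D B i x) \<le> (\<Sum>b\<in>node D B i x. \<Sum>c\<in>C. w b c)" by blast
  have "(q * card (node D B i x)) * card C \<le> (\<Sum>c\<in>C. \<Sum>b\<in>node D B i x. w b c)"
    using x(2) by (subst sum.swap) (simp add: mult_ac)
  from exists_dense_node[OF fin(2) ne(2) this, of D j] obtain y where y: "y \<in> C"
    "(q * card (node D B i x)) * card (node D C j y) \<le> (\<Sum>c\<in>node D C j y. \<Sum>b\<in>node D B i x. w b c)" by blast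
  have "q * (card (node D B i x) * card (node D C j y)) \<le> (\<Sum>b\<in>node D B i x. \<Sum>c\<in>node D C j y. w b c)"
    using y(2) by (subst sum.swap) (simp add: mult_ac)
  then show ?thesis using x(1) y(1) by blast
qed

text \<open>Cauchy--Schwarz is used twice: over the cells of each \<open>G c\<close>, which costs
  \<open>p\<close>, and over \<open>c\<close>, which squares \<open>q\<close>. A triple is kept if
  it is a twist for at least half of the average number of \<open>c\<close>.\<close>

lemma dense_twists:
  fixes p q :: real and G :: "nat \<Rightarrow> (int \<times> nat) set"
  assumes fin: "finite A" "finite B" "finite C" and ne: "A \<noteq> {}" "B \<noteq> {}" "C \<noteq> {}" and p: "p > 0" and q: "q > 0"
    and G: "\<And>c. c \<in> C \<Longrightarrow> G c \<subseteq> A \<times> B" and sm: "\<And>c. c \<in> C \<Longrightarrow> p * card (cell_values M c (G c)) \<le> card A"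
    and sum: "q * (card A * card B * card C) \<le> (\<Sum>c\<in>C. real (card (G c)))"
  shows "\<exists>H S. H \<noteq> {} \<and> H \<subseteq> A \<times> B \<times> B \<and> p * q\<^sup>2 / 2 * (card A * (card B)\<^sup>2) \<le> card H \<and>
     (\<forall>x\<in>H. S x \<subseteq> C \<and> p * q\<^sup>2 / 2 * card C \<le> card (S x) \<and> (\<forall>c\<in>S x. twist M c x \<in> A))"
proof -
  have cA: "card A > 0" and cB: "card B > 0" and cC: "card C > 0" using fin ne by (auto simp: card_gt_0_iff)
  define X where "X = A \<times> B \<times> B"
  have finX: "finite X" using fin by (simp add: X_def)
  have cX: "card X = card A * (card B)\<^sup>2" by (simp add: X_def card_cartesian_product power2_eq_square)
  define S where "S x = {c\<in>C. x \<in> twists M c (G c)}" for x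
  have tX: "twists M c (G c) \<subseteq> X" if "c \<in> C" for c unfolding X_def by (rule twists_energy(2)[OF fin(1,2) G[OF that]])
  have one: "p / card A * (real (card (G c)))\<^sup>2 \<le> card (twists M c (G c))" if c: "c \<in> C" for c
  proof -
    have "p * (real (card (G c)))\<^sup>2 \<le> p * (card (cell_values M c (G c)) * card (twists M c (G c)))"
      using twists_energy(1)[OF fin(1,2) G[OF c], of M c] p by (intro mult_left_mono) auto
    also have "\<dots> = (p * card (cell_values M c (G c))) * card (twists M c (G c))" by simp
    also have "\<dots> \<le> card A * real (card (twists M c (G c)))" using sm[OF c] by (intro mult_right_mono) auto
    finally show ?thesis using cA by (simp add: field_simps)
  qed
  have "p * q\<^sup>2 * card C * card X = p / card A * ((q * (card A * card B * card C))\<^sup>2 / card C)"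
    using cA cC by (simp add: cX power2_eq_square)
  also have "\<dots> \<le> p / card A * ((\<Sum>c\<in>C. real (card (G c)))\<^sup>2 / card C)"
    using sum p q by (intro mult_left_mono divide_right_mono power_mono) auto
  also have "\<dots> \<le> p / card A * (\<Sum>c\<in>C. (real (card (G c)))\<^sup>2)"
  proof (intro mult_left_mono)
    show "(\<Sum>c\<in>C. real (card (G c)))\<^sup>2 / card C \<le> (\<Sum>c\<in>C. (real (card (G c)))\<^sup>2)"
      using sum_squared_le_sum_of_squares[of "\<lambda>c. real (card (G c))" C] cC by (simp add: pos_divide_le_eq)
  qed (use p in simp)
  also have "\<dots> \<le> (\<Sum>c\<in>C. real (card (twists M c (G c))))"
    unfolding sum_distrib_left using one by (intro sum_mono) auto
  also have "\<dots> = real (\<Sum>c\<in>C. card {x\<in>X. x \<in> twists M c (G c)})"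
  proof -
    have "{x\<in>X. x \<in> twists M c (G c)} = twists M c (G c)" if "c \<in> C" for c using tX[OF that] by blast
    then show ?thesis by simp
  qed
  also have "(\<Sum>c\<in>C. card {x\<in>X. x \<in> twists M c (G c)}) = (\<Sum>x\<in>X. card (S x))"
    unfolding S_def using sum_multicount_gen[OF fin(3) finX, of "\<lambda>c x. x \<in> twists M c (G c)" "\<lambda>x. card {c\<in>C. x \<in> twists M c (G c)}"] by simp
  finally have tot: "p * q\<^sup>2 * card C * card X \<le> (\<Sum>x\<in>X. real (card (S x)))" by simp
  define H where "H = {x\<in>X. p * q\<^sup>2 / 2 * card C \<le> card (S x)}"
  have "p * q\<^sup>2 / 2 * card X \<le> card H"
    unfolding H_def
  proof (rule dense_points[OF finX])
    show "real (card (S x)) \<le> card C" for x using fin by (auto simp: S_def intro!: card_mono)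
  qed (use cC p q tot in auto)
  moreover have "p * q\<^sup>2 / 2 * card X > 0" using p q cA cB by (simp add: cX)
  ultimately have cH: "p * q\<^sup>2 / 2 * (card A * (card B)\<^sup>2) \<le> card H" "H \<noteq> {}" by (auto simp: cX)
  have "twist M c x \<in> A" if "c \<in> S x" for c x
    by (rule twists_energy(3)[OF fin(1,2) G]) (use that in \<open>auto simp: S_def\<close>)
  then have "S x \<subseteq> C \<and> p * q\<^sup>2 / 2 * card C \<le> card (S x) \<and> (\<forall>c\<in>S x. twist M c x \<in> A)" if "x \<in> H" for x
    using that by (simp add: H_def) (auto simp: S_def)
  then show ?thesis using cH by (intro exI[of _ H] exI[of _ S]) (auto simp: H_def X_def)
qed

section \<open>Sizes, slopes and the integer form of the theorem\<close>

text \<open>Below the top height \<open>nb\<close> the exponents sum to more than \<open>s\<close>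
  per level, and one level contributes at most \<open>W\<close>. So at least a share
  \<open>s / W\<close> of the \<open>t\<close> levels next to the root is active, for every
  \<open>t\<close>.\<close>

lemma uniform_active_count:
  fixes a :: "nat \<Rightarrow> nat" and s :: real
  assumes fin: "finite X" "X \<noteq> {}" and u: "uniform_below D X a n" and D: "D = 2 ^ W" and W: "W > 0"
    and nb: "nb = top_height (\<lambda>i. \<Sum>j<i. real (a j)) n s" and t: "t \<le> nb"
  shows "s / W * t \<le> card {e. e < t \<and> a (nb - 1 - e) \<ge> 1}"
proof (cases "t = 0")
  case False
  let ?g = "\<lambda>i. \<Sum>j<i. real (a j)"
  have D0: "D > 0" using D by simp
  have nbn: "nb \<le> n" unfolding nb by (rule top_height(1))
  have aW: "a j \<le> W" if "j < n" for j
  proof -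
    obtain x where x: "x \<in> X" using fin by blast
    have "2 ^ a j = card (children D X j x)" using u that x by (simp add: uniform_below_def)
    also have "\<dots> \<le> 2 ^ W" using children_card_le[OF D0] D by simp
    finally show ?thesis by simp
  qed
  define i where "i = nb - t"
  have i: "i < nb" using t False by (simp add: i_def)
  have "s * (real nb - i) < ?g nb - ?g i"
    using top_height(3)[of i ?g n s] i unfolding nb[symmetric] by simp
  also have "?g nb - ?g i = (\<Sum>j\<in>{i..<nb}. real (a j))"
    using i by (simp add: sum_diff_nat_ivl atLeast0LessThan[symmetric])
  also have "\<dots> \<le> (\<Sum>j\<in>{i..<nb}. real W * (if a j \<ge> 1 then 1 else 0))"
    using aW nbn by (intro sum_mono) auto
  also have "\<dots> = W * real (card {j\<in>{i..<nb}. a j \<ge> 1})"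
    by (simp add: sum_distrib_left[symmetric] sum.If_cases Int_def)
  also have "card {j\<in>{i..<nb}. a j \<ge> 1} = card {e. e < t \<and> a (nb - 1 - e) \<ge> 1}"
  proof (rule bij_betw_same_card[of "\<lambda>j. nb - 1 - j"], rule bij_betwI[of _ _ _ "\<lambda>e. nb - 1 - e"])
    show "(\<lambda>j. nb - 1 - j) \<in> {j\<in>{i..<nb}. a j \<ge> 1} \<rightarrow> {e. e < t \<and> a (nb - 1 - e) \<ge> 1}"
      using t by (auto simp: i_def)
    show "(\<lambda>e. nb - 1 - e) \<in> {e. e < t \<and> a (nb - 1 - e) \<ge> 1} \<rightarrow> {j\<in>{i..<nb}. a j \<ge> 1}"
      using t by (auto simp: i_def)
  qed (use t in \<open>auto simp: i_def\<close>)
  finally have "s * t \<le> W * real (card {e. e < t \<and> a (nb - 1 - e) \<ge> 1})" using t by (simp add: i_def)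
  then show ?thesis using W by (simp add: field_simps)
qed simp

text \<open>A node of height \<open>i\<close> fits into an interval of radius \<open>D ^ i\<close>,
  where the Katz--Tao bound limits its number of points.\<close>

lemma uniform_height_le:
  fixes \<beta> :: real
  assumes fin: "finite Y" and XY: "X \<subseteq> Y" "X \<noteq> {}" and u: "uniform_below D X a n" and D: "D = 2 ^ W" and i: "i \<le> n"
    and KT: "\<And>(z::nat) r. r \<ge> 1 \<Longrightarrow> card {x\<in>Y. \<bar>real x - real z\<bar> \<le> r} \<le> r powr \<beta>"
  shows "(\<Sum>j<i. real (a j)) \<le> \<beta> * W * i"
proof -
  obtain x where x: "x \<in> X" using XY by blast
  have D0: "D > 0" using D by simp
  have finX: "finite X" using fin XY finite_subset by blast
  have D1: "real D ^ i \<ge> 1" using D by simp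
  have "real (card (node D X i x)) \<le> card {y\<in>Y. \<bar>real y - real x\<bar> \<le> real D ^ i}"
  proof (rule of_nat_mono, rule card_mono)
    show "node D X i x \<subseteq> {y\<in>Y. \<bar>real y - real x\<bar> \<le> real D ^ i}"
      using same_node_diff[OF D0, of _ i x] XY(1) by (fastforce simp: node_def)
  qed (use fin in simp)
  also have "\<dots> \<le> (real D ^ i) powr \<beta>" by (rule KT[OF D1])
  also have "(real D ^ i) powr \<beta> = 2 powr (\<beta> * W * i)"
    by (simp add: D power_mult[symmetric] powr_realpow[symmetric] powr_powr mult_ac)
  finally have "real (2 ^ (\<Sum>j<i. a j)) \<le> 2 powr (\<beta> * W * i)" unfolding card_node[OF finX u x i D0] .
  moreover have "real (2 ^ (\<Sum>j<i. a j)) = 2 powr (\<Sum>j<i. real (a j))" by (simp add: powr_realpow[symmetric])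
  ultimately have "2 powr (\<Sum>j<i. real (a j)) \<le> 2 powr (\<beta> * W * i)" by (simp only:)
  then show ?thesis by simp
qed

lemma uniform_log_card:
  assumes fin: "finite X" "X \<noteq> {}" and u: "uniform_below D X a n" and D: "D > 0" and X: "\<And>x. x \<in> X \<Longrightarrow> x < D ^ n"
  shows "log 2 (card X) = (\<Sum>j<n. real (a j))"
proof -
  obtain x where x: "x \<in> X" using fin by blast
  have "node D X n x = X" using X x by (auto simp: node_def)
  then have "card X = 2 ^ (\<Sum>j<n. a j)" using card_node[OF fin(1) u x order_refl D] by simp
  then show ?thesis by (simp add: log_nat_power)
qed

lemma log_loss:
  fixes p d :: real
  assumes "0 < p" "0 < x" "0 < y" "0 < d" "0 < w" and le: "p / d * real x \<le> w ^ n * real y"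
  shows "log 2 x + log 2 p - log 2 d - n * log 2 w \<le> log 2 y"
proof -
  have "log 2 (p / d * real x) \<le> log 2 (w ^ n * real y)" using assms by (intro log_mono) auto
  moreover have "log 2 (p / d * real x) = log 2 p - log 2 d + log 2 x" using assms by (simp add: log_mult log_divide)
  moreover have "log 2 (w ^ n * real y) = n * log 2 w + log 2 y" using assms by (simp add: log_mult log_nat_power)
  ultimately show ?thesis by linarith
qed

text \<open>The budget for \<eta>: replacing \<beta>, \<gamma> by \<beta> + \<epsilon>1, \<gamma> +
  \<epsilon>1 leaves 3/4 of it, the losses of density leave 5/8, and uniformisation takes 1/16, as
  do the constants together with the rounding of \<open>m / W\<close> to \<open>n\<close>. What
  remains is 1/2.\<close>

lemma size_numerics:
  fixes \<alpha> \<beta> \<gamma> \<eta> \<epsilon>1 \<epsilon> bl cl gB gC \<omega> :: real and m n W :: nat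
  assumes \<alpha>: "0 < \<alpha>" "\<alpha> \<le> \<beta>" "\<beta> \<le> 1" "\<alpha> \<le> \<gamma>" "\<gamma> \<le> 1" and \<eta>: "0 < \<eta>" "\<eta> \<le> 1" and \<epsilon>1: "0 < \<epsilon>1" "\<epsilon>1 \<le> \<alpha> * \<eta> / 8"
    and \<epsilon>: "0 < \<epsilon>" "\<epsilon> \<le> \<alpha> * \<eta> / 16" and bc: "0 \<le> bl" "0 \<le> cl" and \<omega>: "0 \<le> \<omega>" "\<omega> \<le> \<alpha> * \<eta> / 32 * W"
    and Pi: "m * (\<beta> * \<gamma> + \<eta>) \<le> \<gamma> * bl + \<beta> * cl"
    and gB: "bl - \<epsilon> * m - 1 - n * \<omega> \<le> gB" and gC: "cl - \<epsilon> * m - 2 - n * \<omega> \<le> gC"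
    and n: "W * (real n - 1) \<le> m" "2 + 3 / \<alpha> \<le> \<eta> / 16 * n" and W: "W \<ge> 1"
  shows "(1 + \<eta> / 2) * n \<le> gB / ((\<beta> + \<epsilon>1) * W) + gC / ((\<gamma> + \<epsilon>1) * W)"
proof -
  have one: "(1 - \<eta> / 8) * (x / b) - e / \<alpha> \<le> y / (b + \<epsilon>1)"
    if b: "\<alpha> \<le> b" and x: "0 \<le> x" and e: "0 \<le> e" and y: "x - e \<le> y" for b x e y
  proof -
    have b0: "b > 0" using b \<alpha> by linarith
    have "(1 - \<eta> / 8) * (b + \<epsilon>1) \<le> b"
    proof -
      have "\<alpha> * \<eta> / 8 \<le> \<eta> / 8 * b" using mult_left_mono[OF b, of "\<eta>"] \<eta> by (simp add: mult.commute)
      then have "\<epsilon>1 \<le> \<eta> / 8 * b" using \<epsilon>1(2) by linarith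
      moreover have "\<eta> / 8 * \<epsilon>1 \<ge> 0" using \<eta> \<epsilon>1 by simp
      ultimately show ?thesis by (simp add: algebra_simps)
    qed
    then have "(1 - \<eta> / 8) / b \<le> 1 / (b + \<epsilon>1)" using b0 \<epsilon>1 by (simp add: divide_simps)
    then have "x * ((1 - \<eta> / 8) / b) \<le> x * (1 / (b + \<epsilon>1))" using x by (rule mult_left_mono)
    moreover have "e / (b + \<epsilon>1) \<le> e / \<alpha>" using e b \<epsilon>1 \<alpha> by (intro divide_left_mono) auto
    moreover have "(x - e) / (b + \<epsilon>1) \<le> y / (b + \<epsilon>1)" using y b0 \<epsilon>1 by (intro divide_right_mono) auto
    moreover have "x * ((1 - \<eta> / 8) / b) = (1 - \<eta> / 8) * (x / b)" "x * (1 / (b + \<epsilon>1)) = x / (b + \<epsilon>1)" by simp_all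
    moreover have "(x - e) / (b + \<epsilon>1) = x / (b + \<epsilon>1) - e / (b + \<epsilon>1)" by (rule diff_divide_distrib)
    ultimately show ?thesis by linarith
  qed
  have \<beta>0: "\<beta> > 0" and \<gamma>0: "\<gamma> > 0" using \<alpha> by linarith+
  have e0: "0 \<le> \<epsilon> * m + 1 + n * \<omega>" "0 \<le> \<epsilon> * m + 2 + n * \<omega>" using \<epsilon> \<omega> by simp_all
  have B: "(1 - \<eta> / 8) * (bl / \<beta>) - (\<epsilon> * m + 1 + n * \<omega>) / \<alpha> \<le> gB / (\<beta> + \<epsilon>1)"
    by (rule one[OF \<alpha>(2) bc(1) e0(1)]) (use gB in linarith)
  have C: "(1 - \<eta> / 8) * (cl / \<gamma>) - (\<epsilon> * m + 2 + n * \<omega>) / \<alpha> \<le> gC / (\<gamma> + \<epsilon>1)"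
    by (rule one[OF \<alpha>(4) bc(2) e0(2)]) (use gC in linarith)
  have "m * (1 + \<eta>) \<le> bl / \<beta> + cl / \<gamma>"
  proof -
    have bg: "\<beta> * \<gamma> \<le> 1" using mult_mono[of \<beta> 1 \<gamma> 1] \<alpha> \<gamma>0 by simp
    have "(m * (1 + \<eta>)) * (\<beta> * \<gamma>) \<le> m * (\<beta> * \<gamma> + \<eta>)"
      using mult_left_mono[OF mult_left_mono[OF bg, of \<eta>], of m] \<eta> by (simp add: algebra_simps)
    also have "\<dots> \<le> \<gamma> * bl + \<beta> * cl" by (rule Pi)
    also have "\<dots> = (bl / \<beta> + cl / \<gamma>) * (\<beta> * \<gamma>)" using \<beta>0 \<gamma>0 by (simp add: field_simps)
    finally show ?thesis using \<beta>0 \<gamma>0 by simp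
  qed
  then have f1: "(1 - \<eta> / 8) * (m * (1 + \<eta>)) \<le> (1 - \<eta> / 8) * (bl / \<beta> + cl / \<gamma>)" using \<eta> by (intro mult_left_mono) auto
  have f2: "(1 + 3 * \<eta> / 4) * m \<le> (1 - \<eta> / 8) * (m * (1 + \<eta>))"
  proof -
    have "\<eta> * \<eta> \<le> \<eta>" using \<eta> by (simp add: mult_left_le)
    moreover have "(1 - \<eta> / 8) * (1 + \<eta>) = 1 + 7 * \<eta> / 8 - \<eta> * \<eta> / 8" by (simp add: field_simps)
    ultimately have "1 + 3 * \<eta> / 4 \<le> (1 - \<eta> / 8) * (1 + \<eta>)" by linarith
    then show ?thesis using mult_right_mono[of "1 + 3 * \<eta> / 4" "(1 - \<eta> / 8) * (1 + \<eta>)" "real m"] by (simp add: mult_ac)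
  qed
  have f3: "(1 - \<eta> / 8) * (bl / \<beta> + cl / \<gamma>) = (1 - \<eta> / 8) * (bl / \<beta>) + (1 - \<eta> / 8) * (cl / \<gamma>)" by (rule distrib_left)
  have f4: "(\<epsilon> * m + 1 + n * \<omega>) / \<alpha> + (\<epsilon> * m + 2 + n * \<omega>) / \<alpha> = 2 * \<epsilon> / \<alpha> * m + 3 / \<alpha> + 2 * \<omega> / \<alpha> * n"
    by (simp add: add_divide_distrib[symmetric] algebra_simps)
  have f5: "2 * \<epsilon> / \<alpha> * m \<le> \<eta> / 8 * m" using \<epsilon> \<alpha> by (intro mult_right_mono) (auto simp: field_simps)
  have f6: "2 * \<omega> / \<alpha> * n \<le> \<eta> / 16 * W * n" using \<omega> \<alpha> by (intro mult_right_mono) (auto simp: field_simps)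
  have arith: "t0 - b5 - k3 - b6 \<le> gb + gc" if "t1 \<le> t2" "t0 \<le> t1" "t2 = u + v" "e1 + e2 = a5 + k3 + a6" "a5 \<le> b5" "a6 \<le> b6"
      "u - e1 \<le> gb" "v - e2 \<le> gc" for t0 t1 t2 u v e1 e2 a5 a6 k3 b5 b6 gb gc :: real
    using that by linarith
  have "(1 + 3 * \<eta> / 4) * m - \<eta> / 8 * m = (1 + 5 * \<eta> / 8) * m" by (simp add: field_simps)
  then have tot: "(1 + 5 * \<eta> / 8) * m - 3 / \<alpha> - \<eta> / 16 * W * n \<le> gB / (\<beta> + \<epsilon>1) + gC / (\<gamma> + \<epsilon>1)"
    using arith[OF f1 f2 f3 f4 f5 f6 B C] by (simp only:)
  have "(1 + \<eta> / 2) * n * W \<le> (1 + 5 * \<eta> / 8) * m - 3 / \<alpha> - \<eta> / 16 * W * n"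
  proof -
    have h1: "(1 + 5 * \<eta> / 8) * (W * (real n - 1)) \<le> (1 + 5 * \<eta> / 8) * m" using n(1) \<eta> by (intro mult_left_mono) auto
    have "1 * (3 / \<alpha>) \<le> W * (3 / \<alpha>)" using W \<alpha> by (intro mult_right_mono) auto
    then have h2: "3 / \<alpha> \<le> W * (3 / \<alpha>)" by (simp only: mult_1_left)
    have h3: "W * (2 + 3 / \<alpha>) \<le> W * (\<eta> / 16 * n)" using n(2) by (intro mult_left_mono) auto
    have "real W * (5 * \<eta> / 8) \<le> real W * 1" using \<eta> by (intro mult_left_mono) auto
    then have h4: "real W * (5 * \<eta> / 8) \<le> real W" by (simp only: mult_1_right)
    have e1: "(1 + 5 * \<eta> / 8) * (W * (real n - 1)) = real W * n + 5 / 8 * (\<eta> * (real W * n)) - W - 5 / 8 * (\<eta> * W)"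
      by (simp add: field_simps)
    have e2: "(1 + \<eta> / 2) * n * W = real W * n + 1 / 2 * (\<eta> * (real W * n))" by (simp add: field_simps)
    have e3: "\<eta> / 16 * W * n = 1 / 16 * (\<eta> * (real W * n))" by simp
    have e4: "W * (\<eta> / 16 * n) = 1 / 16 * (\<eta> * (real W * n))" by simp
    have e5: "W * (2 + 3 / \<alpha>) = 2 * real W + W * (3 / \<alpha>)" by (simp add: algebra_simps)
    have e6: "real W * (5 * \<eta> / 8) = 5 / 8 * (\<eta> * W)" by simp
    have "L \<le> m5 - k - e" if "c1 \<le> m5" "k \<le> V" "s5 \<le> s4" "s6 \<le> Z" "c1 = X + 5 / 8 * Y - Z - 5 / 8 * U" "L = X + 1 / 2 * Y"
        "e = 1 / 16 * Y" "s4 = 1 / 16 * Y" "s5 = 2 * Z + V" "s6 = 5 / 8 * U" for L m5 k e c1 V s4 s5 s6 X Y Z U :: real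
      using that by linarith
    from this[OF h1 h2 h3 h4 e1 e2 e3 e4 e5 e6] show ?thesis .
  qed
  then have "(1 + \<eta> / 2) * n * W \<le> gB / (\<beta> + \<epsilon>1) + gC / (\<gamma> + \<epsilon>1)" using tot by linarith
  then have "(1 + \<eta> / 2) * n \<le> (gB / (\<beta> + \<epsilon>1) + gC / (\<gamma> + \<epsilon>1)) / W" using W by (simp add: pos_le_divide_eq)
  then show ?thesis by (simp add: add_divide_distrib)
qed

text \<open>Sets in units of \<delta>, with \<open>2 ^ m\<close> for \<open>1 / \<delta>\<close>,
  turned into a \<open>twist_config\<close>. Uniform subsets of \<open>B\<close> and
  \<open>C\<close> are cut down to nodes of heights \<open>nb\<close> and \<open>nc\<close> below
  which they branch with complementary slopes.\<close>

theorem integer_abc: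
  fixes \<alpha> \<beta> \<gamma> \<eta> :: real
  assumes \<alpha>: "0 < \<alpha>" "\<alpha> < 1" and \<beta>: "\<alpha> \<le> \<beta>" "\<beta> \<le> 1" and \<gamma>: "\<alpha> \<le> \<gamma>" "\<gamma> \<le> 1" and \<eta>: "0 < \<eta>" "\<eta> \<le> 1"
  shows "\<exists>\<epsilon>::real. \<exists>m0::nat. \<epsilon> > 0 \<and> (\<forall>(m::nat) (A::int set) (B::nat set) (C::nat set) G.
    m0 \<le> m \<and> finite A \<and> A \<noteq> {} \<and> B \<subseteq> {..2 ^ m} \<and> C \<subseteq> {..2 ^ m} \<and>
    (\<forall>(z::int) r. r \<ge> 1 \<longrightarrow> card {x\<in>A. \<bar>real_of_int x - real_of_int z\<bar> \<le> r} \<le> r powr \<alpha>) \<and>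
    (\<forall>(z::nat) r. r \<ge> 1 \<longrightarrow> card {x\<in>B. \<bar>real x - real z\<bar> \<le> r} \<le> r powr \<beta>) \<and>
    (\<forall>(z::nat) r. r \<ge> 1 \<longrightarrow> card {x\<in>C. \<bar>real x - real z\<bar> \<le> r} \<le> r powr \<gamma>) \<and>
    2 powr (m * (\<beta> * \<gamma> + \<eta>)) \<le> card B powr \<gamma> * card C powr \<beta> \<and>
    (\<forall>c\<in>C. G c \<subseteq> A \<times> B \<and> 2 powr (- \<epsilon> * m) * (card A * card B) \<le> card (G c) \<and>
       card (cell_values (2 ^ m) c (G c)) \<le> 2 powr (\<epsilon> * m) * card A) \<longrightarrow> False)"
proof -
  define \<epsilon>1 where "\<epsilon>1 = min (1 - \<alpha>) (\<alpha> * \<eta> / 8)"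
  have \<epsilon>1: "0 < \<epsilon>1" "\<epsilon>1 \<le> 1 - \<alpha>" "\<epsilon>1 \<le> \<alpha> * \<eta> / 8"
  proof -
    show "0 < \<epsilon>1" using \<alpha> \<eta> by (simp add: \<epsilon>1_def)
    show "\<epsilon>1 \<le> 1 - \<alpha>" unfolding \<epsilon>1_def by (rule min.cobounded1)
    show "\<epsilon>1 \<le> \<alpha> * \<eta> / 8" unfolding \<epsilon>1_def by (rule min.cobounded2)
  qed
  define cw where "cw = ln 2 * (\<alpha> * \<eta> / 32)"
  have cw: "cw > 0" using \<alpha> \<eta> by (simp add: cw_def)
  obtain w0 where w0: "\<And>n. n \<ge> w0 \<Longrightarrow> 1 * (4 * (real n + 1)) ^ 1 < exp (cw * n)"
    using polynomial_below_exp[OF cw, of 4 1 1] by auto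
  \<comment> \<open>Uniformisation loses a factor \<open>4 * (W + 1)\<close> at each of the roughly
    \<open>m / W\<close> levels; \<open>W\<close> is so large that its logarithm is a small part of
    the \<open>W\<close> bits of a level.\<close>
  define W where "W = max w0 1"
  have W: "W \<ge> 1" by (simp add: W_def)
  define \<omega> where "\<omega> = log 2 (4 * (real W + 1))"
  have \<omega>0: "0 \<le> \<omega>" by (simp add: \<omega>_def)
  have \<omega>: "\<omega> \<le> \<alpha> * \<eta> / 32 * W"
  proof -
    have "4 * (real W + 1) \<le> exp (cw * W)" using w0[of W] by (simp add: W_def)
    then have "ln (4 * (real W + 1)) \<le> cw * W" using ln_le_cancel_iff[of "4 * (real W + 1)" "exp (cw * W)"] by simp
    then show ?thesis by (simp add: \<omega>_def log_def cw_def divide_le_eq mult_ac)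
  qed
  define D :: nat where "D = 2 ^ W"
  have D1: "D > 1" unfolding D_def using W by (intro one_less_power) auto
  \<comment> \<open>The grid of slopes must be fine enough for \<open>level_selection\<close>, and
    the step lost in \<open>R - 1\<close> instead of \<open>R\<close> must cost at most
    \<open>\<epsilon>1 / 2\<close> in the sum of the slopes.\<close>
  define R where "R = nat \<lceil>max (16 / \<eta>) (2 / \<epsilon>1)\<rceil> + 2"
  have R: "R \<ge> 2" "8 < \<eta> / 2 * R" "(\<alpha> + \<epsilon>1) / R \<le> \<epsilon>1 / 2"
  proof -
    have r: "max (16 / \<eta>) (2 / \<epsilon>1) < R" unfolding R_def by linarith
    then have "16 / \<eta> < R" "2 / \<epsilon>1 < R" by simp_all
    then have 1: "16 < \<eta> * R" "2 < \<epsilon>1 * R" using \<eta> \<epsilon>1 by (simp_all add: pos_divide_less_eq mult.commute)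
    then show "8 < \<eta> / 2 * R" by simp
    have "(\<alpha> + \<epsilon>1) \<le> \<epsilon>1 / 2 * R" using 1 \<epsilon>1 by simp
    then show "(\<alpha> + \<epsilon>1) / R \<le> \<epsilon>1 / 2" by (simp add: R_def divide_le_eq)
    show "R \<ge> 2" by (simp add: R_def)
  qed
  have R0: "real R > 0" using R by simp
  have p: "0 < \<epsilon>1 / 2" "\<alpha> + \<epsilon>1 / 2 \<le> 1" "0 < \<alpha> / R" "0 < \<eta> / 4" using \<epsilon>1 \<alpha> \<eta> R0 by auto
  from no_twist_config[OF \<alpha>(1) p D1] obtain l :: real and n0 :: nat where l: "l > 0"
    and no: "\<forall>n A B C a a' nb nc nn M S H \<rho> \<sigma> \<tau>. n0 \<le> n \<and> 2 powr (- l * real n) \<le> \<rho> \<longrightarrow>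
     \<not> twist_config \<alpha> (\<epsilon>1 / 2) (\<alpha> / R) (\<eta> / 4) D n A B C a a' nb nc nn M S H \<rho> \<sigma> \<tau>"
    by (elim exE conjE) blast
  \<comment> \<open>The first bound feeds \<open>size_numerics\<close>. The second keeps the final
    density, about \<open>2 powr (- 3 * \<epsilon> * m)\<close> with \<open>m < W * n\<close>, above
    \<open>2 powr (- l * n)\<close>.\<close>
  define \<epsilon> where "\<epsilon> = min (\<alpha> * \<eta> / 16) (l / (6 * W))"
  have \<epsilon>: "0 < \<epsilon>" "\<epsilon> \<le> \<alpha> * \<eta> / 16" "\<epsilon> \<le> l / (6 * W)"
  proof -
    show "0 < \<epsilon>" using \<alpha> \<eta> l W by (simp add: \<epsilon>_def)
    show "\<epsilon> \<le> \<alpha> * \<eta> / 16" unfolding \<epsilon>_def by (rule min.cobounded1)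
    show "\<epsilon> \<le> l / (6 * W)" unfolding \<epsilon>_def by (rule min.cobounded2)
  qed
  define nr where "nr = max (max n0 (nat \<lceil>10 / l\<rceil>)) (nat \<lceil>16 / \<eta> * (2 + 3 / \<alpha>)\<rceil>)"
  have False if m: "W * nr \<le> m" and A: "finite A" "A \<noteq> {}" and B: "B \<subseteq> {..2 ^ m}" and C: "C \<subseteq> {..2 ^ m}"
    and KA: "\<forall>(z::int) r. r \<ge> 1 \<longrightarrow> card {x\<in>A. \<bar>real_of_int x - real_of_int z\<bar> \<le> r} \<le> r powr \<alpha>"
    and KB: "\<forall>(z::nat) r. r \<ge> 1 \<longrightarrow> card {x\<in>B. \<bar>real x - real z\<bar> \<le> r} \<le> r powr \<beta>"
    and KC: "\<forall>(z::nat) r. r \<ge> 1 \<longrightarrow> card {x\<in>C. \<bar>real x - real z\<bar> \<le> r} \<le> r powr \<gamma>"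
    and Pi: "2 powr (m * (\<beta> * \<gamma> + \<eta>)) \<le> card B powr \<gamma> * card C powr \<beta>"
    and G: "\<forall>c\<in>C. G c \<subseteq> A \<times> B \<and> 2 powr (- \<epsilon> * m) * (card A * card B) \<le> card (G c) \<and>
       card (cell_values (2 ^ m) c (G c)) \<le> 2 powr (\<epsilon> * m) * card A"
    for m :: nat and A :: "int set" and B C :: "nat set" and G :: "nat \<Rightarrow> (int \<times> nat) set"
  proof -
    have fin: "finite B" "finite C" using B C finite_subset by blast+
    define M :: nat where "M = 2 ^ m"
    \<comment> \<open>The number of \<open>D\<close>-adic levels, characterised by
      \<open>D ^ (n - 1) \<le> M < D ^ n\<close>.\<close>
    define n where "n = m div W + 1"
    have n_le: "W * (n - 1) \<le> m" "m < W * n" "n > 0"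
    proof -
      show "W * (n - 1) \<le> m" by (simp add: n_def)
      have "m = W * (m div W) + m mod W" by simp
      moreover have "m mod W < W" using W by simp
      ultimately show "m < W * n" by (simp only: n_def distrib_left mult_1_right)
    qed (simp add: n_def)
    have "nr \<le> m div W" using m W by (simp add: less_eq_div_iff_mult_less_eq mult.commute)
    then have nr: "nr \<le> n" by (simp add: n_def)
    have n1: "n0 \<le> n" "10 / l \<le> n" "16 / \<eta> * (2 + 3 / \<alpha>) \<le> n" using nr unfolding nr_def by linarith+
    have cBC: "card B > 0 \<and> card C > 0"
    proof (rule ccontr)
      assume "\<not> (card B > 0 \<and> card C > 0)"
      then have "card B powr \<gamma> * card C powr \<beta> = 0" by auto
      moreover have "2 powr (m * (\<beta> * \<gamma> + \<eta>)) > 0" by simp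
      ultimately show False using Pi by linarith
    qed
    then have ne: "B \<noteq> {}" "C \<noteq> {}" by auto
    have cA: "card A > 0" using A by (simp add: card_gt_0_iff)
    define pp where "pp = 2 powr (- \<epsilon> * m)"
    have "2 powr (- \<epsilon> * m) \<le> 2 powr 0" using \<epsilon> by (intro powr_mono) auto
    then have pp: "pp > 0" "pp \<le> 1" by (auto simp: pp_def)
    have lpp: "log 2 pp = - \<epsilon> * m" by (simp add: pp_def)
    define w where "w b c = real (card {g\<in>G c. snd g = b})" for b c
    have GAB: "G c \<subseteq> A \<times> B" if "c \<in> C" for c using G that by blast
    have finG: "finite (G c)" if "c \<in> C" for c using GAB[OF that] A(1) fin(1) finite_subset[of "G c" "A \<times> B"] by blast
    have wA: "w b c \<le> card A" if "c \<in> C" for b c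
    proof -
      have "card {g\<in>G c. snd g = b} \<le> card A"
        by (rule card_inj_on_le[of fst]) (use GAB[OF that] A in \<open>auto simp: inj_on_def\<close>)
      then show ?thesis by (simp add: w_def)
    qed
    have wsum: "(\<Sum>b\<in>X. w b c) = card {g\<in>G c. snd g \<in> X}" if "c \<in> C" "finite X" for c X
    proof -
      have "(\<Sum>b\<in>X. card {g\<in>G c. snd g = b}) = card (\<Union>b\<in>X. {g\<in>G c. snd g = b})"
        using finG[OF that(1)] that(2) by (subst card_UN_disjoint) auto
      also have "(\<Union>b\<in>X. {g\<in>G c. snd g = b}) = {g\<in>G c. snd g \<in> X}" by auto
      finally show ?thesis by (simp add: w_def flip: of_nat_sum)
    qed
    have tot: "pp * (real (card A) * card B * card C) \<le> (\<Sum>b\<in>B. \<Sum>c\<in>C. w b c)"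
    proof -
      have "pp * (real (card A) * card B * card C) = (\<Sum>c\<in>C. pp * (card A * card B))" by simp
      also have "\<dots> \<le> (\<Sum>c\<in>C. real (card {g\<in>G c. snd g \<in> B}))"
      proof (rule sum_mono)
        fix c assume c: "c \<in> C"
        have "{g\<in>G c. snd g \<in> B} = G c" using GAB[OF c] by auto
        then show "pp * (card A * card B) \<le> card {g\<in>G c. snd g \<in> B}" using G c unfolding pp_def by simp
      qed
      also have "\<dots> = (\<Sum>c\<in>C. \<Sum>b\<in>B. w b c)" using wsum fin by simp
      also have "\<dots> = (\<Sum>b\<in>B. \<Sum>c\<in>C. w b c)" by (rule sum.swap)
      finally show ?thesis .
    qed
    have cA': "real (card A) > 0" using cA by simp
    have "\<exists>B1 C1 a a'. B1 \<subseteq> B \<and> B1 \<noteq> {} \<and> C1 \<subseteq> C \<and> C1 \<noteq> {} \<and> uniform_below D B1 a n \<and> uniform_below D C1 a' n \<and>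
       pp / 2 * card B \<le> (4 * (real W + 1)) ^ n * card B1 \<and> pp / 4 * card C \<le> (4 * (real W + 1)) ^ n * card C1 \<and>
       pp / 4 * (real (card A) * card B1 * card C1) \<le> (\<Sum>b\<in>B1. \<Sum>c\<in>C1. w b c)"
      by (rule dense_uniform_pair[OF fin ne D_def pp(1) cA' _ tot]) (rule wA)
    then obtain B1 C1 a a' where B1: "B1 \<subseteq> B" "B1 \<noteq> {}" and C1: "C1 \<subseteq> C" "C1 \<noteq> {}"
      and uB: "uniform_below D B1 a n" and uC: "uniform_below D C1 a' n"
      and lB: "pp / 2 * card B \<le> (4 * (real W + 1)) ^ n * card B1" and lC: "pp / 4 * card C \<le> (4 * (real W + 1)) ^ n * card C1"
      and tot1: "pp / 4 * (real (card A) * card B1 * card C1) \<le> (\<Sum>b\<in>B1. \<Sum>c\<in>C1. w b c)"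
      by (elim exE conjE)
    have fin1: "finite B1" "finite C1" using B1 C1 fin finite_subset by blast+
    have c1: "card B1 > 0" "card C1 > 0" using fin1 B1 C1 by (auto simp: card_gt_0_iff)
    have D0: "D > 0" using D1 by simp
    have MD: "M < D ^ n" "D ^ (n - 1) \<le> M"
    proof -
      have "(2::nat) ^ m < 2 ^ (W * n)" using n_le(2) by (intro power_strict_increasing) auto
      then show "M < D ^ n" by (simp add: M_def D_def power_mult)
      have "(2::nat) ^ (W * (n - 1)) \<le> 2 ^ m" using n_le(1) by (intro power_increasing) auto
      then show "D ^ (n - 1) \<le> M" by (simp add: M_def D_def power_mult)
    qed
    have small: "x < D ^ n" if "x \<in> B1 \<union> C1" for x
    proof -
      have "x \<le> M" using that B1 C1 B C unfolding M_def by blast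
      then show ?thesis using MD by linarith
    qed
    define f g where "f i = (\<Sum>j<i. real (a j))" and "g i = (\<Sum>j<i. real (a' j))" for i
    have fn: "log 2 (card B1) = f n" unfolding f_def by (rule uniform_log_card[OF fin1(1) B1(2) uB D0]) (use small in blast)
    have gn: "log 2 (card C1) = g n" unfolding g_def by (rule uniform_log_card[OF fin1(2) C1(2) uC D0]) (use small in blast)
    have fi: "f i \<le> (\<beta> + \<epsilon>1) * W * i" if "i \<le> n" for i
    proof -
      have "f i \<le> \<beta> * W * i" unfolding f_def
        by (rule uniform_height_le[OF fin(1) B1 uB D_def that]) (use KB in blast)
      also have "\<dots> \<le> (\<beta> + \<epsilon>1) * W * i" using \<epsilon>1 by (intro mult_right_mono) auto
      finally show ?thesis .
    qed
    have gi: "g i \<le> (\<gamma> + \<epsilon>1) * W * i" if "i \<le> n" for i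
    proof -
      have "g i \<le> \<gamma> * W * i" unfolding g_def
        by (rule uniform_height_le[OF fin(2) C1 uC D_def that]) (use KC in blast)
      also have "\<dots> \<le> (\<gamma> + \<epsilon>1) * W * i" using \<epsilon>1 by (intro mult_right_mono) auto
      finally show ?thesis .
    qed
    have st: "(\<beta> + \<epsilon>1) * W > 0" "(\<gamma> + \<epsilon>1) * W > 0" using \<alpha> \<beta> \<gamma> \<epsilon>1 W by auto
    have w4: "4 * (real W + 1) > 0" by simp
    have big: "(1 + \<eta> / 2) * n \<le> f n / ((\<beta> + \<epsilon>1) * W) + g n / ((\<gamma> + \<epsilon>1) * W)"
    proof (rule size_numerics[OF \<alpha>(1) \<beta> \<gamma> \<eta> \<epsilon>1(1,3) \<epsilon>(1,2) _ _ \<omega>0 \<omega>, of "log 2 (card B)" "log 2 (card C)" m])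
      show "0 \<le> log 2 (card B)" "0 \<le> log 2 (card C)" using cBC by simp_all
      have "log 2 (2 powr (m * (\<beta> * \<gamma> + \<eta>))) \<le> log 2 (card B powr \<gamma> * card C powr \<beta>)"
        using Pi cBC by (subst log_le_cancel_iff) auto
      also have "log 2 (card B powr \<gamma> * card C powr \<beta>) = \<gamma> * log 2 (card B) + \<beta> * log 2 (card C)"
        using cBC by (simp add: log_mult log_powr)
      finally show "m * (\<beta> * \<gamma> + \<eta>) \<le> \<gamma> * log 2 (card B) + \<beta> * log 2 (card C)" by simp
      show "log 2 (card B) - \<epsilon> * m - 1 - n * \<omega> \<le> f n"
        using log_loss[OF pp(1) _ c1(1) _ w4 lB] cBC unfolding fn lpp \<omega>_def by simp
      have "log 2 (4::real) = 2" using log_nat_power[of 2 2 2] by simp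
      then show "log 2 (card C) - \<epsilon> * m - 2 - n * \<omega> \<le> g n"
        using log_loss[OF pp(1) _ c1(2) _ w4 lC] cBC unfolding gn lpp \<omega>_def by simp
      have "real (W * (n - 1)) \<le> real m" using n_le(1) by (simp only: of_nat_le_iff)
      then show "W * (real n - 1) \<le> m" using n_le(3) by (simp add: of_nat_diff)
      show "2 + 3 / \<alpha> \<le> \<eta> / 16 * n" using n1(3) \<eta> by (simp add: field_simps)
    qed (use W in simp)
    obtain j where j: "1 \<le> j" "j + 2 \<le> R" and jn: "(1 + \<eta> / 2 / 2) * n \<le>
        top_height f n ((\<beta> + \<epsilon>1) * W * j / R) + top_height g n ((\<gamma> + \<epsilon>1) * W * (R - 1 - j) / R)"
      by (rule level_selection[of n f "(\<beta> + \<epsilon>1) * W" g "(\<gamma> + \<epsilon>1) * W" "\<eta> / 2" R])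
        (use fi gi st big R n_le(3) in \<open>auto simp: f_def g_def\<close>)
    define nb nc where "nb = top_height f n ((\<beta> + \<epsilon>1) * W * j / R)" and "nc = top_height g n ((\<gamma> + \<epsilon>1) * W * (R - 1 - j) / R)"
    have nbn: "nb \<le> n" "nc \<le> n" unfolding nb_def nc_def by (rule top_height(1))+
    have jn': "n + \<eta> / 4 * n \<le> real (nb + nc)" using jn by (simp add: nb_def nc_def algebra_simps)
    moreover have "\<eta> / 4 * n \<ge> 0" using \<eta> by simp
    ultimately have "real n \<le> real (nb + nc)" by linarith
    then have nbc: "n \<le> nb + nc" by (simp only: of_nat_le_iff)
    \<comment> \<open>Within nodes of heights \<open>nb\<close> and \<open>nc\<close> the products
      \<open>c * b / M\<close> vary over a range of about \<open>D ^ (nb + nc - n)\<close>, so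
      \<open>nn\<close> is the number of scales in play. The surplus in the product hypothesis makes
      it a positive share of \<open>n\<close>.\<close>
    define nn where "nn = nb + nc - n"
    have nn: "nn \<le> nb" "nn \<le> nc" "nb + nc = nn + n" "\<eta> / 4 * n \<le> nn" using nbc nbn jn' by (auto simp: nn_def of_nat_diff)
    have tot2: "(pp / 4 * card A) * (card B1 * card C1) \<le> (\<Sum>b\<in>B1. \<Sum>c\<in>C1. w b c)" using tot1 by (simp add: mult_ac)
    from localize_pair[OF fin1 B1(2) C1(2) tot2, of D nb nc] obtain x y where x: "x \<in> B1" and y: "y \<in> C1"
      and xy: "(pp / 4 * card A) * (card (node D B1 nb x) * card (node D C1 nc y)) \<le> (\<Sum>b\<in>node D B1 nb x. \<Sum>c\<in>node D C1 nc y. w b c)"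
      by blast
    define Bs Cs where "Bs = node D B1 nb x" and "Cs = node D C1 nc y"
    have Bs: "Bs \<subseteq> B1" "finite Bs" "Bs \<noteq> {}" and Cs: "Cs \<subseteq> C1" "finite Cs" "Cs \<noteq> {}"
      using node_subset[of D B1 nb x] node_subset[of D C1 nc y] node_refl[OF x, of D nb] node_refl[OF y, of D nc] fin1 finite_subset
      unfolding Bs_def Cs_def by blast+
    define G' where "G' c = {g\<in>G c. snd g \<in> Bs}" for c
    have CsC: "c \<in> C" if "c \<in> Cs" for c using that Cs C1 by blast
    have "\<exists>H S. H \<noteq> {} \<and> H \<subseteq> A \<times> Bs \<times> Bs \<and> pp * (pp / 4)\<^sup>2 / 2 * (card A * (card Bs)\<^sup>2) \<le> card H \<and>
       (\<forall>x\<in>H. S x \<subseteq> Cs \<and> pp * (pp / 4)\<^sup>2 / 2 * card Cs \<le> card (S x) \<and> (\<forall>c\<in>S x. twist M c x \<in> A))"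
    proof (rule dense_twists[OF A(1) Bs(2) Cs(2) A(2) Bs(3) Cs(3) pp(1), of _ G'])
      show "G' c \<subseteq> A \<times> Bs" if "c \<in> Cs" for c using GAB[OF CsC[OF that]] by (auto simp: G'_def)
      show "pp * card (cell_values M c (G' c)) \<le> card A" if "c \<in> Cs" for c
      proof -
        have "card (cell_values M c (G' c)) \<le> card (cell_values M c (G c))"
          using finG[OF CsC[OF that]] by (intro card_mono) (auto simp: cell_values_def G'_def)
        then have "pp * card (cell_values M c (G' c)) \<le> pp * card (cell_values M c (G c))" using pp by simp
        also have "\<dots> \<le> pp * (2 powr (\<epsilon> * m) * card A)" using G CsC[OF that] pp unfolding M_def by (intro mult_left_mono) auto
        also have "\<dots> = card A" by (simp add: pp_def powr_minus)
        finally show ?thesis .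
      qed
      have "pp / 4 * real (card A * card Bs * card Cs) = (pp / 4 * card A) * (card Bs * card Cs)" by simp
      also have "\<dots> \<le> (\<Sum>b\<in>Bs. \<Sum>c\<in>Cs. w b c)" using xy by (simp add: Bs_def Cs_def)
      also have "\<dots> = (\<Sum>c\<in>Cs. \<Sum>b\<in>Bs. w b c)" by (rule sum.swap)
      also have "\<dots> = (\<Sum>c\<in>Cs. real (card (G' c)))" unfolding G'_def using wsum[OF CsC Bs(2)] by simp
      finally show "pp / 4 * real (card A * card Bs * card Cs) \<le> (\<Sum>c\<in>Cs. real (card (G' c)))" .
    qed (use pp in auto)
    then obtain H S where H: "H \<noteq> {}" "H \<subseteq> A \<times> Bs \<times> Bs" "pp * (pp / 4)\<^sup>2 / 2 * (card A * (card Bs)\<^sup>2) \<le> card H"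
      and S: "\<forall>x\<in>H. S x \<subseteq> Cs \<and> pp * (pp / 4)\<^sup>2 / 2 * card Cs \<le> card (S x) \<and> (\<forall>c\<in>S x. twist M c x \<in> A)"
      by (elim exE conjE)
    \<comment> \<open>One factor \<open>pp\<close> comes from the small number of cell values and
      two from the squared density of the graphs.\<close>
    define \<rho> where "\<rho> = pp * (pp / 4)\<^sup>2 / 2"
    \<comment> \<open>Both \<beta> and \<gamma> are at least \<alpha>, so these slopes add up to at
      least \<open>(\<alpha> + \<epsilon>1) * (R - 1) / R\<close>; as the extreme \<open>j\<close>
      are excluded, each of them is at least \<open>\<alpha> / R\<close>.\<close>
    define \<sigma> \<tau> where "\<sigma> = (\<beta> + \<epsilon>1) * j / R" and "\<tau> = (\<gamma> + \<epsilon>1) * real (R - 1 - j) / R"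
    have \<rho>p: "\<rho> = pp ^ 3 / 32" by (simp add: \<rho>_def power2_eq_square power3_eq_cube)
    have "twist_config \<alpha> (\<epsilon>1 / 2) (\<alpha> / R) (\<eta> / 4) D n A Bs Cs a a' nb nc nn M S H \<rho> \<sigma> \<tau>"
    proof
      show "finite H" using H(2) A(1) Bs(2) finite_subset[of H "A \<times> Bs \<times> Bs"] by blast
      show "uniform_below D Bs a nb" unfolding Bs_def by (rule uniform_node[OF uB x nbn(1)])
      show "uniform_below D Cs a' nc" unfolding Cs_def by (rule uniform_node[OF uC y nbn(2)])
      show "u div D ^ nb = v div D ^ nb" if "u \<in> Bs" "v \<in> Bs" for u v using that by (simp add: Bs_def node_def)
      show "u div D ^ nc = v div D ^ nc" if "u \<in> Cs" "v \<in> Cs" for u v using that by (simp add: Cs_def node_def)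
      show "M > 0" by (simp add: M_def)
      have M0: "real M > 0" by (simp add: M_def)
      have "real M \<le> real D ^ n" using MD(1) by (metis less_imp_le of_nat_le_iff of_nat_power)
      then have "real D ^ nn * M \<le> real D ^ nn * real D ^ n" by (intro mult_left_mono) auto
      then show "real D ^ nn \<le> real D ^ (nb + nc) / M" using M0 by (simp add: pos_le_divide_eq nn(3) power_add)
      have "real D ^ (n - 1) \<le> M" using MD(2) by (metis of_nat_le_iff of_nat_power)
      from mult_left_mono[OF this, of "real D"] have "real D * real D ^ (n - 1) \<le> real D * M" by simp
      moreover have "real D * real D ^ (n - 1) = real D ^ n" using n_le(3) by (cases n) auto
      ultimately have "real D ^ n \<le> real D * M" by (simp only:)
      from mult_left_mono[OF this, of "real D ^ nn"] have "real D ^ nn * real D ^ n \<le> real D ^ nn * (real D * M)" by simp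
      then show "real D ^ (nb + nc) / M \<le> real D ^ (nn + 1)" using M0 by (simp add: pos_divide_le_eq nn(3) power_add mult_ac)
      show "H \<subseteq> UNIV \<times> Bs \<times> Bs" using H(2) by blast
      show "\<rho> * (card A * (card Bs)\<^sup>2) \<le> card H" using H(3) by (simp add: \<rho>_def)
      show "S z \<subseteq> Cs" "\<rho> * card Cs \<le> card (S z)" if "z \<in> H" for z using S that by (auto simp: \<rho>_def)
      show "twist M c z \<in> A" if "z \<in> H" "c \<in> S z" for z c using S that by blast
      show "0 < \<rho>" using pp by (simp add: \<rho>p)
      have "pp ^ 3 \<le> 1" using pp by (intro power_le_one) auto
      then show "\<rho> \<le> 1" by (simp add: \<rho>p)
      show "card {z\<in>A. \<bar>real_of_int z - real_of_int a0\<bar> \<le> r} \<le> r powr \<alpha>" if "r \<ge> 1" for a0 r using KA that by blast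
      have ba: "\<alpha> * 1 \<le> (\<beta> + \<epsilon>1) * j" "\<alpha> * 1 \<le> (\<gamma> + \<epsilon>1) * real (R - 1 - j)"
        using \<alpha> \<beta> \<gamma> \<epsilon>1 j by (intro mult_mono; simp)+
      show "\<alpha> / R \<le> \<sigma>" "\<alpha> / R \<le> \<tau>" unfolding \<sigma>_def \<tau>_def using ba R0 by (auto intro!: divide_right_mono)
      have "(\<alpha> + \<epsilon>1) * (real R - 1) = (\<alpha> + \<epsilon>1) * j + (\<alpha> + \<epsilon>1) * real (R - 1 - j)"
        using j by (simp add: of_nat_diff algebra_simps)
      also have "\<dots> \<le> (\<beta> + \<epsilon>1) * j + (\<gamma> + \<epsilon>1) * real (R - 1 - j)" using \<beta> \<gamma> by (intro add_mono mult_right_mono) auto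
      finally have "(\<alpha> + \<epsilon>1) * (real R - 1) / R \<le> \<sigma> + \<tau>"
        unfolding \<sigma>_def \<tau>_def add_divide_distrib[symmetric] using R0 by (intro divide_right_mono) auto
      moreover have "(\<alpha> + \<epsilon>1) * (real R - 1) / R = \<alpha> + \<epsilon>1 - (\<alpha> + \<epsilon>1) / R" using R0 by (simp add: field_simps)
      ultimately show "\<alpha> + \<epsilon>1 / 2 \<le> \<sigma> + \<tau>" using R(3) by linarith
      have W0: "W > 0" using W by simp
      have ht: "nb = top_height (\<lambda>i. \<Sum>j<i. real (a j)) n ((\<beta> + \<epsilon>1) * W * j / R)"
        "nc = top_height (\<lambda>i. \<Sum>j<i. real (a' j)) n ((\<gamma> + \<epsilon>1) * W * (R - 1 - j) / R)"
        unfolding nb_def nc_def f_def[abs_def] g_def[abs_def] by (rule refl)+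
      have sl: "(\<beta> + \<epsilon>1) * W * j / R / W = \<sigma>" "(\<gamma> + \<epsilon>1) * W * (R - 1 - j) / R / W = \<tau>"
        using W0 by (simp_all add: \<sigma>_def \<tau>_def)
      show "\<sigma> * t \<le> card {s. s < t \<and> a (nb - 1 - s) \<ge> 1}" if "t \<le> nn" for t
        using uniform_active_count[OF fin1(1) B1(2) uB D_def W0 ht(1)] that nn(1) unfolding sl(1) by simp
      show "\<tau> * t \<le> card {s. s < t \<and> a' (nc - 1 - s) \<ge> 1}" if "t \<le> nn" for t
        using uniform_active_count[OF fin1(2) C1(2) uC D_def W0 ht(2)] that nn(2) unfolding sl(2) by simp
    qed (use A Bs Cs H nbn nn in auto)
    moreover have "2 powr (- l * real n) \<le> \<rho>"
    proof -
      have "3 * (\<epsilon> * m) + 5 \<le> l * n"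
      proof -
        have "\<epsilon> * m \<le> l / (6 * W) * (W * n)" using \<epsilon> n_le(2) l W
          by (intro mult_mono) (auto simp flip: of_nat_mult)
        then have "\<epsilon> * m \<le> l * n / 6" using W by simp
        moreover have "10 \<le> l * n" using n1(2) l by (simp add: pos_divide_le_eq mult.commute)
        ultimately show ?thesis by linarith
      qed
      then have "2 powr (- l * real n) \<le> 2 powr (3 * (- \<epsilon> * m) - 5)" by (intro powr_mono) auto
      also have "\<dots> = 2 powr (3 * (- \<epsilon> * m)) / 2 powr 5" by (rule powr_diff)
      also have "\<dots> = \<rho>" by (simp add: \<rho>p pp_def powr_power mult.commute)
      finally show ?thesis .
    qed
    ultimately show False using no n1(1) by blast
  qed
  then show ?thesis using \<epsilon>(1) by (intro exI[of _ \<epsilon>] exI[of _ "W * nr"]) blast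
qed

section \<open>From integers back to reals\<close>

text \<open>On the line a dyadic cube is a level set of
  \<open>\<lfloor>x / \<delta>\<rfloor>\<close>.\<close>

lemma dyadic_number_real:
  fixes X :: "real set"
  assumes "\<delta> > 0"
  shows "dyadic_number \<delta> X = card ((\<lambda>x. \<lfloor>x / \<delta>\<rfloor>) ` X)"
proof -
  define Q where "Q k = {x::real. \<delta> * of_int k \<le> x \<and> x < \<delta> * (of_int k + 1)}" for k :: int
  have mem: "x \<in> Q k \<longleftrightarrow> \<lfloor>x / \<delta>\<rfloor> = k" for x k
    using assms by (auto simp: Q_def floor_eq_iff field_simps)
  have cubes: "dyadic_cubes \<delta> = range Q"
  proof
    show "dyadic_cubes \<delta> \<subseteq> range Q" by (auto simp: dyadic_cubes_def Q_def)
    show "range Q \<subseteq> dyadic_cubes \<delta>"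
    proof
      fix Y assume "Y \<in> range Q"
      then obtain k where "Y = Q k" by blast
      then show "Y \<in> dyadic_cubes \<delta>" unfolding dyadic_cubes_def Q_def by (intro CollectI exI[of _ "\<lambda>_. k"]) simp
    qed
  qed
  have inj: "inj Q"
  proof (rule injI)
    fix k l assume "Q k = Q l"
    moreover have "\<delta> * of_int k \<in> Q k" using assms by (simp add: mem)
    ultimately show "k = l" using assms mem[of "\<delta> * of_int k" l] by simp
  qed
  have "{P \<in> dyadic_cubes \<delta>. P \<inter> X \<noteq> {}} = Q ` ((\<lambda>x. \<lfloor>x / \<delta>\<rfloor>) ` X)"
  proof (intro set_eqI iffI)
    fix P assume "P \<in> {P \<in> dyadic_cubes \<delta>. P \<inter> X \<noteq> {}}"
    then obtain k x where "P = Q k" "x \<in> Q k" "x \<in> X" unfolding cubes by blast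
    then show "P \<in> Q ` ((\<lambda>x. \<lfloor>x / \<delta>\<rfloor>) ` X)" using mem[of x k] by blast
  next
    fix P assume "P \<in> Q ` ((\<lambda>x. \<lfloor>x / \<delta>\<rfloor>) ` X)"
    then obtain x where "x \<in> X" "P = Q \<lfloor>x / \<delta>\<rfloor>" by blast
    then show "P \<in> {P \<in> dyadic_cubes \<delta>. P \<inter> X \<noteq> {}}" unfolding cubes using mem[of x "\<lfloor>x / \<delta>\<rfloor>"] by blast
  qed
  then show ?thesis unfolding dyadic_number_def using card_image[OF inj_on_subset[OF inj subset_UNIV]] by simp
qed

text \<open>Different multiples of \<delta> lie in different cubes, so covering numbers of grid sets
  are cardinalities.\<close>

lemma katz_tao_integers:
  fixes A :: "real set" and r z \<delta> s :: real
  assumes \<delta>: "\<delta> > 0" and KT: "katz_tao \<delta> s A" and r: "r \<ge> 1"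
  shows "card {k::int. \<delta> * k \<in> A \<and> \<bar>k - z\<bar> \<le> r} \<le> r powr s"
proof -
  let ?X = "{k::int. \<delta> * k \<in> A \<and> \<bar>k - z\<bar> \<le> r}"
  have "finite ?X"
    by (rule finite_subset[of _ "{\<lfloor>z - r\<rfloor>..\<lceil>z + r\<rceil>}"]) (auto simp: abs_le_iff floor_le_iff le_ceiling_iff)
  moreover have "?X \<subseteq> (\<lambda>x. \<lfloor>x / \<delta>\<rfloor>) ` (A \<inter> cball (\<delta> * z) (\<delta> * r))"
  proof
    fix k assume k: "k \<in> ?X"
    have "dist (\<delta> * z) (\<delta> * k) = \<delta> * \<bar>k - z\<bar>" using \<delta> by (simp add: dist_real_def abs_mult[symmetric] right_diff_distrib[symmetric] abs_minus_commute abs_mult)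
    then have "\<delta> * k \<in> A \<inter> cball (\<delta> * z) (\<delta> * r)" using k \<delta> by simp
    moreover have "\<lfloor>\<delta> * k / \<delta>\<rfloor> = k" using \<delta> by simp
    ultimately show "k \<in> (\<lambda>x. \<lfloor>x / \<delta>\<rfloor>) ` (A \<inter> cball (\<delta> * z) (\<delta> * r))" by (metis image_eqI)
  qed
  moreover have "finite ((\<lambda>x. \<lfloor>x / \<delta>\<rfloor>) ` (A \<inter> cball (\<delta> * z) (\<delta> * r)))"
  proof (rule finite_subset[of _ "{\<lfloor>z - r\<rfloor>..\<lfloor>z + r\<rfloor>}"])
    show "(\<lambda>x. \<lfloor>x / \<delta>\<rfloor>) ` (A \<inter> cball (\<delta> * z) (\<delta> * r)) \<subseteq> {\<lfloor>z - r\<rfloor>..\<lfloor>z + r\<rfloor>}"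
    proof (clarsimp)
      fix x assume "dist (\<delta> * z) x \<le> \<delta> * r"
      then have "\<delta> * (z - r) \<le> x" "x \<le> \<delta> * (z + r)" by (auto simp: dist_real_def algebra_simps)
      then have "z - r \<le> x / \<delta>" "x / \<delta> \<le> z + r" using \<delta> by (auto simp: pos_le_divide_eq pos_divide_le_eq mult.commute)
      then show "\<lfloor>z - r\<rfloor> \<le> \<lfloor>x / \<delta>\<rfloor> \<and> \<lfloor>x / \<delta>\<rfloor> \<le> \<lfloor>z + r\<rfloor>" by (simp add: floor_mono)
    qed
  qed simp
  ultimately have "card ?X \<le> dyadic_number \<delta> (A \<inter> cball (\<delta> * z) (\<delta> * r))"
    unfolding dyadic_number_real[OF \<delta>] by (intro card_mono)
  moreover have "\<delta> * r \<ge> \<delta>" using \<delta> r by simp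
  then have "real (dyadic_number \<delta> (A \<inter> cball (\<delta> * z) (\<delta> * r))) \<le> 1 * (\<delta> * r / \<delta>) powr s"
    using KT unfolding katz_tao_def katz_tao_const_def by blast
  ultimately show ?thesis using \<delta> by simp
qed

lemma scaled_nats:
  fixes B :: "real set"
  assumes \<delta>: "\<delta> = 1 / 2 ^ m" and B: "B \<subseteq> scaled_ints \<delta> \<inter> {0..1}"
  defines "N \<equiv> {k::nat. \<delta> * k \<in> B}"
  shows "N \<subseteq> {..2 ^ m}" "B = (\<lambda>k. \<delta> * real k) ` N" "card N = card B"
proof -
  have \<delta>0: "\<delta> > 0" using \<delta> by simp
  show "N \<subseteq> {..2 ^ m}"
  proof
    fix k assume "k \<in> N"
    then have "\<delta> * k \<le> 1" using B by (auto simp: N_def)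
    then have "real k \<le> 2 ^ m" by (simp add: \<delta> pos_divide_le_eq)
    then have "real k \<le> real (2 ^ m)" by simp
    then show "k \<in> {..2 ^ m}" by (simp only: of_nat_le_iff atMost_iff)
  qed
  show im: "B = (\<lambda>k. \<delta> * real k) ` N"
  proof
    show "B \<subseteq> (\<lambda>k. \<delta> * real k) ` N"
    proof
      fix x assume x: "x \<in> B"
      then obtain i :: int where i: "x = \<delta> * i" using B by (auto simp: scaled_ints_def)
      have "0 \<le> x" using x B by auto
      then have "0 \<le> i" using i \<delta>0 by (simp add: zero_le_mult_iff)
      then have "real (nat i) = i" by simp
      then show "x \<in> (\<lambda>k. \<delta> * real k) ` N" using x i by (intro image_eqI[of _ _ "nat i"]) (auto simp: N_def)
    qed
  qed (auto simp: N_def)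
  have "inj_on (\<lambda>k. \<delta> * real k) N" using \<delta>0 by (auto simp: inj_on_def)
  then show "card N = card B" unfolding im by (simp add: card_image)
qed

theorem theorem1p6:
  fixes \<alpha> \<beta> \<gamma> \<eta> :: real
  assumes "\<alpha> \<in> {0<..<1}" and "\<beta> \<in> {\<alpha>..1}" and "\<gamma> \<in> {\<alpha>..1}" and "\<eta> > 0"
  shows "\<exists>\<delta>\<^sub>0 > 0. \<exists>\<epsilon> > 0. \<forall>\<delta> \<in> dyadic_scales \<inter> {0<..\<delta>\<^sub>0}.
    \<forall>A B C :: real set.
      A \<subseteq> scaled_ints \<delta> \<inter> {0..1} \<and> B \<subseteq> scaled_ints \<delta> \<inter> {0..1} \<and> C \<subseteq> scaled_ints \<delta> \<inter> {0..1} \<and>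
      katz_tao \<delta> \<alpha> A \<and> katz_tao \<delta> \<beta> B \<and> katz_tao \<delta> \<gamma> C \<and>
      real (card B) powr \<gamma> * real (card C) powr \<beta> * \<delta> powr (\<beta> * \<gamma>) \<ge> \<delta> powr (- \<eta>)
      \<longrightarrow> (\<exists>c\<in>C. \<forall>G. G \<subseteq> A \<times> B \<and> real (card G) \<ge> \<delta> powr \<epsilon> * real (card A) * real (card B) \<longrightarrow>
             real (dyadic_number \<delta> {a + c * b | a b. (a, b) \<in> G}) \<ge> \<delta> powr (- \<epsilon>) * real (card A))"
proof -
  \<comment> \<open>\<open>integer_abc\<close> asks for \<eta> at most 1; lowering \<eta> only
    weakens the size hypothesis.\<close>
  define \<eta>' where "\<eta>' = min \<eta> 1"
  have \<eta>': "0 < \<eta>'" "\<eta>' \<le> 1" "\<eta>' \<le> \<eta>" using assms(4) by (auto simp: \<eta>'_def)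
  have ab: "0 < \<alpha>" "\<alpha> < 1" "\<alpha> \<le> \<beta>" "\<beta> \<le> 1" "\<alpha> \<le> \<gamma>" "\<gamma> \<le> 1" using assms by auto
  from integer_abc[OF ab \<eta>'(1,2)] obtain \<epsilon> :: real and m0 :: nat where \<epsilon>: "\<epsilon> > 0"
    and int_abc: "\<forall>(m::nat) (A::int set) (B::nat set) (C::nat set) G.
    m0 \<le> m \<and> finite A \<and> A \<noteq> {} \<and> B \<subseteq> {..2 ^ m} \<and> C \<subseteq> {..2 ^ m} \<and>
    (\<forall>(z::int) r. r \<ge> 1 \<longrightarrow> card {x\<in>A. \<bar>real_of_int x - real_of_int z\<bar> \<le> r} \<le> r powr \<alpha>) \<and>
    (\<forall>(z::nat) r. r \<ge> 1 \<longrightarrow> card {x\<in>B. \<bar>real x - real z\<bar> \<le> r} \<le> r powr \<beta>) \<and>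
    (\<forall>(z::nat) r. r \<ge> 1 \<longrightarrow> card {x\<in>C. \<bar>real x - real z\<bar> \<le> r} \<le> r powr \<gamma>) \<and>
    2 powr (m * (\<beta> * \<gamma> + \<eta>')) \<le> card B powr \<gamma> * card C powr \<beta> \<and>
    (\<forall>c\<in>C. G c \<subseteq> A \<times> B \<and> 2 powr (- \<epsilon> * m) * (card A * card B) \<le> card (G c) \<and>
       card (cell_values (2 ^ m) c (G c)) \<le> 2 powr (\<epsilon> * m) * card A) \<longrightarrow> False"
    by (elim exE conjE) blast
  have main: "\<exists>c\<in>C. \<forall>G. G \<subseteq> A \<times> B \<and> real (card G) \<ge> \<delta> powr \<epsilon> * real (card A) * real (card B) \<longrightarrow>
             real (dyadic_number \<delta> {a + c * b | a b. (a, b) \<in> G}) \<ge> \<delta> powr (- \<epsilon>) * real (card A)"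
    if \<delta>: "\<delta> = 1 / 2 ^ m" and m: "m0 \<le> m" and A: "A \<subseteq> scaled_ints \<delta> \<inter> {0..1}" and B: "B \<subseteq> scaled_ints \<delta> \<inter> {0..1}"
      and C: "C \<subseteq> scaled_ints \<delta> \<inter> {0..1}" and KA: "katz_tao \<delta> \<alpha> A" and KB: "katz_tao \<delta> \<beta> B" and KC: "katz_tao \<delta> \<gamma> C"
      and Pi: "real (card B) powr \<gamma> * real (card C) powr \<beta> * \<delta> powr (\<beta> * \<gamma>) \<ge> \<delta> powr (- \<eta>)"
    for \<delta> :: real and m :: nat and A B C :: "real set"
  proof (rule ccontr)
    assume neg: "\<not> (\<exists>c\<in>C. \<forall>G. G \<subseteq> A \<times> B \<and> real (card G) \<ge> \<delta> powr \<epsilon> * real (card A) * real (card B) \<longrightarrow>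
             real (dyadic_number \<delta> {a + c * b | a b. (a, b) \<in> G}) \<ge> \<delta> powr (- \<epsilon>) * real (card A))"
    have \<delta>0: "\<delta> > 0" using \<delta> by simp
    have dp: "\<delta> powr e = 2 powr (- (real m * e))" for e
    proof -
      have "\<delta> = 2 powr (- real m)" by (simp add: \<delta> powr_minus powr_realpow divide_simps)
      then show ?thesis by (simp add: powr_powr)
    qed
    have "\<forall>c\<in>C. \<exists>G. G \<subseteq> A \<times> B \<and> real (card G) \<ge> \<delta> powr \<epsilon> * real (card A) * real (card B) \<and>
        real (dyadic_number \<delta> {a + c * b | a b. (a, b) \<in> G}) < \<delta> powr (- \<epsilon>) * real (card A)"
      using neg by (meson not_le)
    from bchoice[OF this] obtain Gr where Gr: "\<And>c. c \<in> C \<Longrightarrow> Gr c \<subseteq> A \<times> B"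
      "\<And>c. c \<in> C \<Longrightarrow> real (card (Gr c)) \<ge> \<delta> powr \<epsilon> * real (card A) * real (card B)"
      "\<And>c. c \<in> C \<Longrightarrow> real (dyadic_number \<delta> {a + c * b | a b. (a, b) \<in> Gr c}) < \<delta> powr (- \<epsilon>) * real (card A)"
      by blast
    define Ai where "Ai = {k::int. \<delta> * k \<in> A}"
    define Bn where "Bn = {k::nat. \<delta> * k \<in> B}"
    define Cn where "Cn = {k::nat. \<delta> * k \<in> C}"
    note B' = scaled_nats[OF \<delta> B, folded Bn_def] and C' = scaled_nats[OF \<delta> C, folded Cn_def]
    have Aim: "A = (\<lambda>k. \<delta> * real_of_int k) ` Ai" using A by (auto simp: Ai_def scaled_ints_def)
    have "inj_on (\<lambda>k. \<delta> * real_of_int k) Ai" using \<delta>0 by (auto simp: inj_on_def)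
    then have cA: "card Ai = card A" unfolding Aim by (simp add: card_image)
    have "Ai \<subseteq> {0..2 ^ m}"
    proof
      fix k assume "k \<in> Ai"
      then have "0 \<le> \<delta> * k" "\<delta> * k \<le> 1" using A by (auto simp: Ai_def)
      then have "0 \<le> k" using \<delta>0 by (simp add: zero_le_mult_iff)
      moreover have "real_of_int k \<le> 2 ^ m" using \<open>\<delta> * k \<le> 1\<close> by (simp add: \<delta> pos_divide_le_eq)
      then have "real_of_int k \<le> real_of_int (2 ^ m)" by simp
      ultimately show "k \<in> {0..2 ^ m}" by (simp only: of_int_le_iff atLeastAtMost_iff)
    qed
    then have finA: "finite Ai" by (rule finite_subset) simp
    define Gi where "Gi c = {(k::int, l::nat). (\<delta> * k, \<delta> * l) \<in> Gr (\<delta> * real c)}" for c :: nat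
    have Gi: "Gi c \<subseteq> Ai \<times> Bn \<and> 2 powr (- \<epsilon> * m) * (card Ai * card Bn) \<le> card (Gi c) \<and>
       card (cell_values (2 ^ m) c (Gi c)) \<le> 2 powr (\<epsilon> * m) * card Ai" if c: "c \<in> Cn" for c
    proof (intro conjI)
      have cC: "\<delta> * real c \<in> C" using c by (simp add: Cn_def)
      show sub: "Gi c \<subseteq> Ai \<times> Bn" using Gr(1)[OF cC] by (auto simp: Gi_def Ai_def Bn_def)
      let ?h = "\<lambda>(k, l). (\<delta> * real_of_int k, \<delta> * real l)"
      have im: "Gr (\<delta> * real c) = ?h ` Gi c"
      proof
        show "Gr (\<delta> * real c) \<subseteq> ?h ` Gi c"
        proof
          fix g assume g: "g \<in> Gr (\<delta> * real c)"
          then obtain a b where ab: "g = (a, b)" "a \<in> A" "b \<in> B" using Gr(1)[OF cC] by auto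
          obtain k where k: "a = \<delta> * real_of_int k" using ab(2) Aim by auto
          obtain l where l: "b = \<delta> * real l" using ab(3) B'(2) by auto
          show "g \<in> ?h ` Gi c" using g unfolding ab(1) k l by (intro image_eqI[of _ _ "(k, l)"]) (auto simp: Gi_def)
        qed
      qed (auto simp: Gi_def)
      have "inj_on ?h (Gi c)" using \<delta>0 by (auto simp: inj_on_def)
      then have "card (Gr (\<delta> * real c)) = card (Gi c)" unfolding im by (rule card_image)
      then show "2 powr (- \<epsilon> * m) * (card Ai * card Bn) \<le> card (Gi c)"
        using Gr(2)[OF cC] unfolding dp cA B'(3) by (simp add: mult_ac)
      \<comment> \<open>The rounding matches exactly, since \<open>\<delta> * 2 ^ m = 1\<close>: the
        cube of \<open>a + c * b\<close> has the integer cell value as its index, without any error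
        term.\<close>
      have fl: "\<lfloor>(\<delta> * real_of_int k + \<delta> * real c * (\<delta> * real l)) / \<delta>\<rfloor> = k + int (c * l div 2 ^ m)" for k l
      proof -
        have "(\<delta> * real_of_int k + \<delta> * real c * (\<delta> * real l)) / \<delta> = real_of_int k + real (c * l) / real (2 ^ m)"
          using \<delta>0 by (simp add: \<delta> field_simps)
        then show ?thesis by (simp only: floor_divide_of_nat_eq int_add_floor[symmetric])
      qed
      have "{a + (\<delta> * real c) * b | a b. (a, b) \<in> Gr (\<delta> * real c)} = (\<lambda>(k, l). \<delta> * real_of_int k + \<delta> * real c * (\<delta> * real l)) ` Gi c"
        unfolding im by (auto simp: image_iff split_beta)
      then have "(\<lambda>x. \<lfloor>x / \<delta>\<rfloor>) ` {a + (\<delta> * real c) * b | a b. (a, b) \<in> Gr (\<delta> * real c)} = cell_values (2 ^ m) c (Gi c)"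
        unfolding cell_values_def by (simp only: image_image split_beta fl)
      then have "dyadic_number \<delta> {a + (\<delta> * real c) * b | a b. (a, b) \<in> Gr (\<delta> * real c)} = card (cell_values (2 ^ m) c (Gi c))"
        unfolding dyadic_number_real[OF \<delta>0] by (simp only:)
      then have "real (card (cell_values (2 ^ m) c (Gi c))) < \<delta> powr (- \<epsilon>) * real (card A)" using Gr(3)[OF cC] by (simp only:)
      then show "card (cell_values (2 ^ m) c (Gi c)) \<le> 2 powr (\<epsilon> * m) * card Ai" unfolding dp cA by (simp add: mult.commute)
    qed
    have Pi': "2 powr (m * (\<beta> * \<gamma> + \<eta>')) \<le> card Bn powr \<gamma> * card Cn powr \<beta>"
    proof -
      have "2 powr (m * \<eta>') \<le> 2 powr (m * \<eta>)" using \<eta>'(3) by (intro powr_mono mult_left_mono) auto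
      also have "\<dots> \<le> real (card B) powr \<gamma> * real (card C) powr \<beta> * 2 powr (- (real m * (\<beta> * \<gamma>)))" using Pi unfolding dp by simp
      finally have "2 powr (m * \<eta>') * 2 powr (m * (\<beta> * \<gamma>)) \<le>
          real (card B) powr \<gamma> * real (card C) powr \<beta> * 2 powr (- (real m * (\<beta> * \<gamma>))) * 2 powr (m * (\<beta> * \<gamma>))"
        by (intro mult_right_mono) auto
      then show ?thesis unfolding B'(3) C'(3) by (simp add: powr_add[symmetric] powr_minus distrib_left mult.assoc add.commute)
    qed
    have "Cn \<noteq> {}"
    proof
      assume "Cn = {}"
      then have "real (card Cn) powr \<beta> = 0" by simp
      moreover have "2 powr (m * (\<beta> * \<gamma> + \<eta>')) > 0" by simp
      ultimately show False using Pi' by (metis mult_zero_right not_le)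
    qed
    then obtain c0 where "\<delta> * real c0 \<in> C" by (auto simp: Cn_def)
    \<comment> \<open>A covering number strictly below
      \<open>\<delta> powr (- \<epsilon>) * card A\<close> is possible only if \<open>A\<close> is
      nonempty, which \<open>integer_abc\<close> demands.\<close>
    then have "real (dyadic_number \<delta> {a + (\<delta> * real c0) * b | a b. (a, b) \<in> Gr (\<delta> * real c0)}) < \<delta> powr (- \<epsilon>) * real (card A)" by (rule Gr(3))
    then have "0 < \<delta> powr (- \<epsilon>) * real (card A)" by linarith
    then have "card A \<noteq> 0" by (cases "card A") simp_all
    then have Ane: "Ai \<noteq> {}" using cA by auto
    have kA: "card {x\<in>Ai. \<bar>real_of_int x - real_of_int z\<bar> \<le> r} \<le> r powr \<alpha>" if "r \<ge> 1" for z :: int and r :: real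
      using katz_tao_integers[OF \<delta>0 KA that, of "real_of_int z"] by (simp add: Ai_def)
    have kN: "card {x\<in>{k::nat. \<delta> * k \<in> X}. \<bar>real x - real z\<bar> \<le> r} \<le> r powr s" if "r \<ge> 1" "katz_tao \<delta> s X" for z :: nat and r s :: real and X
    proof -
      let ?Y = "{k::int. \<delta> * k \<in> X \<and> \<bar>k - real z\<bar> \<le> r}"
      have "finite ?Y"
        by (rule finite_subset[of _ "{\<lfloor>real z - r\<rfloor>..\<lceil>real z + r\<rceil>}"]) (auto simp: abs_le_iff floor_le_iff le_ceiling_iff)
      then have "card {x\<in>{k::nat. \<delta> * k \<in> X}. \<bar>real x - real z\<bar> \<le> r} \<le> card ?Y"
        by (intro card_inj_on_le[of int]) (auto simp: inj_on_def)
      then show ?thesis using katz_tao_integers[OF \<delta>0 that(2,1), of "real z"] by linarith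
    qed
    have kB: "card {x\<in>Bn. \<bar>real x - real z\<bar> \<le> r} \<le> r powr \<beta>" if "r \<ge> 1" for z :: nat and r :: real
      unfolding Bn_def by (rule kN[OF that KB])
    have kC: "card {x\<in>Cn. \<bar>real x - real z\<bar> \<le> r} \<le> r powr \<gamma>" if "r \<ge> 1" for z :: nat and r :: real
      unfolding Cn_def by (rule kN[OF that KC])
    have "m0 \<le> m \<and> finite Ai \<and> Ai \<noteq> {} \<and> Bn \<subseteq> {..2 ^ m} \<and> Cn \<subseteq> {..2 ^ m} \<and>
        (\<forall>(z::int) r. r \<ge> 1 \<longrightarrow> card {x\<in>Ai. \<bar>real_of_int x - real_of_int z\<bar> \<le> r} \<le> r powr \<alpha>) \<and>
        (\<forall>(z::nat) r. r \<ge> 1 \<longrightarrow> card {x\<in>Bn. \<bar>real x - real z\<bar> \<le> r} \<le> r powr \<beta>) \<and>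
        (\<forall>(z::nat) r. r \<ge> 1 \<longrightarrow> card {x\<in>Cn. \<bar>real x - real z\<bar> \<le> r} \<le> r powr \<gamma>) \<and>
        2 powr (m * (\<beta> * \<gamma> + \<eta>')) \<le> card Bn powr \<gamma> * card Cn powr \<beta> \<and>
        (\<forall>c\<in>Cn. Gi c \<subseteq> Ai \<times> Bn \<and> 2 powr (- \<epsilon> * m) * (card Ai * card Bn) \<le> card (Gi c) \<and>
           card (cell_values (2 ^ m) c (Gi c)) \<le> 2 powr (\<epsilon> * m) * card Ai)"
      by (intro conjI[OF m] conjI[OF finA] conjI[OF Ane] conjI[OF B'(1)] conjI[OF C'(1)] conjI[OF _ conjI[OF _ conjI[OF _ conjI[OF Pi']]]] allI impI ballI kA kB kC Gi)
    then show False by (rule mp[OF spec[OF spec[OF spec[OF spec[OF spec[OF int_abc, of m], of Ai], of Bn], of Cn], of Gi]])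
  qed
  show ?thesis
  proof (rule exI[of _ "1 / 2 ^ m0"], rule conjI, simp, rule exI[of _ \<epsilon>], intro conjI ballI allI impI)
    fix \<delta> :: real and A B C :: "real set"
    assume d: "\<delta> \<in> dyadic_scales \<inter> {0<..1 / 2 ^ m0}"
      and h: "A \<subseteq> scaled_ints \<delta> \<inter> {0..1} \<and> B \<subseteq> scaled_ints \<delta> \<inter> {0..1} \<and> C \<subseteq> scaled_ints \<delta> \<inter> {0..1} \<and>
      katz_tao \<delta> \<alpha> A \<and> katz_tao \<delta> \<beta> B \<and> katz_tao \<delta> \<gamma> C \<and>
      real (card B) powr \<gamma> * real (card C) powr \<beta> * \<delta> powr (\<beta> * \<gamma>) \<ge> \<delta> powr (- \<eta>)"
    from d obtain m where m: "\<delta> = 1 / 2 ^ m" by (auto simp: dyadic_scales_def)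
    have "1 / 2 ^ m \<le> (1 / 2 ^ m0 :: real)" using d m by auto
    then have "(2::real) ^ m0 \<le> 2 ^ m" by (simp add: divide_simps)
    then have "m0 \<le> m" by simp
    then show "\<exists>c\<in>C. \<forall>G. G \<subseteq> A \<times> B \<and> real (card G) \<ge> \<delta> powr \<epsilon> * real (card A) * real (card B) \<longrightarrow>
             real (dyadic_number \<delta> {a + c * b | a b. (a, b) \<in> G}) \<ge> \<delta> powr (- \<epsilon>) * real (card A)"
      using main[OF m] h by blast
  qed (use \<epsilon> in auto)
qed

end
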